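(* Let $X=V(az_1^2+2bz_1z_2+cz_2^2+2dz_1+2ez_2+f)\subseteq\mathbb{C}^2$ be an affine conic ($a,b,c,d,e,f\in\mathbb{C}$, with $(a,b,c)\neq(0,0,0)$), let $$A=\begin{bmatrix}a&b&d\\ b&c&e\\ d&e&f\end{bmatrix}$$ be its representative complex symmetric matrix and let $A_1=\begin{bmatrix}a&b\\ b&c\end{bmatrix}$ be the $2\times2$ leading principal submatrix of $A$. If $A$ is singular then (i) $\mathrm{vHDdeg}(X)=1$ and $\mathrm{HDdeg}(X)=\{1\}$ if $\mathrm{rk}(A)=1$; (ii) $\mathrm{vHDdeg}(X)=2$ and $\mathrm{HDdeg}(X)=\{2\}$ if $\mathrm{rk}(A)=2$. If $A$ is non singular then (i) $\mathrm{vHDdeg}(X)=5$ and $\mathrm{HDdeg}(X)=\{1,3\}$ if $A_1$ is singular; (ii) $\mathrm{vHDdeg}(X)=6$ and $\mathrm{HDdeg}(X)=\{2,4\}$ if $A_1$ is non singular and has two equal singular values; (iii) $\mathrm{vHDdeg}(X)=8$ and $\{2,4\}\subseteq\mathrm{HDdeg}(X)\subseteq\{2,4,6\}$ if $A_1$ is non singular and has two different singular values.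
   Context: For an irreducible affine variety $X=V(I_X)\subseteq\mathbb{V}=\mathbb{C}^n$ of codimension $c$ with prime ideal $I_X=\langle f_1,\dots,f_s\rangle\subseteq\mathbb{C}[\mathbf{z}]$ and Jacobian $J(f)$, put $I_{X_{\mathrm{sing}}}=I_X+\langle c\text{-minors of }J(f)\rangle$. Let $\ast$ be the antilinear ring involution of $\mathbb{C}[\mathbf{z},\mathbf{w},\mathbf{u},\mathbf{v}]$ with $z_k\leftrightarrow w_k$, $u_k\leftrightarrow v_k$ and $\alpha^\ast=\bar \alpha$ for $\alpha\in\mathbb{C}$. With $I_X'=\left\langle (c+1)\text{-minors of }\begin{bmatrix}\mathbf{v}-\mathbf{w}\\ J_{\mathbf{z}}(f)\end{bmatrix}\right\rangle$, the Hermitian critical ideal of $X$ is $$\left(I_X+(I_X)^\ast+I_X'+(I_X')^\ast\right):\left(I_{X_{\mathrm{sing}}}\cdot(I_{X_{\mathrm{sing}}})^\ast\right)^\infty ;$$ for fixed $(\mathbf{u},\mathbf{v})\in\mathbb{V}^2$ it is considered as an ideal of $\mathbb{C}[\mathbf{z},\mathbf{w}]$. $\mathrm{vHDdeg}(X)$ is the number of zeros in $\mathbb{V}^2$ of the Hermitian critical ideal of $(\mathbf{u},\mathbf{v})$, constant for $(\mathbf{u},\mathbf{v})$ in a Zariski-open dense subset of $\mathbb{V}^2$. Let $q_{\mathbf{u}}(\mathbf{z})=\sum_k|u_k-z_k|^2$; its critical points on $X$ are the regular points $\mathbf{z}\in X$ with $\sum_k(\bar u_k-\bar z_k)\nu_k=0$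 for all $\nu\in T_{\mathbf{z}}X$ (equivalently, for generic $\mathbf{u}$, the zeros of the form $(\mathbf{z},\bar{\mathbf{z}})$ of the Hermitian critical ideal of $(\mathbf{u},\bar{\mathbf{u}})$). $\mathrm{HDdeg}(X)\subseteq\mathbb{N}$ is the set of numbers $m$ such that $q_{\mathbf{u}}$ has exactly $m$ critical points on $X$ for all $\mathbf{u}$ in some nonempty Euclidean-open subset of $\mathbb{V}$. For a reducible variety (taken reduced) the counts of solutions are defined additively, by summing over the irreducible components. *)

theory Defs
  imports "HOL-Analysis.Analysis" "HOL-Library.Poly_Mapping"
begin

section \<open>Polynomials in several variables\<close>

text \<open>The polynomial ring over the complex numbers with variables indexed by a type, as the
  monoid algebra of the finitely supported exponent vectors.\<close>

type_synonym 'v mpoly = "('v \<Rightarrow>\<^sub>0 nat) \<Rightarrow>\<^sub>0 complex"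

definition Const :: "complex \<Rightarrow> 'v mpoly" where
  "Const \<alpha> = Poly_Mapping.single 0 \<alpha>"

definition Var :: "'v \<Rightarrow> 'v mpoly" where
  "Var x = Poly_Mapping.single (Poly_Mapping.single x 1) 1"

text \<open>The map that sends each coefficient through \<open>h\<close> and each variable \<open>x\<close> to \<open>\<sigma> x\<close>;
  a ring homomorphism whenever \<open>h\<close> is one.\<close>

definition poly_subst :: "(complex \<Rightarrow> 'b) \<Rightarrow> ('v \<Rightarrow> 'b) \<Rightarrow> 'v mpoly \<Rightarrow> 'b::comm_ring_1" where
  "poly_subst h \<sigma> p =
     (\<Sum>m\<in>Poly_Mapping.keys p. h (Poly_Mapping.lookup p m) *
        (\<Prod>x\<in>Poly_Mapping.keys m. \<sigma> x ^ Poly_Mapping.lookup m x))"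

definition poly_eval :: "complex ^ 'v \<Rightarrow> 'v mpoly \<Rightarrow> complex" where
  "poly_eval z = poly_subst (\<lambda>\<alpha>. \<alpha>) (\<lambda>x. z $ x)"

text \<open>Formal partial derivative. If \<open>x\<close> does not occur in \<open>m\<close>, the coefficient below is 0,
  so the truncated subtraction of exponents is harmless.\<close>

definition partial_deriv :: "'v \<Rightarrow> 'v mpoly \<Rightarrow> 'v mpoly" where
  "partial_deriv x p =
     (\<Sum>m\<in>Poly_Mapping.keys p. Poly_Mapping.single (m - Poly_Mapping.single x 1)
        (of_nat (Poly_Mapping.lookup m x) * Poly_Mapping.lookup p m))"


section \<open>Ideals\<close>

text \<open>The ideals of a commutative ring are its submodules as a module over itself.\<close>

lemma module_times: "module ((*) :: 'a::comm_ring_1 \<Rightarrow> 'a \<Rightarrow> 'a)"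
  by unfold_locales (simp_all add: algebra_simps)

definition ideal_span :: "'a::comm_ring_1 set \<Rightarrow> 'a set" where
  "ideal_span S = module.span (*) S"

definition ideal_sum :: "'a::comm_ring_1 set \<Rightarrow> 'a set \<Rightarrow> 'a set" where
  "ideal_sum I J = {p + q |p q. p \<in> I \<and> q \<in> J}"

definition ideal_prod :: "'a::comm_ring_1 set \<Rightarrow> 'a set \<Rightarrow> 'a set" where
  "ideal_prod I J = ideal_span {p * q |p q. p \<in> I \<and> q \<in> J}"

primrec ideal_power :: "'a::comm_ring_1 set \<Rightarrow> nat \<Rightarrow> 'a set" where
  "ideal_power I 0 = UNIV"
| "ideal_power I (Suc k) = ideal_prod I (ideal_power I k)"

definition ideal_quotient :: "'a::comm_ring_1 set \<Rightarrow> 'a set \<Rightarrow> 'a set" where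
  "ideal_quotient I J = {p. \<forall>q\<in>J. p * q \<in> I}"

definition saturation :: "'a::comm_ring_1 set \<Rightarrow> 'a set \<Rightarrow> 'a set" where
  "saturation I J = (\<Union>k. ideal_quotient I (ideal_power J k))"

text \<open>The \<open>k\<close>-minors of a matrix given by the list of its rows, with columns indexed by a type.
  The injections \<open>r\<close> and \<open>c\<close> select rows and columns in an arbitrary order, so each minor
  occurs with both signs (if \<open>k > 1\<close>).\<close>

definition minors :: "nat \<Rightarrow> ('n \<Rightarrow> 'a::comm_ring_1) list \<Rightarrow> 'a set" where
  "minors k M =
     {\<Sum>\<pi> | \<pi> permutes {..<k}. of_int (sign \<pi>) * (\<Prod>i<k. (M ! r i) (c (\<pi> i))) |r c.
        inj_on r {..<k} \<and> r ` {..<k} \<subseteq> {..<length M} \<and> inj_on c {..<k}}"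


section \<open>Affine varieties\<close>

definition zero_locus :: "'v mpoly set \<Rightarrow> (complex ^ 'v) set" where
  "zero_locus S = {z. \<forall>p\<in>S. poly_eval z p = 0}"

definition vanishing_ideal :: "(complex ^ 'v) set \<Rightarrow> 'v mpoly set" where
  "vanishing_ideal X = {p. \<forall>z\<in>X. poly_eval z p = 0}"

definition zariski_closed :: "(complex ^ 'v) set \<Rightarrow> bool" where
  "zariski_closed X \<longleftrightarrow> (\<exists>S. X = zero_locus S)"

definition zariski_open :: "(complex ^ 'v) set \<Rightarrow> bool" where
  "zariski_open U \<longleftrightarrow> zariski_closed (- U)"

definition zariski_dense :: "(complex ^ 'v) set \<Rightarrow> bool" where
  "zariski_dense U \<longleftrightarrow> (\<forall>Z. zariski_closed Z \<and> U \<subseteq> Z \<longrightarrow> Z = UNIV)"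

definition irreducible_variety :: "(complex ^ 'v) set \<Rightarrow> bool" where
  "irreducible_variety X \<longleftrightarrow> zariski_closed X \<and> X \<noteq> {} \<and>
     (\<forall>Y Z. zariski_closed Y \<and> zariski_closed Z \<and> X = Y \<union> Z \<longrightarrow> X = Y \<or> X = Z)"

definition irreducible_components :: "(complex ^ 'v) set \<Rightarrow> (complex ^ 'v) set set" where
  "irreducible_components X = {Y. irreducible_variety Y \<and> Y \<subseteq> X \<and>
     (\<forall>Z. irreducible_variety Z \<and> Y \<subseteq> Z \<and> Z \<subseteq> X \<longrightarrow> Z = Y)}"

text \<open>Codimension of an irreducible variety in the affine space: the supremum of the lengths of
  the chains of irreducible varieties starting at \<open>X\<close>. These lengths are at most the dimension
  of the affine space, so that this is the supremum of a bounded set of natural numbers.\<close>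

definition codimension :: "(complex ^ 'v) set \<Rightarrow> nat" where
  "codimension X = Sup {k. \<exists>C :: nat \<Rightarrow> (complex ^ 'v) set. C 0 = X \<and>
     (\<forall>i\<le>k. irreducible_variety (C i)) \<and> (\<forall>i<k. C i \<subset> C (Suc i))}"

text \<open>Some finite list of generators of the ideal of \<open>X\<close>, which exists by Hilbert's basis
  theorem. The singular locus ideal and the Hermitian critical ideal below do not depend on
  the choice.\<close>

definition generators :: "(complex ^ 'v) set \<Rightarrow> 'v mpoly list" where
  "generators X = (SOME fs. ideal_span (set fs) = vanishing_ideal X)"

definition jacobian :: "'v mpoly list \<Rightarrow> ('v \<Rightarrow> 'v mpoly) list" where
  "jacobian fs = map (\<lambda>f k. partial_deriv k f) fs"

definition sing_ideal :: "(complex ^ 'v) set \<Rightarrow> 'v mpoly set" where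
  "sing_ideal X = ideal_sum (vanishing_ideal X)
     (ideal_span (minors (codimension X) (jacobian (generators X))))"

definition regular_points :: "(complex ^ 'v) set \<Rightarrow> (complex ^ 'v) set" where
  "regular_points X = X - zero_locus (sing_ideal X)"

definition tangent_space :: "(complex ^ 'v::finite) set \<Rightarrow> complex ^ 'v \<Rightarrow> (complex ^ 'v) set" where
  "tangent_space X z =
     {\<nu>. \<forall>f\<in>vanishing_ideal X. (\<Sum>k\<in>UNIV. poly_eval z (partial_deriv k f) * \<nu> $ k) = 0}"


section \<open>The Hermitian critical ideal\<close>

text \<open>The variables of \<open>\<complex>[z,w,u,v]\<close> are indexed by \<open>('n + 'n) + ('n + 'n)\<close>: the left
  summand for \<open>(z,w)\<close> and the right one for \<open>(u,v)\<close>. Accordingly \<open>\<complex>[z,w]\<close> has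
  variables indexed by \<open>'n + 'n\<close>, and the pairs of vectors \<open>(z,w)\<close> and \<open>(u,v)\<close> are the
  elements of \<open>complex ^ ('n + 'n)\<close>.\<close>

type_synonym 'n zwuv = "('n + 'n) + ('n + 'n)"

abbreviation z_var :: "'n \<Rightarrow> 'n zwuv" where "z_var k \<equiv> Inl (Inl k)"
abbreviation w_var :: "'n \<Rightarrow> 'n zwuv" where "w_var k \<equiv> Inl (Inr k)"
abbreviation u_var :: "'n \<Rightarrow> 'n zwuv" where "u_var k \<equiv> Inr (Inl k)"
abbreviation v_var :: "'n \<Rightarrow> 'n zwuv" where "v_var k \<equiv> Inr (Inr k)"

text \<open>The inclusion of \<open>\<complex>[z]\<close>.\<close>

definition in_z :: "'n mpoly \<Rightarrow> 'n zwuv mpoly" where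
  "in_z = poly_subst Const (\<lambda>k. Var (z_var k))"

definition extend_ideal :: "'n mpoly set \<Rightarrow> 'n zwuv mpoly set" where
  "extend_ideal I = ideal_span (in_z ` I)"

definition swap_sum :: "'a + 'a \<Rightarrow> 'a + 'a" where
  "swap_sum = case_sum Inr Inl"

text \<open>The antilinear involution exchanging \<open>z\<close> with \<open>w\<close> and \<open>u\<close> with \<open>v\<close>.\<close>

definition star :: "'n zwuv mpoly \<Rightarrow> 'n zwuv mpoly" where
  "star = poly_subst (\<lambda>\<alpha>. Const (cnj \<alpha>)) (\<lambda>x. Var (map_sum swap_sum swap_sum x))"

definition augmented_minors_ideal :: "(complex ^ 'n) set \<Rightarrow> 'n zwuv mpoly set" where
  "augmented_minors_ideal X = ideal_span (minors (Suc (codimension X))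
     ((\<lambda>k. Var (v_var k) - Var (w_var k)) #
      map (\<lambda>row k. in_z (row k)) (jacobian (generators X))))"

definition hermitian_critical_ideal :: "(complex ^ 'n) set \<Rightarrow> 'n zwuv mpoly set" where
  "hermitian_critical_ideal X =
     (let I = extend_ideal (vanishing_ideal X);
          I' = augmented_minors_ideal X;
          S = extend_ideal (sing_ideal X)
      in saturation (ideal_sum (ideal_sum (ideal_sum I (star ` I)) I') (star ` I'))
           (ideal_prod S (star ` S)))"

text \<open>Specialisation \<open>\<complex>[z,w,u,v] \<rightarrow> \<complex>[z,w]\<close> at a point \<open>t = (u,v)\<close>.\<close>

definition specialize :: "complex ^ ('n::finite + 'n) \<Rightarrow> 'n zwuv mpoly \<Rightarrow> ('n + 'n) mpoly" where
  "specialize t = poly_subst Const (case_sum Var (\<lambda>x. Const (t $ x)))"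

definition hermitian_critical_ideal_at ::
  "(complex ^ 'n::finite) set \<Rightarrow> complex ^ ('n + 'n) \<Rightarrow> ('n + 'n) mpoly set" where
  "hermitian_critical_ideal_at X t = specialize t ` hermitian_critical_ideal X"


section \<open>Hermitian distance degrees\<close>

text \<open>Solutions are tagged with the irreducible component they come from, so that the cardinality
  is additive over the components (a point lying on two components may count twice).\<close>

definition virtual_critical_points ::
  "(complex ^ 'n::finite) set \<Rightarrow> complex ^ ('n + 'n) \<Rightarrow> ((complex ^ 'n) set \<times> (complex ^ ('n + 'n))) set" where
  "virtual_critical_points X t =
     (SIGMA Y : irreducible_components X. zero_locus (hermitian_critical_ideal_at Y t))"

text \<open>\<open>has_vHDdeg X m\<close> is \<open>vHDdeg(X) = m\<close>; a relation, as the generic count is not a total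
  function by definition. It is single-valued by the lemma below.\<close>

definition has_vHDdeg :: "(complex ^ 'n::finite) set \<Rightarrow> nat \<Rightarrow> bool" where
  "has_vHDdeg X m \<longleftrightarrow> (\<exists>U :: (complex ^ ('n + 'n)) set. zariski_open U \<and> zariski_dense U \<and>
     (\<forall>t\<in>U. finite (virtual_critical_points X t) \<and> card (virtual_critical_points X t) = m))"

lemma zariski_closed_empty: "zariski_closed ({} :: (complex ^ 'v) set)"
proof -
  have "poly_eval z 1 = 1" for z :: "complex ^ 'v"
    by (simp add: poly_eval_def poly_subst_def)
  then have "({} :: (complex ^ 'v) set) = zero_locus {1}"
    by (auto simp: zero_locus_def)
  then show ?thesis
    unfolding zariski_closed_def by blast
qed

lemma has_vHDdeg_unique:
  assumes "has_vHDdeg X m" and "has_vHDdeg X m'"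
  shows "m = m'"
proof -
  obtain U where U: "zariski_open U" "zariski_dense U"
    "\<And>t. t \<in> U \<Longrightarrow> card (virtual_critical_points X t) = m"
    using assms(1) unfolding has_vHDdeg_def by blast
  obtain U' where U': "zariski_dense U'"
    "\<And>t. t \<in> U' \<Longrightarrow> card (virtual_critical_points X t) = m'"
    using assms(2) unfolding has_vHDdeg_def by blast
  have "U \<noteq> {}"
    using U(2) zariski_closed_empty unfolding zariski_dense_def by blast
  have "U \<inter> U' \<noteq> {}"
  proof
    assume "U \<inter> U' = {}"
    then have "U' \<subseteq> - U" by blast
    then have "- U = UNIV"
      using U(1) U'(1) unfolding zariski_open_def zariski_dense_def by blast
    with \<open>U \<noteq> {}\<close> show False by blast
  qed
  then show ?thesis
    using U(3) U'(2) by blast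
qed

text \<open>The critical points of \<open>q\<^sub>u\<close> on an irreducible variety.\<close>

definition hermitian_critical_points ::
  "(complex ^ 'n::finite) set \<Rightarrow> complex ^ 'n \<Rightarrow> (complex ^ 'n) set" where
  "hermitian_critical_points X u =
     {z \<in> regular_points X. \<forall>\<nu>\<in>tangent_space X z. (\<Sum>k\<in>UNIV. (cnj (u $ k) - cnj (z $ k)) * \<nu> $ k) = 0}"

definition tagged_critical_points ::
  "(complex ^ 'n::finite) set \<Rightarrow> complex ^ 'n \<Rightarrow> ((complex ^ 'n) set \<times> (complex ^ 'n)) set" where
  "tagged_critical_points X u =
     (SIGMA Y : irreducible_components X. hermitian_critical_points Y u)"

definition HDdeg :: "(complex ^ 'n::finite) set \<Rightarrow> nat set" where
  "HDdeg X = {m. \<exists>U. open U \<and> U \<noteq> {} \<and>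
     (\<forall>u\<in>U. finite (tagged_critical_points X u) \<and> card (tagged_critical_points X u) = m)}"


section \<open>Singular values\<close>

definition conj_transpose :: "complex ^ 'n ^ 'm \<Rightarrow> complex ^ 'm ^ 'n" where
  "conj_transpose A = (\<chi> i j. cnj (A $ j $ i))"

definition charpoly :: "'a::comm_ring_1 ^ 'n::finite ^ 'n \<Rightarrow> 'a poly" where
  "charpoly A = det (\<chi> i j. (if i = j then [:0, 1:] else 0) - [:A $ i $ j:])"

text \<open>The square roots of the eigenvalues of \<open>A\<^sup>* A\<close>, with multiplicities. These eigenvalues
  are nonnegative reals.\<close>

definition singular_values :: "complex ^ 'n::finite ^ 'n \<Rightarrow> real multiset" where
  "singular_values A = image_mset (\<lambda>x. sqrt (Re x)) (proots (charpoly (conj_transpose A ** A)))"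


section \<open>Affine conics\<close>

definition affine_conic ::
  "complex \<Rightarrow> complex \<Rightarrow> complex \<Rightarrow> complex \<Rightarrow> complex \<Rightarrow> complex \<Rightarrow> (complex ^ 2) set" where
  "affine_conic a b c d e f = zero_locus
     {Const a * Var 1 ^ 2 + Const (2 * b) * Var 1 * Var 2 + Const c * Var 2 ^ 2 +
      Const (2 * d) * Var 1 + Const (2 * e) * Var 2 + Const f}"

end

theory Submission
  imports Defs "HOL-Computational_Algebra.Fundamental_Theorem_Algebra"
begin

text \<open>
  In affine coordinates adapted to the conic, a nonsingular conic is a parabola \<open>y = x\<^sup>2\<close> or a hyperbola
  \<open>x y = 1\<close>, and the coordinate vectors \<open>p\<close>, \<open>q\<close> can be scaled to have equal norm \<open>\<surd>\<kappa>\<close> and inner product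
  \<open>\<kappa> l\<close> with \<open>0 \<le> l < 1\<close>. For the parabola \<open>l = 0\<close>; for the hyperbola \<open>l = 0\<close> exactly if the singular values
  of \<open>A\<^sub>1\<close> agree. These curves are smooth, so the critical ideal needs no saturation, and its zeros become
  pairs \<open>(x, w)\<close> solving two equations, with the involution \<open>(x, w) \<mapsto> (cnj w, cnj x)\<close> whose fixed points for \<open>v = cnj u\<close>
  are the critical points of the distance. Eliminating down to \<open>1 + 2 x w\<close> or \<open>x w\<close> gives a polynomial in one
  variable, of degree 5, 6 or 8, with simple roots for generic \<open>(u, v)\<close>; for \<open>v = cnj u\<close> it has real coefficients
  and its real roots correspond to the critical points. Parity, the traces of a few functions on the solutions, and
  Descartes' rule bound the number of real roots, and sign changes at suitable points realise the
  values claimed. A hyperbola has at least one critical point, since the distance to it attains its minimum.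
  A singular conic is a union of lines, each of which contributes one point.\<close>

section \<open>Polynomials in several variables\<close>

text \<open>Every genericity condition is the nonvanishing of a polynomial in \<open>(u, v)\<close>
  and is certified at a single sample: the Sylvester matrix of two univariate polynomials without
  common root is injective there, hence injective off a hypersurface. The points
  \<open>(u, cnj u)\<close> with \<open>u\<close> in a nonempty open set are Zariski dense, which
  links this to the real count in both directions. A bound proved for generic conjugate parameters
  holds for every element of \<open>HDdeg\<close>. An element of \<open>HDdeg\<close> is produced by
  one conjugate parameter satisfying finitely many strict inequalities on coefficients or values of
  the eliminant: they persist on an open set, and there Descartes' rule, sign changes and parity
  leave a single count. For a skew hyperbola the count 8 has to be excluded. Replacing
  \<open>w\<close> by \<open>1 / w\<close> turns \<open>l\<close> into \<open>1 / l\<close> and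
  yields the trace of \<open>x / w\<close>; its factor \<open>1 / l^2\<close> with
  \<open>l < 1\<close> contradicts Cauchy-Schwarz for the traces of \<open>x w\<close> and
  \<open>1 / (x w)\<close>.\<close>

lemma Const_0 [simp]: "Const 0 = 0"
  by (simp add: Const_def)

lemma Const_1 [simp]: "Const 1 = 1"
  by (simp add: Const_def)

lemma Const_add: "Const (a + b) = Const a + Const b"
  by (simp add: Const_def single_add)

lemma Const_uminus: "Const (- a) = - Const a"
  by (simp add: Const_def single_uminus)

lemma Const_diff: "Const (a - b) = Const a - Const b"
  by (simp add: Const_def single_diff)

lemma Const_mult: "Const (a * b) = Const a * Const b"
  by (simp add: Const_def mult_single)

definition monom_prod :: "('v \<Rightarrow> 'b::comm_ring_1) \<Rightarrow> ('v \<Rightarrow>\<^sub>0 nat) \<Rightarrow> 'b" where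
  "monom_prod \<sigma> m = (\<Prod>x\<in>Poly_Mapping.keys m. \<sigma> x ^ Poly_Mapping.lookup m x)"

lemma monom_prod_superset:
  assumes "finite S" "Poly_Mapping.keys m \<subseteq> S"
  shows "monom_prod \<sigma> m = (\<Prod>x\<in>S. \<sigma> x ^ Poly_Mapping.lookup m x)"
  unfolding monom_prod_def
  by (rule prod.mono_neutral_left) (use assms in \<open>auto simp: in_keys_iff\<close>)

lemma monom_prod_0 [simp]: "monom_prod \<sigma> 0 = 1"
  by (simp add: monom_prod_def)

lemma monom_prod_add: "monom_prod \<sigma> (m + n) = monom_prod \<sigma> m * monom_prod \<sigma> n"
proof -
  let ?S = "Poly_Mapping.keys m \<union> Poly_Mapping.keys n"
  have "Poly_Mapping.keys (m + n) \<subseteq> ?S"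
    by (rule Poly_Mapping.keys_add)
  then show ?thesis
    by (simp add: monom_prod_superset[of ?S] lookup_add power_add prod.distrib)
qed

lemma monom_prod_single [simp]: "monom_prod \<sigma> (Poly_Mapping.single x k) = \<sigma> x ^ k"
  by (cases "k = 0") (simp_all add: monom_prod_def)

lemma poly_subst_alt:
  "poly_subst h \<sigma> p =
     (\<Sum>m\<in>Poly_Mapping.keys p. h (Poly_Mapping.lookup p m) * monom_prod \<sigma> m)"
  by (simp add: poly_subst_def monom_prod_def)

text \<open>Only additivity, multiplicativity and the unit are asked of \<open>h\<close>, so the
  same lemmas serve evaluation (\<open>h\<close> the identity), the inclusions
  (\<open>h = Const\<close>) and the antilinear involution \<open>star\<close> (\<open>h\<close>
  conjugates).\<close>

locale coeff_hom =
  fixes h :: "complex \<Rightarrow> 'b::comm_ring_1"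
  assumes h_add: "h (a + b) = h a + h b"
    and h_mult: "h (a * b) = h a * h b"
    and h_1: "h 1 = 1"
begin

lemma h_0: "h 0 = 0"
  using h_add[of 0 0] by simp

lemma poly_subst_superset:
  assumes "finite S" "Poly_Mapping.keys p \<subseteq> S"
  shows "poly_subst h \<sigma> p = (\<Sum>m\<in>S. h (Poly_Mapping.lookup p m) * monom_prod \<sigma> m)"
  unfolding poly_subst_alt
  by (rule sum.mono_neutral_left) (use assms in \<open>auto simp: in_keys_iff h_0\<close>)

lemma poly_subst_0: "poly_subst h \<sigma> 0 = 0"
  by (simp add: poly_subst_def)

lemma poly_subst_single: "poly_subst h \<sigma> (Poly_Mapping.single m a) = h a * monom_prod \<sigma> m"
  by (cases "a = 0") (simp_all add: poly_subst_alt h_0)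

lemma poly_subst_add: "poly_subst h \<sigma> (p + q) = poly_subst h \<sigma> p + poly_subst h \<sigma> q"
proof -
  let ?S = "Poly_Mapping.keys p \<union> Poly_Mapping.keys q"
  have "Poly_Mapping.keys (p + q) \<subseteq> ?S"
    by (rule Poly_Mapping.keys_add)
  then show ?thesis
    by (simp add: poly_subst_superset[of ?S] lookup_add h_add distrib_right sum.distrib)
qed

lemma poly_subst_sum: "poly_subst h \<sigma> (sum f S) = (\<Sum>i\<in>S. poly_subst h \<sigma> (f i))"
  by (induction S rule: infinite_finite_induct) (simp_all add: poly_subst_0 poly_subst_add)

end

lemma mpoly_as_sum:
  "(p :: 'v mpoly) = (\<Sum>m\<in>Poly_Mapping.keys p. Poly_Mapping.single m (Poly_Mapping.lookup p m))"
  by (rule poly_mapping_eqI)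
    (auto simp: lookup_sum lookup_single when_def in_keys_iff sum.delta)

lemma mpoly_induct_single [case_names single add]:
  assumes "\<And>m a. P (Poly_Mapping.single m a)" and "\<And>p q. P p \<Longrightarrow> P q \<Longrightarrow> P (p + q)"
  shows "P (p :: 'v mpoly)"
proof -
  have "P (\<Sum>m\<in>S. Poly_Mapping.single m (Poly_Mapping.lookup p m))" if "finite S" for S
    using that
  proof (induction S)
    case empty
    show ?case using assms(1)[of 0 0] by simp
  qed (auto intro: assms)
  then show ?thesis
    by (subst mpoly_as_sum) simp
qed

lemma mpoly_induct [case_names Const Var add mult]:
  assumes C: "\<And>a. P (Const a)" and V: "\<And>x. P (Var x)"
    and A: "\<And>p q. P p \<Longrightarrow> P q \<Longrightarrow> P (p + q)" and M: "\<And>p q. P p \<Longrightarrow> P q \<Longrightarrow> P (p * q)"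
  shows "P (p :: 'v mpoly)"
proof (induction p rule: mpoly_induct_single)
  case (single m a)
  have pow: "P (Poly_Mapping.single (Poly_Mapping.single x k) 1)" for x :: 'v and k
  proof (induction k)
    case 0
    show ?case using C[of 1] by (simp add: Const_def)
  next
    case (Suc k)
    have "Poly_Mapping.single x (Suc k) = Poly_Mapping.single x 1 + Poly_Mapping.single x k"
      by (simp flip: single_add)
    then show ?case
      using M[OF V[of x] Suc] by (simp add: Var_def mult_single)
  qed
  have *: "P (Poly_Mapping.single (\<Sum>x\<in>S. Poly_Mapping.single x (k x)) 1)" if "finite S" for S k
    using that
  proof (induction S)
    case empty
    show ?case using C[of 1] by (simp add: Const_def)
  next
    case (insert x S)
    then show ?case
      using M[OF pow[of x "k x"] insert.IH] by (simp add: mult_single)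
  qed
  have "m = (\<Sum>x\<in>Poly_Mapping.keys m. Poly_Mapping.single x (Poly_Mapping.lookup m x))"
    by (rule poly_mapping_eqI)
      (auto simp: lookup_sum lookup_single when_def in_keys_iff sum.delta)
  then have "P (Poly_Mapping.single m 1)"
    using *[of "Poly_Mapping.keys m" "Poly_Mapping.lookup m"] by simp
  from M[OF C[of a] this] show ?case
    by (simp add: Const_def mult_single)
qed (rule A)

context coeff_hom
begin

lemma poly_subst_mult: "poly_subst h \<sigma> (p * q) = poly_subst h \<sigma> p * poly_subst h \<sigma> q"
proof (induction p arbitrary: q rule: mpoly_induct_single)
  case (single m a)
  show ?case
    by (induction q rule: mpoly_induct_single)
      (simp_all add: mult_single poly_subst_single h_mult monom_prod_add poly_subst_add
         algebra_simps)
qed (simp add: poly_subst_add distrib_right)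

lemma poly_subst_Const [simp]: "poly_subst h \<sigma> (Const a) = h a"
  by (simp add: Const_def poly_subst_single)

lemma poly_subst_Var [simp]: "poly_subst h \<sigma> (Var x) = \<sigma> x"
  by (simp add: Var_def poly_subst_single h_1)

lemma poly_subst_1 [simp]: "poly_subst h \<sigma> 1 = 1"
  using poly_subst_Const[of \<sigma> 1] by (simp add: h_1)

lemma poly_subst_uminus: "poly_subst h \<sigma> (- p) = - poly_subst h \<sigma> p"
  using poly_subst_add[of \<sigma> p "- p"] by (simp add: poly_subst_0 add_eq_0_iff)

lemma poly_subst_diff: "poly_subst h \<sigma> (p - q) = poly_subst h \<sigma> p - poly_subst h \<sigma> q"
  using poly_subst_add[of \<sigma> p "- q"] by (simp add: poly_subst_uminus)

lemma poly_subst_prod: "poly_subst h \<sigma> (prod f S) = (\<Prod>i\<in>S. poly_subst h \<sigma> (f i))"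
  by (induction S rule: infinite_finite_induct) (simp_all add: poly_subst_mult)

lemma poly_subst_power: "poly_subst h \<sigma> (p ^ k) = poly_subst h \<sigma> p ^ k"
  by (induction k) (simp_all add: poly_subst_mult)

lemma poly_subst_of_int: "poly_subst h \<sigma> (of_int k) = of_int k"
proof -
  have "poly_subst h \<sigma> (of_nat n) = of_nat n" for n
    by (induction n) (simp_all add: poly_subst_0 poly_subst_add)
  then show ?thesis
    by (cases k rule: int_cases2) (simp_all add: poly_subst_uminus)
qed

lemmas poly_subst_hom = poly_subst_0 poly_subst_1 poly_subst_add poly_subst_mult
  poly_subst_uminus poly_subst_diff poly_subst_Const poly_subst_Var poly_subst_power
  poly_subst_sum poly_subst_prod poly_subst_of_int

end

interpretation eval: coeff_hom "\<lambda>\<alpha>. \<alpha>"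
  by unfold_locales simp_all

interpretation const: coeff_hom Const
  by unfold_locales (simp_all add: Const_add Const_mult)

interpretation cnj_const: coeff_hom "\<lambda>\<alpha>. Const (cnj \<alpha>)"
  by unfold_locales (simp_all add: Const_add Const_mult)

lemma poly_eval_hom [simp]:
  "poly_eval z 0 = 0" "poly_eval z 1 = 1"
  "poly_eval z (p + q) = poly_eval z p + poly_eval z q"
  "poly_eval z (p * q) = poly_eval z p * poly_eval z q"
  "poly_eval z (- p) = - poly_eval z p"
  "poly_eval z (p - q) = poly_eval z p - poly_eval z q"
  "poly_eval z (Const a) = a"
  "poly_eval z (Var x) = z $ x"
  "poly_eval z (p ^ k) = poly_eval z p ^ k"
  "poly_eval z (sum f S) = (\<Sum>i\<in>S. poly_eval z (f i))"
  "poly_eval z (prod f' S) = (\<Prod>i\<in>S. poly_eval z (f' i))"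
  "poly_eval z (of_int j) = of_int j"
  by (simp_all add: poly_eval_def eval.poly_subst_hom)

lemma in_z_hom:
  "in_z (p + q) = in_z p + in_z q" "in_z (p * q) = in_z p * in_z q" "in_z 1 = 1" "in_z 0 = 0"
  by (simp_all add: in_z_def const.poly_subst_hom)

lemma poly_eval_in_z: "poly_eval s (in_z p) = poly_eval (\<chi> k. s $ z_var k) p"
  by (induction p rule: mpoly_induct) (simp_all add: in_z_def const.poly_subst_hom)

lemma poly_eval_specialize:
  "poly_eval s (specialize t p) = poly_eval (\<chi> i. case i of Inl j \<Rightarrow> s $ j | Inr j \<Rightarrow> t $ j) p"
proof (induction p rule: mpoly_induct)
  case (Var x)
  then show ?case by (cases x) (simp_all add: specialize_def const.poly_subst_hom)
qed (simp_all add: specialize_def const.poly_subst_hom)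

lemma star_hom:
  "star (p + q) = star p + star q" "star (p * q) = star p * star q" "star 1 = 1" "star 0 = 0"
  by (simp_all add: star_def cnj_const.poly_subst_hom)

lemma poly_eval_star:
  "poly_eval s (star p) = cnj (poly_eval (\<chi> i. cnj (s $ map_sum swap_sum swap_sum i)) p)"
  by (induction p rule: mpoly_induct) (simp_all add: star_def cnj_const.poly_subst_hom)

subsection \<open>Partial derivatives\<close>

lemma partial_deriv_superset:
  assumes "finite S" "Poly_Mapping.keys p \<subseteq> S"
  shows "partial_deriv x p =
     (\<Sum>m\<in>S. Poly_Mapping.single (m - Poly_Mapping.single x 1)
        (of_nat (Poly_Mapping.lookup m x) * Poly_Mapping.lookup p m))"
  unfolding partial_deriv_def
  by (rule sum.mono_neutral_left) (use assms in \<open>auto simp: in_keys_iff\<close>)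

lemma partial_deriv_add: "partial_deriv x (p + q) = partial_deriv x p + partial_deriv x q"
proof -
  let ?S = "Poly_Mapping.keys p \<union> Poly_Mapping.keys q"
  have "Poly_Mapping.keys (p + q) \<subseteq> ?S"
    by (rule Poly_Mapping.keys_add)
  then show ?thesis
    by (simp add: partial_deriv_superset[of ?S] lookup_add distrib_left single_add sum.distrib)
qed

lemma partial_deriv_single:
  "partial_deriv x (Poly_Mapping.single m a) =
     Poly_Mapping.single (m - Poly_Mapping.single x 1) (of_nat (Poly_Mapping.lookup m x) * a)"
  by (cases "a = 0") (simp_all add: partial_deriv_def)

text \<open>Exponents are subtracted with truncation, so lowering the exponent of \<open>x\<close>
  commutes with adding \<open>n\<close> only if that exponent is nonzero; in the product rule the
  other case has coefficient 0.\<close>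

lemma single_minus_add:
  assumes "Poly_Mapping.lookup m x \<noteq> 0"
  shows "(m - Poly_Mapping.single x 1) + n = (m + n) - Poly_Mapping.single x (1::nat)"
  by (rule poly_mapping_eqI)
    (use assms in \<open>auto simp: lookup_add lookup_minus lookup_single when_def\<close>)

lemma partial_deriv_mult:
  "partial_deriv x (p * q) = partial_deriv x p * q + p * partial_deriv x q"
proof (induction p arbitrary: q rule: mpoly_induct_single)
  case (single m a)
  show ?case
  proof (induction q rule: mpoly_induct_single)
    case (single n b)
    have 1: "partial_deriv x (Poly_Mapping.single m a) * Poly_Mapping.single n b =
        Poly_Mapping.single (m + n - Poly_Mapping.single x 1)
          (of_nat (Poly_Mapping.lookup m x) * (a * b))"
      using single_minus_add[of m x n]
      by (cases "Poly_Mapping.lookup m x = 0")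
        (simp_all add: partial_deriv_single mult_single mult.assoc)
    have 2: "Poly_Mapping.single m a * partial_deriv x (Poly_Mapping.single n b) =
        Poly_Mapping.single (m + n - Poly_Mapping.single x 1)
          (of_nat (Poly_Mapping.lookup n x) * (a * b))"
      using single_minus_add[of n x m]
      by (cases "Poly_Mapping.lookup n x = 0")
        (simp_all add: partial_deriv_single mult_single add.commute mult_ac)
    show ?case
      unfolding 1 2
      by (simp add: mult_single partial_deriv_single lookup_add distrib_right single_add)
  qed (simp add: partial_deriv_add algebra_simps)
qed (simp add: partial_deriv_add algebra_simps)

lemma partial_deriv_Const [simp]: "partial_deriv x (Const a) = 0"
  by (simp add: Const_def partial_deriv_single)

lemma partial_deriv_Var [simp]: "partial_deriv x (Var y) = (if x = y then 1 else 0)"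
  by (auto simp: Var_def partial_deriv_single lookup_single when_def single_one)

lemma partial_deriv_1 [simp]: "partial_deriv x 1 = 0"
  using partial_deriv_Const[of x 1] by (simp del: partial_deriv_Const)

lemma partial_deriv_uminus: "partial_deriv x (- p) = - partial_deriv x p"
proof -
  have "- p = Const (- 1) * p"
    by (simp add: Const_uminus)
  then show ?thesis
    by (simp only: partial_deriv_mult partial_deriv_Const) (simp add: Const_uminus)
qed

lemma partial_deriv_diff: "partial_deriv x (p - q) = partial_deriv x p - partial_deriv x q"
  using partial_deriv_add[of x p "- q"] by (simp add: partial_deriv_uminus)

lemmas partial_deriv_simps = partial_deriv_add partial_deriv_mult partial_deriv_uminus
  partial_deriv_diff

section \<open>Ideals and varieties\<close>

lemmas ideal_span_base = module.span_base[OF module_times, folded ideal_span_def]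
  and ideal_span_zero = module.span_zero[OF module_times, folded ideal_span_def]
  and ideal_span_add = module.span_add[OF module_times, folded ideal_span_def]
  and ideal_span_mult = module.span_scale[OF module_times, folded ideal_span_def]
  and ideal_span_induct_alt =
    module.span_induct_alt[OF module_times, folded ideal_span_def, consumes 1, case_names zero step]

lemma ideal_span_diff: "p \<in> ideal_span S \<Longrightarrow> q \<in> ideal_span S \<Longrightarrow> p - q \<in> ideal_span S"
  unfolding ideal_span_def by (rule module.span_diff[OF module_times])

lemma ideal_span_singleton: "p \<in> ideal_span {F} \<longleftrightarrow> (\<exists>h. p = h * F)"
  unfolding ideal_span_def by (auto simp: module.span_singleton[OF module_times])

lemma zero_on_ideal_span:
  assumes "\<And>p q. \<phi> (p + q) = \<phi> p + \<phi> q" "\<And>p q. \<phi> (p * q) = \<phi> p * \<phi> q" "\<phi> 0 = 0"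
  shows "(\<forall>p\<in>ideal_span S. \<phi> p = (0 :: complex)) \<longleftrightarrow> (\<forall>p\<in>S. \<phi> p = 0)"
proof
  assume *: "\<forall>p\<in>S. \<phi> p = 0"
  show "\<forall>p\<in>ideal_span S. \<phi> p = 0"
  proof
    fix p assume "p \<in> ideal_span S"
    then show "\<phi> p = 0"
      by (induction rule: ideal_span_induct_alt) (use * in \<open>simp_all add: assms\<close>)
  qed
qed (auto intro: ideal_span_base)

lemma zero_locus_Un: "zero_locus (S \<union> T) = zero_locus S \<inter> zero_locus T"
  by (auto simp: zero_locus_def)

lemma zariski_closed_Int: "zariski_closed Y \<Longrightarrow> zariski_closed Z \<Longrightarrow> zariski_closed (Y \<inter> Z)"
  unfolding zariski_closed_def by (metis zero_locus_Un)

lemma zariski_closed_UNIV: "zariski_closed UNIV"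
  unfolding zariski_closed_def by (rule exI[of _ "{}"]) (simp add: zero_locus_def)

lemma zariski_closed_zero_locus: "zariski_closed (zero_locus S)"
  unfolding zariski_closed_def by blast

lemma zariski_closed_separate:
  assumes "zariski_closed Y" "z \<notin> Y"
  obtains p where "p \<in> vanishing_ideal Y" "poly_eval z p \<noteq> 0"
  using assms unfolding zariski_closed_def zero_locus_def vanishing_ideal_def by blast

text \<open>Restriction to a line is the bridge to univariate polynomials: it gives the absence of
  zero divisors, the order of vanishing in \<open>irreducible_above\<close> and the density of real
  points.\<close>

lemma poly_eval_on_line: "\<exists>P. \<forall>s. poly_eval (a + s *s b) p = poly P s"
proof (induction p rule: mpoly_induct)
  case (Const \<alpha>)
  show ?case by (rule exI[of _ "[:\<alpha>:]"]) simp
next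
  case (Var x)
  show ?case by (rule exI[of _ "[:a $ x, b $ x:]"]) simp
next
  case (add p q)
  then obtain P Q where "\<forall>s. poly_eval (a + s *s b) p = poly P s"
      "\<forall>s. poly_eval (a + s *s b) q = poly Q s" by blast
  then show ?case by (intro exI[of _ "P + Q"]) simp
next
  case (mult p q)
  then obtain P Q where "\<forall>s. poly_eval (a + s *s b) p = poly P s"
      "\<forall>s. poly_eval (a + s *s b) q = poly Q s" by blast
  then show ?case by (intro exI[of _ "P * Q"]) simp
qed

text \<open>On the line through a point where \<open>p\<close> is nonzero and one where
  \<open>q\<close> is nonzero both restrictions are nonzero univariate polynomials, so their product
  cannot vanish.\<close>

lemma poly_eval_mult_eq_0:
  assumes "\<And>z. poly_eval z p * poly_eval z q = 0"
  shows "(\<forall>z. poly_eval z p = 0) \<or> (\<forall>z. poly_eval z q = 0)"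
proof (rule ccontr)
  assume "\<not> ?thesis"
  then obtain y z where yz: "poly_eval y p \<noteq> 0" "poly_eval z q \<noteq> 0" by blast
  obtain P Q where P: "\<And>s. poly_eval (y + s *s (z - y)) p = poly P s"
      and Q: "\<And>s. poly_eval (y + s *s (z - y)) q = poly Q s"
    using poly_eval_on_line by metis
  have "poly (P * Q) s = 0" for s
    using assms[of "y + s *s (z - y)"] unfolding P Q by simp
  then have "P * Q = 0"
    using poly_all_0_iff_0 by blast
  moreover have "P \<noteq> 0" "Q \<noteq> 0"
    using P[of 0] Q[of 1] yz by auto
  ultimately show False by simp
qed

lemma irreducible_variety_UNIV: "irreducible_variety (UNIV :: (complex ^ 'v) set)"
  unfolding irreducible_variety_def
proof (intro conjI allI impI)
  fix Y Z :: "(complex ^ 'v) set"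
  assume YZ: "zariski_closed Y \<and> zariski_closed Z \<and> UNIV = Y \<union> Z"
  show "UNIV = Y \<or> UNIV = Z"
  proof (rule ccontr)
    assume "\<not> ?thesis"
    then obtain y z where yz: "y \<notin> Y" "z \<notin> Z" by blast
    obtain p q where p: "p \<in> vanishing_ideal Y" "poly_eval y p \<noteq> 0"
        and q: "q \<in> vanishing_ideal Z" "poly_eval z q \<noteq> 0"
      using zariski_closed_separate YZ yz by metis
    have "poly_eval x p * poly_eval x q = 0" for x
      using p q YZ unfolding vanishing_ideal_def by (cases "x \<in> Y") auto
    then show False
      using poly_eval_mult_eq_0 p q by blast
  qed
qed (auto intro: zariski_closed_UNIV)

lemma irreducible_variety_subset_Un:
  assumes "irreducible_variety Y" "zariski_closed U" "zariski_closed V" "Y \<subseteq> U \<union> V"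
  shows "Y \<subseteq> U \<or> Y \<subseteq> V"
proof -
  have Y: "Y = (Y \<inter> U) \<union> (Y \<inter> V)" using assms(4) by blast
  have closed: "zariski_closed (Y \<inter> U)" "zariski_closed (Y \<inter> V)"
    using assms(1-3) by (simp_all add: irreducible_variety_def zariski_closed_Int)
  have split: "Y = P \<or> Y = Q" if "Y = P \<union> Q" "zariski_closed P" "zariski_closed Q" for P Q
    using assms(1) that unfolding irreducible_variety_def by metis
  have "Y = Y \<inter> U \<or> Y = Y \<inter> V" by (rule split[OF Y closed])
  then show ?thesis by (simp add: inf.absorb_iff1 eq_commute)
qed

lemma irreducible_components_irreducible:
  assumes "irreducible_variety X"
  shows "irreducible_components X = {X}"
proof (intro equalityI subsetI)
  fix Y assume "Y \<in> irreducible_components X"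
  then have "Y \<subseteq> X" and max: "\<And>Z. irreducible_variety Z \<and> Y \<subseteq> Z \<and> Z \<subseteq> X \<Longrightarrow> Z = Y"
    by (auto simp: irreducible_components_def)
  then have "X = Y" using assms by simp
  then show "Y \<in> {X}" by simp
qed (use assms in \<open>auto simp: irreducible_components_def\<close>)

lemma irreducible_components_Un:
  assumes "irreducible_variety U" "irreducible_variety V" "\<not> U \<subseteq> V" "\<not> V \<subseteq> U"
  shows "irreducible_components (U \<union> V) = {U, V}"
proof -
  have *: "Y \<subseteq> U \<or> Y \<subseteq> V" if "irreducible_variety Y" "Y \<subseteq> U \<union> V" for Y
    using irreducible_variety_subset_Un[OF that(1) _ _ that(2)] assms
    by (auto simp: irreducible_variety_def)
  have U: "Z = U" if "irreducible_variety Z" "U \<subseteq> Z" "Z \<subseteq> U \<union> V" for Z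
    using *[OF that(1,3)] that(2) assms(3) by (meson order.trans subset_antisym)
  have V: "Z = V" if "irreducible_variety Z" "V \<subseteq> Z" "Z \<subseteq> U \<union> V" for Z
    using *[OF that(1,3)] that(2) assms(4) by (meson order.trans subset_antisym)
  show ?thesis
  proof (intro equalityI subsetI)
    fix Y assume "Y \<in> irreducible_components (U \<union> V)"
    then have Y: "irreducible_variety Y" "Y \<subseteq> U \<union> V"
      and max: "\<And>Z. irreducible_variety Z \<and> Y \<subseteq> Z \<and> Z \<subseteq> U \<union> V \<Longrightarrow> Z = Y"
      by (auto simp: irreducible_components_def)
    from *[OF Y] show "Y \<in> {U, V}"
    proof
      assume "Y \<subseteq> U"
      then have "U = Y" by (intro max) (simp add: assms(1))
      then show ?thesis by simp
    next
      assume "Y \<subseteq> V"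
      then have "V = Y" by (intro max) (simp add: assms(2))
      then show ?thesis by simp
    qed
  next
    fix Y assume "Y \<in> {U, V}"
    then show "Y \<in> irreducible_components (U \<union> V)"
      unfolding irreducible_components_def using assms(1,2) U V by auto
  qed
qed

lemma type2_cases: "(k :: 2) = 1 \<or> k = 2"
  using exhaust_2 by blast

subsection \<open>Smooth plane curves\<close>

text \<open>\<open>smooth\<close> is the algebraic form of having no singular point. It makes
  \<open>sing_ideal X\<close> the unit ideal, so that the saturation in the critical ideal changes
  nothing; \<open>vanishing\<close> lets one equation stand for all generators.\<close>

locale smooth_plane_curve =
  fixes X :: "(complex ^ 2) set" and F :: "2 mpoly"
  assumes X_eq: "X = zero_locus {F}"
    and vanishing: "vanishing_ideal X = ideal_span {F}"
    and irreducible: "irreducible_variety X"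
    and proper: "X \<noteq> UNIV"
    and smooth: "1 \<in> ideal_span {F, partial_deriv 1 F, partial_deriv 2 F}"
begin

lemma mem_X: "z \<in> X \<longleftrightarrow> poly_eval z F = 0"
  by (simp add: X_eq zero_locus_def)

lemma vanishing_multiple: "p \<in> vanishing_ideal X \<Longrightarrow> \<exists>q. p = F * q"
  by (auto simp: vanishing ideal_span_singleton mult.commute)

text \<open>A polynomial vanishing on an irreducible set strictly between the curve and the plane would
  be divisible by all powers of \<open>F\<close>, hence have a zero of infinite order on a line through a point
  of the curve.\<close>

lemma irreducible_above:
  assumes Y: "irreducible_variety Y" "X \<subset> Y"
  shows "Y = UNIV"
proof (rule ccontr)
  assume "Y \<noteq> UNIV"
  then obtain z where "z \<notin> Y" by blast
  moreover have closed: "zariski_closed Y"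
    using Y(1) by (simp add: irreducible_variety_def)
  ultimately obtain p where p: "p \<in> vanishing_ideal Y" "poly_eval z p \<noteq> 0"
    using zariski_closed_separate by blast
  have *: "\<exists>q\<in>vanishing_ideal Y. p = F ^ k * q" for k
  proof (induction k)
    case (Suc k)
    then obtain q where q: "q \<in> vanishing_ideal Y" "p = F ^ k * q" by blast
    then have "q \<in> vanishing_ideal X"
      using Y(2) unfolding vanishing_ideal_def by blast
    then obtain q' where q': "q = F * q'"
      using vanishing_multiple by blast
    have "Y \<subseteq> X \<union> zero_locus {q'}"
      using q(1) unfolding q' by (auto simp: vanishing_ideal_def mem_X zero_locus_def)
    then have "Y \<subseteq> zero_locus {q'}"
      using irreducible_variety_subset_Un[OF Y(1)] Y(2) X_eq zariski_closed_zero_locus by blast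
    then have "q' \<in> vanishing_ideal Y"
      by (auto simp: vanishing_ideal_def zero_locus_def)
    then show ?case
      using q(2) q' by (intro bexI[of _ q']) (simp_all add: mult_ac)
  qed (use p(1) in auto)
  obtain x where x: "x \<in> X"
    using irreducible by (auto simp: irreducible_variety_def)
  obtain L where L: "\<And>p s. poly_eval (x + s *s (z - x)) p = poly (L p) s"
    using poly_eval_on_line by metis
  have "poly (L F) 0 = 0"
    using L[of 0 F] x by (simp add: mem_X)
  then have X_dvd: "[:0, 1:] dvd L F"
    by (metis poly_eq_0_iff_dvd minus_zero)
  have nz: "L p \<noteq> 0"
    using L[of 1 p] p(2) by auto
  obtain q where q: "p = F ^ Suc (degree (L p)) * q"
    using * by blast
  have "poly (L p) s = poly (L F ^ Suc (degree (L p)) * L q) s" for s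
    unfolding poly_mult poly_power L[symmetric] by (subst (1) q) simp
  then have "L p = L F ^ Suc (degree (L p)) * L q"
    by (metis poly_eq_poly_eq_iff ext)
  then have "[:0, 1:] ^ Suc (degree (L p)) dvd L p"
    by (metis X_dvd dvd_mult2 dvd_power_same)
  then show False
    using nz dvd_imp_degree_le[OF _ nz] by (metis degree_linear_power not_less_eq_eq order_refl)
qed

text \<open>By \<open>irreducible_above\<close> nothing irreducible lies strictly between the curve
  and the plane, so chains starting at \<open>X\<close> have length 0 or 1.\<close>

lemma codimension: "codimension X = 1"
proof -
  have "{k. \<exists>C :: nat \<Rightarrow> (complex ^ 2) set. C 0 = X \<and>
     (\<forall>i\<le>k. irreducible_variety (C i)) \<and> (\<forall>i<k. C i \<subset> C (Suc i))} = {0, 1}" (is "?S = _")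
  proof (intro equalityI subsetI)
    fix k assume "k \<in> ?S"
    then obtain C where C: "C 0 = X" "\<forall>i\<le>k. irreducible_variety (C i)" "\<forall>i<k. C i \<subset> C (Suc i)"
      by blast
    have "\<not> k \<ge> 2"
    proof
      assume "k \<ge> 2"
      then have "C 0 \<subset> C 1" "C 1 \<subset> C 2" "irreducible_variety (C 1)"
        using C(2,3) by (auto simp: numeral_2_eq_2)
      then show False
        using irreducible_above[of "C 1"] C(1) by auto
    qed
    then show "k \<in> {0, 1}" by auto
  next
    fix k :: nat assume "k \<in> {0, 1}"
    then consider "k = 0" | "k = 1" by blast
    then show "k \<in> ?S"
    proof cases
      case 1
      then show ?thesis
        by (intro CollectI exI[of _ "\<lambda>_. X"]) (auto simp: irreducible)
    next
      case 2
      then show ?thesis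
        using proper
        by (intro CollectI exI[of _ "\<lambda>i. if i = 0 then X else UNIV"])
          (auto simp: irreducible irreducible_variety_UNIV)
    qed
  qed
  then show ?thesis
    by (simp add: codimension_def cSup_eq_Max)
qed

lemma generators: "ideal_span (set (generators X)) = vanishing_ideal X"
  unfolding generators_def by (rule someI[of _ "[F]"]) (simp add: vanishing)

lemma minors_1:
  assumes "f \<in> set fs"
  shows "partial_deriv k f \<in> minors 1 (jacobian fs)"
proof -
  obtain i where i: "i < length fs" "fs ! i = f"
    using assms by (auto simp: in_set_conv_nth)
  have "{..<1 :: nat} = {0}" by auto
  then have "{\<pi>. \<pi> permutes {..<1 :: nat}} = {id}" by simp
  then show ?thesis
    unfolding minors_def
    by (intro CollectI exI[of _ "\<lambda>_. i"] exI[of _ "\<lambda>_. k"]) (use i in \<open>auto simp: jacobian_def inj_on_def\<close>)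
qed

lemma subspace_sing_ideal: "module.subspace (*) (sing_ideal X)"
proof -
  have "sing_ideal X =
      module.span (*) ({F} \<union> minors (codimension X) (jacobian (generators X)))"
    unfolding sing_ideal_def ideal_sum_def vanishing ideal_span_def
    by (rule module.span_Un[OF module_times, symmetric])
  then show ?thesis
    by (simp add: module.subspace_span[OF module_times])
qed

text \<open>The list \<open>generators X\<close> is an arbitrary choice. Writing \<open>p\<close> as
  a combination of its members and applying the product rule shows that the derivatives of every
  element of the ideal, in particular those of \<open>F\<close>, lie in the singular ideal formed
  from that choice.\<close>

lemma partial_deriv_in_sing_ideal:
  assumes "p \<in> vanishing_ideal X"
  shows "partial_deriv k p \<in> sing_ideal X" and "p \<in> sing_ideal X"
proof -
  note sub = module.subspace_add[OF module_times subspace_sing_ideal]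
    module.subspace_scale[OF module_times subspace_sing_ideal]
  have I: "q \<in> sing_ideal X" if "q \<in> vanishing_ideal X" for q
    unfolding sing_ideal_def ideal_sum_def
    by (rule CollectI, rule exI[of _ q], rule exI[of _ 0]) (simp add: that ideal_span_zero)
  have J: "partial_deriv k f \<in> sing_ideal X" if "f \<in> set (generators X)" for f
    unfolding sing_ideal_def ideal_sum_def codimension
    by (rule CollectI, rule exI[of _ 0], rule exI[of _ "partial_deriv k f"])
      (auto simp: vanishing ideal_span_zero intro!: ideal_span_base minors_1 that[unfolded One_nat_def]
        simp flip: One_nat_def)
  show "p \<in> sing_ideal X" by (rule I[OF assms])
  have "p \<in> ideal_span (set (generators X))"
    using assms by (simp add: generators)
  then show "partial_deriv k p \<in> sing_ideal X"
  proof (induction rule: ideal_span_induct_alt)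
    case zero
    have "partial_deriv k (0 :: 2 mpoly) = 0" by (simp add: partial_deriv_def)
    then show ?case using I[of 0] by (simp add: vanishing ideal_span_zero)
  next
    case (step c x y)
    have "x \<in> sing_ideal X"
      using step(1) by (intro I) (auto simp: generators[symmetric] intro: ideal_span_base)
    then show ?case
      unfolding partial_deriv_simps using J[OF step(1)] step(2) by (intro sub)
  qed
qed

lemma F_in: "F \<in> vanishing_ideal X"
  by (simp add: vanishing ideal_span_base)

lemma sing_ideal: "sing_ideal X = UNIV"
proof -
  have "ideal_span {F, partial_deriv 1 F, partial_deriv 2 F} \<subseteq> sing_ideal X"
    unfolding ideal_span_def
    by (rule module.span_minimal[OF module_times _ subspace_sing_ideal])
      (auto intro: partial_deriv_in_sing_ideal F_in)
  then have "1 \<in> sing_ideal X" using smooth by blast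
  then have "p * 1 \<in> sing_ideal X" for p
    by (rule module.subspace_scale[OF module_times subspace_sing_ideal])
  then show ?thesis by auto
qed

lemma regular_points: "regular_points X = X"
proof -
  have "z \<notin> zero_locus UNIV" for z :: "complex ^ 2"
  proof
    assume "z \<in> zero_locus UNIV"
    then have "poly_eval z 1 = 0" unfolding zero_locus_def by blast
    then show False by simp
  qed
  then show ?thesis by (auto simp: regular_points_def sing_ideal)
qed

definition grad :: "2 \<Rightarrow> complex ^ 2 \<Rightarrow> complex" where
  "grad k z = poly_eval z (partial_deriv k F)"

lemma grad_nonzero:
  assumes "z \<in> X"
  shows "grad 1 z \<noteq> 0 \<or> grad 2 z \<noteq> 0"
proof (rule ccontr)
  assume *: "\<not> ?thesis"
  have "(\<forall>p\<in>ideal_span {F, partial_deriv 1 F, partial_deriv 2 F}. poly_eval z p = 0)"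
    by (subst zero_on_ideal_span) (use * assms in \<open>auto simp: mem_X grad_def\<close>)
  then show False using smooth by fastforce
qed

lemma grad_vanishing:
  assumes "p \<in> vanishing_ideal X" "z \<in> X"
  shows "\<exists>g. \<forall>k. poly_eval z (partial_deriv k p) = g * grad k z"
proof -
  obtain q where "p = F * q" using vanishing_multiple[OF assms(1)] by blast
  then show ?thesis
    using assms(2)
    by (intro exI[of _ "poly_eval z q"]) (simp add: partial_deriv_mult mem_X grad_def)
qed

lemma tangent_space:
  assumes "z \<in> X"
  shows "tangent_space X z = {\<nu> :: complex ^ 2. grad 1 z * \<nu> $ 1 + grad 2 z * \<nu> $ 2 = 0}"
proof (intro equalityI subsetI CollectI)
  fix \<nu> :: "complex ^ 2" assume "\<nu> \<in> tangent_space X z"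
  then show "grad 1 z * \<nu> $ 1 + grad 2 z * \<nu> $ 2 = 0"
    using F_in by (auto simp: tangent_space_def sum_2 grad_def)
next
  fix \<nu> :: "complex ^ 2" assume *: "\<nu> \<in> {\<nu>. grad 1 z * \<nu> $ 1 + grad 2 z * \<nu> $ 2 = 0}"
  show "\<nu> \<in> tangent_space X z"
    unfolding tangent_space_def
  proof (intro CollectI ballI)
    fix f assume "f \<in> vanishing_ideal X"
    then obtain g where "\<forall>k. poly_eval z (partial_deriv k f) = g * grad k z"
      using grad_vanishing assms by blast
    then have "(\<Sum>k\<in>UNIV. poly_eval z (partial_deriv k f) * \<nu> $ k) =
        g * (grad 1 z * \<nu> $ 1 + grad 2 z * \<nu> $ 2)"
      by (simp add: sum_2 algebra_simps)
    then show "(\<Sum>k\<in>UNIV. poly_eval z (partial_deriv k f) * \<nu> $ k) = 0"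
      using * by simp
  qed
qed

text \<open>\<open>v - w\<close> is a multiple of the gradient at the point \<open>z\<close> of the curve.\<close>

definition normal_at :: "complex ^ 2 \<Rightarrow> complex ^ 2 \<Rightarrow> complex ^ 2 \<Rightarrow> bool" where
  "normal_at z w v \<longleftrightarrow>
     z \<in> X \<and> (v $ 1 - w $ 1) * grad 2 z = (v $ 2 - w $ 2) * grad 1 z"

end

definition vcnj :: "complex ^ 'n \<Rightarrow> complex ^ 'n" where
  "vcnj z = (\<chi> k. cnj (z $ k))"

definition lpart :: "complex ^ ('n::finite + 'n) \<Rightarrow> complex ^ 'n" where
  "lpart s = (\<chi> k. s $ Inl k)"

definition rpart :: "complex ^ ('n::finite + 'n) \<Rightarrow> complex ^ 'n" where
  "rpart s = (\<chi> k. s $ Inr k)"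

lemma vcnj_nth [simp]: "vcnj z $ k = cnj (z $ k)"
  by (simp add: vcnj_def)

lemma part_nth [simp]: "lpart s $ k = s $ Inl k" "rpart s $ k = s $ Inr k"
  by (simp_all add: lpart_def rpart_def)

text \<open>The kernel of the nonzero functional \<open>(\<alpha>, \<beta>)\<close> is spanned by
  \<open>(\<beta>, - \<alpha>)\<close>.\<close>

lemma annihilates_kernel_iff:
  fixes \<alpha> \<beta> :: complex
  assumes "\<alpha> \<noteq> 0 \<or> \<beta> \<noteq> 0"
  shows "(\<forall>\<nu> :: complex ^ 2. \<alpha> * \<nu> $ 1 + \<beta> * \<nu> $ 2 = 0 \<longrightarrow> x * \<nu> $ 1 + y * \<nu> $ 2 = 0) \<longleftrightarrow>
    x * \<beta> = y * \<alpha>"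
proof
  assume *: "\<forall>\<nu> :: complex ^ 2. \<alpha> * \<nu> $ 1 + \<beta> * \<nu> $ 2 = 0 \<longrightarrow> x * \<nu> $ 1 + y * \<nu> $ 2 = 0"
  show "x * \<beta> = y * \<alpha>"
    using *[rule_format, of "vector [\<beta>, - \<alpha>]"] by simp
next
  assume *: "x * \<beta> = y * \<alpha>"
  show "\<forall>\<nu> :: complex ^ 2. \<alpha> * \<nu> $ 1 + \<beta> * \<nu> $ 2 = 0 \<longrightarrow> x * \<nu> $ 1 + y * \<nu> $ 2 = 0"
  proof (intro allI impI)
    fix \<nu> :: "complex ^ 2"
    assume "\<alpha> * \<nu> $ 1 + \<beta> * \<nu> $ 2 = 0"
    then have "\<alpha> * (x * \<nu> $ 1 + y * \<nu> $ 2) = 0" "\<beta> * (x * \<nu> $ 1 + y * \<nu> $ 2) = 0"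
      using * by algebra+
    then show "x * \<nu> $ 1 + y * \<nu> $ 2 = 0" using assms by auto
  qed
qed

lemma (in smooth_plane_curve) hermitian_critical_points:
  "hermitian_critical_points X u = {z. normal_at z (vcnj z) (vcnj u)}"
proof -
  have "(\<forall>\<nu>\<in>tangent_space X z. (\<Sum>k\<in>UNIV. (cnj (u $ k) - cnj (z $ k)) * \<nu> $ k) = 0) \<longleftrightarrow>
      (cnj (u $ 1) - cnj (z $ 1)) * grad 2 z = (cnj (u $ 2) - cnj (z $ 2)) * grad 1 z"
    if "z \<in> X" for z
    using annihilates_kernel_iff[OF grad_nonzero[OF that]]
    by (simp add: tangent_space[OF that] sum_2)
  then show ?thesis
    unfolding hermitian_critical_points_def regular_points normal_at_def by auto
qed

lemma minors_2:
  "minors 2 M = {(M ! r 0) (c 0) * (M ! r 1) (c 1) - (M ! r 0) (c 1) * (M ! r 1) (c 0)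
      |(r :: nat \<Rightarrow> nat) (c :: nat \<Rightarrow> 'n).
        inj_on r {..<2} \<and> r ` {..<2} \<subseteq> {..<length M} \<and> inj_on c {..<2}}"
proof -
  have two: "{..<2 :: nat} = insert 0 {1}" by auto
  have "{\<pi>. \<pi> permutes {..<2 :: nat}} = {id, Transposition.transpose 0 1}"
    unfolding two by (auto simp: permutes_doubleton_iff)
  then have "(\<Sum>\<pi> | \<pi> permutes {..<2}. of_int (sign \<pi>) * (\<Prod>i<2. (M ! r i) (c (\<pi> i)))) =
      (M ! r 0) (c 0) * (M ! r 1) (c 1) - (M ! r 0) (c 1) * (M ! r 1) (c 0)"
    for r :: "nat \<Rightarrow> nat" and c :: "nat \<Rightarrow> 'n"
  proof -
    have "id \<noteq> Transposition.transpose 0 (1::nat)"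
      by (metis id_apply transpose_apply_first zero_neq_one)
    then show ?thesis
      using \<open>{\<pi>. \<pi> permutes {..<2 :: nat}} = _\<close>
      by (simp add: sign_swap_id numeral_2_eq_2)
  qed
  then show ?thesis unfolding minors_def by auto
qed

subsection \<open>The Hermitian critical ideal of a smooth plane curve\<close>

lemma swap_sum_swap_sum [simp]: "swap_sum (swap_sum x) = x"
  by (cases x) (simp_all add: swap_sum_def)

lemma star_star [simp]: "star (star p) = p"
proof (induction p rule: mpoly_induct)
  case (Var x)
  show ?case by (cases x) (simp_all add: star_def cnj_const.poly_subst_hom)
qed (simp_all add: star_hom, simp add: star_def cnj_const.poly_subst_hom)

definition absorbing :: "'a::comm_ring_1 set \<Rightarrow> bool" where
  "absorbing I \<longleftrightarrow> (\<forall>p\<in>I. \<forall>q. q * p \<in> I)"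

lemma absorbing_ideal_span: "absorbing (ideal_span S)"
  by (simp add: absorbing_def ideal_span_mult)

lemma absorbing_star: "absorbing I \<Longrightarrow> absorbing (star ` I)"
  unfolding absorbing_def by (metis image_iff star_hom(2) star_star)

lemma absorbing_ideal_sum: "absorbing I \<Longrightarrow> absorbing J \<Longrightarrow> absorbing (ideal_sum I J)"
  unfolding absorbing_def ideal_sum_def by (fastforce simp: distrib_left)

lemma absorbing_eq_UNIV: "absorbing I \<Longrightarrow> 1 \<in> I \<Longrightarrow> I = UNIV"
  unfolding absorbing_def by (metis UNIV_eq_I mult.right_neutral)

lemma ideal_prod_UNIV: "ideal_prod UNIV UNIV = UNIV"
proof (rule absorbing_eq_UNIV)
  have "(1 :: 'a) = 1 * 1" by simp
  then show "(1 :: 'a) \<in> ideal_prod UNIV UNIV"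
    unfolding ideal_prod_def by (intro ideal_span_base) blast
qed (simp add: ideal_prod_def absorbing_ideal_span)

lemma ideal_power_UNIV: "ideal_power UNIV k = UNIV"
  by (induction k) (simp_all add: ideal_prod_UNIV)

lemma saturation_UNIV:
  assumes "absorbing I"
  shows "saturation I UNIV = I"
proof -
  have "ideal_quotient I UNIV = I"
  proof (intro equalityI subsetI)
    fix p assume "p \<in> ideal_quotient I UNIV"
    then have "p * 1 \<in> I" unfolding ideal_quotient_def by blast
    then show "p \<in> I" by simp
  next
    fix p assume "p \<in> I"
    then have "q * p \<in> I" for q using assms unfolding absorbing_def by blast
    then show "p \<in> ideal_quotient I UNIV" by (simp add: ideal_quotient_def mult.commute)
  qed
  then show ?thesis
    by (simp add: saturation_def ideal_power_UNIV)
qed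

lemma zero_on_ideal_sum:
  assumes "\<And>p q. \<phi> (p + q) = \<phi> p + \<phi> q" "0 \<in> I" "0 \<in> J"
  shows "(\<forall>p\<in>ideal_sum I J. \<phi> p = (0 :: complex)) \<longleftrightarrow> (\<forall>p\<in>I. \<phi> p = 0) \<and> (\<forall>p\<in>J. \<phi> p = 0)"
proof -
  have "p \<in> ideal_sum I J" if "p \<in> I \<or> p \<in> J" for p
    unfolding ideal_sum_def using that assms(2,3)
    by (metis (mono_tags, lifting) add.left_neutral add.right_neutral mem_Collect_eq)
  then show ?thesis
    by (auto simp: ideal_sum_def assms(1))
qed

definition join_pt :: "complex ^ ('a + 'a) \<Rightarrow> complex ^ ('a + 'a) \<Rightarrow> complex ^ (('a::finite + 'a) + ('a + 'a))"
  where "join_pt s t = (\<chi> i. case i of Inl j \<Rightarrow> s $ j | Inr j \<Rightarrow> t $ j)"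

definition swap_pt :: "complex ^ ('a + 'a) \<Rightarrow> complex ^ ('a::finite + 'a)" where
  "swap_pt s = (\<chi> i. cnj (s $ swap_sum i))"

lemma swap_pt_parts [simp]:
  "lpart (swap_pt s) = vcnj (rpart s)" "rpart (swap_pt s) = vcnj (lpart s)"
  by (simp_all add: vec_eq_iff swap_pt_def swap_sum_def)

lemma poly_eval_star_join: "poly_eval (join_pt s t) (star p) = cnj (poly_eval (join_pt (swap_pt s) (swap_pt t)) p)"
proof -
  have "(\<chi> i. cnj (join_pt s t $ map_sum swap_sum swap_sum i)) = join_pt (swap_pt s) (swap_pt t)"
    by (auto simp: vec_eq_iff join_pt_def swap_pt_def split: sum.splits)
  then show ?thesis by (simp add: poly_eval_star)
qed

lemma poly_eval_in_z_join: "poly_eval (join_pt s t) (in_z p) = poly_eval (lpart s) p"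
proof -
  have "(\<chi> k. join_pt s t $ z_var k) = lpart s"
    by (simp add: vec_eq_iff join_pt_def)
  then show ?thesis by (simp add: poly_eval_in_z)
qed

lemma parallel_rows:
  fixes \<alpha> \<beta> :: complex
  assumes "\<alpha> \<noteq> 0 \<or> \<beta> \<noteq> 0" "x * \<beta> = y * \<alpha>" "x' * \<beta> = y' * \<alpha>"
  shows "x * y' = y * x'"
proof -
  have "\<alpha> * (x * y' - y * x') = 0" "\<beta> * (x * y' - y * x') = 0"
    using assms(2,3) by algebra+
  then show ?thesis using assms(1) by auto
qed

context smooth_plane_curve
begin

lemma zero_on_extend_ideal:
  "(\<forall>p\<in>extend_ideal (vanishing_ideal X). poly_eval (join_pt s t) p = 0) \<longleftrightarrow> lpart s \<in> X"
proof -
  have "(\<forall>p\<in>extend_ideal (vanishing_ideal X). poly_eval (join_pt s t) p = 0) \<longleftrightarrow>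
      (\<forall>p\<in>vanishing_ideal X. poly_eval (lpart s) p = 0)"
    unfolding extend_ideal_def by (subst zero_on_ideal_span) (simp_all add: poly_eval_in_z_join)
  also have "\<dots> \<longleftrightarrow> lpart s \<in> X"
    unfolding vanishing by (subst zero_on_ideal_span) (simp_all add: mem_X)
  finally show ?thesis .
qed

definition aug_matrix :: "(2 \<Rightarrow> 2 zwuv mpoly) list" where
  "aug_matrix = (\<lambda>k. Var (v_var k) - Var (w_var k)) #
      map (\<lambda>row k. in_z (row k)) (jacobian (generators X))"

text \<open>At a point of the curve each row of the Jacobian of the chosen generators is a multiple
  of the gradient of \<open>F\<close>, and \<open>F\<close> in turn is a combination of the
  generators. So the 2-minors vanish exactly if the first row \<open>v - w\<close> is parallel to
  this gradient.\<close>

lemma zero_on_augmented: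
  assumes "lpart s \<in> X"
  shows "(\<forall>p\<in>augmented_minors_ideal X. poly_eval (join_pt s t) p = 0) \<longleftrightarrow>
    normal_at (lpart s) (rpart s) (rpart t)"
proof -
  let ?e = "poly_eval (join_pt s t)" and ?z = "lpart s"
  define \<eta> where "\<eta> k = rpart t $ k - rpart s $ k" for k
  have aug: "(\<forall>p\<in>augmented_minors_ideal X. ?e p = 0) \<longleftrightarrow> (\<forall>p\<in>minors 2 aug_matrix. ?e p = 0)"
    unfolding augmented_minors_ideal_def codimension aug_matrix_def
    by (subst zero_on_ideal_span) (simp_all add: numeral_2_eq_2)
  have row0: "?e ((aug_matrix ! 0) k) = \<eta> k" for k
    by (simp add: aug_matrix_def \<eta>_def join_pt_def)
  have row: "?e ((aug_matrix ! Suc i) k) = poly_eval ?z (partial_deriv k (generators X ! i))"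
    if "i < length (generators X)" for i k
    using that by (simp add: aug_matrix_def jacobian_def poly_eval_in_z_join)
  have len: "length aug_matrix = Suc (length (generators X))"
    by (simp add: aug_matrix_def jacobian_def)
  have "(\<forall>p\<in>minors 2 aug_matrix. ?e p = 0) \<longleftrightarrow> \<eta> 1 * grad 2 ?z = \<eta> 2 * grad 1 ?z"
  proof
    assume *: "\<forall>p\<in>minors 2 aug_matrix. ?e p = 0"
    have "\<eta> 1 * poly_eval ?z (partial_deriv 2 f) = \<eta> 2 * poly_eval ?z (partial_deriv 1 f)"
      if f: "f \<in> set (generators X)" for f
    proof -
      obtain i where i: "i < length (generators X)" "generators X ! i = f"
        using f by (auto simp: in_set_conv_nth)
      define r :: "nat \<Rightarrow> nat" where "r j = (if j = 0 then 0 else Suc i)" for j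
      define c :: "nat \<Rightarrow> 2" where "c j = (if j = 0 then 1 else 2)" for j
      have "inj_on r {..<2}" "inj_on c {..<2}" "r ` {..<2} \<subseteq> {..<length aug_matrix}"
        using i by (auto simp: inj_on_def r_def c_def len)
      then have "(aug_matrix ! r 0) (c 0) * (aug_matrix ! r 1) (c 1) -
          (aug_matrix ! r 0) (c 1) * (aug_matrix ! r 1) (c 0) \<in> minors 2 aug_matrix"
        unfolding minors_2 by blast
      then show ?thesis
        using * row0 row[OF i(1)] i(2) by (fastforce simp: r_def c_def)
    qed
    note gens = this
    have "F \<in> ideal_span (set (generators X))"
      by (simp add: generators F_in)
    then have "poly_eval ?z F = 0 \<and>
        \<eta> 1 * poly_eval ?z (partial_deriv 2 F) = \<eta> 2 * poly_eval ?z (partial_deriv 1 F)"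
    proof (induction rule: ideal_span_induct_alt)
      case zero
      show ?case by (simp add: partial_deriv_def)
    next
      case (step c x y)
      have "x \<in> vanishing_ideal X"
        using step(1) by (auto simp: generators[symmetric] intro: ideal_span_base)
      then have "poly_eval ?z x = 0"
        using assms by (auto simp: vanishing_ideal_def)
      then show ?case
        using step(2) gens[OF step(1)] by (simp add: partial_deriv_simps algebra_simps)
    qed
    then show "\<eta> 1 * grad 2 ?z = \<eta> 2 * grad 1 ?z" by (simp add: grad_def)
  next
    assume *: "\<eta> 1 * grad 2 ?z = \<eta> 2 * grad 1 ?z"
    have rows: "?e ((aug_matrix ! i) 1) * grad 2 ?z = ?e ((aug_matrix ! i) 2) * grad 1 ?z"
      if i: "i < length aug_matrix" for i
    proof (cases i)
      case 0
      then show ?thesis using * by (simp add: row0)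
    next
      case (Suc j)
      then have j: "j < length (generators X)" using i by (simp add: len)
      then have "generators X ! j \<in> vanishing_ideal X"
        by (auto simp: generators[symmetric] intro: ideal_span_base)
      then obtain g where "\<And>k. poly_eval ?z (partial_deriv k (generators X ! j)) = g * grad k ?z"
        using grad_vanishing[OF _ assms] by blast
      then show ?thesis by (simp add: Suc row[OF j])
    qed
    show "\<forall>p\<in>minors 2 aug_matrix. ?e p = 0"
    proof
      fix p assume "p \<in> minors 2 aug_matrix"
      then obtain r :: "nat \<Rightarrow> nat" and c :: "nat \<Rightarrow> 2" where
        p: "p = (aug_matrix ! r 0) (c 0) * (aug_matrix ! r 1) (c 1) -
          (aug_matrix ! r 0) (c 1) * (aug_matrix ! r 1) (c 0)"
        and r: "r ` {..<2} \<subseteq> {..<length aug_matrix}"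
        unfolding minors_2 by blast
      have "r i < length aug_matrix" if "i < 2" for i using r that by blast
      then have len: "r 0 < length aug_matrix" "r 1 < length aug_matrix" by simp_all
      have par: "?e ((aug_matrix ! r 0) 1) * ?e ((aug_matrix ! r 1) 2) =
          ?e ((aug_matrix ! r 0) 2) * ?e ((aug_matrix ! r 1) 1)"
        by (rule parallel_rows[OF grad_nonzero[OF assms] rows[OF len(1)] rows[OF len(2)]])
      show "?e p = 0"
        using type2_cases[of "c 0"] type2_cases[of "c 1"]
        by (elim disjE) (simp_all only: p par poly_eval_hom diff_self)
    qed
  qed
  then show ?thesis
    using assms by (simp add: aug normal_at_def \<eta>_def)
qed

text \<open>The value of a starred polynomial at \<open>s\<close> is the conjugate of the value of
  the original one at \<open>swap_pt s\<close>. Thus the starred ideals contribute the same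
  normality condition with the two blocks exchanged and conjugated.\<close>

theorem critical_zeros:
  "zero_locus (hermitian_critical_ideal_at X t) =
    {s. normal_at (lpart s) (rpart s) (rpart t) \<and>
        normal_at (vcnj (rpart s)) (vcnj (lpart s)) (vcnj (lpart t))}"
proof -
  let ?I = "extend_ideal (vanishing_ideal X)" and ?J = "augmented_minors_ideal X"
  have "(1 :: 2 zwuv mpoly) \<in> extend_ideal UNIV"
    unfolding extend_ideal_def by (rule ideal_span_base) (metis in_z_hom(3) rangeI)
  then have S: "extend_ideal (sing_ideal X) = UNIV"
    unfolding sing_ideal by (intro absorbing_eq_UNIV) (simp_all add: extend_ideal_def absorbing_ideal_span)
  have surj: "surj (star :: 2 zwuv mpoly \<Rightarrow> _)"
    by (metis star_star surj_def)
  have abs: "absorbing ?I" "absorbing ?J"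
    by (simp_all add: extend_ideal_def augmented_minors_ideal_def absorbing_ideal_span)
  have crit: "hermitian_critical_ideal X =
      ideal_sum (ideal_sum (ideal_sum ?I (star ` ?I)) ?J) (star ` ?J)"
    unfolding hermitian_critical_ideal_def Let_def S surj ideal_prod_UNIV
    by (intro saturation_UNIV absorbing_ideal_sum absorbing_star abs)
  have zero: "0 \<in> ?I" "0 \<in> ?J" "0 \<in> star ` ?I" "0 \<in> star ` ?J"
    using star_hom(4) by (auto simp: extend_ideal_def augmented_minors_ideal_def ideal_span_zero
        intro!: image_eqI[of _ star 0])
  have zero_sum: "0 \<in> ideal_sum A B" if "0 \<in> A" "0 \<in> B" for A B :: "2 zwuv mpoly set"
    unfolding ideal_sum_def using that by force
  have "s \<in> zero_locus (hermitian_critical_ideal_at X t) \<longleftrightarrow>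
      normal_at (lpart s) (rpart s) (rpart t) \<and>
        normal_at (vcnj (rpart s)) (vcnj (lpart s)) (vcnj (lpart t))" for s
  proof -
  have "s \<in> zero_locus (hermitian_critical_ideal_at X t) \<longleftrightarrow>
      (\<forall>p\<in>hermitian_critical_ideal X. poly_eval (join_pt s t) p = 0)"
    by (simp add: zero_locus_def hermitian_critical_ideal_at_def poly_eval_specialize join_pt_def)
  also have "\<dots> \<longleftrightarrow> (\<forall>p\<in>?I. poly_eval (join_pt s t) p = 0) \<and>
      (\<forall>p\<in>?I. poly_eval (join_pt (swap_pt s) (swap_pt t)) p = 0) \<and>
      (\<forall>p\<in>?J. poly_eval (join_pt s t) p = 0) \<and>
      (\<forall>p\<in>?J. poly_eval (join_pt (swap_pt s) (swap_pt t)) p = 0)"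
    unfolding crit
    by (simp add: zero_on_ideal_sum zero zero_sum poly_eval_star_join)
  also have "\<dots> \<longleftrightarrow> normal_at (lpart s) (rpart s) (rpart t) \<and>
        normal_at (vcnj (rpart s)) (vcnj (lpart s)) (vcnj (lpart t))"
    using zero_on_augmented[of s t] zero_on_augmented[of "swap_pt s" "swap_pt t"]
    by (auto simp: zero_on_extend_ideal normal_at_def)
  finally show ?thesis .
  qed
  then show ?thesis by blast
qed

end

section \<open>Lines, parabolas and hyperbolas\<close>

definition lift_at :: "'v mpoly \<Rightarrow> complex poly \<Rightarrow> 'v mpoly" where
  "lift_at L R = poly (map_poly Const R) L"

lemma lift_at_0 [simp]: "lift_at L 0 = 0"
  by (simp add: lift_at_def)

lemma lift_at_pCons [simp]: "lift_at L (pCons a R) = Const a + L * lift_at L R"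
  by (simp add: lift_at_def map_poly_pCons)

lemma lift_at_1 [simp]: "lift_at L 1 = 1"
  by (simp add: one_pCons)

lemma lift_at_add: "lift_at L (R + S) = lift_at L R + lift_at L S"
  by (induction R S rule: poly_induct2) (simp_all add: Const_add algebra_simps)

lemma lift_at_smult: "lift_at L (smult a R) = Const a * lift_at L R"
  by (induction R) (simp_all add: Const_mult algebra_simps)

lemma lift_at_mult: "lift_at L (R * S) = lift_at L R * lift_at L S"
  by (induction R) (simp_all add: lift_at_add lift_at_smult algebra_simps)

lemma lift_at_power: "lift_at L (R ^ k) = lift_at L R ^ k"
  by (induction k) (simp_all add: lift_at_mult)

lemma poly_eval_lift_at: "poly_eval z (lift_at L R) = poly R (poly_eval z L)"
  by (induction R) simp_all

definition cong_mod :: "'v mpoly \<Rightarrow> 'v mpoly \<Rightarrow> 'v mpoly \<Rightarrow> bool" where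
  "cong_mod F p q \<longleftrightarrow> p - q \<in> ideal_span {F}"

lemma cong_mod_refl [simp]: "cong_mod F p p"
  by (simp add: cong_mod_def ideal_span_zero)

lemma cong_mod_sym: "cong_mod F p q \<Longrightarrow> cong_mod F q p"
  unfolding cong_mod_def using ideal_span_diff[OF ideal_span_zero, of "p - q"] by simp

lemma cong_mod_trans: "cong_mod F p q \<Longrightarrow> cong_mod F q r \<Longrightarrow> cong_mod F p r"
  unfolding cong_mod_def using ideal_span_add[of "p - q" _ "q - r"] by simp

lemma cong_mod_add: "cong_mod F p q \<Longrightarrow> cong_mod F p' q' \<Longrightarrow> cong_mod F (p + p') (q + q')"
  unfolding cong_mod_def using ideal_span_add[of "p - q" _ "p' - q'"] by (simp add: algebra_simps)

lemma cong_mod_mult: "cong_mod F p q \<Longrightarrow> cong_mod F p' q' \<Longrightarrow> cong_mod F (p * p') (q * q')"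
  unfolding cong_mod_def
  using ideal_span_add[OF ideal_span_mult[of "p - q" _ p'] ideal_span_mult[of "p' - q'" _ q]]
  by (simp add: algebra_simps)

lemma cong_mod_power: "cong_mod F p q \<Longrightarrow> cong_mod F (p ^ k) (q ^ k)"
  by (induction k) (simp_all add: cong_mod_mult)

lemma cong_mod_eval: "cong_mod F p q \<Longrightarrow> poly_eval z F = 0 \<Longrightarrow> poly_eval z p = poly_eval z q"
  unfolding cong_mod_def ideal_span_singleton
  by (metis mult_zero_right poly_eval_hom(4,6) right_minus_eq)

text \<open>A plane curve parametrised by an infinite subset of the line, where \<open>L\<close> recovers the
  parameter and a unit \<open>M\<close> of the coordinate ring clears the denominators of the coordinates.\<close>

locale rational_curve =
  fixes F L M M' :: "'v::finite mpoly" and R0 :: "complex poly" and T :: "complex set"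
    and \<phi> :: "complex \<Rightarrow> complex ^ 'v"
  assumes inf: "infinite T"
    and on_curve: "t \<in> T \<Longrightarrow> poly_eval (\<phi> t) F = 0"
    and L_\<phi>: "t \<in> T \<Longrightarrow> poly_eval (\<phi> t) L = t"
    and unit: "cong_mod F (M * M') 1"
    and M_lift: "cong_mod F M (lift_at L R0)"
    and Var_lift: "\<exists>R. cong_mod F (M * Var k) (lift_at L R)"
begin

text \<open>To add two lifts, both are brought to the common power \<open>N + N'\<close> of
  \<open>M\<close>; for this \<open>M\<close> itself must be congruent to a polynomial in
  \<open>L\<close>, which is \<open>M_lift\<close>.\<close>

lemma all_lift: "\<exists>N R. cong_mod F (M ^ N * p) (lift_at L R)"
proof (induction p rule: mpoly_induct)
  case (Const a)
  show ?case by (rule exI[of _ 0], rule exI[of _ "[:a:]"]) simp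
next
  case (Var x)
  show ?case using Var_lift[of x] by (metis power_one_right)
next
  case (add p q)
  then obtain N R N' R' where p: "cong_mod F (M ^ N * p) (lift_at L R)"
      and q: "cong_mod F (M ^ N' * q) (lift_at L R')" by blast
  have "cong_mod F (M ^ N' * (M ^ N * p) + M ^ N * (M ^ N' * q))
      (lift_at L (R0 ^ N' * R + R0 ^ N * R'))"
    unfolding lift_at_add lift_at_mult lift_at_power
    by (intro cong_mod_add cong_mod_mult cong_mod_power M_lift p q)
  then have "cong_mod F (M ^ (N + N') * (p + q)) (lift_at L (R0 ^ N' * R + R0 ^ N * R'))"
    by (simp add: power_add algebra_simps)
  then show ?case by blast
next
  case (mult p q)
  then obtain N R N' R' where p: "cong_mod F (M ^ N * p) (lift_at L R)"
      and q: "cong_mod F (M ^ N' * q) (lift_at L R')" by blast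
  have "cong_mod F ((M ^ N * p) * (M ^ N' * q)) (lift_at L (R * R'))"
    unfolding lift_at_mult by (intro cong_mod_mult p q)
  then have "cong_mod F (M ^ (N + N') * (p * q)) (lift_at L (R * R'))"
    by (simp add: power_add algebra_simps)
  then show ?case by blast
qed

lemma poly_zero_on_T: "(\<And>t. t \<in> T \<Longrightarrow> poly R t = 0) \<Longrightarrow> R = 0"
  using inf poly_roots_finite[of R] finite_subset[of T "{t. poly R t = 0}"] by auto

lemma lift_eval:
  assumes "cong_mod F (M ^ N * p) (lift_at L R)" "t \<in> T"
  shows "poly R t = poly_eval (\<phi> t) M ^ N * poly_eval (\<phi> t) p"
  using cong_mod_eval[OF assms(1) on_curve[OF assms(2)]] assms(2)
  by (simp add: poly_eval_lift_at L_\<phi>)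

lemma in_ideal_if_lift_0:
  assumes "cong_mod F (M ^ N * p) 0"
  shows "p \<in> ideal_span {F}"
proof -
  have "cong_mod F (M' ^ N * (M ^ N * p)) (M' ^ N * 0)"
    by (intro cong_mod_mult assms cong_mod_refl)
  then have "cong_mod F ((M * M') ^ N * p) 0"
    by (simp add: power_mult_distrib mult_ac)
  moreover have "cong_mod F ((M * M') ^ N * p) (1 ^ N * p)"
    by (intro cong_mod_mult cong_mod_power unit cong_mod_refl)
  ultimately have "cong_mod F (1 ^ N * p) 0"
    by (blast intro: cong_mod_sym cong_mod_trans)
  then show ?thesis by (simp add: cong_mod_def)
qed

text \<open>This replaces the Nullstellensatz. After multiplication by a power of \<open>M\<close>,
  a polynomial vanishing on the curve is a polynomial in \<open>L\<close> that is zero on the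
  infinite set \<open>T\<close>, hence zero; since \<open>M\<close> is a unit modulo
  \<open>F\<close>, the power can be removed again.\<close>

lemma vanishing_ideal_eq: "vanishing_ideal (zero_locus {F}) = ideal_span {F}"
proof (intro equalityI subsetI)
  fix p assume p: "p \<in> vanishing_ideal (zero_locus {F})"
  obtain N R where R: "cong_mod F (M ^ N * p) (lift_at L R)" using all_lift by blast
  have "R = 0"
  proof (rule poly_zero_on_T)
    fix t assume t: "t \<in> T"
    then have "poly_eval (\<phi> t) p = 0"
      using p on_curve by (simp add: vanishing_ideal_def zero_locus_def)
    then show "poly R t = 0" by (simp add: lift_eval[OF R t])
  qed
  then show "p \<in> ideal_span {F}" using in_ideal_if_lift_0 R by simp
next
  fix p assume "p \<in> ideal_span {F}"
  then show "p \<in> vanishing_ideal (zero_locus {F})"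
    by (auto simp: ideal_span_singleton vanishing_ideal_def zero_locus_def)
qed

text \<open>If two proper closed subsets covered the curve, the lifts of two separating polynomials
  would have a product vanishing on \<open>T\<close>, so one of the lifts would be zero.\<close>

lemma irreducible: "irreducible_variety (zero_locus {F})"
  unfolding irreducible_variety_def
proof (intro conjI allI impI)
  show "zero_locus {F} \<noteq> {}"
    using infinite_imp_nonempty[OF inf] on_curve by (auto simp: zero_locus_def)
next
  fix Y Z :: "(complex ^ 'v) set"
  assume YZ: "zariski_closed Y \<and> zariski_closed Z \<and> zero_locus {F} = Y \<union> Z"
  show "zero_locus {F} = Y \<or> zero_locus {F} = Z"
  proof (rule ccontr)
    assume "\<not> ?thesis"
    then obtain y z where y: "y \<in> zero_locus {F}" "y \<notin> Y" and z: "z \<in> zero_locus {F}" "z \<notin> Z"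
      using YZ by blast
    obtain p where p: "p \<in> vanishing_ideal Y" "poly_eval y p \<noteq> 0"
      using zariski_closed_separate YZ y(2) by blast
    obtain q where q: "q \<in> vanishing_ideal Z" "poly_eval z q \<noteq> 0"
      using zariski_closed_separate YZ z(2) by blast
    obtain N R where R: "cong_mod F (M ^ N * p) (lift_at L R)" using all_lift by blast
    obtain N' S where S: "cong_mod F (M ^ N' * q) (lift_at L S)" using all_lift by blast
    have "R * S = 0"
    proof (rule poly_zero_on_T)
      fix t assume t: "t \<in> T"
      then have "\<phi> t \<in> Y \<union> Z" using on_curve YZ by (auto simp: zero_locus_def)
      then have "poly_eval (\<phi> t) p * poly_eval (\<phi> t) q = 0"
        using p q by (auto simp: vanishing_ideal_def)
      then show "poly (R * S) t = 0"
        using lift_eval[OF R t] lift_eval[OF S t] by auto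
    qed
    then have "p \<in> ideal_span {F} \<or> q \<in> ideal_span {F}"
      using in_ideal_if_lift_0[of N p] in_ideal_if_lift_0[of N' q] R S by auto
    then show False
      using p q y z unfolding vanishing_ideal_eq[symmetric] by (auto simp: vanishing_ideal_def)
  qed
qed (rule zariski_closed_zero_locus)

end

section \<open>Affine frames and the model curves in them\<close>

locale affine_frame =
  fixes z0 p q :: "complex ^ 2"
  assumes det: "p $ 1 * q $ 2 - p $ 2 * q $ 1 \<noteq> 0"
begin

definition \<delta> :: complex where "\<delta> = p $ 1 * q $ 2 - p $ 2 * q $ 1"

lemma \<delta>_nonzero: "\<delta> \<noteq> 0"
  using det by (simp add: \<delta>_def)

text \<open>Cramer's rule: \<open>L1\<close> and \<open>L2\<close> are the coordinates with respect
  to the origin \<open>z0\<close> and the basis \<open>p\<close>, \<open>q\<close>, as polynomials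
  in the ambient variables.\<close>

definition L1 :: "2 mpoly" where
  "L1 = Const (q $ 2 / \<delta>) * (Var 1 - Const (z0 $ 1)) - Const (q $ 1 / \<delta>) * (Var 2 - Const (z0 $ 2))"

definition L2 :: "2 mpoly" where
  "L2 = Const (p $ 1 / \<delta>) * (Var 2 - Const (z0 $ 2)) - Const (p $ 2 / \<delta>) * (Var 1 - Const (z0 $ 1))"

definition pt :: "complex \<Rightarrow> complex \<Rightarrow> complex ^ 2" where
  "pt x y = z0 + x *s p + y *s q"

lemma Var_frame: "Const (z0 $ k) + Const (p $ k) * L1 + Const (q $ k) * L2 = Var k"
proof -
  let ?a = "Var 1 - Const (z0 $ 1) :: 2 mpoly" and ?b = "Var 2 - Const (z0 $ 2) :: 2 mpoly"
  define i :: "2 mpoly" where "i = Const (1 / \<delta>)"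
  have div: "Const (a / \<delta>) = Const a * i" for a
    by (simp add: i_def flip: Const_mult)
  have "Const (p $ k) * L1 + Const (q $ k) * L2 =
      Const ((p $ k * q $ 2 - q $ k * p $ 2) / \<delta>) * ?a + Const ((q $ k * p $ 1 - p $ k * q $ 1) / \<delta>) * ?b"
    unfolding L1_def L2_def div by (simp add: Const_diff Const_mult algebra_simps)
  then have *: "Const (z0 $ k) + Const (p $ k) * L1 + Const (q $ k) * L2 =
      Const (z0 $ k) + (Const ((p $ k * q $ 2 - q $ k * p $ 2) / \<delta>) * ?a +
        Const ((q $ k * p $ 1 - p $ k * q $ 1) / \<delta>) * ?b)"
    by (simp add: add.assoc)
  have \<delta>: "(p $ 1 * q $ 2 - q $ 1 * p $ 2) / \<delta> = 1" "(q $ 2 * p $ 1 - p $ 2 * q $ 1) / \<delta> = 1"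
    using \<delta>_nonzero by (simp_all add: \<delta>_def mult.commute)
  show ?thesis
    unfolding * using type2_cases[of k] by (elim disjE) (simp_all add: \<delta> mult.commute)
qed

lemma eval_frame [simp]: "poly_eval (pt x y) L1 = x" "poly_eval (pt x y) L2 = y"
  using \<delta>_nonzero by (simp_all add: L1_def L2_def pt_def field_simps) (simp_all add: \<delta>_def algebra_simps)

lemma pt_eval: "pt (poly_eval z L1) (poly_eval z L2) = z"
  using arg_cong[OF Var_frame, of "poly_eval z"] by (simp add: pt_def vec_eq_iff algebra_simps)

lemma pt_surj: "\<exists>x y. z = pt x y"
  using pt_eval by metis

lemma pt_inject: "pt x y = pt x' y' \<longleftrightarrow> x = x' \<and> y = y'"
  by (metis eval_frame)

lemma partial_deriv_frame:
  "partial_deriv 1 L1 = Const (q $ 2 / \<delta>)" "partial_deriv 2 L1 = - Const (q $ 1 / \<delta>)"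
  "partial_deriv 1 L2 = - Const (p $ 2 / \<delta>)" "partial_deriv 2 L2 = Const (p $ 1 / \<delta>)"
  by (simp_all add: L1_def L2_def partial_deriv_simps)

lemma directional_deriv:
  "Const (p $ 1) * partial_deriv 1 L1 + Const (p $ 2) * partial_deriv 2 L1 = 1"
  "Const (p $ 1) * partial_deriv 1 L2 + Const (p $ 2) * partial_deriv 2 L2 = 0"
  "Const (q $ 1) * partial_deriv 1 L1 + Const (q $ 2) * partial_deriv 2 L1 = 0"
  "Const (q $ 1) * partial_deriv 1 L2 + Const (q $ 2) * partial_deriv 2 L2 = 1"
proof -
  have \<delta>: "(p $ 1 * q $ 2 - p $ 2 * q $ 1) / \<delta> = 1"
    using \<delta>_nonzero by (simp_all add: \<delta>_def)
  show "Const (p $ 1) * partial_deriv 1 L1 + Const (p $ 2) * partial_deriv 2 L1 = 1"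
    using arg_cong[OF \<delta>, of Const]
    by (simp add: partial_deriv_frame diff_divide_distrib Const_diff flip: Const_mult)
  show "Const (q $ 1) * partial_deriv 1 L2 + Const (q $ 2) * partial_deriv 2 L2 = 1"
    using arg_cong[OF \<delta>, of Const]
    by (simp add: partial_deriv_frame diff_divide_distrib Const_diff algebra_simps flip: Const_mult)
  show "Const (p $ 1) * partial_deriv 1 L2 + Const (p $ 2) * partial_deriv 2 L2 = 0"
    "Const (q $ 1) * partial_deriv 1 L1 + Const (q $ 2) * partial_deriv 2 L1 = 0"
    by (simp_all add: partial_deriv_frame mult.commute flip: Const_mult)
qed

text \<open>The derivatives along \<open>p\<close> and \<open>q\<close> are the partial derivatives
  with respect to the frame coordinates.\<close>

definition deriv_p :: "2 mpoly \<Rightarrow> 2 mpoly" where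
  "deriv_p F = Const (p $ 1) * partial_deriv 1 F + Const (p $ 2) * partial_deriv 2 F"

definition deriv_q :: "2 mpoly \<Rightarrow> 2 mpoly" where
  "deriv_q F = Const (q $ 1) * partial_deriv 1 F + Const (q $ 2) * partial_deriv 2 F"

lemma deriv_frame [simp]: "deriv_p L1 = 1" "deriv_p L2 = 0" "deriv_q L1 = 0" "deriv_q L2 = 1"
  by (simp_all add: deriv_p_def deriv_q_def directional_deriv)

lemma deriv_pq_simps [simp]:
  "deriv_p (Const a) = 0" "deriv_q (Const a) = 0" "deriv_p 1 = 0" "deriv_q 1 = 0"
  "deriv_p (F + G) = deriv_p F + deriv_p G" "deriv_q (F + G) = deriv_q F + deriv_q G"
  "deriv_p (F - G) = deriv_p F - deriv_p G" "deriv_q (F - G) = deriv_q F - deriv_q G"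
  "deriv_p (F * G) = deriv_p F * G + F * deriv_p G" "deriv_q (F * G) = deriv_q F * G + F * deriv_q G"
  by (simp_all add: deriv_p_def deriv_q_def partial_deriv_simps algebra_simps)

lemma gradient_ideal:
  "deriv_p F \<in> ideal_span {F, partial_deriv 1 F, partial_deriv 2 F}"
  "deriv_q F \<in> ideal_span {F, partial_deriv 1 F, partial_deriv 2 F}"
  "F \<in> ideal_span {F, partial_deriv 1 F, partial_deriv 2 F}"
proof -
  let ?I = "ideal_span {F, partial_deriv 1 F, partial_deriv 2 F}"
  have "F \<in> ?I" and 1: "partial_deriv 1 F \<in> ?I" and 2: "partial_deriv 2 F \<in> ?I"
    by (simp_all add: ideal_span_base)
  then show "F \<in> ?I" "deriv_p F \<in> ?I" "deriv_q F \<in> ?I"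
    unfolding deriv_p_def deriv_q_def by (simp_all add: ideal_span_add ideal_span_mult)
qed

text \<open>Passing to the basis \<open>p\<close>, \<open>q\<close> multiplies the determinant
  formed by \<open>\<eta>\<close> and the gradient by \<open>\<delta>\<close>, so parallelism can be
  tested in the frame.\<close>

lemma normal_frame:
  "(\<eta> $ 1 * poly_eval z (partial_deriv 2 F) = \<eta> $ 2 * poly_eval z (partial_deriv 1 F)) \<longleftrightarrow>
    (\<Sum>k\<in>UNIV. \<eta> $ k * p $ k) * poly_eval z (deriv_q F) =
    (\<Sum>k\<in>UNIV. \<eta> $ k * q $ k) * poly_eval z (deriv_p F)"
proof -
  define a b where "a = poly_eval z (partial_deriv 1 F)" and "b = poly_eval z (partial_deriv 2 F)"
  have "(\<Sum>k\<in>UNIV. \<eta> $ k * p $ k) * poly_eval z (deriv_q F) -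
    (\<Sum>k\<in>UNIV. \<eta> $ k * q $ k) * poly_eval z (deriv_p F) = \<delta> * (\<eta> $ 1 * b - \<eta> $ 2 * a)"
    unfolding sum_2 deriv_p_def deriv_q_def \<delta>_def poly_eval_hom a_def[symmetric] b_def[symmetric]
    by algebra
  then show ?thesis
    using \<delta>_nonzero unfolding a_def b_def by auto
qed

lemma cong_mod_multiple: "a - b = h * G \<Longrightarrow> g \<noteq> 0 \<Longrightarrow> cong_mod (Const g * G) a b"
  unfolding cong_mod_def ideal_span_singleton
  by (rule exI[of _ "h * Const (1 / g)"]) (simp add: mult.assoc flip: Const_mult mult.assoc[of "Const (1/g)"])

lemma cong_mod_Var:
  assumes "cong_mod F (M * L1) (lift_at L1 R)" "cong_mod F (M * L2) (lift_at L1 S)"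
    and "cong_mod F M (lift_at L1 R0)"
  shows "\<exists>R. cong_mod F (M * Var k) (lift_at L1 R)"
proof -
  have "cong_mod F (Const (z0 $ k) * M + Const (p $ k) * (M * L1) + Const (q $ k) * (M * L2))
    (lift_at L1 (smult (z0 $ k) R0 + smult (p $ k) R + smult (q $ k) S))"
    unfolding lift_at_add lift_at_smult
    by (intro cong_mod_add cong_mod_mult cong_mod_refl assms)
  moreover have "Const (z0 $ k) * M + Const (p $ k) * (M * L1) + Const (q $ k) * (M * L2) = M * Var k"
    unfolding Var_frame[of k, symmetric] by (simp add: algebra_simps)
  ultimately show ?thesis by metis
qed

lemma line: "smooth_plane_curve (zero_locus {L2}) L2"
proof -
  have 0: "cong_mod L2 L2 0" by (simp add: cong_mod_def ideal_span_base)
  interpret rational_curve L2 L1 1 1 1 UNIV "\<lambda>x. pt x 0"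
  proof
    show "\<exists>R. cong_mod L2 (1 * Var k) (lift_at L1 R)" for k
      by (rule cong_mod_Var[of _ _ "[:0, 1:]" 0 1]) (use 0 in simp_all)
  qed (simp_all add: infinite_UNIV_char_0)
  show ?thesis
  proof
    have "pt 0 1 \<notin> zero_locus {L2}" by (simp add: zero_locus_def)
    then show "zero_locus {L2} \<noteq> UNIV" by blast
    show "1 \<in> ideal_span {L2, partial_deriv 1 L2, partial_deriv 2 L2}"
      using gradient_ideal(2)[of L2] by simp
  qed (use vanishing_ideal_eq irreducible in simp_all)
qed

definition parabola :: "complex \<Rightarrow> 2 mpoly" where
  "parabola g = Const g * (L2 - L1 * L1)"

lemma parabola:
  assumes g: "g \<noteq> 0"
  shows "smooth_plane_curve (zero_locus {parabola g}) (parabola g)"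
proof -
  interpret rational_curve "parabola g" L1 1 1 1 UNIV "\<lambda>x. pt x (x * x)"
  proof
    show "\<exists>R. cong_mod (parabola g) (1 * Var k) (lift_at L1 R)" for k
      by (rule cong_mod_Var[of _ _ "[:0, 1:]" "[:0, 0, 1:]" 1])
        (use cong_mod_multiple[of L2 "L1 * L1" 1, OF _ g] in \<open>simp_all add: parabola_def\<close>)
  qed (simp_all add: infinite_UNIV_char_0 parabola_def)
  show ?thesis
  proof
    have "pt 0 1 \<notin> zero_locus {parabola g}" using g by (simp add: zero_locus_def parabola_def)
    then show "zero_locus {parabola g} \<noteq> UNIV" by blast
    have "deriv_q (parabola g) = Const g" by (simp add: parabola_def)
    then have "Const (1 / g) * Const g \<in> ideal_span {parabola g, partial_deriv 1 (parabola g), partial_deriv 2 (parabola g)}"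
      using ideal_span_mult[OF gradient_ideal(2)] by metis
    then show "1 \<in> ideal_span {parabola g, partial_deriv 1 (parabola g), partial_deriv 2 (parabola g)}"
      using g by (simp flip: Const_mult)
  qed (use vanishing_ideal_eq irreducible in simp_all)
qed

definition hyperbola :: "complex \<Rightarrow> 2 mpoly" where
  "hyperbola g = Const g * (L1 * L2 - 1)"

lemma hyperbola:
  assumes g: "g \<noteq> 0"
  shows "smooth_plane_curve (zero_locus {hyperbola g}) (hyperbola g)"
proof -
  have unit: "cong_mod (hyperbola g) (L1 * L2) 1"
    using cong_mod_multiple[of "L1 * L2" 1 1, OF _ g] by (simp add: hyperbola_def)
  \<comment> \<open>On the hyperbola \<open>L1\<close> is a unit with inverse \<open>L2\<close>, and
    multiplying by it turns the second coordinate into the constant 1.\<close>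
  interpret rational_curve "hyperbola g" L1 L1 L2 "[:0, 1:]" "- {0}" "\<lambda>x. pt x (1 / x)"
  proof
    show "\<exists>R. cong_mod (hyperbola g) (L1 * Var k) (lift_at L1 R)" for k
      by (rule cong_mod_Var[of _ _ "[:0, 0, 1:]" 1 "[:0, 1:]"]) (use unit in simp_all)
  qed (use unit in \<open>simp_all add: infinite_UNIV_char_0 hyperbola_def\<close>)
  show ?thesis
  proof
    have "pt 0 0 \<notin> zero_locus {hyperbola g}" using g by (simp add: zero_locus_def hyperbola_def)
    then show "zero_locus {hyperbola g} \<noteq> UNIV" by blast
    let ?I = "ideal_span {hyperbola g, partial_deriv 1 (hyperbola g), partial_deriv 2 (hyperbola g)}"
    have "deriv_q (hyperbola g) = Const g * L1" by (simp add: hyperbola_def)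
    \<comment> \<open>\<open>L2\<close> times the derivative along \<open>q\<close> differs from the
      equation by the constant \<open>g\<close>.\<close>
    then have "Const (1 / g) * L2 * (Const g * L1) - Const (1 / g) * hyperbola g \<in> ?I"
      using ideal_span_mult[OF gradient_ideal(2)] ideal_span_mult[OF gradient_ideal(3)]
        ideal_span_diff by metis
    moreover have "Const (1 / g) * L2 * (Const g * L1) - Const (1 / g) * hyperbola g =
        Const (1 / g) * Const g"
      by (simp add: hyperbola_def algebra_simps)
    ultimately show "1 \<in> ?I"
      using g by (simp flip: Const_mult)
  qed (use vanishing_ideal_eq irreducible in simp_all)
qed

end

section \<open>Critical points in the coordinates of a frame\<close>

definition pair_pt :: "complex ^ 2 \<Rightarrow> complex ^ 2 \<Rightarrow> complex ^ (2 + 2)" where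
  "pair_pt z w = (\<chi> i. case i of Inl k \<Rightarrow> z $ k | Inr k \<Rightarrow> w $ k)"

lemma pair_pt_parts [simp]: "lpart (pair_pt z w) = z" "rpart (pair_pt z w) = w"
  by (simp_all add: vec_eq_iff pair_pt_def)

lemma pair_pt_collapse [simp]: "pair_pt (lpart s) (rpart s) = s"
  by (simp add: vec_eq_iff pair_pt_def split: sum.split)

lemma vcnj_vcnj [simp]: "vcnj (vcnj z) = z"
  by (simp add: vec_eq_iff)

lemma vcnj_inject [simp]: "vcnj z = vcnj w \<longleftrightarrow> z = w"
  by (metis vcnj_vcnj)

context affine_frame
begin

text \<open>The inner and outer conjugations make \<open>x'\<close> and \<open>y'\<close> the
  coordinates of the second block in the conjugate frame \<open>cnj z0\<close>,
  \<open>cnj p\<close>, \<open>cnj q\<close>, on which it depends polynomially.\<close>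

definition joint_pt :: "(complex \<times> complex) \<times> (complex \<times> complex) \<Rightarrow> complex ^ (2 + 2)" where
  "joint_pt = (\<lambda>((x, y), (x', y')). pair_pt (pt x y) (vcnj (pt (cnj x') (cnj y'))))"

lemma inj_joint_pt: "inj joint_pt"
  by (rule injI) (auto simp: joint_pt_def pt_inject dest: arg_cong[of _ _ lpart] arg_cong[of _ _ rpart])

lemma joint_pt_surj: "\<exists>x y x' y'. s = joint_pt ((x, y), (x', y'))"
proof -
  obtain x y where 1: "lpart s = pt x y" using pt_surj by blast
  obtain x' y' where 2: "vcnj (rpart s) = pt x' y'" using pt_surj by blast
  have "s = pair_pt (pt x y) (vcnj (pt (cnj (cnj x')) (cnj (cnj y'))))"
    unfolding complex_cnj_cnj 1[symmetric] 2[symmetric] by simp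
  then show ?thesis unfolding joint_pt_def by (metis (mono_tags, lifting) case_prod_conv)
qed

definition coord_p :: "complex ^ 2 \<Rightarrow> complex" where
  "coord_p v = (\<Sum>k\<in>UNIV. (v $ k - cnj (z0 $ k)) * p $ k)"

definition coord_q :: "complex ^ 2 \<Rightarrow> complex" where
  "coord_q v = (\<Sum>k\<in>UNIV. (v $ k - cnj (z0 $ k)) * q $ k)"

lemma coords_surj:
  fixes a b :: complex
  obtains v where "coord_p v = a" "coord_q v = b"
proof
  define v :: "complex ^ 2" where
    "v = vector [cnj (z0 $ 1) + (a * q $ 2 - b * p $ 2) / \<delta>, cnj (z0 $ 2) + (b * p $ 1 - a * q $ 1) / \<delta>]"
  show "coord_p v = a" "coord_q v = b"
    using \<delta>_nonzero
    by (simp_all add: coord_p_def coord_q_def v_def sum_2 field_simps)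
      (simp_all add: \<delta>_def algebra_simps)
qed

end

text \<open>The Gram matrix of the frame is \<kappa> times the matrix with diagonal entries 1 and
  off-diagonal entries \<open>l\<close>, so up to scale the metric is reduced to one real
  number.\<close>

locale metric_frame = affine_frame +
  fixes \<kappa> l :: real
  assumes \<kappa>_pos: "\<kappa> > 0"
    and norm_p: "(\<Sum>k\<in>UNIV. p $ k * cnj (p $ k)) = of_real \<kappa>"
    and norm_q: "(\<Sum>k\<in>UNIV. q $ k * cnj (q $ k)) = of_real \<kappa>"
    and inner_pq: "(\<Sum>k\<in>UNIV. p $ k * cnj (q $ k)) = of_real (\<kappa> * l)"
begin

lemma inner_qp: "(\<Sum>k\<in>UNIV. q $ k * cnj (p $ k)) = of_real (\<kappa> * l)"
  using arg_cong[OF inner_pq, of cnj] by (simp add: sum_2 mult.commute)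

lemma normal_coords:
  fixes x y :: complex
  shows
  "(\<Sum>k\<in>UNIV. (v - vcnj (pt (cnj x) (cnj y))) $ k * p $ k) = \<kappa> * (coord_p v / \<kappa> - x - l * y)"
  "(\<Sum>k\<in>UNIV. (v - vcnj (pt (cnj x) (cnj y))) $ k * q $ k) = \<kappa> * (coord_q v / \<kappa> - l * x - y)"
proof -
  have "(\<Sum>k\<in>UNIV. (v - vcnj (pt (cnj x) (cnj y))) $ k * p $ k) =
      coord_p v - x * (\<Sum>k\<in>UNIV. p $ k * cnj (p $ k)) - y * (\<Sum>k\<in>UNIV. p $ k * cnj (q $ k))"
    by (simp add: coord_p_def pt_def sum_2 algebra_simps)
  then show "(\<Sum>k\<in>UNIV. (v - vcnj (pt (cnj x) (cnj y))) $ k * p $ k) =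
      \<kappa> * (coord_p v / \<kappa> - x - l * y)"
    using \<kappa>_pos unfolding norm_p inner_pq by (simp add: algebra_simps)
  have "(\<Sum>k\<in>UNIV. (v - vcnj (pt (cnj x) (cnj y))) $ k * q $ k) =
      coord_q v - x * (\<Sum>k\<in>UNIV. q $ k * cnj (p $ k)) - y * (\<Sum>k\<in>UNIV. q $ k * cnj (q $ k))"
    by (simp add: coord_q_def pt_def sum_2 algebra_simps)
  then show "(\<Sum>k\<in>UNIV. (v - vcnj (pt (cnj x) (cnj y))) $ k * q $ k) =
      \<kappa> * (coord_q v / \<kappa> - l * x - y)"
    using \<kappa>_pos unfolding norm_q inner_qp by (simp add: algebra_simps)
qed

text \<open>Scaled inner products of \<open>v\<close> and \<open>u\<close>, taken relative to the
  origin of the frame, with the frame vectors. The outer conjugation makes \<open>C_par\<close> and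
  \<open>D_par\<close> polynomial in \<open>u\<close>; all four together are affine coordinates on
  the space of pairs \<open>(u, v)\<close>.\<close>

definition c_par :: "complex ^ (2 + 2) \<Rightarrow> complex" where "c_par t = coord_p (rpart t) / \<kappa>"
definition d_par :: "complex ^ (2 + 2) \<Rightarrow> complex" where "d_par t = coord_q (rpart t) / \<kappa>"
definition C_par :: "complex ^ (2 + 2) \<Rightarrow> complex" where "C_par t = cnj (coord_p (vcnj (lpart t)) / \<kappa>)"
definition D_par :: "complex ^ (2 + 2) \<Rightarrow> complex" where "D_par t = cnj (coord_q (vcnj (lpart t)) / \<kappa>)"

lemma pars_surj: "\<exists>t. c_par t = c \<and> d_par t = d \<and> C_par t = C \<and> D_par t = D"
proof -
  obtain v where "coord_p v = \<kappa> * c" "coord_q v = \<kappa> * d" using coords_surj by metis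
  moreover obtain u where "coord_p u = \<kappa> * cnj C" "coord_q u = \<kappa> * cnj D" using coords_surj by metis
  ultimately show ?thesis
    using \<kappa>_pos by (intro exI[of _ "pair_pt (vcnj u) v"]) (simp add: c_par_def d_par_def C_par_def D_par_def)
qed

lemma pars_real_surj: "\<exists>u. c_par (pair_pt u (vcnj u)) = c \<and> d_par (pair_pt u (vcnj u)) = d"
proof -
  obtain v where "coord_p v = \<kappa> * c" "coord_q v = \<kappa> * d" using coords_surj by metis
  then show ?thesis
    using \<kappa>_pos by (intro exI[of _ "vcnj v"]) (simp add: c_par_def d_par_def)
qed

lemma pars_real:
  "C_par (pair_pt u (vcnj u)) = cnj (c_par (pair_pt u (vcnj u)))"
  "D_par (pair_pt u (vcnj u)) = cnj (d_par (pair_pt u (vcnj u)))"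
  by (simp_all add: c_par_def d_par_def C_par_def D_par_def)

lemma normal_at_frame:
  fixes x' y' :: complex
  assumes "smooth_plane_curve (zero_locus {F}) F"
  shows "smooth_plane_curve.normal_at (zero_locus {F}) F z (vcnj (pt (cnj x') (cnj y'))) v \<longleftrightarrow>
    poly_eval z F = 0 \<and> (coord_p v / \<kappa> - x' - l * y') * poly_eval z (deriv_q F) =
      (coord_q v / \<kappa> - l * x' - y') * poly_eval z (deriv_p F)"
proof -
  interpret smooth_plane_curve "zero_locus {F}" F by fact
  show ?thesis
    using normal_frame[of "v - vcnj (pt (cnj x') (cnj y'))" z F] \<kappa>_pos
    unfolding normal_at_def grad_def mem_X normal_coords by simp
qed

text \<open>\<open>c - x' - l y'\<close> and \<open>d - l x' - y'\<close> are the pairings of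
  \<open>v - w\<close> with \<open>p\<close> and \<open>q\<close>, divided by \<kappa>; the equation
  says that they are proportional to the derivatives of \<open>F\<close> along \<open>p\<close> and
  \<open>q\<close>.\<close>

definition frame_critical :: "2 mpoly \<Rightarrow> complex \<Rightarrow> complex \<Rightarrow> complex \<times> complex \<Rightarrow> complex \<times> complex \<Rightarrow> bool" where
  "frame_critical F c d = (\<lambda>(x, y) (x', y'). poly_eval (pt x y) F = 0 \<and>
     (c - x' - of_real l * y') * poly_eval (pt x y) (deriv_q F) =
     (d - of_real l * x' - y') * poly_eval (pt x y) (deriv_p F))"

lemma critical_zeros_frame:
  assumes "smooth_plane_curve (zero_locus {F}) F"
  shows "zero_locus (hermitian_critical_ideal_at (zero_locus {F}) t) =
    joint_pt ` {((x, y), (x', y')). frame_critical F (c_par t) (d_par t) (x, y) (x', y') \<and>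
      frame_critical F (cnj (C_par t)) (cnj (D_par t)) (cnj x', cnj y') (cnj x, cnj y)}"
    (is "?Z = joint_pt ` ?S")
proof -
  interpret smooth_plane_curve "zero_locus {F}" F by fact
  have "joint_pt ((x, y), (x', y')) \<in> ?Z \<longleftrightarrow> ((x, y), (x', y')) \<in> ?S" for x y x' y' :: complex
    using normal_at_frame[OF assms, of "pt x y" x' y' "rpart t"]
      normal_at_frame[OF assms, of "pt (cnj x') (cnj y')" "cnj x" "cnj y" "vcnj (lpart t)"]
    unfolding critical_zeros
    by (simp add: joint_pt_def frame_critical_def c_par_def d_par_def C_par_def D_par_def)
  then show ?thesis using joint_pt_surj by (auto simp: image_iff) metis
qed

lemma critical_points_frame:
  assumes "smooth_plane_curve (zero_locus {F}) F" and "t = pair_pt u (vcnj u)"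
  shows "hermitian_critical_points (zero_locus {F}) u =
    (\<lambda>(x, y). pt x y) ` {(x, y). frame_critical F (c_par t) (d_par t) (x, y) (cnj x, cnj y)}"
proof -
  interpret smooth_plane_curve "zero_locus {F}" F by fact
  have "pt x y \<in> hermitian_critical_points (zero_locus {F}) u \<longleftrightarrow>
      frame_critical F (c_par t) (d_par t) (x, y) (cnj x, cnj y)" for x y
    using normal_at_frame[OF assms(1), of "pt x y" "cnj x" "cnj y" "vcnj u"]
    unfolding hermitian_critical_points by (simp add: frame_critical_def c_par_def d_par_def assms(2))
  then show ?thesis using pt_surj by (auto simp: image_iff) metis
qed

end

text \<open>A pair \<open>(x, w)\<close> stands for the critical point with frame coordinates \<open>(x, x\<^sup>2)\<close> and \<open>(w, w\<^sup>2)\<close> on a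
  parabola, \<open>(x, 1/x)\<close> and \<open>(w, 1/w)\<close> on a hyperbola, where \<open>hyperbola_system\<close> contains the sum and
  the difference of the two equations, cleared of denominators.\<close>

definition parabola_system :: "complex \<Rightarrow> complex \<Rightarrow> complex \<Rightarrow> complex \<Rightarrow> (complex \<times> complex) set" where
  "parabola_system c d C D = {(x, w). c - w + 2 * x * (d - w * w) = 0 \<and> C - x + 2 * w * (D - x * x) = 0}"

definition hyperbola_system ::
  "complex \<Rightarrow> complex \<Rightarrow> complex \<Rightarrow> complex \<Rightarrow> complex \<Rightarrow> (complex \<times> complex) set" where
  "hyperbola_system l c d C D = {(x, w). x \<noteq> 0 \<and> w \<noteq> 0 \<and>
     (c * (x * w) - D) * x + (C * (x * w) - d) * w = 2 * ((x * w)\<^sup>2 - 1) \<and>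
     (c * (x * w) + D) * x - (C * (x * w) + d) * w = 2 * l * (x\<^sup>2 - w\<^sup>2)}"

lemma hyperbola_system_iff:
  fixes x w l c d C D :: complex
  assumes "x \<noteq> 0" "w \<noteq> 0"
  shows "(x, w) \<in> hyperbola_system l c d C D \<longleftrightarrow>
    (c - w - l * (1 / w)) * x = (d - l * w - 1 / w) * (1 / x) \<and>
    (C - x - l * (1 / x)) * w = (D - l * x - 1 / x) * (1 / w)"
proof -
  \<comment> \<open>\<open>E\<close> and \<open>E'\<close> are the two normality equations
    multiplied by \<open>x w\<close>; the system consists of \<open>E + E' = 0\<close> and
    \<open>E - E' = 0\<close>.\<close>
  define E where "E = (c * w - w * w - l) * (x * x) - (d * w - l * (w * w) - 1)"
  define E' where "E' = (C * x - x * x - l) * (w * w) - (D * x - l * (x * x) - 1)"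
  have 1: "(c - w - l * (1 / w)) * x = (d - l * w - 1 / w) * (1 / x) \<longleftrightarrow> E = 0"
  proof -
    have "(c - w - l * (1 / w)) * x - (d - l * w - 1 / w) * (1 / x) = E / (x * w)"
      using assms by (simp add: E_def field_simps)
    then show ?thesis using assms by (metis divide_eq_0_iff mult_eq_0_iff right_minus_eq)
  qed
  have 2: "(C - x - l * (1 / x)) * w = (D - l * x - 1 / x) * (1 / w) \<longleftrightarrow> E' = 0"
  proof -
    have "(C - x - l * (1 / x)) * w - (D - l * x - 1 / x) * (1 / w) = E' / (x * w)"
      using assms by (simp add: E'_def field_simps)
    then show ?thesis using assms by (metis divide_eq_0_iff mult_eq_0_iff right_minus_eq)
  qed
  have "E + E' = (c * (x * w) - D) * x + (C * (x * w) - d) * w - 2 * ((x * w)\<^sup>2 - 1)"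
    "E - E' = (c * (x * w) + D) * x - (C * (x * w) + d) * w - 2 * l * (x\<^sup>2 - w\<^sup>2)"
    by (simp_all add: E_def E'_def power2_eq_square algebra_simps)
  then have "(x, w) \<in> hyperbola_system l c d C D \<longleftrightarrow> E + E' = 0 \<and> E - E' = 0"
    using assms by (simp add: hyperbola_system_def)
  also have "\<dots> \<longleftrightarrow> E = 0 \<and> E' = 0"
    by (auto simp: add_eq_0_iff)
  finally show ?thesis unfolding 1 2 .
qed

context metric_frame
begin

lemma parabola_frame_critical:
  fixes x y x' y' c d :: complex
  assumes "g \<noteq> 0" "l = 0"
  shows "frame_critical (parabola g) c d (x, y) (x', y') \<longleftrightarrow>
    y = x * x \<and> c - x' + 2 * x * (d - y') = 0"
proof -
  have "(c - x' - of_real l * y') * g - (d - of_real l * x' - y') * (g * (- (x + x))) =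
      g * (c - x' + 2 * x * (d - y'))"
    using assms(2) by (simp add: algebra_simps)
  then have "(c - x' - of_real l * y') * g = (d - of_real l * x' - y') * (g * (- (x + x))) \<longleftrightarrow>
      c - x' + 2 * x * (d - y') = 0"
    using assms(1) by (metis mult_eq_0_iff right_minus_eq)
  moreover have "poly_eval (pt x y) (deriv_q (parabola g)) = g"
    "poly_eval (pt x y) (deriv_p (parabola g)) = g * (- (x + x))"
    "poly_eval (pt x y) (parabola g) = g * (y - x * x)"
    using poly_eval_hom(12)[of "pt x y" 2] by (simp_all add: parabola_def)
  ultimately show ?thesis
    using assms(1) by (simp add: frame_critical_def)
qed

lemma parabola_zeros:
  assumes "g \<noteq> 0" "l = 0"
  shows "zero_locus (hermitian_critical_ideal_at (zero_locus {parabola g}) t) =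
    (\<lambda>(x, w). joint_pt ((x, x * x), (w, w * w))) ` parabola_system (c_par t) (d_par t) (C_par t) (D_par t)"
proof -
  note fc = parabola_frame_critical[OF assms]
  have *: "cnj C - cnj x + 2 * cnj x' * (cnj D - cnj y) = 0 \<longleftrightarrow> C - x + 2 * x' * (D - y) = 0" for C D x x' y :: complex
    by (metis complex_cnj_add complex_cnj_diff complex_cnj_mult complex_cnj_numeral complex_cnj_zero_iff)
  have y: "cnj y' = cnj x' * cnj x' \<longleftrightarrow> y' = x' * x'" for x' y' :: complex
    by (metis complex_cnj_cancel_iff complex_cnj_mult)
  show ?thesis
    unfolding critical_zeros_frame[OF parabola[OF assms(1)]] fc * y
    by (auto simp: parabola_system_def image_iff)
qed

lemma parabola_points:
  assumes "g \<noteq> 0" "l = 0" "t = pair_pt u (vcnj u)"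
  shows "hermitian_critical_points (zero_locus {parabola g}) u =
    (\<lambda>x. pt x (x * x)) ` {x. (x, cnj x) \<in> parabola_system (c_par t) (d_par t) (C_par t) (D_par t)}"
proof -
  note fc = parabola_frame_critical[OF assms(1,2)]
  have cnj_eq: "cnj c - x + 2 * cnj x * (cnj d - x * x) = cnj (c - cnj x + 2 * x * (d - cnj x * cnj x))" for c d x :: complex
    by simp
  have "(x, cnj x) \<in> parabola_system c d (cnj c) (cnj d) \<longleftrightarrow>
      c - cnj x + 2 * x * (d - cnj x * cnj x) = 0" for c d x :: complex
    unfolding parabola_system_def mem_Collect_eq case_prod_conv cnj_eq complex_cnj_zero_iff by simp
  then show ?thesis
    unfolding critical_points_frame[OF parabola[OF assms(1)] assms(3)] fc assms(3) pars_real
    by (auto simp: image_iff)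
qed

lemma hyperbola_frame_critical:
  fixes x y x' y' c d :: complex
  assumes "g \<noteq> 0"
  shows "frame_critical (hyperbola g) c d (x, y) (x', y') \<longleftrightarrow>
    x \<noteq> 0 \<and> y = 1 / x \<and> (c - x' - l * y') * x = (d - l * x' - y') * (1 / x)"
proof -
  have "x * y - 1 = 0 \<longleftrightarrow> x \<noteq> 0 \<and> y = 1 / x" by (auto simp: eq_divide_eq mult.commute)
  then show ?thesis
    using assms by (auto simp: frame_critical_def hyperbola_def)
qed

lemma hyperbola_zeros:
  assumes "g \<noteq> 0"
  shows "zero_locus (hermitian_critical_ideal_at (zero_locus {hyperbola g}) t) =
    (\<lambda>(x, w). joint_pt ((x, 1 / x), (w, 1 / w))) ` hyperbola_system l (c_par t) (d_par t) (C_par t) (D_par t)"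
proof -
  have *: "(cnj C - cnj x - l * cnj y) * cnj x' = (cnj D - l * cnj x - cnj y) * (1 / cnj x') \<longleftrightarrow>
      (C - x - l * y) * x' = (D - l * x - y) * (1 / x')" for C D x x' y :: complex
  proof -
    have "(cnj C - cnj x - l * cnj y) * cnj x' = cnj ((C - x - l * y) * x')"
      "(cnj D - l * cnj x - cnj y) * (1 / cnj x') = cnj ((D - l * x - y) * (1 / x'))" by simp_all
    then show ?thesis by (simp only: complex_cnj_cancel_iff)
  qed
  have y: "cnj y' = 1 / cnj x' \<longleftrightarrow> y' = 1 / x'" for x' y' :: complex
    by (metis complex_cnj_cancel_iff complex_cnj_divide complex_cnj_one)
  have S: "(x, w) \<in> hyperbola_system l' c d C D \<Longrightarrow> x \<noteq> 0 \<and> w \<noteq> 0" for x w l' c d C D :: complex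
    by (simp add: hyperbola_system_def)
  have "{((x, y), (x', y')). (x \<noteq> 0 \<and> y = 1 / x \<and> (c - x' - l * y') * x = (d - l * x' - y') * (1 / x)) \<and>
      (x' \<noteq> 0 \<and> y' = 1 / x' \<and> (C - x - l * y) * x' = (D - l * x - y) * (1 / x'))} =
      (\<lambda>(x, w). ((x, 1 / x), (w, 1 / w))) ` hyperbola_system l c d C D" for c d C D :: complex
  proof (intro equalityI subsetI)
    fix r assume "r \<in> (\<lambda>(x, w). ((x, 1 / x), (w, 1 / w))) ` hyperbola_system l c d C D"
    then obtain x w where "(x, w) \<in> hyperbola_system l c d C D" "r = ((x, 1 / x), (w, 1 / w))"
      by auto
    then show "r \<in> {((x, y), (x', y')). (x \<noteq> 0 \<and> y = 1 / x \<and> (c - x' - l * y') * x = (d - l * x' - y') * (1 / x)) \<and>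
      (x' \<noteq> 0 \<and> y' = 1 / x' \<and> (C - x - l * y) * x' = (D - l * x - y) * (1 / x'))}"
      using S[of x w l c d C D] hyperbola_system_iff[of x w l c d C D] by simp
  next
    fix r :: "(complex \<times> complex) \<times> (complex \<times> complex)"
    assume "r \<in> {((x, y), (x', y')). (x \<noteq> 0 \<and> y = 1 / x \<and> (c - x' - l * y') * x = (d - l * x' - y') * (1 / x)) \<and>
      (x' \<noteq> 0 \<and> y' = 1 / x' \<and> (C - x - l * y) * x' = (D - l * x - y) * (1 / x'))}"
    then obtain x w :: complex where r: "r = ((x, 1 / x), (w, 1 / w))" and "x \<noteq> 0" "w \<noteq> 0"
      "(c - w - l * (1 / w)) * x = (d - l * w - 1 / w) * (1 / x)"
      "(C - x - l * (1 / x)) * w = (D - l * x - 1 / x) * (1 / w)" by auto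
    then have "(x, w) \<in> hyperbola_system l c d C D" by (simp add: hyperbola_system_iff)
    then show "r \<in> (\<lambda>(x, w). ((x, 1 / x), (w, 1 / w))) ` hyperbola_system l c d C D"
      by (rule rev_image_eqI) (simp add: r)
  qed
  then show ?thesis
    unfolding critical_zeros_frame[OF hyperbola[OF assms(1)]] hyperbola_frame_critical[OF assms] * y
      complex_cnj_zero_iff
    by (simp add: image_image case_prod_unfold)
qed

lemma hyperbola_points:
  assumes "g \<noteq> 0" "t = pair_pt u (vcnj u)"
  shows "hermitian_critical_points (zero_locus {hyperbola g}) u =
    (\<lambda>x. pt x (1 / x)) ` {x. (x, cnj x) \<in> hyperbola_system l (c_par t) (d_par t) (C_par t) (D_par t)}"
proof -
  have "(x, cnj x) \<in> hyperbola_system l c d (cnj c) (cnj d) \<longleftrightarrow>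
      x \<noteq> 0 \<and> (c - cnj x - l * (1 / cnj x)) * x = (d - l * cnj x - 1 / cnj x) * (1 / x)" for c d x :: complex
  proof (cases "x = 0")
    case False
    have "(cnj c - x - l * (1 / x)) * cnj x = cnj ((c - cnj x - l * (1 / cnj x)) * x)"
      "(cnj d - l * x - 1 / x) * (1 / cnj x) = cnj ((d - l * cnj x - 1 / cnj x) * (1 / x))" by simp_all
    then have "(cnj c - x - l * (1 / x)) * cnj x = (cnj d - l * x - 1 / x) * (1 / cnj x) \<longleftrightarrow>
      (c - cnj x - l * (1 / cnj x)) * x = (d - l * cnj x - 1 / cnj x) * (1 / x)"
      by (simp only: complex_cnj_cancel_iff)
    then show ?thesis using False by (simp add: hyperbola_system_iff)
  qed (simp add: hyperbola_system_def)
  then show ?thesis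
    unfolding critical_points_frame[OF hyperbola[OF assms(1)] assms(2)] hyperbola_frame_critical[OF assms(1)]
      assms(2) pars_real
    by (auto simp: image_iff)
qed

end

section \<open>Critical points on a line\<close>

context affine_frame
begin

text \<open>Normality to a line with direction \<open>p\<close> is one linear equation on the other
  block, which fixes its coordinate along the line: \<open>v\<close> determines \<open>w\<close> and
  \<open>u\<close> determines \<open>z\<close>, as in an orthogonal projection.\<close>

lemma line_zeros: "\<exists>s. zero_locus (hermitian_critical_ideal_at (zero_locus {L2}) t) = {s}"
proof -
  interpret smooth_plane_curve "zero_locus {L2}" L2 by (rule line)
  let ?n = "\<Sum>k\<in>UNIV. p $ k * cnj (p $ k)"
  have "?n = of_real ((cmod (p $ 1))\<^sup>2 + (cmod (p $ 2))\<^sup>2)"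
    by (simp only: sum_2 of_real_add complex_norm_square)
  moreover have "p $ 1 \<noteq> 0 \<or> p $ 2 \<noteq> 0" using det by auto
  ultimately have n: "?n \<noteq> 0"
    by (simp only: of_real_eq_0_iff) (simp add: add_nonneg_eq_0_iff)
  define a k where "a = coord_p (rpart t) / ?n" and "k = coord_p (vcnj (lpart t)) / ?n"
  define b where "b = cnj k"
  have cn: "cnj ?n = ?n" by (simp add: sum_2 mult.commute)
  have N: "normal_at (pt x y) (vcnj (pt (cnj x') 0)) v \<longleftrightarrow> y = 0 \<and> x' = coord_p v / ?n" for x y x' :: complex and v
  proof -
    have "(\<Sum>k\<in>UNIV. (v - vcnj (pt (cnj x') 0)) $ k * p $ k) = coord_p v - x' * ?n"
      by (simp add: coord_p_def pt_def sum_2 algebra_simps)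
    then show ?thesis
      using normal_frame[of "v - vcnj (pt (cnj x') 0)" "pt x y" L2] n
      unfolding normal_at_def grad_def mem_X by (auto simp: field_simps)
  qed
  have "joint_pt ((x, y), (x', y')) \<in> zero_locus (hermitian_critical_ideal_at (zero_locus {L2}) t) \<longleftrightarrow>
      x = b \<and> y = 0 \<and> x' = a \<and> y' = 0" for x y x' y' :: complex
  proof (cases "y = 0 \<and> y' = 0")
    case True
    have "cnj x = k \<longleftrightarrow> x = b"
      unfolding b_def by (metis complex_cnj_cnj)
    have "joint_pt ((x, y), (x', y')) \<in> zero_locus (hermitian_critical_ideal_at (zero_locus {L2}) t) \<longleftrightarrow>
        normal_at (pt x 0) (vcnj (pt (cnj x') 0)) (rpart t) \<and>
        normal_at (pt (cnj x') 0) (vcnj (pt (cnj (cnj x)) 0)) (vcnj (lpart t))"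
      unfolding critical_zeros using True by (simp add: joint_pt_def)
    also have "\<dots> \<longleftrightarrow> x' = a \<and> cnj x = k"
      unfolding N a_def[symmetric] k_def[symmetric] by simp
    finally show ?thesis
      using True \<open>cnj x = k \<longleftrightarrow> x = b\<close> by auto
  next
    case False
    then show ?thesis
      unfolding critical_zeros by (auto simp: joint_pt_def normal_at_def mem_X)
  qed
  note mem = this
  have "zero_locus (hermitian_critical_ideal_at (zero_locus {L2}) t) = {joint_pt ((b, 0), (a, 0))}"
    (is "?Z = _")
  proof (intro equalityI subsetI)
    fix s assume s: "s \<in> ?Z"
    obtain x y x' y' where "s = joint_pt ((x, y), (x', y'))" using joint_pt_surj by blast
    then show "s \<in> {joint_pt ((b, 0), (a, 0))}" using s mem by simp
  next
    fix s assume "s \<in> {joint_pt ((b, 0), (a, 0))}"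
    then show "s \<in> ?Z" using mem by simp
  qed
  then show ?thesis by blast
qed

text \<open>For \<open>v = cnj u\<close> the involution maps the unique zero of the critical ideal
  to a zero, hence fixes it, and a fixed zero has the form \<open>(z, cnj z)\<close>.\<close>

lemma line_points: "\<exists>z. hermitian_critical_points (zero_locus {L2}) u = {z}"
proof -
  interpret smooth_plane_curve "zero_locus {L2}" L2 by (rule line)
  obtain s where s: "zero_locus (hermitian_critical_ideal_at (zero_locus {L2}) (pair_pt u (vcnj u))) = {s}"
    using line_zeros by blast
  have eq: "normal_at (lpart r) (rpart r) (vcnj u) \<and> normal_at (vcnj (rpart r)) (vcnj (lpart r)) (vcnj u) \<longleftrightarrow> r = s" for r
    using s unfolding critical_zeros set_eq_iff by simp
  have "pair_pt (vcnj (rpart s)) (vcnj (lpart s)) = s"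
    using eq[of s] by (subst eq[symmetric]) simp
  then have "rpart s = vcnj (lpart s)" by (metis pair_pt_parts(2))
  then have 1: "normal_at (lpart s) (vcnj (lpart s)) (vcnj u)" using eq[of s] by simp
  have 2: "z = lpart s" if "normal_at z (vcnj z) (vcnj u)" for z
  proof -
    have "pair_pt z (vcnj z) = s" using that by (subst eq[symmetric]) simp
    then show ?thesis by (metis pair_pt_parts(1))
  qed
  have "{z. normal_at z (vcnj z) (vcnj u)} = {lpart s}" using 1 2 by blast
  then show ?thesis unfolding hermitian_critical_points by blast
qed

end

section \<open>Generic points\<close>

text \<open>Polynomial functions as bare functions: closure rules establish that a compound
  expression is polynomial without naming a representing \<open>mpoly\<close>.\<close>

definition polyfun :: "(complex ^ 'v \<Rightarrow> complex) set" where
  "polyfun = range (\<lambda>p z. poly_eval z p)"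

lemma polyfun_poly_eval: "(\<lambda>z. poly_eval z p) \<in> polyfun"
  by (simp add: polyfun_def)

lemma polyfunE:
  assumes "f \<in> polyfun"
  obtains p where "f = (\<lambda>z. poly_eval z p)"
  using assms unfolding polyfun_def by blast

lemma polyfun_const: "(\<lambda>z. a) \<in> polyfun"
  using polyfun_poly_eval[of "Const a"] by simp

lemma polyfun_component: "(\<lambda>z. z $ k) \<in> polyfun"
  using polyfun_poly_eval[of "Var k"] by simp

lemma polyfun_add:
  assumes "f \<in> polyfun" "g \<in> polyfun"
  shows "(\<lambda>z. f z + g z) \<in> polyfun"
proof -
  obtain p q where "f = (\<lambda>z. poly_eval z p)" "g = (\<lambda>z. poly_eval z q)"
    using assms by (auto elim!: polyfunE)
  then show ?thesis using polyfun_poly_eval[of "p + q"] by simp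
qed

lemma polyfun_mult:
  assumes "f \<in> polyfun" "g \<in> polyfun"
  shows "(\<lambda>z. f z * g z) \<in> polyfun"
proof -
  obtain p q where "f = (\<lambda>z. poly_eval z p)" "g = (\<lambda>z. poly_eval z q)"
    using assms by (auto elim!: polyfunE)
  then show ?thesis using polyfun_poly_eval[of "p * q"] by simp
qed

lemma polyfun_uminus: "f \<in> polyfun \<Longrightarrow> (\<lambda>z. - f z) \<in> polyfun"
  using polyfun_mult[OF polyfun_const[of "- 1"], of f] by simp

lemma polyfun_diff: "f \<in> polyfun \<Longrightarrow> g \<in> polyfun \<Longrightarrow> (\<lambda>z. f z - g z) \<in> polyfun"
  using polyfun_add[of f "\<lambda>z. - g z"] polyfun_uminus[of g] by simp

lemma polyfun_sum: "(\<And>i. i \<in> S \<Longrightarrow> f i \<in> polyfun) \<Longrightarrow> (\<lambda>z. \<Sum>i\<in>S. f i z) \<in> polyfun"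
  by (induction S rule: infinite_finite_induct) (simp_all add: polyfun_const polyfun_add)

lemmas polyfun_intros = polyfun_const polyfun_component polyfun_add polyfun_mult polyfun_uminus
  polyfun_diff polyfun_sum

lemma polyfun_on_line:
  assumes "f \<in> polyfun"
  obtains P where "\<And>s. f (a + s *s b) = poly P s"
proof -
  obtain p where "f = (\<lambda>z. poly_eval z p)" using assms by (rule polyfunE)
  then show ?thesis using poly_eval_on_line[of a b p] that by auto
qed

text \<open>Principal open sets suffice as generic sets: they are stable under conjunction, because
  the product of two nonzero polynomial functions is nonzero, and one point with
  \<open>G t \<noteq> 0\<close> certifies that they are nonempty.\<close>

definition generic :: "(complex ^ 'v \<Rightarrow> bool) \<Rightarrow> bool" where
  "generic P \<longleftrightarrow> (\<exists>G\<in>polyfun. (\<exists>t. G t \<noteq> 0) \<and> (\<forall>t. G t \<noteq> 0 \<longrightarrow> P t))"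

lemma generic_mono: "generic P \<Longrightarrow> (\<And>t. P t \<Longrightarrow> Q t) \<Longrightarrow> generic Q"
  unfolding generic_def by blast

lemma polyfun_mult_nonzero:
  assumes "f \<in> polyfun" "g \<in> polyfun" "f s \<noteq> 0" "g t \<noteq> 0"
  shows "\<exists>z. f z * g z \<noteq> 0"
proof -
  obtain p q where "f = (\<lambda>z. poly_eval z p)" "g = (\<lambda>z. poly_eval z q)"
    using assms(1,2) by (auto elim!: polyfunE)
  then show ?thesis using poly_eval_mult_eq_0[of p q] assms(3,4) by auto
qed

lemma generic_conj:
  assumes "generic P" "generic Q"
  shows "generic (\<lambda>t. P t \<and> Q t)"
proof -
  obtain f where f: "f \<in> polyfun" "\<exists>t. f t \<noteq> 0" "\<And>t. f t \<noteq> 0 \<Longrightarrow> P t"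
    using assms(1) unfolding generic_def by blast
  obtain g where g: "g \<in> polyfun" "\<exists>t. g t \<noteq> 0" "\<And>t. g t \<noteq> 0 \<Longrightarrow> Q t"
    using assms(2) unfolding generic_def by blast
  have "(\<lambda>t. f t * g t) \<in> polyfun" by (intro polyfun_mult f(1) g(1))
  moreover have "\<exists>t. f t * g t \<noteq> 0"
    using f(2) g(2) polyfun_mult_nonzero[OF f(1) g(1)] by blast
  ultimately show ?thesis
    unfolding generic_def using f(3) g(3) by (intro bexI[of _ "\<lambda>t. f t * g t"]) auto
qed

lemma generic_polyfun: "f \<in> polyfun \<Longrightarrow> f t \<noteq> 0 \<Longrightarrow> generic (\<lambda>t. f t \<noteq> 0)"
  unfolding generic_def by blast

lemma zariski_open_polyfun:
  assumes "f \<in> polyfun" "f t \<noteq> 0"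
  shows "zariski_open {t. f t \<noteq> 0}" "zariski_dense {t. f t \<noteq> 0}"
proof -
  obtain p where p: "f = (\<lambda>z. poly_eval z p)" using assms(1) by (rule polyfunE)
  have "- {t. f t \<noteq> 0} = zero_locus {p}" by (auto simp: p zero_locus_def)
  then show "zariski_open {t. f t \<noteq> 0}"
    unfolding zariski_open_def by (simp add: zariski_closed_zero_locus)
  show "zariski_dense {t. f t \<noteq> 0}"
    unfolding zariski_dense_def
  proof (intro allI impI, elim conjE)
    fix Z assume Z: "zariski_closed Z" "{t. f t \<noteq> 0} \<subseteq> Z"
    show "Z = UNIV"
    proof (rule ccontr)
      assume "Z \<noteq> UNIV"
      then obtain z where "z \<notin> Z" by blast
      then obtain q where q: "q \<in> vanishing_ideal Z" "poly_eval z q \<noteq> 0"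
        using zariski_closed_separate Z(1) by blast
      have "poly_eval y p * poly_eval y q = 0" for y
        using Z(2) q(1) unfolding p vanishing_ideal_def by (cases "y \<in> Z") auto
      then show False
        using poly_eval_mult_eq_0 assms(2) q(2) unfolding p by blast
    qed
  qed
qed

text \<open>The points \<open>(u, cnj u)\<close> form a totally real subspace whose complexification is everything,
  so a polynomial vanishing on an open piece of it vanishes identically.\<close>

lemma poly_zero_near_0:
  fixes P :: "complex poly"
  assumes "e > 0" "\<And>r :: real. \<bar>r\<bar> < e \<Longrightarrow> poly P (of_real r) = 0"
  shows "P = 0"
proof (rule ccontr)
  assume "P \<noteq> 0"
  then have "finite {z. poly P z = 0}" by (rule poly_roots_finite)
  moreover have "of_real ` {0<..<e} \<subseteq> {z. poly P z = 0}" using assms by auto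
  ultimately have "finite (complex_of_real ` {0<..<e})" by (rule finite_subset[rotated])
  then have "finite {0<..<e}" by (rule finite_imageD) (simp add: inj_on_def)
  then show False using assms(1) infinite_Ioo by blast
qed

lemma vcnj_add: "vcnj (x + y) = vcnj x + vcnj y"
  by (simp add: vec_eq_iff)

lemma vcnj_smult: "vcnj (a *s x) = cnj a *s vcnj x"
  by (simp add: vec_eq_iff)

lemma pair_pt_add: "pair_pt (a + b) (a' + b') = pair_pt a a' + pair_pt b b'"
  by (simp add: vec_eq_iff pair_pt_def split: sum.split)

lemma pair_pt_smult: "pair_pt (s *s a) (s *s b) = s *s pair_pt a b"
  by (simp add: vec_eq_iff pair_pt_def split: sum.split)

lemma polyfun_nonzero_real_point:
  fixes f :: "complex ^ (2 + 2) \<Rightarrow> complex"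
  assumes f: "f \<in> polyfun" "f t \<noteq> 0" and U: "open U" "U \<noteq> {}"
  shows "\<exists>u\<in>U. f (pair_pt u (vcnj u)) \<noteq> 0"
proof (rule ccontr)
  assume *: "\<not> ?thesis"
  obtain u0 where u0: "u0 \<in> U" using U(2) by blast
  define d where "d = t - pair_pt u0 (vcnj u0)"
  \<comment> \<open>The analogue of real and imaginary part: \<open>d = D e1 + i D e2\<close> with
    both \<open>D e1\<close> and \<open>D e2\<close> in the real subspace of points
    \<open>(e, vcnj e)\<close>.\<close>
  define e1 where "e1 = (1 / 2) *s (lpart d + vcnj (rpart d))"
  define e2 where "e2 = (1 / (2 * \<i>)) *s (lpart d - vcnj (rpart d))"
  define D where "D e = pair_pt e (vcnj e)" for e
  have d: "d = D e1 + \<i> *s D e2"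
  proof -
    have "lpart d $ k = e1 $ k + \<i> * e2 $ k" "rpart d $ k = cnj (e1 $ k) + \<i> * cnj (e2 $ k)" for k
      by (simp_all add: e1_def e2_def field_simps)
    then show ?thesis
      by (auto simp: vec_eq_iff D_def pair_pt_def split: sum.split)
  qed
  have D: "pair_pt u0 (vcnj u0) + complex_of_real s *s (D e1 + complex_of_real r *s D e2) =
      D (u0 + complex_of_real s *s (e1 + complex_of_real r *s e2))" for s r
    by (simp add: D_def vcnj_add vcnj_smult pair_pt_add pair_pt_smult)
  \<comment> \<open>For real \<open>r\<close> the segment towards \<open>D e1 + r D e2\<close>
    starts inside \<open>U\<close>, so \<open>f\<close> vanishes on the whole complex line, in
    particular at its end. The end values are polynomial in \<open>r\<close> and vanish for real
    \<open>r\<close>, hence also at \<open>r = i\<close>, which is the point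
    \<open>t\<close>.\<close>
  have zero: "f (pair_pt u0 (vcnj u0) + (D e1 + complex_of_real r *s D e2)) = 0" for r
  proof -
    define h where "h = e1 + complex_of_real r *s e2"
    have lim: "((\<lambda>s. u0 + complex_of_real s *s h) \<longlongrightarrow> u0 + complex_of_real 0 *s h) (at 0)"
      unfolding vector_scalar_mult_def by (intro vec_tendstoI) (auto intro!: tendsto_eq_intros)
    have "\<forall>\<^sub>F s in at 0. u0 + complex_of_real s *s h \<in> U"
      by (rule topological_tendstoD[OF lim U(1)]) (simp add: u0)
    then obtain e where e: "e > 0" "\<And>s. s \<noteq> 0 \<Longrightarrow> dist s 0 < e \<Longrightarrow> u0 + complex_of_real s *s h \<in> U"
      unfolding eventually_at by blast
    then have e': "u0 + complex_of_real s *s h \<in> U" if "\<bar>s\<bar> < e" for s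
      using that u0 by (cases "s = 0") (auto simp: dist_norm)
    obtain P where P: "\<And>s. f (pair_pt u0 (vcnj u0) + s *s (D e1 + complex_of_real r *s D e2)) = poly P s"
      using polyfun_on_line[OF f(1)] by metis
    have "P = 0"
    proof (rule poly_zero_near_0[OF e(1)])
      fix s :: real assume "\<bar>s\<bar> < e"
      from e'[OF this] * show "poly P (of_real s) = 0"
        unfolding P[symmetric] D h_def[symmetric] by (auto simp: D_def)
    qed
    then show ?thesis using P[of 1] by simp
  qed
  obtain P where P: "\<And>r. f ((pair_pt u0 (vcnj u0) + D e1) + r *s D e2) = poly P r"
    using polyfun_on_line[OF f(1)] by metis
  have "P = 0"
    by (rule poly_zero_near_0[of 1]) (use zero in \<open>simp_all add: P[symmetric] add.assoc\<close>)
  then have "f ((pair_pt u0 (vcnj u0) + D e1) + \<i> *s D e2) = 0" by (simp add: P)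
  then show False using f(2) d by (simp add: d_def add.assoc algebra_simps)
qed

lemma continuous_on_real_points:
  fixes f :: "complex ^ (2 + 2) \<Rightarrow> complex"
  assumes "f \<in> polyfun"
  shows "continuous_on UNIV (\<lambda>u. f (pair_pt u (vcnj u)))"
proof -
  have "continuous_on UNIV (\<lambda>u. poly_eval (pair_pt u (vcnj u)) p)" for p
  proof (induction p rule: mpoly_induct)
    case (Var x)
    show ?case
      by (cases x) (auto simp: pair_pt_def intro!: continuous_intros)
  qed (auto intro!: continuous_intros)
  then show ?thesis using assms by (auto elim!: polyfunE)
qed

section \<open>Reduction of the degrees of an irreducible variety to generic counts\<close>

lemma has_vHDdeg_irreducible:
  assumes "irreducible_variety X"
    and "generic (\<lambda>t. finite (zero_locus (hermitian_critical_ideal_at X t)) \<and>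
      card (zero_locus (hermitian_critical_ideal_at X t)) = n)"
  shows "has_vHDdeg X n"
proof -
  obtain G s where G: "G \<in> polyfun" "G s \<noteq> 0"
    "\<And>t. G t \<noteq> 0 \<Longrightarrow> finite (zero_locus (hermitian_critical_ideal_at X t)) \<and>
      card (zero_locus (hermitian_critical_ideal_at X t)) = n"
    using assms(2) unfolding generic_def by blast
  have v: "virtual_critical_points X t = Pair X ` zero_locus (hermitian_critical_ideal_at X t)" for t
    unfolding virtual_critical_points_def irreducible_components_irreducible[OF assms(1)] by auto
  have "inj_on (Pair X) A" for A :: "(complex ^ ('a + 'a)) set" by (simp add: inj_on_def)
  then show ?thesis
    unfolding has_vHDdeg_def v
    using zariski_open_polyfun[OF G(1,2)] G(3)
    by (intro exI[of _ "{t. G t \<noteq> 0}"]) (simp add: card_image)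
qed

lemma HDdeg_irreducible:
  assumes "irreducible_variety X"
  shows "HDdeg X = {m. \<exists>U. open U \<and> U \<noteq> {} \<and>
    (\<forall>u\<in>U. finite (hermitian_critical_points X u) \<and> card (hermitian_critical_points X u) = m)}"
proof -
  have t: "tagged_critical_points X u = Pair X ` hermitian_critical_points X u" for u
    unfolding tagged_critical_points_def irreducible_components_irreducible[OF assms] by auto
  have "inj_on (Pair X) A" for A :: "(complex ^ 'a) set" by (simp add: inj_on_def)
  then show ?thesis
    unfolding HDdeg_def t by (simp add: finite_image_iff card_image)
qed

text \<open>An open set on which the count is constant contains a point \<open>u\<close> with
  \<open>(u, cnj u)\<close> generic, so a restriction valid there restricts the constant.\<close>

lemma HDdeg_subset:
  fixes X :: "(complex ^ 2) set"
  assumes "irreducible_variety X" and "generic P"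
    and "\<And>u. P (pair_pt u (vcnj u)) \<Longrightarrow> card (hermitian_critical_points X u) \<in> S"
  shows "HDdeg X \<subseteq> S"
proof
  fix m assume "m \<in> HDdeg X"
  then obtain U where U: "open U" "U \<noteq> {}" "\<And>u. u \<in> U \<Longrightarrow> card (hermitian_critical_points X u) = m"
    unfolding HDdeg_irreducible[OF assms(1)] by blast
  obtain G s where G: "G \<in> polyfun" "G s \<noteq> 0" "\<And>t. G t \<noteq> 0 \<Longrightarrow> P t"
    using assms(2) unfolding generic_def by blast
  obtain u where "u \<in> U" "G (pair_pt u (vcnj u)) \<noteq> 0"
    using polyfun_nonzero_real_point[OF G(1,2) U(1,2)] by blast
  then show "m \<in> S" using U(3) G(3) assms(3) by metis
qed

text \<open>Nongeneric points are removed from \<open>U\<close>: the rest is open by continuity and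
  nonempty by the density of the real points.\<close>

lemma HDdeg_mem:
  fixes X :: "(complex ^ 2) set"
  assumes "irreducible_variety X" and "generic P" and U: "open U" "U \<noteq> {}"
    and "\<And>u. u \<in> U \<Longrightarrow> P (pair_pt u (vcnj u)) \<Longrightarrow>
      finite (hermitian_critical_points X u) \<and> card (hermitian_critical_points X u) = m"
  shows "m \<in> HDdeg X"
proof -
  obtain G s where G: "G \<in> polyfun" "G s \<noteq> 0" "\<And>t. G t \<noteq> 0 \<Longrightarrow> P t"
    using assms(2) unfolding generic_def by blast
  let ?V = "U \<inter> {u. G (pair_pt u (vcnj u)) \<noteq> 0}"
  have "open {u. G (pair_pt u (vcnj u)) \<noteq> 0}"
    using open_Collect_neq[OF continuous_on_real_points[OF G(1)] continuous_on_const] .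
  then have "open ?V" using U(1) by blast
  moreover have "?V \<noteq> {}" using polyfun_nonzero_real_point[OF G(1,2) U] by blast
  ultimately show ?thesis
    unfolding HDdeg_irreducible[OF assms(1)] using assms(5) G(3)
    by (intro CollectI exI[of _ ?V]) blast
qed

subsection \<open>Families of univariate polynomials\<close>

definition polyfun_poly :: "(complex ^ 'v \<Rightarrow> complex poly) \<Rightarrow> bool" where
  "polyfun_poly N \<longleftrightarrow> (\<forall>k. (\<lambda>t. coeff (N t) k) \<in> polyfun)"

lemma polyfun_poly_const: "polyfun_poly (\<lambda>t. p)"
  by (simp add: polyfun_poly_def polyfun_const)

lemma polyfun_poly_pCons: "f \<in> polyfun \<Longrightarrow> polyfun_poly N \<Longrightarrow> polyfun_poly (\<lambda>t. pCons (f t) (N t))"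
  unfolding polyfun_poly_def
proof
  fix k assume "f \<in> polyfun" "\<forall>k. (\<lambda>t. coeff (N t) k) \<in> polyfun"
  then show "(\<lambda>t. coeff (pCons (f t) (N t)) k) \<in> polyfun" by (cases k) simp_all
qed

lemma polyfun_poly_add: "polyfun_poly N \<Longrightarrow> polyfun_poly K \<Longrightarrow> polyfun_poly (\<lambda>t. N t + K t)"
  by (simp add: polyfun_poly_def polyfun_add)

lemma polyfun_poly_diff: "polyfun_poly N \<Longrightarrow> polyfun_poly K \<Longrightarrow> polyfun_poly (\<lambda>t. N t - K t)"
  by (simp add: polyfun_poly_def polyfun_diff)

lemma polyfun_poly_mult: "polyfun_poly N \<Longrightarrow> polyfun_poly K \<Longrightarrow> polyfun_poly (\<lambda>t. N t * K t)"
  by (simp add: polyfun_poly_def coeff_mult polyfun_sum polyfun_mult)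

lemma polyfun_poly_power: "polyfun_poly N \<Longrightarrow> polyfun_poly (\<lambda>t. N t ^ k)"
  by (induction k) (simp_all add: polyfun_poly_const polyfun_poly_mult)

lemma polyfun_poly_pderiv: "polyfun_poly N \<Longrightarrow> polyfun_poly (\<lambda>t. pderiv (N t))"
  by (simp add: polyfun_poly_def coeff_pderiv polyfun_mult polyfun_const)

lemmas polyfun_poly_intros = polyfun_poly_const polyfun_poly_pCons polyfun_poly_add
  polyfun_poly_diff polyfun_poly_mult polyfun_poly_power polyfun_poly_pderiv

text \<open>One step of fraction-free Gaussian elimination reduces the number of columns by one.\<close>

lemma generic_injective_matrix:
  fixes M :: "nat \<Rightarrow> nat \<Rightarrow> complex ^ 'v \<Rightarrow> complex"
  assumes "\<And>i j. M i j \<in> polyfun"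
    and "\<And>v. (\<And>i. (\<Sum>j<k. M i j t0 * v j) = 0) \<Longrightarrow> \<forall>j<k. v j = 0"
  shows "generic (\<lambda>t. \<forall>v. (\<forall>i. (\<Sum>j<k. M i j t * v j) = 0) \<longrightarrow> (\<forall>j<k. v j = 0))"
  using assms
proof (induction k arbitrary: M)
  case 0
  show ?case
    using generic_polyfun[OF polyfun_const[of 1]] by (rule generic_mono) simp_all
next
  case (Suc k)
  have "\<exists>i. M i 0 t0 \<noteq> 0"
  proof (rule ccontr)
    assume *: "\<not> ?thesis"
    have "(\<Sum>j<Suc k. M i j t0 * (if j = 0 then 1 else 0)) = 0" for i
      using * by (intro sum.neutral) simp
    from Suc.prems(2)[of "\<lambda>j. if j = 0 then 1 else 0", OF this, rule_format, of 0]
    show False by simp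
  qed
  then obtain r where r: "M r 0 t0 \<noteq> 0" by blast
  define M' where "M' i j t = M r 0 t * M i (Suc j) t - M i 0 t * M r (Suc j) t" for i j t
  have M': "M' i j \<in> polyfun" for i j
    unfolding M'_def by (intro polyfun_intros Suc.prems(1))
  have elim: "(\<Sum>j<k. M' i j t * v j) =
      M r 0 t * (\<Sum>j<k. M i (Suc j) t * v j) - M i 0 t * (\<Sum>j<k. M r (Suc j) t * v j)" for i t v
    by (simp add: M'_def left_diff_distrib sum_subtractf sum_distrib_left mult.assoc)
  have split: "(\<Sum>j<Suc k. M i j t * v j) = M i 0 t * v 0 + (\<Sum>j<k. M i (Suc j) t * v (Suc j))" for i t v
    by (rule sum.lessThan_Suc_shift)
  have inj: "\<forall>j<k. v j = 0" if v: "\<And>i. (\<Sum>j<k. M' i j t0 * v j) = 0" for v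
  proof -
    \<comment> \<open>A kernel vector of the reduced matrix, scaled by the pivot and completed in
      the pivot column, is a kernel vector of \<open>M\<close>.\<close>
    define v' where "v' j = (if j = 0 then - (\<Sum>j<k. M r (Suc j) t0 * v j) else M r 0 t0 * v (j - 1))" for j
    have "(\<Sum>j<Suc k. M i j t0 * v' j) = 0" for i
    proof -
      have "(\<Sum>j<k. M i (Suc j) t0 * v' (Suc j)) = M r 0 t0 * (\<Sum>j<k. M i (Suc j) t0 * v j)"
        unfolding sum_distrib_left by (rule sum.cong) (simp_all add: v'_def)
      then show ?thesis
        using v[of i] unfolding split elim by (simp add: v'_def)
    qed
    from Suc.prems(2)[OF this] have "v' (Suc j) = 0" if "j < k" for j using that by simp
    then show ?thesis using r by (simp add: v'_def)
  qed
  have "generic (\<lambda>t. \<forall>v. (\<forall>i. (\<Sum>j<k. M' i j t * v j) = 0) \<longrightarrow> (\<forall>j<k. v j = 0))"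
    by (rule Suc.IH[OF M']) (rule inj)
  from generic_conj[OF this generic_polyfun[OF Suc.prems(1) r]]
  show ?case
  proof (rule generic_mono, intro allI impI)
    fix t v j
    assume t: "(\<forall>v. (\<forall>i. (\<Sum>j<k. M' i j t * v j) = 0) \<longrightarrow> (\<forall>j<k. v j = 0)) \<and> M r 0 t \<noteq> 0"
      and v: "\<forall>i. (\<Sum>j<Suc k. M i j t * v j) = 0" and j: "j < Suc k"
    have s: "(\<Sum>j<k. M i (Suc j) t * v (Suc j)) = - (M i 0 t * v 0)" for i
      using v unfolding split by (simp add: eq_neg_iff_add_eq_0 add.commute)
    have "(\<Sum>j<k. M' i j t * v (Suc j)) = 0" for i
      unfolding elim s by simp
    then have *: "v (Suc j) = 0" if "j < k" for j
      using t that by (auto dest!: spec[of _ "\<lambda>j. v (Suc j)"])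
    then have "M r 0 t * v 0 = 0" using s[of r] by simp
    then have "v 0 = 0" using t by simp
    then show "v j = 0" using * j by (cases j) simp_all
  qed
qed

section \<open>Common roots and the Sylvester matrix\<close>

definition no_common_root :: "complex poly \<Rightarrow> complex poly \<Rightarrow> bool" where
  "no_common_root p q \<longleftrightarrow> (\<forall>x. poly p x = 0 \<longrightarrow> poly q x \<noteq> 0)"

text \<open>Euclid's lemma by splitting off one root of \<open>p\<close> at a time: it is no root of
  \<open>q\<close>, hence one of \<open>r\<close>.\<close>

lemma no_common_root_dvd_mult:
  assumes "no_common_root p q" "p \<noteq> 0" "p dvd r * q"
  shows "p dvd r"
  using assms
proof (induction "degree p" arbitrary: p r)
  case 0
  then have "is_unit p" by (simp add: is_unit_iff_degree)
  then show ?case by (rule unit_imp_dvd)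
next
  case (Suc n)
  then have "\<not> constant (poly p)" by (simp add: constant_degree)
  then obtain x where x: "poly p x = 0" using fundamental_theorem_of_algebra by blast
  then obtain p' where p': "p = [:- x, 1:] * p'" by (meson dvdE poly_eq_0_iff_dvd)
  have "[:- x, 1:] dvd r * q" using Suc.prems(3) x by (meson dvd_trans poly_eq_0_iff_dvd)
  then have "poly (r * q) x = 0" by (simp only: poly_eq_0_iff_dvd)
  then have "poly r x = 0" using Suc.prems(1) x by (simp add: no_common_root_def)
  then obtain r' where r': "r = [:- x, 1:] * r'" by (meson dvdE poly_eq_0_iff_dvd)
  have nz: "p' \<noteq> 0" using Suc.prems(2) p' by auto
  have "p' dvd r' * q"
    using Suc.prems(3) unfolding p' r' mult.assoc by (subst (asm) dvd_mult_cancel_left) simp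
  moreover have "no_common_root p' q"
    using Suc.prems(1) by (simp add: p' no_common_root_def)
  moreover have "n = degree p'"
    using Suc.hyps(2) nz unfolding p' by (subst (asm) degree_mult_eq) auto
  ultimately have "p' dvd r'" using Suc.hyps(1) nz by blast
  then show ?case unfolding p' r' by (rule mult_dvd_mono[OF dvd_refl])
qed

lemma coeff_sum_monom_mult:
  "coeff ((\<Sum>j<m. monom (v j) j) * p) i = (\<Sum>j<m. (if j \<le> i then coeff p (i - j) else 0) * v j)"
  unfolding sum_distrib_right coeff_sum
  by (rule sum.cong, rule refl, subst coeff_monom_mult) (simp add: mult.commute)

lemma poly_as_monom_sum: "degree p < m \<Longrightarrow> p = (\<Sum>j<m. monom (coeff p j) j)"
  by (rule poly_eqI) (auto simp: coeff_sum coeff_eq_0)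

text \<open>\<open>M\<close> is the Sylvester matrix: its columns are the coefficients of
  \<open>X^j N\<close> for \<open>j < m\<close> and of \<open>X^j K\<close> for
  \<open>j < n\<close>, so a kernel vector is a relation \<open>U N + V K = 0\<close> with
  \<open>degree U < m\<close> and \<open>degree V < n\<close>. Without common root at
  \<open>t0\<close> only the trivial relation exists there, and injectivity is inherited by generic
  \<open>t\<close>.\<close>

lemma generic_no_common_root:
  assumes N: "polyfun_poly N" "\<And>t. degree (N t) \<le> n" "coeff (N t0) n \<noteq> 0"
    and K: "polyfun_poly K" "\<And>t. degree (K t) \<le> m" and "no_common_root (N t0) (K t0)"
  shows "generic (\<lambda>t. degree (N t) = n \<and> no_common_root (N t) (K t))"
proof -
  define M where "M i j t = (if j < m then if j \<le> i then coeff (N t) (i - j) else 0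
    else if j - m \<le> i then coeff (K t) (i - (j - m)) else 0)" for i j t
  have row: "(\<Sum>j<m + n. M i j t * v j) =
      coeff ((\<Sum>j<m. monom (v j) j) * N t + (\<Sum>j<n. monom (v (m + j)) j) * K t) i" for i t v
  proof -
    have "(\<Sum>j<m + n. M i j t * v j) = (\<Sum>j<m. M i j t * v j) + (\<Sum>j<n. M i (m + j) t * v (m + j))"
      by (induction n) simp_all
    then show ?thesis
      unfolding coeff_add coeff_sum_monom_mult by (simp add: M_def cong: if_cong)
  qed
  have "M i j \<in> polyfun" for i j
  proof -
    consider "j < m" "j \<le> i" | "j \<ge> m" "j - m \<le> i" | "M i j = (\<lambda>t. 0)"
      unfolding M_def by fastforce
    then show ?thesis
    proof cases
      case 1
      then have "M i j = (\<lambda>t. coeff (N t) (i - j))" by (simp add: M_def fun_eq_iff)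
      then show ?thesis using N(1) by (simp add: polyfun_poly_def)
    next
      case 2
      then have "M i j = (\<lambda>t. coeff (K t) (i - (j - m)))" by (simp add: M_def fun_eq_iff)
      then show ?thesis using K(1) by (simp add: polyfun_poly_def)
    qed (simp add: polyfun_const)
  qed
  moreover have "\<forall>j<m + n. v j = 0" if v: "\<And>i. (\<Sum>j<m + n. M i j t0 * v j) = 0" for v
  proof -
    define U where "U = (\<Sum>j<m. monom (v j) j)"
    define V where "V = (\<Sum>j<n. monom (v (m + j)) j)"
    have cU: "coeff U j = v j" if "j < m" for j using that by (simp add: U_def coeff_sum)
    have cV: "coeff V j = v (m + j)" if "j < n" for j using that by (simp add: V_def coeff_sum)
    have zero: "U * N t0 + V * K t0 = 0"
      unfolding U_def V_def by (rule poly_eqI) (simp only: row[symmetric] v coeff_0)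
    have deg: "degree (N t0) = n" and nz: "N t0 \<noteq> 0"
      using N(2,3) by (auto simp: le_degree order.antisym)
    have "N t0 dvd V * K t0"
      using zero by (metis add.commute add_eq_0_iff dvd_minus_iff dvd_triv_right)
    \<comment> \<open>\<open>V\<close> is a sum of monomials of index below \<open>n\<close>,
      whereas \<open>N t0\<close> has degree \<open>n\<close>; so divisibility forces
      \<open>V = 0\<close>.\<close>
    then have "N t0 dvd V" by (rule no_common_root_dvd_mult[OF assms(6) nz])
    have "V = 0"
    proof (rule ccontr)
      assume "V \<noteq> 0"
      then have "n \<le> degree V" using \<open>N t0 dvd V\<close> deg dvd_imp_degree_le by metis
      moreover have "coeff V (degree V) = 0"
        using calculation by (simp add: V_def coeff_sum)
      ultimately show False using \<open>V \<noteq> 0\<close> by simp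
    qed
    then have "U = 0" using zero nz by simp
    have "v j = 0" if "j < m + n" for j
      using cU[of j] cV[of "j - m"] that \<open>U = 0\<close> \<open>V = 0\<close> by (cases "j < m") auto
    then show ?thesis by blast
  qed
  ultimately have gen: "generic (\<lambda>t. \<forall>v. (\<forall>i. (\<Sum>j<m + n. M i j t * v j) = 0) \<longrightarrow> (\<forall>j<m + n. v j = 0))"
    by (rule generic_injective_matrix)
  have "generic (\<lambda>t. coeff (N t) n \<noteq> 0)"
    using N(1,3) by (intro generic_polyfun) (auto simp: polyfun_poly_def)
  from generic_conj[OF gen this] show ?thesis
  proof (rule generic_mono, elim conjE, intro conjI)
    fix t
    assume inj: "\<forall>v. (\<forall>i. (\<Sum>j<m + n. M i j t * v j) = 0) \<longrightarrow> (\<forall>j<m + n. v j = 0)"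
      and lead: "coeff (N t) n \<noteq> 0"
    show deg: "degree (N t) = n" using lead N(2)[of t] by (simp add: le_degree order.antisym)
    show "no_common_root (N t) (K t)"
      unfolding no_common_root_def
    proof (intro allI impI notI)
      fix x assume x: "poly (N t) x = 0" "poly (K t) x = 0"
      then obtain V U where V: "N t = [:- x, 1:] * V" and U: "K t = [:- x, 1:] * U"
        by (meson dvdE poly_eq_0_iff_dvd)
      have "N t \<noteq> 0" using lead by auto
      then have "V \<noteq> 0" using V by auto
      then have degV: "degree V < n" using deg unfolding V by (subst (asm) degree_mult_eq) auto
      have U_sum: "U = (\<Sum>j<m. monom (coeff U j) j)"
      proof (cases "U = 0")
        case False
        then have "degree U < m" using K(2)[of t] unfolding U by (subst (asm) degree_mult_eq) auto
        then show ?thesis by (rule poly_as_monom_sum)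
      qed simp
      \<comment> \<open>A common root would give the nontrivial relation with the cofactors
        \<open>U\<close> and \<open>- V\<close>, against injectivity.\<close>
      define v where "v j = (if j < m then coeff U j else - coeff V (j - m))" for j
      have "(\<Sum>j<m. monom (v j) j) = U" by (simp add: v_def flip: U_sum)
      moreover have "(\<Sum>j<n. monom (v (m + j)) j) = - V"
        by (simp add: v_def sum_negf flip: minus_monom poly_as_monom_sum[OF degV])
      ultimately have "(\<Sum>j<m + n. M i j t * v j) = coeff (U * N t + (- V) * K t) i" for i
        unfolding row by simp
      moreover have "U * (L * V) + (- V) * (L * U) = 0" for L by (simp add: algebra_simps)
      then have "U * N t + (- V) * K t = 0" unfolding U V .
      ultimately have "(\<Sum>j<m + n. M i j t * v j) = 0" for i by simp
      then have "\<forall>j<m + n. v j = 0" using inj by blast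
      then have "coeff V j = 0" if "j < n" for j
        using that by (auto simp: v_def dest!: spec[of _ "m + j"])
      then have "coeff V (degree V) = 0" using degV by blast
      then show False using \<open>V \<noteq> 0\<close> by simp
    qed
  qed
qed

lemma card_roots_no_common_root_pderiv:
  assumes "degree p = n" "n > 0" "no_common_root p (pderiv p)"
  shows "card {x. poly p x = 0} = n"
proof -
  have "rsquarefree p" using assms(3) by (auto simp: rsquarefree_roots no_common_root_def)
  then have "smult (lead_coeff p) (\<Prod>x | poly p x = 0. [:- x, 1:]) = p"
    by (rule complex_poly_decompose_rsquarefree)
  moreover have "p \<noteq> 0" using assms(1,2) by auto
  then have "degree (smult (lead_coeff p) (\<Prod>x | poly p x = 0. [:- x, 1:])) = card {x. poly p x = 0}"
    by (simp add: degree_prod_eq_sum_degree)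
  ultimately show ?thesis using assms(1) by metis
qed

section \<open>Counting roots\<close>

lemma prod_linear_dvd:
  fixes p :: "'a::field poly"
  assumes "finite R" "\<And>r. r \<in> R \<Longrightarrow> poly p r = 0"
  shows "(\<Prod>r\<in>R. [:- r, 1:]) dvd p"
  using assms
proof (induction R)
  case (insert r R)
  then obtain q where q: "p = (\<Prod>r\<in>R. [:- r, 1:]) * q" by (auto elim: dvdE)
  have "poly (\<Prod>r\<in>R. [:- r, 1:]) r \<noteq> 0"
    using insert.hyps by (auto simp: poly_prod)
  then have "poly q r = 0" using insert.prems[of r] by (simp add: q)
  then have "[:- r, 1:] dvd q" by (simp add: poly_eq_0_iff_dvd)
  then have "(\<Prod>r\<in>R. [:- r, 1:]) * [:- r, 1:] dvd p" unfolding q by (rule mult_dvd_mono[OF dvd_refl])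
  then show ?case unfolding prod.insert[OF insert.hyps] by (simp only: mult.commute)
qed simp

lemma degree_prod_linear: "degree (\<Prod>r\<in>R. [:- r, 1 :: 'a::field:]) = card R"
  by (cases "finite R") (simp_all add: degree_prod_eq_sum_degree)

lemma poly_eq_prod_roots:
  fixes p :: "'a::field poly"
  assumes "finite R" "\<And>r. r \<in> R \<Longrightarrow> poly p r = 0" "card R = degree p"
  shows "p = smult (lead_coeff p) (\<Prod>r\<in>R. [:- r, 1:])"
proof (cases "p = 0")
  case False
  let ?P = "\<Prod>r\<in>R. [:- r, 1:]"
  obtain q where q: "p = ?P * q" using prod_linear_dvd[OF assms(1,2)] by (auto elim: dvdE)
  have "q \<noteq> 0" "?P \<noteq> 0" using False q by auto
  then have "degree p = card R + degree q"
    by (simp add: q degree_mult_eq degree_prod_linear)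
  then obtain a where a: "q = [:a:]" using assms(3) by (metis add_cancel_left_right degree_eq_zeroE)
  have "lead_coeff p = lead_coeff ?P * lead_coeff q" unfolding q by (rule lead_coeff_mult)
  moreover have "lead_coeff ?P = 1" by (simp add: lead_coeff_prod)
  ultimately have lead: "lead_coeff p = a" by (simp add: a)
  show ?thesis unfolding lead using q a by simp
qed simp

lemma coeff_linear_mult:
  fixes r :: "'a::field"
  shows "coeff ([:- r, 1:] * p) (Suc k) = coeff p k - r * coeff p (Suc k)"
  by (simp add: mult_pCons_left algebra_simps)

text \<open>Vieta's formulas for the two highest and the two lowest coefficients; the latter turn
  the sum of the inverse roots into a quotient of coefficients.\<close>

lemma coeff_prod_linear:
  fixes R :: "'a::field set"
  assumes "finite R"
  shows "coeff (\<Prod>r\<in>R. [:- r, 1:]) (card R) = 1"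
    and "R \<noteq> {} \<Longrightarrow> coeff (\<Prod>r\<in>R. [:- r, 1:]) (card R - 1) = - (\<Sum>r\<in>R. r)"
    and "0 \<notin> R \<Longrightarrow> coeff (\<Prod>r\<in>R. [:- r, 1:]) 0 \<noteq> 0"
    and "0 \<notin> R \<Longrightarrow> coeff (\<Prod>r\<in>R. [:- r, 1:]) 1 =
      - (\<Sum>r\<in>R. 1 / r) * coeff (\<Prod>r\<in>R. [:- r, 1:]) 0"
proof -
  have 1: "coeff (\<Prod>r\<in>R. [:- r, 1:]) (card R) = 1" if "finite R" for R :: "'a set"
    using lead_coeff_prod[of "\<lambda>r. [:- r, 1 :: 'a:]" R] by (simp add: degree_prod_linear)
  show "coeff (\<Prod>r\<in>R. [:- r, 1:]) (card R) = 1" by (rule 1[OF assms])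
  show "coeff (\<Prod>r\<in>R. [:- r, 1:]) (card R - 1) = - (\<Sum>r\<in>R. r)" if "R \<noteq> {}"
    using assms that
  proof (induction R rule: finite_ne_induct)
    case (insert r R)
    obtain k where k: "card R = Suc k" using insert.hyps by (metis card_eq_0_iff not0_implies_Suc)
    have "coeff (\<Prod>r\<in>insert r R. [:- r, 1:]) (card (insert r R) - 1) =
        coeff ([:- r, 1:] * (\<Prod>r\<in>R. [:- r, 1:])) (Suc k)"
      using k by (simp only: prod.insert[OF insert.hyps(1,3)] card_insert_disjoint[OF insert.hyps(1,3)] diff_Suc_1)
    also have "\<dots> = coeff (\<Prod>r\<in>R. [:- r, 1:]) (card R - 1) - r * coeff (\<Prod>r\<in>R. [:- r, 1:]) (card R)"
      unfolding coeff_linear_mult by (simp add: k)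
    finally show ?case using insert.IH 1[OF insert.hyps(1)] insert.hyps by simp
  qed simp
  show "coeff (\<Prod>r\<in>R. [:- r, 1:]) 0 \<noteq> 0" if "0 \<notin> R"
    using assms that by (auto simp: poly_prod simp flip: poly_0_coeff_0)
  show "coeff (\<Prod>r\<in>R. [:- r, 1:]) 1 = - (\<Sum>r\<in>R. 1 / r) * coeff (\<Prod>r\<in>R. [:- r, 1:]) 0" if "0 \<notin> R"
    using assms that
  proof (induction R)
    case (insert r R)
    have "coeff ([:- r, 1:] * p) 1 = coeff p 0 - r * coeff p 1" "coeff ([:- r, 1:] * p) 0 = - r * coeff p 0" for p
      using coeff_linear_mult[of r p 0] by (simp_all add: mult_pCons_left)
    then show ?case
      using insert.IH insert.prems insert.hyps
      by (simp only: prod.insert[OF insert.hyps] sum.insert[OF insert.hyps]) (simp add: field_simps)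
  qed simp
qed

text \<open>Up to sign the coefficients are elementary symmetric functions of positive numbers,
  hence alternate strictly.\<close>

lemma coeff_prod_positive_roots:
  fixes R :: "real set"
  assumes "finite R" "\<And>r. r \<in> R \<Longrightarrow> r > 0" "k \<le> card R"
  shows "(- 1) ^ (card R + k) * coeff (\<Prod>r\<in>R. [:- r, 1:]) k > 0"
  using assms
proof (induction R arbitrary: k)
  case (insert r R)
  let ?P = "\<Prod>r\<in>R. [:- r, 1:]"
  have IH: "(- 1) ^ (card R + k) * coeff ?P k > 0" if "k \<le> card R" for k
    using insert.IH insert.prems(1) that by simp
  have r: "r > 0" using insert.prems(1) by simp
  have P: "(\<Prod>r\<in>insert r R. [:- r, 1:]) = [:- r, 1:] * ?P" "card (insert r R) = Suc (card R)"
    by (simp_all only: prod.insert[OF insert.hyps] card_insert_disjoint[OF insert.hyps])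
  show ?case
  proof (cases k)
    case 0
    then show ?thesis using IH[of 0] r unfolding P by (simp add: mult_pCons_left zero_less_mult_iff mult_less_0_iff)
  next
    case (Suc j)
    have "(- 1) ^ (card R + j) * coeff ?P j > 0" using IH insert.prems(2) Suc P(2) by simp
    moreover have "- ((- 1) ^ (card R + j) * (r * coeff ?P (Suc j))) \<ge> 0"
    proof (cases "Suc j \<le> card R")
      case True
      have "r * ((- 1) ^ (card R + Suc j) * coeff ?P (Suc j)) > 0" by (rule mult_pos_pos[OF r IH[OF True]])
      then show ?thesis by (simp add: algebra_simps)
    next
      case False
      then have "coeff ?P (Suc j) = 0" by (intro coeff_eq_0) (simp add: degree_prod_linear)
      then show ?thesis by simp
    qed
    ultimately show ?thesis
      unfolding P Suc coeff_linear_mult by (simp add: algebra_simps)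
  qed
qed simp

subsection \<open>Descartes' rule of signs\<close>

text \<open>Rolle's theorem between each zero \<open>s\<close> and the next one
  \<open>nxt s\<close>; only the largest zero has no successor.\<close>

lemma card_zeros_le_Suc_card_deriv_zeros:
  fixes f f' :: "real \<Rightarrow> real"
  assumes "\<And>x. x > 0 \<Longrightarrow> (f has_real_derivative f' x) (at x)"
    and fin: "finite {x. x > 0 \<and> f x = 0}" "finite {x. x > 0 \<and> f' x = 0}"
  shows "card {x. x > 0 \<and> f x = 0} \<le> Suc (card {x. x > 0 \<and> f' x = 0})"
proof (cases "{x. x > 0 \<and> f x = 0} = {}")
  case False
  let ?S = "{x. x > 0 \<and> f x = 0}" and ?T = "{x. x > 0 \<and> f' x = 0}"
  define nxt where "nxt s = Min {s'\<in>?S. s' > s}" for s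
  have nxt: "nxt s \<in> ?S" "s < nxt s" "\<And>s'. s' \<in> ?S \<Longrightarrow> s < s' \<Longrightarrow> nxt s \<le> s'"
    if "s \<in> ?S - {Max ?S}" for s
  proof -
    have fin': "finite {s'\<in>?S. s' > s}" by (rule finite_subset[OF _ fin(1)]) auto
    have "Max ?S \<in> {s'\<in>?S. s' > s}"
      using that Max_in[OF fin(1) False] Max_ge[OF fin(1), of s] by auto
    then have "nxt s \<in> {s'\<in>?S. s' > s}"
      unfolding nxt_def by (intro Min_in[OF fin']) blast
    then show "nxt s \<in> ?S" "s < nxt s" by auto
    show "nxt s \<le> s'" if "s' \<in> ?S" "s < s'" for s'
      unfolding nxt_def using that by (intro Min_le[OF fin']) simp
  qed
  have "\<exists>\<xi>. s < \<xi> \<and> \<xi> < nxt s \<and> f' \<xi> = 0" if s: "s \<in> ?S - {Max ?S}" for s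
  proof -
    have pos: "x > 0" if "s \<le> x" for x using s that by auto
    have "\<exists>\<xi>>s. \<xi> < nxt s \<and> f (nxt s) - f s = (nxt s - s) * f' \<xi>"
      by (rule MVT2[OF nxt(2)[OF s]]) (use assms(1) pos in auto)
    then show ?thesis using s nxt(1,2)[OF s] by auto
  qed
  then obtain g where g: "\<And>s. s \<in> ?S - {Max ?S} \<Longrightarrow> s < g s \<and> g s < nxt s \<and> f' (g s) = 0"
    by metis
  have "inj_on g (?S - {Max ?S})"
  proof (rule linorder_inj_onI')
    fix s s' assume s: "s \<in> ?S - {Max ?S}" "s' \<in> ?S - {Max ?S}" "s < s'"
    then have "g s < s'" using g[OF s(1)] nxt(3)[OF s(1), of s'] by auto
    then show "g s \<noteq> g s'" using g[OF s(2)] by auto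
  qed
  moreover have "g ` (?S - {Max ?S}) \<subseteq> ?T" using g by fastforce
  ultimately have "card (?S - {Max ?S}) \<le> card ?T" using fin(2) by (rule card_inj_on_le)
  then show ?thesis using Max_in[OF fin(1) False] fin(1) by (simp add: card_Diff_singleton)
next
  case True
  then show ?thesis by (simp only: card.empty le0)
qed

text \<open>The signs of the coefficients change at most at the indices listed in \<open>js\<close>.\<close>

definition sign_pattern :: "nat list \<Rightarrow> nat \<Rightarrow> real" where
  "sign_pattern js k = (\<Prod>j\<leftarrow>js. if k < j then - 1 else 1)"

lemma poly_pos_if_coeffs_nonneg:
  fixes p :: "real poly"
  assumes "p \<noteq> 0" "\<And>k. coeff p k \<ge> 0" "x > 0"
  shows "poly p x > 0"
proof -
  have "lead_coeff p * x ^ degree p > 0"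
  proof (rule mult_pos_pos)
    have "lead_coeff p \<noteq> 0" using assms(1) by simp
    then show "lead_coeff p > 0" using assms(2)[of "degree p"] by linarith
  qed (use assms(3) in simp)
  also have "lead_coeff p * x ^ degree p \<le> (\<Sum>i\<le>degree p. coeff p i * x ^ i)"
    by (rule member_le_sum) (use assms in auto)
  finally show ?thesis by (simp add: poly_altdef)
qed

text \<open>Dividing \<open>p\<close> by \<open>x ^ i\<close> and differentiating multiplies the
  coefficient of index \<open>k\<close> by \<open>k - i\<close>, up to a power of \<open>x\<close>.
  This flips exactly the signs below \<open>i\<close>, so one entry of the list is used up, while by
  Rolle the number of positive zeros drops by at most one.\<close>

theorem descartes_rule:
  fixes p :: "real poly"
  assumes "p \<noteq> 0" and "\<sigma> \<noteq> 0" and "\<And>k. \<sigma> * (sign_pattern js k * coeff p k) \<ge> 0"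
  shows "card {x. x > 0 \<and> poly p x = 0} \<le> length js"
  using assms
proof (induction js arbitrary: p)
  case Nil
  have "poly (smult \<sigma> p) x > 0" if "x > 0" for x
    by (rule poly_pos_if_coeffs_nonneg) (use Nil that in \<open>simp_all add: sign_pattern_def\<close>)
  then have "{x. x > 0 \<and> poly p x = 0} = {}" by fastforce
  then show ?case by (simp only: card.empty le0)
next
  case (Cons i js)
  define q where "q = pCons 0 (pderiv p) - smult (of_nat i) p"
  have cq: "coeff q k = (of_nat k - of_nat i) * coeff p k" for k
    by (cases k) (simp_all add: q_def coeff_pderiv algebra_simps)
  define f where "f x = poly p x / x ^ i" for x
  define f' where "f' x = poly q x / x ^ Suc i" for x
  have deriv: "(f has_real_derivative f' x) (at x)" if "x > 0" for x
  proof -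
    have "(f has_real_derivative (poly (pderiv p) x * x ^ i - poly p x * (of_nat i * x ^ (i - 1))) / (x ^ i * x ^ i)) (at x)"
      unfolding f_def using that by (auto intro!: derivative_eq_intros)
    moreover have "(poly (pderiv p) x * x ^ i - poly p x * (of_nat i * x ^ (i - 1))) / (x ^ i * x ^ i) = f' x"
      using that by (cases i) (simp_all add: f'_def q_def field_simps)
    ultimately show ?thesis by simp
  qed
  have Sf: "{x. x > 0 \<and> f x = 0} = {x. x > 0 \<and> poly p x = 0}"
    and Tf: "{x. x > 0 \<and> f' x = 0} = {x. x > 0 \<and> poly q x = 0}"
    by (auto simp: f_def f'_def)
  show ?case
  proof (cases "q = 0")
    \<comment> \<open>If \<open>q\<close> is zero, \<open>p\<close> is a multiple of
      \<open>x ^ i\<close> and has no positive zero.\<close>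
    case True
    then have "coeff p k = 0" if "k \<noteq> i" for k using cq[of k] that by simp
    then have p: "p = monom (coeff p i) i" by (intro poly_eqI) auto
    then have "coeff p i \<noteq> 0" using Cons.prems(1) by auto
    then have "{x. x > 0 \<and> poly p x = 0} = {}" by (subst p) (auto simp: poly_monom)
    then show ?thesis by (simp only: card.empty le0)
  next
    case False
    have "\<sigma> * (sign_pattern js k * coeff q k) \<ge> 0" for k
    proof (cases "k < i")
      case True
      then have "(of_nat i - of_nat k) * (\<sigma> * (sign_pattern (i # js) k * coeff p k)) \<ge> 0"
        by (intro mult_nonneg_nonneg Cons.prems(3)) simp
      then show ?thesis using True by (simp add: cq sign_pattern_def algebra_simps)
    next
      case False
      then have "(of_nat k - of_nat i) * (\<sigma> * (sign_pattern (i # js) k * coeff p k)) \<ge> 0"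
        by (intro mult_nonneg_nonneg Cons.prems(3)) simp
      then show ?thesis using False by (simp add: cq sign_pattern_def algebra_simps)
    qed
    then have "card {x. x > 0 \<and> poly q x = 0} \<le> length js"
      by (rule Cons.IH[OF False Cons.prems(2)])
    moreover have "card {x. x > 0 \<and> f x = 0} \<le> Suc (card {x. x > 0 \<and> f' x = 0})"
      by (rule card_zeros_le_Suc_card_deriv_zeros[OF deriv])
        (auto simp: Sf Tf intro: finite_subset[OF _ poly_roots_finite[OF Cons.prems(1)]] finite_subset[OF _ poly_roots_finite[OF False]])
    ultimately show ?thesis by (simp add: Sf Tf)
  qed
qed

lemma card_roots_ge_sign_changes:
  fixes p :: "real poly"
  assumes "p \<noteq> 0" and "\<And>i. i < n \<Longrightarrow> s i < s (Suc i)" and "\<And>i. i < n \<Longrightarrow> poly p (s i) * poly p (s (Suc i)) < 0"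
  shows "n \<le> card {x. x > s 0 \<and> poly p x = 0}"
proof -
  have "\<exists>x. s i < x \<and> x < s (Suc i) \<and> poly p x = 0" if "i < n" for i
    using poly_IVT[OF assms(2)[OF that] assms(3)[OF that]] by blast
  then obtain r where r: "\<And>i. i < n \<Longrightarrow> s i < r i \<and> r i < s (Suc i) \<and> poly p (r i) = 0" by metis
  have mono: "s i \<le> s j" if "i \<le> j" "j \<le> n" for i j
    using that
  proof (induction j)
    case (Suc j)
    then show ?case using assms(2)[of j] by (cases "i = Suc j") auto
  qed simp
  have "inj_on r {..<n}"
  proof (rule linorder_inj_onI')
    fix i j assume "i \<in> {..<n}" "j \<in> {..<n}" "i < j"
    then show "r i \<noteq> r j" using r[of i] r[of j] mono[of "Suc i" j] by auto
  qed
  moreover have "r ` {..<n} \<subseteq> {x. x > s 0 \<and> poly p x = 0}"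
  proof (rule image_subsetI)
    fix i assume "i \<in> {..<n}"
    then show "r i \<in> {x. x > s 0 \<and> poly p x = 0}" using r[of i] mono[of 0 i] by auto
  qed
  moreover have "finite {x. x > s 0 \<and> poly p x = 0}"
    by (rule finite_subset[OF _ poly_roots_finite[OF assms(1)]]) auto
  ultimately show ?thesis by (metis card_image card_lessThan card_mono)
qed

subsection \<open>Conjugation invariant systems\<close>

lemma even_card_fixpoint_free_involution:
  assumes "finite A" "\<And>a. a \<in> A \<Longrightarrow> f a \<in> A" "\<And>a. a \<in> A \<Longrightarrow> f (f a) = a" "\<And>a. a \<in> A \<Longrightarrow> f a \<noteq> a"
  shows "even (card A)"
  using assms
proof (induction "card A" arbitrary: A rule: less_induct)
  case less
  show ?case
  proof (cases "A = {}")
    case False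
    then obtain a where a: "a \<in> A" by blast
    let ?B = "A - {a, f a}"
    have fa: "f a \<in> A" "f a \<noteq> a" using less.prems a by auto
    then have card: "card A = Suc (Suc (card ?B))"
      using a less.prems(1) by (metis Diff_insert2 card_Suc_Diff1 finite_Diff insertE insert_Diff)
    have "even (card ?B)"
    proof (rule less.hyps)
      show "f b \<in> ?B" if "b \<in> ?B" for b
      proof -
        have b: "b \<in> A" "b \<noteq> a" "b \<noteq> f a" using that by auto
        have "f b \<noteq> a" using b(3) less.prems(3)[OF b(1)] by auto
        moreover have "f b \<noteq> f a" using b(2) less.prems(3)[OF b(1)] less.prems(3)[OF a] by auto
        ultimately show ?thesis using less.prems(2)[OF b(1)] by simp
      qed
    qed (use card less.prems in auto)
    then show ?thesis by (simp add: card)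
  qed simp
qed

lemma even_card_fixpoints_involution:
  assumes "finite A" "\<And>a. a \<in> A \<Longrightarrow> f a \<in> A" "\<And>a. a \<in> A \<Longrightarrow> f (f a) = a"
  shows "even (card {a\<in>A. f a = a}) \<longleftrightarrow> even (card A)"
proof -
  have "even (card (A - {a\<in>A. f a = a}))"
    by (rule even_card_fixpoint_free_involution[where f = f]) (use assms in auto)
  moreover have "card A = card {a\<in>A. f a = a} + card (A - {a\<in>A. f a = a})"
    using assms(1) by (subst card_Un_disjoint[symmetric]) (auto intro: arg_cong[where f = card])
  ultimately show ?thesis by simp
qed

text \<open>The fixed points of \<open>(x, w) -> (cnj w, cnj x)\<close> are the pairs
  \<open>(x, cnj x)\<close>. As \<open>\<theta>\<close> is injective on \<open>S\<close> and
  commutes with conjugation, a solution is fixed exactly if its value is real; so fixed solutions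
  correspond to real roots of \<open>N\<close>, and their number has the parity of
  \<open>card S\<close>.\<close>

locale conj_system =
  fixes S :: "(complex \<times> complex) set" and \<theta> :: "complex \<times> complex \<Rightarrow> complex" and N :: "complex poly"
  assumes fin: "finite S" and inj: "inj_on \<theta> S" and roots: "\<theta> ` S = {z. poly N z = 0}"
    and swap: "(x, w) \<in> S \<Longrightarrow> (cnj w, cnj x) \<in> S"
    and \<theta>_swap: "\<theta> (cnj w, cnj x) = cnj (\<theta> (x, w))"
begin

definition real_sols :: "complex set" where
  "real_sols = {x. (x, cnj x) \<in> S}"

lemma finite_real_sols: "finite real_sols"
proof -
  have "real_sols \<subseteq> fst ` S" unfolding real_sols_def by force
  then show ?thesis using fin by (meson finite_imageI finite_subset)
qed

lemma card_real_sols_S: "card real_sols = card {s\<in>S. snd s = cnj (fst s)}"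
proof -
  have "inj_on (\<lambda>x. (x, cnj x)) real_sols" by (simp add: inj_on_def)
  moreover have "(\<lambda>x. (x, cnj x)) ` real_sols = {s\<in>S. snd s = cnj (fst s)}"
    unfolding real_sols_def by (auto simp: image_iff)
  ultimately show ?thesis by (metis card_image)
qed

lemma even_card_real_sols: "even (card real_sols) \<longleftrightarrow> even (card S)"
proof -
  let ?f = "\<lambda>s. (cnj (snd s), cnj (fst s))"
  have "even (card {s\<in>S. ?f s = s}) \<longleftrightarrow> even (card S)"
    by (rule even_card_fixpoints_involution) (use fin swap in auto)
  moreover have "{s\<in>S. ?f s = s} = {s\<in>S. snd s = cnj (fst s)}" by auto
  ultimately show ?thesis unfolding card_real_sols_S by simp
qed

lemma real_sols_\<theta>:
  assumes "s \<in> S"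
  shows "snd s = cnj (fst s) \<longleftrightarrow> \<theta> s \<in> \<real>"
proof -
  obtain x w where s: "s = (x, w)" by force
  have "\<theta> s \<in> \<real> \<longleftrightarrow> \<theta> (cnj w, cnj x) = \<theta> s"
    unfolding s \<theta>_swap by (simp add: complex_is_Real_iff complex_eq_iff)
  also have "\<dots> \<longleftrightarrow> (cnj w, cnj x) = s"
    using inj_on_eq_iff[OF inj swap[of x w] assms] assms s by simp
  finally show ?thesis unfolding s by auto
qed

lemma card_real_sols: "card real_sols = card {r :: real. poly N (of_real r) = 0}"
proof -
  have "inj_on \<theta> {s\<in>S. snd s = cnj (fst s)}" by (rule inj_on_subset[OF inj]) auto
  then have "card real_sols = card (\<theta> ` {s\<in>S. snd s = cnj (fst s)})"
    by (simp add: card_image card_real_sols_S)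
  also have "\<theta> ` {s\<in>S. snd s = cnj (fst s)} = {z\<in>\<theta> ` S. z \<in> \<real>}"
    using real_sols_\<theta> by auto
  also have "\<dots> = of_real ` {r :: real. poly N (of_real r) = 0}"
    unfolding roots by (auto elim!: Reals_cases)
  also have "card \<dots> = card {r :: real. poly N (of_real r) = 0}"
    by (rule card_image) (simp add: inj_on_def)
  finally show ?thesis .
qed

lemma real_root_sol:
  assumes "poly N (of_real r) = 0"
  obtains x where "(x, cnj x) \<in> S" "\<theta> (x, cnj x) = of_real r"
proof -
  obtain s where s: "s \<in> S" "\<theta> s = of_real r" proof -
    have "of_real r \<in> \<theta> ` S" unfolding roots using assms by simp
    then show ?thesis using that by auto
  qed
  then have "s = (fst s, cnj (fst s))" using real_sols_\<theta>[OF s(1)] by (metis Reals_of_real prod.collapse)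
  then show ?thesis using that[of "fst s"] s by metis
qed

lemma all_real:
  assumes "card real_sols = card S" "(x, w) \<in> S"
  shows "w = cnj x"
proof -
  have "{s\<in>S. snd s = cnj (fst s)} = S"
    using assms(1) fin unfolding card_real_sols_S by (intro card_subset_eq) auto
  then show ?thesis using assms(2) by force
qed

end

text \<open>Stated through values rather than coefficients, because the eliminants come with closed
  formulas for their values.\<close>

definition real_coeffs :: "complex poly \<Rightarrow> bool" where
  "real_coeffs N \<longleftrightarrow> (\<forall>x. poly N (cnj x) = cnj (poly N x))"

definition re_poly :: "complex poly \<Rightarrow> real poly" where
  "re_poly N = map_poly Re N"

lemma coeff_re_poly [simp]: "coeff (re_poly N) k = Re (coeff N k)"
  by (simp add: re_poly_def coeff_map_poly)

lemma real_coeffs_coeff: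
  assumes "real_coeffs N"
  shows "coeff N k = of_real (Re (coeff N k))"
proof -
  have "poly (map_poly cnj N) x = poly N x" for x
    using assms unfolding real_coeffs_def by (metis complex_cnj_cnj poly_cnj)
  then have "map_poly cnj N = N" by (metis ext poly_eq_poly_eq_iff)
  then have "cnj (coeff N k) = coeff N k" by (metis coeff_map_poly complex_cnj_zero)
  then show ?thesis by (simp add: complex_eq_iff)
qed

lemma re_poly_of_real:
  assumes "real_coeffs N"
  shows "map_poly of_real (re_poly N) = N"
  by (rule poly_eqI) (simp add: coeff_map_poly real_coeffs_coeff[OF assms, symmetric])

lemma poly_re_poly:
  assumes "real_coeffs N"
  shows "poly N (of_real r) = of_real (poly (re_poly N) r)"
proof -
  have "poly (map_poly of_real p) (of_real r :: complex) = of_real (poly p r)" for p :: "real poly"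
    by (induction p) (simp_all add: map_poly_pCons)
  then show ?thesis by (metis re_poly_of_real[OF assms])
qed

lemma degree_re_poly:
  assumes "real_coeffs N"
  shows "degree (re_poly N) = degree N"
  by (subst re_poly_of_real[OF assms, symmetric]) (simp add: degree_map_poly)

lemma card_real_roots_re_poly:
  assumes "real_coeffs N"
  shows "{r :: real. poly N (of_real r) = 0} = {r. poly (re_poly N) r = 0}"
  by (simp add: poly_re_poly[OF assms])

section \<open>Degrees from a system in frame coordinates\<close>

lemma polyfun_poly_value:
  assumes "polyfun_poly N" "\<And>t. degree (N t) \<le> n"
  shows "(\<lambda>t. poly (N t) r) \<in> polyfun"
proof -
  have "poly (N t) r = (\<Sum>i\<le>n. coeff (N t) i * r ^ i)" for t
    unfolding poly_altdef by (rule sum.mono_neutral_left) (use assms(2) in \<open>auto simp: coeff_eq_0\<close>)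
  then show ?thesis
    using assms(1) by (simp add: polyfun_poly_def polyfun_sum polyfun_mult polyfun_const)
qed

lemma open_Re_pos:
  fixes f :: "complex ^ (2 + 2) \<Rightarrow> complex"
  assumes "f \<in> polyfun"
  shows "open {u. \<sigma> * Re (f (pair_pt u (vcnj u))) > 0}"
  by (rule open_Collect_less)
    (auto intro!: continuous_intros continuous_on_real_points[OF assms])

lemma open_coeff_signs:
  fixes N :: "complex ^ (2 + 2) \<Rightarrow> complex poly"
  assumes "polyfun_poly N"
  shows "open {u. \<forall>k\<le>(n::nat). \<sigma> k * Re (coeff (N (pair_pt u (vcnj u))) k) > 0}"
proof -
  have "{u. \<forall>k\<le>n. \<sigma> k * Re (coeff (N (pair_pt u (vcnj u))) k) > 0} =
      (\<Inter>k\<in>{..n}. {u. \<sigma> k * Re (coeff (N (pair_pt u (vcnj u))) k) > 0})" by auto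
  also have "open \<dots>"
    by (intro open_INT ballI open_Re_pos) (use assms in \<open>auto simp: polyfun_poly_def\<close>)
  finally show ?thesis .
qed

lemma open_value_signs:
  fixes N :: "complex ^ (2 + 2) \<Rightarrow> complex poly"
  assumes "polyfun_poly N" "\<And>t. degree (N t) \<le> n"
  shows "open {u. \<forall>i\<le>(k::nat). \<sigma> i * Re (poly (N (pair_pt u (vcnj u))) (s i)) > 0}"
proof -
  have "{u. \<forall>i\<le>k. \<sigma> i * Re (poly (N (pair_pt u (vcnj u))) (s i)) > 0} =
      (\<Inter>i\<in>{..k}. {u. \<sigma> i * Re (poly (N (pair_pt u (vcnj u))) (s i)) > 0})" by auto
  also have "open \<dots>"
    by (intro open_INT ballI open_Re_pos polyfun_poly_value[OF assms]) auto
  finally show ?thesis .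
qed

context metric_frame
begin

definition at_pars :: "(complex \<Rightarrow> complex \<Rightarrow> complex \<Rightarrow> complex \<Rightarrow> 'b) \<Rightarrow> complex ^ (2 + 2) \<Rightarrow> 'b" where
  "at_pars f = (\<lambda>t. f (c_par t) (d_par t) (C_par t) (D_par t))"

lemma polyfun_pars: "c_par \<in> polyfun" "d_par \<in> polyfun" "C_par \<in> polyfun" "D_par \<in> polyfun"
proof -
  have "c_par = (\<lambda>t. (1 / \<kappa>) * ((t $ Inr 1 - cnj (z0 $ 1)) * p $ 1 + (t $ Inr 2 - cnj (z0 $ 2)) * p $ 2))"
    "d_par = (\<lambda>t. (1 / \<kappa>) * ((t $ Inr 1 - cnj (z0 $ 1)) * q $ 1 + (t $ Inr 2 - cnj (z0 $ 2)) * q $ 2))"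
    "C_par = (\<lambda>t. (1 / \<kappa>) * ((t $ Inl 1 - z0 $ 1) * cnj (p $ 1) + (t $ Inl 2 - z0 $ 2) * cnj (p $ 2)))"
    "D_par = (\<lambda>t. (1 / \<kappa>) * ((t $ Inl 1 - z0 $ 1) * cnj (q $ 1) + (t $ Inl 2 - z0 $ 2) * cnj (q $ 2)))"
    by (simp_all add: fun_eq_iff c_par_def d_par_def C_par_def D_par_def coord_p_def coord_q_def sum_2)
  then show "c_par \<in> polyfun" "d_par \<in> polyfun" "C_par \<in> polyfun" "D_par \<in> polyfun"
    by (simp_all only:) (intro polyfun_intros)+
qed

text \<open>The sample need not satisfy \<open>C0 = cnj c0\<close> or \<open>D0 = cnj d0\<close>:
  the four parameters are independent on the space of pairs \<open>(u, v)\<close>, and this freedom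
  allows sparse samples.\<close>

lemma generic_pars:
  fixes N K :: "complex \<Rightarrow> complex \<Rightarrow> complex \<Rightarrow> complex \<Rightarrow> complex poly"
  assumes "polyfun_poly (at_pars N)" "\<And>c d C D. degree (N c d C D) \<le> n" "coeff (N c0 d0 C0 D0) n \<noteq> 0"
    and "polyfun_poly (at_pars K)" "\<And>c d C D. degree (K c d C D) \<le> m"
    and "no_common_root (N c0 d0 C0 D0) (K c0 d0 C0 D0)"
  shows "generic (at_pars (\<lambda>c d C D. degree (N c d C D) = n \<and> no_common_root (N c d C D) (K c d C D)))"
proof -
  obtain t0 where "c_par t0 = c0" "d_par t0 = d0" "C_par t0 = C0" "D_par t0 = D0"
    using pars_surj by metis
  then have t0: "at_pars f t0 = f c0 d0 C0 D0" for f :: "_ \<Rightarrow> _ \<Rightarrow> _ \<Rightarrow> _ \<Rightarrow> complex poly" by (simp add: at_pars_def)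
  have "generic (\<lambda>t. degree (at_pars N t) = n \<and> no_common_root (at_pars N t) (at_pars K t))"
    by (rule generic_no_common_root[of _ _ t0]) (use assms in \<open>auto simp: t0, auto simp: at_pars_def\<close>)
  then show ?thesis by (simp add: at_pars_def)
qed

abbreviation real_t :: "complex ^ 2 \<Rightarrow> complex ^ (2 + 2)" where
  "real_t u \<equiv> pair_pt u (vcnj u)"

lemma at_pars_real: "at_pars f (real_t u) = f (c_par (real_t u)) (d_par (real_t u)) (cnj (c_par (real_t u))) (cnj (d_par (real_t u)))"
  by (simp add: at_pars_def pars_real)

lemma real_t_surj: "\<exists>u. \<forall>f. at_pars f (real_t u) = f c d (cnj c) (cnj d)"
proof -
  obtain u where "c_par (real_t u) = c" "d_par (real_t u) = d" using pars_real_surj by blast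
  then show ?thesis by (intro exI[of _ u]) (simp add: at_pars_real)
qed

text \<open>\<open>good\<close> is the generic condition under which the system has the expected
  number of solutions. The upper bound concerns all good conjugate parameters, whereas each value of
  \<open>L\<close> needs one open set on which bad parameters may be ignored.\<close>

lemma degrees_from_system:
  fixes X :: "(complex ^ 2) set" and Sys :: "complex \<Rightarrow> complex \<Rightarrow> complex \<Rightarrow> complex \<Rightarrow> (complex \<times> complex) set"
  assumes irr: "irreducible_variety X"
    and zeros: "\<And>t. zero_locus (hermitian_critical_ideal_at X t) = f ` at_pars Sys t" "inj f"
    and points: "\<And>u. hermitian_critical_points X u = g ` {x. (x, cnj x) \<in> at_pars Sys (real_t u)}" "inj g"
    and gen: "generic (at_pars good)"
    and card: "\<And>c d C D. good c d C D \<Longrightarrow> finite (Sys c d C D) \<and> card (Sys c d C D) = n"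
    and upper: "\<And>c d. good c d (cnj c) (cnj d) \<Longrightarrow> card {x. (x, cnj x) \<in> Sys c d (cnj c) (cnj d)} \<in> S"
    and lower: "\<And>m. m \<in> L \<Longrightarrow> \<exists>U. open U \<and> U \<noteq> {} \<and>
      (\<forall>u\<in>U. at_pars good (real_t u) \<longrightarrow> card {x. (x, cnj x) \<in> at_pars Sys (real_t u)} = m)"
  shows "has_vHDdeg X n \<and> L \<subseteq> HDdeg X \<and> HDdeg X \<subseteq> S"
proof (intro conjI)
  have "finite (at_pars Sys t) \<and> card (at_pars Sys t) = n" if "at_pars good t" for t
    using card that by (simp add: at_pars_def)
  then show "has_vHDdeg X n"
    unfolding zeros(1)
    by (intro has_vHDdeg_irreducible[OF irr] generic_mono[OF gen])
      (simp add: zeros card_image[OF inj_on_subset[OF zeros(2)]])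
  have card_points: "card (hermitian_critical_points X u) = card {x. (x, cnj x) \<in> at_pars Sys (real_t u)}" for u
    unfolding points(1) by (rule card_image[OF inj_on_subset[OF points(2)]]) simp
  show "HDdeg X \<subseteq> S"
    by (rule HDdeg_subset[OF irr gen]) (simp add: card_points at_pars_real upper)
  show "L \<subseteq> HDdeg X"
  proof
    fix m assume "m \<in> L"
    then obtain U where U: "open U" "U \<noteq> {}"
      "\<forall>u\<in>U. at_pars good (real_t u) \<longrightarrow> card {x. (x, cnj x) \<in> at_pars Sys (real_t u)} = m"
      using lower by blast
    show "m \<in> HDdeg X"
    proof (rule HDdeg_mem[OF irr gen U(1,2)])
      fix u assume u: "u \<in> U" "at_pars good (real_t u)"
      have "finite (at_pars Sys (real_t u))" using card u(2) by (simp add: at_pars_def)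
      then have "finite (fst ` at_pars Sys (real_t u))" by simp
      then have "finite {x. (x, cnj x) \<in> at_pars Sys (real_t u)}"
        by (rule finite_subset[rotated]) force
      then show "finite (hermitian_critical_points X u) \<and> card (hermitian_critical_points X u) = m"
        using U(3) u by (simp add: card_points) (simp add: points(1))
    qed
  qed
qed

end

section \<open>Parabolas\<close>

text \<open>With \<open>r = 1 + 2 x w\<close> the system becomes linear:
  \<open>c + 2 d x = r w\<close> and \<open>C + 2 D w = r x\<close>. Solving for \<open>x\<close>
  and \<open>w\<close> with determinant \<open>r^2 - 4 d D\<close> and substituting into
  \<open>r - 1 = 2 x w\<close> gives this eliminant.\<close>

definition parabola_poly :: "complex \<Rightarrow> complex \<Rightarrow> complex \<Rightarrow> complex \<Rightarrow> complex poly" where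
  "parabola_poly c d C D = [:- 1, 1:] * [:- 4 * d * D, 0, 1:] ^ 2 - [:2:] * [:2 * D * c, C:] * [:2 * d * C, c:]"

lemma poly_parabola_poly:
  "poly (parabola_poly c d C D) r = (r - 1) * (r\<^sup>2 - 4 * d * D)\<^sup>2 - 2 * (r * C + 2 * D * c) * (r * c + 2 * d * C)"
  by (simp add: parabola_poly_def power2_eq_square algebra_simps)

lemma parabola_poly_expand:
  "parabola_poly c d C D = [:- 16 * (d * D)\<^sup>2 - 8 * c * C * d * D, 16 * (d * D)\<^sup>2 - 4 * (d * C\<^sup>2 + D * c\<^sup>2),
     8 * d * D - 2 * c * C, - 8 * d * D, - 1, 1:]"
  by (simp add: parabola_poly_def power2_eq_square algebra_simps)

lemma degree_parabola_poly: "degree (parabola_poly c d C D) = 5"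
  by (simp add: parabola_poly_expand)

lemma coeff_parabola_poly: "coeff (parabola_poly c d C D) 5 = 1" "coeff (parabola_poly c d C D) 4 = - 1"
  by (simp_all add: parabola_poly_expand numeral_eq_Suc)

definition parabola_var :: "complex \<times> complex \<Rightarrow> complex" where
  "parabola_var = (\<lambda>(x, w). 1 + 2 * x * w)"

lemma parabola_system_solved:
  assumes "(x, w) \<in> parabola_system c d C D"
  defines "r \<equiv> parabola_var (x, w)"
  shows "x * (r\<^sup>2 - 4 * d * D) = r * C + 2 * D * c" "w * (r\<^sup>2 - 4 * d * D) = r * c + 2 * d * C"
    "poly (parabola_poly c d C D) r = 0"
proof -
  have 1: "c + 2 * x * d = w * r" and 2: "C + 2 * w * D = x * r"
    using assms(1) unfolding parabola_system_def r_def parabola_var_def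
    by (simp_all add: algebra_simps)
  show x: "x * (r\<^sup>2 - 4 * d * D) = r * C + 2 * D * c" using 1 2 by algebra
  show w: "w * (r\<^sup>2 - 4 * d * D) = r * c + 2 * d * C" using 1 2 by algebra
  have r: "r - 1 = 2 * x * w" by (simp add: r_def parabola_var_def)
  show "poly (parabola_poly c d C D) r = 0"
    unfolding poly_parabola_poly r x[symmetric] w[symmetric] by (simp add: power2_eq_square)
qed

text \<open>The hypothesis keeps the determinant \<open>r^2 - 4 d D\<close> away from 0, so that
  Cramer's rule recovers a unique solution from each root.\<close>

lemma parabola_system_roots:
  assumes "no_common_root (parabola_poly c d C D) [:- 4 * d * D, 0, 1:]"
  shows "inj_on parabola_var (parabola_system c d C D)"
    and "parabola_var ` parabola_system c d C D = {r. poly (parabola_poly c d C D) r = 0}"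
proof -
  have nz: "r\<^sup>2 - 4 * d * D \<noteq> 0" if "poly (parabola_poly c d C D) r = 0" for r
    using assms that by (auto simp: no_common_root_def power2_eq_square)
  show "inj_on parabola_var (parabola_system c d C D)"
  proof (rule inj_onI)
    fix s s' assume s: "s \<in> parabola_system c d C D" "s' \<in> parabola_system c d C D" "parabola_var s = parabola_var s'"
    obtain x w x' w' where xw: "s = (x, w)" "s' = (x', w')" by force
    show "s = s'"
      using parabola_system_solved[of x w c d C D] parabola_system_solved[of x' w' c d C D] s nz
      unfolding xw by (metis mult_cancel_right)
  qed
  show "parabola_var ` parabola_system c d C D = {r. poly (parabola_poly c d C D) r = 0}"
  proof (intro equalityI subsetI)
    fix r assume "r \<in> {r. poly (parabola_poly c d C D) r = 0}"
    then have r: "poly (parabola_poly c d C D) r = 0" by simp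
    define Q where "Q = r\<^sup>2 - 4 * d * D"
    have Q: "Q \<noteq> 0" using nz[OF r] by (simp add: Q_def)
    define x where "x = (r * C + 2 * D * c) / Q"
    define w where "w = (r * c + 2 * d * C) / Q"
    have x: "x * Q = r * C + 2 * D * c" and w: "w * Q = r * c + 2 * d * C"
      using Q by (simp_all add: x_def w_def)
    have "Q\<^sup>2 * (r - 1 - 2 * x * w) = 0"
      using r x w unfolding poly_parabola_poly Q_def[symmetric] by algebra
    then have "r - 1 - 2 * x * w = 0" using Q by simp
    then have xw: "r = 1 + 2 * x * w" by (simp add: algebra_simps)
    have "Q * (c + 2 * x * d - w * r) = 0" "Q * (C + 2 * w * D - x * r) = 0"
      using x w unfolding Q_def by algebra+
    then have "c + 2 * x * d - w * r = 0" "C + 2 * w * D - x * r = 0" using Q by simp_all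
    then have "(x, w) \<in> parabola_system c d C D"
      unfolding parabola_system_def xw by (simp add: algebra_simps)
    then show "r \<in> parabola_var ` parabola_system c d C D"
      by (rule rev_image_eqI) (simp add: parabola_var_def xw)
  qed (use parabola_system_solved(3) in auto)
qed

definition parabola_good :: "complex \<Rightarrow> complex \<Rightarrow> complex \<Rightarrow> complex \<Rightarrow> bool" where
  "parabola_good c d C D \<longleftrightarrow> no_common_root (parabola_poly c d C D) (pderiv (parabola_poly c d C D)) \<and>
     no_common_root (parabola_poly c d C D) [:- 4 * d * D, 0, 1:]"

lemma parabola_system_card:
  assumes "parabola_good c d C D"
  shows "finite (parabola_system c d C D) \<and> card (parabola_system c d C D) = 5"
proof -
  note roots = parabola_system_roots[OF conjunct2[OF assms[unfolded parabola_good_def]]]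
  have "card {r. poly (parabola_poly c d C D) r = 0} = 5"
    by (rule card_roots_no_common_root_pderiv)
      (use assms in \<open>auto simp: parabola_good_def degree_parabola_poly\<close>)
  then have "card (parabola_var ` parabola_system c d C D) = 5" by (simp add: roots(2))
  then have "card (parabola_system c d C D) = 5" by (simp add: card_image[OF roots(1)])
  then show ?thesis by (metis card.infinite zero_neq_numeral)
qed

lemma parabola_system_swap:
  assumes "(x, w) \<in> parabola_system c d (cnj c) (cnj d)"
  shows "(cnj w, cnj x) \<in> parabola_system c d (cnj c) (cnj d)"
proof -
  have "c - w + 2 * x * (d - w * w) = 0" "cnj c - x + 2 * w * (cnj d - x * x) = 0"
    using assms by (simp_all add: parabola_system_def)
  then have "cnj (c - w + 2 * x * (d - w * w)) = 0" "cnj (cnj c - x + 2 * w * (cnj d - x * x)) = 0"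
    by (simp_all only: complex_cnj_zero)
  then show ?thesis by (simp add: parabola_system_def)
qed

context
  fixes c d :: complex
  assumes good: "parabola_good c d (cnj c) (cnj d)"
begin

interpretation conj_system "parabola_system c d (cnj c) (cnj d)" parabola_var "parabola_poly c d (cnj c) (cnj d)"
proof
  show "finite (parabola_system c d (cnj c) (cnj d))" using parabola_system_card[OF good] by blast
  show "inj_on parabola_var (parabola_system c d (cnj c) (cnj d))"
    "parabola_var ` parabola_system c d (cnj c) (cnj d) = {z. poly (parabola_poly c d (cnj c) (cnj d)) z = 0}"
    using parabola_system_roots good by (auto simp: parabola_good_def)
qed (auto intro: parabola_system_swap simp: parabola_var_def)

lemma parabola_real_coeffs: "real_coeffs (parabola_poly c d (cnj c) (cnj d))"
  unfolding real_coeffs_def poly_parabola_poly by (simp add: algebra_simps)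

text \<open>A real root is \<open>1 + 2 |x|^2\<close> for a solution
  \<open>(x, cnj x)\<close>.\<close>

lemma parabola_real_root_ge_1:
  assumes "poly (parabola_poly c d (cnj c) (cnj d)) (of_real r) = 0"
  shows "r \<ge> 1"
proof -
  obtain x where "parabola_var (x, cnj x) = of_real r" using real_root_sol[OF assms] by metis
  then have "1 + 2 * of_real ((cmod x)\<^sup>2) = complex_of_real r"
    unfolding complex_norm_square by (simp add: parabola_var_def mult.assoc)
  then have "complex_of_real (1 + 2 * (cmod x)\<^sup>2) = of_real r" by simp
  then have "1 + 2 * (cmod x)\<^sup>2 = r" by (simp only: of_real_eq_iff)
  then show ?thesis using zero_le_power2[of "cmod x"] by linarith
qed

lemma parabola_card_real:
  "card {x. (x, cnj x) \<in> parabola_system c d (cnj c) (cnj d)} =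
    card {r. poly (re_poly (parabola_poly c d (cnj c) (cnj d))) r = 0}"
  using card_real_sols unfolding real_sols_def card_real_roots_re_poly[OF parabola_real_coeffs] .

lemma parabola_card_odd: "odd (card {x. (x, cnj x) \<in> parabola_system c d (cnj c) (cnj d)})"
  using even_card_real_sols parabola_system_card[OF good] unfolding real_sols_def by simp

text \<open>The roots sum to 1, whereas each real root is at least 1.\<close>

lemma parabola_card_le_3: "card {x. (x, cnj x) \<in> parabola_system c d (cnj c) (cnj d)} \<le> 3"
proof (rule ccontr)
  assume *: "\<not> ?thesis"
  let ?N = "re_poly (parabola_poly c d (cnj c) (cnj d))"
  let ?R = "{r. poly ?N r = 0}"
  have deg: "degree ?N = 5"
    by (simp add: degree_re_poly[OF parabola_real_coeffs] degree_parabola_poly)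
  then have nz: "?N \<noteq> 0" by auto
  have fin: "finite ?R" by (rule poly_roots_finite[OF nz])
  have "card ?R \<le> 5" using card_poly_roots_bound[OF nz] deg by simp
  moreover have "card ?R \<noteq> 4" using parabola_card_odd unfolding parabola_card_real by auto
  ultimately have card: "card ?R = 5" using * unfolding parabola_card_real by linarith
  have "?N = smult (lead_coeff ?N) (\<Prod>r\<in>?R. [:- r, 1:])"
    by (rule poly_eq_prod_roots) (use fin card deg in auto)
  then have "coeff ?N 4 = lead_coeff ?N * - (\<Sum>r\<in>?R. r)"
    using coeff_prod_linear(2)[OF fin] card by (metis card.empty coeff_smult diff_Suc_1 eval_nat_numeral(3) zero_neq_numeral)
  then have "(\<Sum>r\<in>?R. r) = 1"
    using deg by (simp add: coeff_parabola_poly)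
  moreover have "(\<Sum>r\<in>?R. r) \<ge> (\<Sum>r\<in>?R. 1)"
    by (rule sum_mono) (use parabola_real_root_ge_1 in \<open>simp add: poly_re_poly[OF parabola_real_coeffs]\<close>)
  ultimately show False using card by simp
qed

lemma parabola_card_1_3: "card {x. (x, cnj x) \<in> parabola_system c d (cnj c) (cnj d)} \<in> {1, 3}"
proof -
  have "n \<in> {1, 3}" if "odd n" "n \<le> 3" for n :: nat
    using that by (cases "n = 0 \<or> n = 2") auto
  then show ?thesis using parabola_card_odd parabola_card_le_3 by blast
qed

end

text \<open>The same polynomial in the variable \<open>r - 1\<close>.\<close>

definition parabola_poly_shift :: "complex \<Rightarrow> complex \<Rightarrow> complex \<Rightarrow> complex \<Rightarrow> complex poly" where
  "parabola_poly_shift c d C D =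
     [:0, 1:] * [:1 - 4 * d * D, 2, 1:] ^ 2 - [:2:] * [:C + 2 * D * c, C:] * [:c + 2 * d * C, c:]"

lemma poly_parabola_poly_shift:
  "poly (parabola_poly_shift c d C D) r = poly (parabola_poly c d C D) (r + 1)"
  unfolding poly_parabola_poly by (simp add: parabola_poly_shift_def power2_eq_square algebra_simps)

context metric_frame
begin

lemma polyfun_poly_parabola:
  "polyfun_poly (at_pars parabola_poly)" "polyfun_poly (at_pars parabola_poly_shift)"
  unfolding at_pars_def parabola_poly_def parabola_poly_shift_def
  by (intro polyfun_poly_intros polyfun_intros polyfun_pars)+

lemma generic_parabola_good: "generic (at_pars parabola_good)"
proof -
  \<comment> \<open>A sparse sample: the eliminant is \<open>r^5 - r^4 - r\<close>.\<close>
  have 1: "no_common_root (parabola_poly 0 (1 / 4) 1 0) (pderiv (parabola_poly 0 (1 / 4) 1 0))"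
    unfolding no_common_root_def
  proof (intro allI impI notI)
    fix r :: complex
    assume "poly (parabola_poly 0 (1 / 4) 1 0) r = 0" "poly (pderiv (parabola_poly 0 (1 / 4) 1 0)) r = 0"
    then have "r ^ 5 - r ^ 4 - r = 0" "5 * r ^ 4 - 4 * r ^ 3 - 1 = 0"
      by (simp_all add: parabola_poly_expand pderiv_pCons algebra_simps power_numeral_reduce)
    then show False by algebra
  qed
  \<comment> \<open>At a zero of the determinant, \<open>r^2 = 4\<close>, this sample has the value
    \<open>- 4 r\<close>.\<close>
  have 2: "no_common_root (parabola_poly 0 1 1 1) [:- 4 * 1 * 1, 0, 1:]"
    unfolding no_common_root_def
  proof (intro allI impI notI)
    fix r :: complex
    assume "poly (parabola_poly 0 1 1 1) r = 0" "poly [:- 4 * 1 * 1, 0, 1:] r = 0"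
    then have "(r - 1) * (r\<^sup>2 - 4)\<^sup>2 - 2 * r * 2 = 0" "r\<^sup>2 - 4 = 0"
      by (simp_all add: poly_parabola_poly power2_eq_square)
    then show False by algebra
  qed
  have g1: "generic (at_pars (\<lambda>c d C D. degree (parabola_poly c d C D) = 5 \<and>
      no_common_root (parabola_poly c d C D) (pderiv (parabola_poly c d C D))))"
    by (rule generic_pars[of parabola_poly 5 0 "1 / 4" 1 0 "\<lambda>c d C D. pderiv (parabola_poly c d C D)" 4, OF polyfun_poly_parabola(1) _ _ _ _ 1])
      (use polyfun_poly_pderiv[OF polyfun_poly_parabola(1)] in
        \<open>simp_all add: degree_parabola_poly coeff_parabola_poly at_pars_def degree_pderiv\<close>)
  have "polyfun_poly (at_pars (\<lambda>c d C D. [:- 4 * d * D, 0, 1:]))"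
    unfolding at_pars_def by (intro polyfun_poly_intros polyfun_intros polyfun_pars)
  then have g2: "generic (at_pars (\<lambda>c d C D. degree (parabola_poly c d C D) = 5 \<and>
      no_common_root (parabola_poly c d C D) [:- 4 * d * D, 0, 1:]))"
    by (intro generic_pars[of parabola_poly 5 0 1 1 1 "\<lambda>c d C D. [:- 4 * d * D, 0, 1:]" 2, OF polyfun_poly_parabola(1) _ _ _ _ 2])
      (simp_all add: degree_parabola_poly coeff_parabola_poly)
  show ?thesis
    by (rule generic_mono[OF generic_conj[OF g1 g2]]) (simp add: at_pars_def parabola_good_def)
qed

text \<open>Real roots are at least 1, so after the shift they are nonnegative. At the sample all
  shifted coefficients are positive except the negative constant one; Descartes' rule leaves at most
  one root, and the count is odd.\<close>

lemma parabola_open_1: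
  "\<exists>U. open U \<and> U \<noteq> {} \<and> (\<forall>u\<in>U. at_pars parabola_good (real_t u) \<longrightarrow>
    card {x. (x, cnj x) \<in> at_pars parabola_system (real_t u)} = 1)"
proof -
  define \<sigma> :: "nat \<Rightarrow> real" where "\<sigma> k = (if k = 0 then - 1 else 1)" for k
  let ?U = "{u. \<forall>k\<le>5. \<sigma> k * Re (coeff (at_pars parabola_poly_shift (real_t u)) k) > 0}"
  have "open ?U" by (rule open_coeff_signs[OF polyfun_poly_parabola(2)])
  moreover have "?U \<noteq> {}"
  proof -
    obtain u where u: "at_pars parabola_poly_shift (real_t u) = parabola_poly_shift (1 / 4) 0 (cnj (1 / 4)) (cnj 0)"
      using real_t_surj[of "1 / 4" 0] by blast
    have "parabola_poly_shift (1 / 4) 0 (cnj (1 / 4)) (cnj 0) =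
        [:- 1 / 8, 3 / 4, 31 / 8, 6, 4, 1:]"
      by (simp add: parabola_poly_shift_def power2_eq_square)
    then have "u \<in> ?U" by (auto simp: u \<sigma>_def le_Suc_eq numeral_eq_Suc)
    then show ?thesis by blast
  qed
  moreover have "card {x. (x, cnj x) \<in> at_pars parabola_system (real_t u)} = 1"
    if u: "u \<in> ?U" and good: "at_pars parabola_good (real_t u)" for u
  proof -
    define c d where "c = c_par (real_t u)" and "d = d_par (real_t u)"
    have good: "parabola_good c d (cnj c) (cnj d)" using good by (simp add: at_pars_real c_def d_def)
    let ?N = "re_poly (parabola_poly c d (cnj c) (cnj d))" and ?M = "re_poly (parabola_poly_shift c d (cnj c) (cnj d))"
    have real: "real_coeffs (parabola_poly_shift c d (cnj c) (cnj d))"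
      using parabola_real_coeffs[OF good] unfolding real_coeffs_def poly_parabola_poly_shift by (metis complex_cnj_add complex_cnj_one)
    have M: "poly ?M r = poly ?N (r + 1)" for r
      using poly_re_poly[OF real, of r] poly_re_poly[OF parabola_real_coeffs[OF good], of "r + 1"]
        poly_parabola_poly_shift[of c d "cnj c" "cnj d" "of_real r"]
      by (metis of_real_1 of_real_add of_real_eq_iff)
    have coeffs: "\<sigma> k * coeff ?M k > 0" if "k \<le> 5" for k
      using u that by (simp add: at_pars_real c_def d_def)
    have "degree (parabola_poly_shift c d (cnj c) (cnj d)) \<le> 5"
      by (rule degree_le) (auto simp: parabola_poly_shift_def power2_eq_square coeff_pCons split: nat.split)
    then have high: "coeff ?M k = 0" if "k > 5" for k
      using that by (simp add: coeff_eq_0)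
    have nz: "?M \<noteq> 0" using coeffs[of 0] by (metis coeff_0 le0 less_irrefl mult_zero_right)
    have "1 * (sign_pattern [1] k * coeff ?M k) \<ge> 0" for k
      using coeffs[of k] high[of k] by (cases "k \<le> 5") (auto simp: \<sigma>_def sign_pattern_def split: if_splits)
    then have le1: "card {r. r > 0 \<and> poly ?M r = 0} \<le> length [1::nat]"
      by (intro descartes_rule[OF nz, of 1]) auto
    have sub: "{r. poly ?N r = 0} \<subseteq> (\<lambda>r. r + 1) ` {r. r > 0 \<and> poly ?M r = 0}"
    proof
      fix r assume r: "r \<in> {r. poly ?N r = 0}"
      then have "r \<ge> 1"
        using parabola_real_root_ge_1[OF good] by (simp add: poly_re_poly[OF parabola_real_coeffs[OF good]])
      moreover have "r \<noteq> 1"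
        using r coeffs[of 0] M[of 0] by (auto simp: poly_0_coeff_0)
      ultimately show "r \<in> (\<lambda>r. r + 1) ` {r. r > 0 \<and> poly ?M r = 0}"
        using r M[of "r - 1"] by (intro image_eqI[of _ _ "r - 1"]) auto
    qed
    have fin: "finite {r. r > 0 \<and> poly ?M r = 0}"
      by (rule finite_subset[OF _ poly_roots_finite[OF nz]]) auto
    have "card {r. poly ?N r = 0} \<le> card ((\<lambda>r. r + 1) ` {r. r > 0 \<and> poly ?M r = 0})"
      by (rule card_mono[OF finite_imageI[OF fin] sub])
    also have "\<dots> \<le> card {r. r > 0 \<and> poly ?M r = 0}" by (rule card_image_le[OF fin])
    also have "\<dots> \<le> 1" using le1 by simp
    finally have "card {r. poly ?N r = 0} \<le> 1" .
    then have "card {x. (x, cnj x) \<in> parabola_system c d (cnj c) (cnj d)} = 1"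
      using parabola_card_1_3[OF good] parabola_card_real[OF good] by auto
    then show ?thesis by (simp add: at_pars_real c_def d_def)
  qed
  ultimately show ?thesis by blast
qed

lemma parabola_open_3:
  "\<exists>U. open U \<and> U \<noteq> {} \<and> (\<forall>u\<in>U. at_pars parabola_good (real_t u) \<longrightarrow>
    card {x. (x, cnj x) \<in> at_pars parabola_system (real_t u)} = 3)"
proof -
  \<comment> \<open>At \<open>c = 1 / 2\<close>, \<open>d = 2\<close> the leading term contains
    \<open>(r^2 - 16)^2\<close>. It vanishes at \<open>r = 4\<close>, where the subtracted square
    makes the value negative; the signs at 1, 2, 4, 6 are -, +, -, +.\<close>
  define s :: "nat \<Rightarrow> real" where "s = nth [1, 2, 4, 6]"
  define \<sigma> :: "nat \<Rightarrow> real" where "\<sigma> i = (- 1) ^ Suc i" for i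
  let ?U = "{u. \<forall>i\<le>3. \<sigma> i * Re (poly (at_pars parabola_poly (real_t u)) (s i)) > 0}"
  have le3: "i \<le> 3 \<longleftrightarrow> i = 0 \<or> i = 1 \<or> i = 2 \<or> i = 3" for i :: nat by auto
  have "open ?U"
    by (rule open_value_signs[OF polyfun_poly_parabola(1), of 5]) (simp add: at_pars_def degree_parabola_poly)
  moreover have "?U \<noteq> {}"
  proof -
    obtain u where "at_pars parabola_poly (real_t u) = parabola_poly (1 / 2) 2 (cnj (1 / 2)) (cnj 2)"
      using real_t_surj[of "1 / 2" 2] by blast
    then have "u \<in> ?U"
      by (auto simp: poly_parabola_poly \<sigma>_def s_def le3 power2_eq_square)
    then show ?thesis by blast
  qed
  moreover have "card {x. (x, cnj x) \<in> at_pars parabola_system (real_t u)} = 3"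
    if u: "u \<in> ?U" and good: "at_pars parabola_good (real_t u)" for u
  proof -
    define c d where "c = c_par (real_t u)" and "d = d_par (real_t u)"
    have good: "parabola_good c d (cnj c) (cnj d)" using good by (simp add: at_pars_real c_def d_def)
    let ?N = "re_poly (parabola_poly c d (cnj c) (cnj d))"
    have signs: "\<sigma> i * poly ?N (s i) > 0" if "i \<le> 3" for i
      using u that by (simp add: at_pars_real c_def d_def poly_re_poly[OF parabola_real_coeffs[OF good, unfolded c_def d_def]])
    have nz: "?N \<noteq> 0" using signs[of 0] by auto
    have "3 \<le> card {r. r > s 0 \<and> poly ?N r = 0}"
    proof (rule card_roots_ge_sign_changes[OF nz])
      fix i :: nat assume i: "i < 3"
      then show "s i < s (Suc i)" by (auto simp: s_def less_Suc_eq numeral_3_eq_3)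
      have "0 < (\<sigma> i * poly ?N (s i)) * (\<sigma> (Suc i) * poly ?N (s (Suc i)))"
        using i by (intro mult_pos_pos signs) auto
      then show "poly ?N (s i) * poly ?N (s (Suc i)) < 0"
        by (simp add: \<sigma>_def algebra_simps flip: power_add power2_eq_square)
    qed
    also have "\<dots> \<le> card {r. poly ?N r = 0}"
      by (rule card_mono[OF poly_roots_finite[OF nz]]) auto
    finally have "card {x. (x, cnj x) \<in> parabola_system c d (cnj c) (cnj d)} = 3"
      using parabola_card_1_3[OF good] parabola_card_real[OF good] by auto
    then show ?thesis by (simp add: at_pars_real c_def d_def)
  qed
  ultimately show ?thesis by blast
qed

theorem parabola_degrees:
  assumes "g \<noteq> 0" "l = 0"
  shows "has_vHDdeg (zero_locus {parabola g}) 5 \<and> HDdeg (zero_locus {parabola g}) = {1, 3}"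
proof -
  interpret smooth_plane_curve "zero_locus {parabola g}" "parabola g" by (rule parabola[OF assms(1)])
  have "has_vHDdeg (zero_locus {parabola g}) 5 \<and> {1, 3} \<subseteq> HDdeg (zero_locus {parabola g}) \<and>
      HDdeg (zero_locus {parabola g}) \<subseteq> {1, 3}"
  proof (rule degrees_from_system[where Sys = parabola_system and good = parabola_good])
    show "zero_locus (hermitian_critical_ideal_at (zero_locus {parabola g}) t) =
        (\<lambda>(x, w). joint_pt ((x, x * x), (w, w * w))) ` at_pars parabola_system t" for t
      using parabola_zeros[OF assms] by (simp add: at_pars_def)
    show "inj (\<lambda>(x, w). joint_pt ((x, x * x), (w, w * w)))"
      by (rule injI) (auto dest: injD[OF inj_joint_pt])
    show "hermitian_critical_points (zero_locus {parabola g}) u =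
        (\<lambda>x. pt x (x * x)) ` {x. (x, cnj x) \<in> at_pars parabola_system (real_t u)}" for u
      using parabola_points[OF assms refl] by (simp add: at_pars_def)
    show "inj (\<lambda>x. pt x (x * x))" by (rule injI) (simp add: pt_inject)
    show "\<exists>U. open U \<and> U \<noteq> {} \<and> (\<forall>u\<in>U. at_pars parabola_good (real_t u) \<longrightarrow>
        card {x. (x, cnj x) \<in> at_pars parabola_system (real_t u)} = m)" if "m \<in> {1, 3}" for m
      using that parabola_open_1 parabola_open_3 by blast
  qed (use irreducible generic_parabola_good parabola_system_card parabola_card_1_3 in auto)
  then show ?thesis by blast
qed

end

section \<open>Hyperbolas\<close>

lemma hyperbola_system_swap:
  fixes l :: real
  assumes "(x, w) \<in> hyperbola_system l c d (cnj c) (cnj d)"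
  shows "(cnj w, cnj x) \<in> hyperbola_system l c d (cnj c) (cnj d)"
proof -
  have nz: "x \<noteq> 0" "w \<noteq> 0"
    and 1: "(c * (x * w) - cnj d) * x + (cnj c * (x * w) - d) * w - 2 * ((x * w)\<^sup>2 - 1) = 0"
    and 2: "(c * (x * w) + cnj d) * x - (cnj c * (x * w) + d) * w - 2 * l * (x\<^sup>2 - w\<^sup>2) = 0"
    using assms by (simp_all add: hyperbola_system_def)
  have "cnj ((c * (x * w) - cnj d) * x + (cnj c * (x * w) - d) * w - 2 * ((x * w)\<^sup>2 - 1)) = 0"
    "cnj ((c * (x * w) + cnj d) * x - (cnj c * (x * w) + d) * w - 2 * l * (x\<^sup>2 - w\<^sup>2)) = 0"
    by (simp_all only: 1 2 complex_cnj_zero)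
  then show ?thesis
    using nz by (simp add: hyperbola_system_def algebra_simps)
qed

lemma norm_square_real_derivative:
  assumes "(g has_vector_derivative g') (at t)"
  shows "((\<lambda>t. (cmod (g t))\<^sup>2) has_real_derivative 2 * Re (cnj (g t) * g')) (at t)"
proof -
  have "((\<lambda>t. Re (g t)) has_real_derivative Re g') (at t)" "((\<lambda>t. Im (g t)) has_real_derivative Im g') (at t)"
    using bounded_linear.has_vector_derivative[OF bounded_linear_Re assms]
      bounded_linear.has_vector_derivative[OF bounded_linear_Im assms]
    by (simp_all add: has_real_derivative_iff_has_vector_derivative)
  moreover have "((\<lambda>t. (a t)\<^sup>2 + (b t)\<^sup>2) has_real_derivative 2 * (a t * a' + b t * b')) (at t)"
    if "(a has_real_derivative a') (at t)" "(b has_real_derivative b') (at t)" for a b :: "real \<Rightarrow> real" and a' b'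
    using that by (auto intro!: derivative_eq_intros)
  ultimately show ?thesis
    unfolding cmod_power2 by simp
qed

lemma closed_zero_locus: "closed (zero_locus {F :: 2 mpoly})"
proof -
  have "continuous_on UNIV (\<lambda>z. poly_eval z p)" for p :: "2 mpoly"
    by (induction p rule: mpoly_induct) (auto intro!: continuous_intros)
  from closed_Collect_eq[OF this[of F] continuous_on_const[of UNIV 0]]
  show ?thesis by (simp add: zero_locus_def)
qed

context metric_frame
begin

text \<open>A point of the hyperbola nearest to \<open>u\<close> is critical.\<close>

lemma hyperbola_real_solution:
  "\<exists>x. (x, cnj x) \<in> at_pars (hyperbola_system l) (real_t u)"
proof -
  let ?X = "zero_locus {hyperbola 1}"
  have mem: "pt y (1 / y) \<in> ?X" if "y \<noteq> 0" for y
    using that by (simp add: zero_locus_def hyperbola_def)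
  have "?X \<noteq> {}" using mem[of 1] by auto
  then obtain z where z: "z \<in> ?X" "\<And>z'. z' \<in> ?X \<Longrightarrow> dist u z \<le> dist u z'"
    using distance_attains_inf[OF closed_zero_locus] by metis
  obtain x y where xy: "z = pt x y" using pt_surj by blast
  then have x: "x \<noteq> 0" "y = 1 / x"
    using z(1) by (auto simp: zero_locus_def hyperbola_def eq_divide_eq mult.commute)
  \<comment> \<open>Moving the parameter \<open>x\<close> in the direction \<open>e\<close> changes
    the squared distance at the rate \<open>2 Re (e s)\<close>. The choice \<open>e = cnj s\<close>
    makes this \<open>2 |s|^2\<close>, so a minimum forces \<open>s = 0\<close>.\<close>
  define s where "s = (\<Sum>k\<in>UNIV. cnj (z $ k - u $ k) * (p $ k - q $ k / x\<^sup>2))"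
  define e where "e = cnj s"
  define g where "g k t = z0 $ k + (x + of_real t * e) * p $ k + q $ k / (x + of_real t * e) - u $ k" for k t
  have g0: "g k 0 = z $ k - u $ k" for k
    by (simp add: g_def xy pt_def x(2))
  have dg: "(g k has_vector_derivative e * (p $ k - q $ k / x\<^sup>2)) (at 0)" for k
    unfolding g_def using x(1)
    by (auto intro!: derivative_eq_intros has_vector_derivative_real_field simp: power2_eq_square field_simps)
  have deriv: "((\<lambda>t. \<Sum>k\<in>UNIV. (cmod (g k t))\<^sup>2) has_real_derivative
      (\<Sum>k\<in>UNIV. 2 * Re (cnj (g k 0) * (e * (p $ k - q $ k / x\<^sup>2))))) (at 0)"
    by (intro DERIV_sum norm_square_real_derivative dg)
  have val: "(\<Sum>k\<in>UNIV. (cmod (g k t))\<^sup>2) = (dist u (pt (x + of_real t * e) (1 / (x + of_real t * e))))\<^sup>2" for t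
    unfolding dist_vec_def L2_set_def
    by (simp add: sum_nonneg g_def pt_def dist_norm norm_minus_commute distrib_right)
  have "eventually (\<lambda>t :: real. x + of_real t * e \<noteq> 0) (nhds 0)"
  proof -
    have "isCont (\<lambda>t :: real. x + of_real t * e) 0" by (intro continuous_intros)
    then have "((\<lambda>t :: real. x + of_real t * e) \<longlongrightarrow> x) (nhds 0)"
      by (simp add: continuous_at tendsto_nhds_iff)
    then show ?thesis using x(1) by (rule tendsto_imp_eventually_ne)
  qed
  then obtain \<delta>' where \<delta>': "\<delta>' > 0" "\<And>t :: real. dist t 0 < \<delta>' \<Longrightarrow> x + of_real t * e \<noteq> 0"
    unfolding eventually_nhds_metric by blast
  have "(\<Sum>k\<in>UNIV. 2 * Re (cnj (g k 0) * (e * (p $ k - q $ k / x\<^sup>2)))) = 0"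
  proof (rule DERIV_local_min[OF deriv \<delta>'(1)], intro allI impI)
    fix t :: real assume "\<bar>0 - t\<bar> < \<delta>'"
    then have "x + of_real t * e \<noteq> 0" using \<delta>'(2)[of t] by (simp add: dist_norm)
    then have "dist u z \<le> dist u (pt (x + of_real t * e) (1 / (x + of_real t * e)))"
      by (intro z(2) mem)
    then show "(\<Sum>k\<in>UNIV. (cmod (g k 0))\<^sup>2) \<le> (\<Sum>k\<in>UNIV. (cmod (g k t))\<^sup>2)"
      unfolding val by (simp add: xy x(2) power_mono)
  qed
  moreover have "(\<Sum>k\<in>UNIV. 2 * Re (cnj (g k 0) * (e * (p $ k - q $ k / x\<^sup>2)))) = 2 * (cmod s)\<^sup>2"
  proof -
    have "(\<Sum>k\<in>UNIV. 2 * Re (cnj (g k 0) * (e * (p $ k - q $ k / x\<^sup>2)))) = 2 * Re (e * s)"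
      by (simp add: g0 s_def sum_2 algebra_simps)
    also have "e * s = of_real ((cmod s)\<^sup>2)"
      unfolding complex_norm_square e_def by (rule mult.commute)
    finally show ?thesis by simp
  qed
  ultimately have s0: "s = 0" by simp
  let ?c = "c_par (real_t u)" and ?d = "d_par (real_t u)"
  have "(\<Sum>k\<in>UNIV. (vcnj u - vcnj (pt x y)) $ k * p $ k) - (\<Sum>k\<in>UNIV. (vcnj u - vcnj (pt x y)) $ k * q $ k) / x\<^sup>2 = - s"
    unfolding s_def xy sum_2 by (simp add: diff_divide_distrib add_divide_distrib algebra_simps)
  then have "\<kappa> * (?c - cnj x - l * cnj y) - \<kappa> * (?d - l * cnj x - cnj y) / x\<^sup>2 = 0"
    using normal_coords[of "vcnj u" "cnj x" "cnj y"] s0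
    by (simp add: c_par_def d_par_def)
  then have "\<kappa> * ((?c - cnj x - l * cnj y) - (?d - l * cnj x - cnj y) / x\<^sup>2) = 0"
    by (simp only: right_diff_distrib times_divide_eq_right)
  then have "?c - cnj x - l * cnj y = (?d - l * cnj x - cnj y) / x\<^sup>2"
    using \<kappa>_pos by simp
  then have "(?c - cnj x - l * cnj y) * x = (?d - l * cnj x - cnj y) * (1 / x)"
    using x(1) by (simp add: power2_eq_square)
  then have "frame_critical (hyperbola 1) ?c ?d (x, y) (cnj x, cnj y)"
    using x hyperbola_frame_critical[of 1 ?c ?d x y "cnj x" "cnj y"] by simp
  then have "pt x y \<in> hermitian_critical_points ?X u"
    using critical_points_frame[OF hyperbola[of 1] refl, of u] by auto
  then show ?thesis
    using hyperbola_points[of 1, OF _ refl, of u] unfolding at_pars_def by auto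
qed

lemma hyperbola_real_nonempty: "{x. (x, cnj x) \<in> hyperbola_system l c d (cnj c) (cnj d)} \<noteq> {}"
proof -
  obtain u where "at_pars (hyperbola_system l) (real_t u) = hyperbola_system l c d (cnj c) (cnj d)"
  proof -
    obtain u where "c_par (real_t u) = c" "d_par (real_t u) = d" using pars_real_surj by blast
    then show ?thesis by (intro that[of u]) (simp add: at_pars_real)
  qed
  then show ?thesis using hyperbola_real_solution[of u] by auto
qed

lemma hyperbola_degrees_from_system:
  assumes "g \<noteq> 0"
    and gen: "generic (at_pars good)"
    and card: "\<And>c d C D. good c d C D \<Longrightarrow> finite (hyperbola_system l c d C D) \<and> card (hyperbola_system l c d C D) = n"
    and upper: "\<And>c d. good c d (cnj c) (cnj d) \<Longrightarrow> card {x. (x, cnj x) \<in> hyperbola_system l c d (cnj c) (cnj d)} \<in> S"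
    and lower: "\<And>m. m \<in> L \<Longrightarrow> \<exists>U. open U \<and> U \<noteq> {} \<and>
      (\<forall>u\<in>U. at_pars good (real_t u) \<longrightarrow> card {x. (x, cnj x) \<in> at_pars (hyperbola_system l) (real_t u)} = m)"
  shows "has_vHDdeg (zero_locus {hyperbola g}) n \<and> L \<subseteq> HDdeg (zero_locus {hyperbola g}) \<and>
    HDdeg (zero_locus {hyperbola g}) \<subseteq> S"
proof (rule degrees_from_system[OF _ _ _ _ _ gen card upper lower])
  interpret smooth_plane_curve "zero_locus {hyperbola g}" "hyperbola g" by (rule hyperbola[OF assms(1)])
  show "irreducible_variety (zero_locus {hyperbola g})" by (rule irreducible)
  show "zero_locus (hermitian_critical_ideal_at (zero_locus {hyperbola g}) t) =
      (\<lambda>(x, w). joint_pt ((x, 1 / x), (w, 1 / w))) ` at_pars (hyperbola_system l) t" for t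
    using hyperbola_zeros[OF assms(1)] by (simp add: at_pars_def)
  show "inj (\<lambda>(x, w). joint_pt ((x, 1 / x), (w, 1 / w)))"
    by (rule injI) (auto dest: injD[OF inj_joint_pt])
  show "hermitian_critical_points (zero_locus {hyperbola g}) u =
      (\<lambda>x. pt x (1 / x)) ` {x. (x, cnj x) \<in> at_pars (hyperbola_system l) (real_t u)}" for u
    using hyperbola_points[OF assms(1) refl] by (simp add: at_pars_def)
  show "inj (\<lambda>x. pt x (1 / x))" by (rule injI) (simp add: pt_inject)
qed

end

subsection \<open>The case of an orthogonal frame\<close>

text \<open>This is \<open>(r\<^sup>2 - 1)\<^sup>2 (c r + D) (C r + d) - r (c C r\<^sup>2 - d D)\<^sup>2\<close>.\<close>

definition circle_poly :: "complex \<Rightarrow> complex \<Rightarrow> complex \<Rightarrow> complex \<Rightarrow> complex poly" where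
  "circle_poly c d C D = [:d * D, (c * d + C * D) - (d * D) * (d * D), c * C - 2 * (d * D),
    2 * ((c * C) * (d * D)) - 2 * (c * d + C * D), d * D - 2 * (c * C),
    (c * d + C * D) - (c * C) * (c * C), c * C:]"

lemma poly_circle_poly:
  "poly (circle_poly c d C D) r =
    (r\<^sup>2 - 1)\<^sup>2 * ((c * r + D) * (C * r + d)) - r * (c * C * r\<^sup>2 - d * D)\<^sup>2"
  by (simp add: circle_poly_def power2_eq_square algebra_simps)

lemma degree_circle_poly: "degree (circle_poly c d C D) \<le> 6"
  by (rule degree_le) (auto simp: circle_poly_def coeff_pCons split: nat.split)

lemma coeff_circle_poly:
  "coeff (circle_poly c d C D) 0 = d * D" "coeff (circle_poly c d C D) 1 = (c * d + C * D) - (d * D) * (d * D)"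
  "coeff (circle_poly c d C D) 2 = c * C - 2 * (d * D)"
  "coeff (circle_poly c d C D) 3 = 2 * ((c * C) * (d * D)) - 2 * (c * d + C * D)"
  "coeff (circle_poly c d C D) 4 = d * D - 2 * (c * C)"
  "coeff (circle_poly c d C D) 5 = (c * d + C * D) - (c * C) * (c * C)"
  "coeff (circle_poly c d C D) 6 = c * C"
  by (simp_all add: circle_poly_def numeral_eq_Suc)

definition prod_var :: "complex \<times> complex \<Rightarrow> complex" where
  "prod_var = (\<lambda>(x, w). x * w)"

text \<open>For \<open>l = 0\<close> the quadratic right-hand side of the second equation
  disappears. With \<open>r = x w\<close> fixed both equations are then linear in \<open>x\<close>
  and \<open>w\<close>, with determinant proportional to \<open>c C r^2 - d D\<close>, and the
  product of the two solutions gives the eliminant.\<close>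

lemma circle_system_solved:
  assumes "(x, w) \<in> hyperbola_system 0 c d C D"
  defines "r \<equiv> x * w"
  shows "x * (c * C * r\<^sup>2 - d * D) = (C * r + d) * (r\<^sup>2 - 1)"
    "w * (c * C * r\<^sup>2 - d * D) = (c * r + D) * (r\<^sup>2 - 1)"
    "poly (circle_poly c d C D) r = 0"
proof -
  have 1: "(c * r - D) * x + (C * r - d) * w = 2 * (r\<^sup>2 - 1)" and 2: "(c * r + D) * x = (C * r + d) * w"
    using assms(1) unfolding hyperbola_system_def r_def by simp_all
  show x: "x * (c * C * r\<^sup>2 - d * D) = (C * r + d) * (r\<^sup>2 - 1)" using 1 2 by algebra
  show w: "w * (c * C * r\<^sup>2 - d * D) = (c * r + D) * (r\<^sup>2 - 1)" using 1 2 by algebra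
  have "poly (circle_poly c d C D) r = ((C * r + d) * (r\<^sup>2 - 1)) * ((c * r + D) * (r\<^sup>2 - 1)) -
      (x * w) * (c * C * r\<^sup>2 - d * D)\<^sup>2"
    unfolding poly_circle_poly by (simp add: r_def power2_eq_square algebra_simps)
  then show "poly (circle_poly c d C D) r = 0"
    unfolding x[symmetric] w[symmetric] by (simp add: power2_eq_square)
qed

text \<open>The factor \<open>[:0, 1:]\<close> keeps \<open>r\<close>, hence \<open>x\<close> and
  \<open>w\<close>, different from 0 as the system demands; the other factor is the
  determinant.\<close>

lemma circle_system_roots:
  assumes "no_common_root (circle_poly c d C D) ([:0, 1:] * [:- d * D, 0, c * C:])"
  shows "inj_on prod_var (hyperbola_system 0 c d C D)"
    and "prod_var ` hyperbola_system 0 c d C D = {r. poly (circle_poly c d C D) r = 0}"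
proof -
  have nz: "r \<noteq> 0 \<and> c * C * r\<^sup>2 - d * D \<noteq> 0" if "poly (circle_poly c d C D) r = 0" for r
  proof -
    have "poly ([:0, 1:] * [:- d * D, 0, c * C:]) r \<noteq> 0"
      using assms that unfolding no_common_root_def by blast
    then show ?thesis by (auto simp: power2_eq_square algebra_simps)
  qed
  show "inj_on prod_var (hyperbola_system 0 c d C D)"
  proof (rule inj_onI)
    fix s s' assume s: "s \<in> hyperbola_system 0 c d C D" "s' \<in> hyperbola_system 0 c d C D" "prod_var s = prod_var s'"
    obtain x w x' w' where xw: "s = (x, w)" "s' = (x', w')" by force
    have r: "x * w = x' * w'" using s(3) by (simp add: prod_var_def xw)
    show "s = s'"
      using circle_system_solved[of x w c d C D] circle_system_solved[of x' w' c d C D] s(1,2) nz r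
      unfolding xw by (metis mult_cancel_right)
  qed
  show "prod_var ` hyperbola_system 0 c d C D = {r. poly (circle_poly c d C D) r = 0}"
  proof (intro equalityI subsetI)
    fix r assume "r \<in> {r. poly (circle_poly c d C D) r = 0}"
    then have r: "poly (circle_poly c d C D) r = 0" by simp
    define H where "H = c * C * r\<^sup>2 - d * D"
    have H: "H \<noteq> 0" and r0: "r \<noteq> 0" using nz[OF r] by (simp_all add: H_def)
    define x where "x = (C * r + d) * (r\<^sup>2 - 1) / H"
    define w where "w = (c * r + D) * (r\<^sup>2 - 1) / H"
    have x: "x * H = (C * r + d) * (r\<^sup>2 - 1)" and w: "w * H = (c * r + D) * (r\<^sup>2 - 1)"
      using H by (simp_all add: x_def w_def)
    have "H\<^sup>2 * (x * w - r) = 0"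
      using r x w unfolding poly_circle_poly H_def[symmetric] by algebra
    then have xw: "r = x * w" using H by simp
    have "H * ((c * r - D) * x + (C * r - d) * w - 2 * (r\<^sup>2 - 1)) = 0" "H * ((c * r + D) * x - (C * r + d) * w) = 0"
      using x w unfolding H_def by algebra+
    then have "(c * r - D) * x + (C * r - d) * w - 2 * (r\<^sup>2 - 1) = 0" "(c * r + D) * x - (C * r + d) * w = 0"
      using H by simp_all
    then have "(x, w) \<in> hyperbola_system 0 c d C D"
      using r0 unfolding hyperbola_system_def xw by simp
    then show "r \<in> prod_var ` hyperbola_system 0 c d C D"
      by (rule rev_image_eqI) (simp add: prod_var_def xw)
  qed (use circle_system_solved(3) in \<open>auto simp: prod_var_def\<close>)
qed

definition circle_good :: "complex \<Rightarrow> complex \<Rightarrow> complex \<Rightarrow> complex \<Rightarrow> bool" where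
  "circle_good c d C D \<longleftrightarrow> degree (circle_poly c d C D) = 6 \<and>
     no_common_root (circle_poly c d C D) (pderiv (circle_poly c d C D)) \<and>
     no_common_root (circle_poly c d C D) ([:0, 1:] * [:- d * D, 0, c * C:])"

lemma circle_system_card:
  assumes "circle_good c d C D"
  shows "finite (hyperbola_system 0 c d C D) \<and> card (hyperbola_system 0 c d C D) = 6"
proof -
  have "no_common_root (circle_poly c d C D) ([:0, 1:] * [:- d * D, 0, c * C:])"
    using assms by (simp add: circle_good_def)
  note roots = circle_system_roots[OF this]
  have "card {r. poly (circle_poly c d C D) r = 0} = 6"
    by (rule card_roots_no_common_root_pderiv) (use assms in \<open>auto simp: circle_good_def\<close>)
  then have "card (prod_var ` hyperbola_system 0 c d C D) = 6" by (simp add: roots(2))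
  then have "card (hyperbola_system 0 c d C D) = 6" by (simp add: card_image[OF roots(1)])
  then show ?thesis by (metis card.infinite zero_neq_numeral)
qed

lemma prod_var_real: "prod_var (x, cnj x) = of_real ((cmod x)\<^sup>2)"
  by (simp only: prod_var_def case_prod_conv complex_norm_square)

text \<open>For a real solution \<open>x w = |x|^2 > 0\<close>, so all real roots of
  \<open>N\<close> are positive and Descartes' rule for positive roots counts all of them.\<close>

locale hyperbola_roots = conj_system "hyperbola_system l c d (cnj c) (cnj d)" prod_var N
  for l c d :: complex and N :: "complex poly" +
  assumes real: "real_coeffs N"
begin

lemma real_root_pos:
  assumes "poly N (of_real r) = 0"
  shows "r > 0"
proof -
  obtain x where x: "(x, cnj x) \<in> hyperbola_system l c d (cnj c) (cnj d)" "prod_var (x, cnj x) = of_real r"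
    using real_root_sol[OF assms] by metis
  then have "r = (cmod x)\<^sup>2" unfolding prod_var_real by (simp only: of_real_eq_iff)
  moreover have "x \<noteq> 0" using x(1) by (simp add: hyperbola_system_def)
  ultimately show ?thesis by simp
qed

lemma card_pos_roots:
  "card {x. (x, cnj x) \<in> hyperbola_system l c d (cnj c) (cnj d)} = card {r. r > 0 \<and> poly (re_poly N) r = 0}"
proof -
  have "{r. poly (re_poly N) r = 0} = {r. r > 0 \<and> poly (re_poly N) r = 0}"
    using real_root_pos by (auto simp: poly_re_poly[OF real])
  then show ?thesis
    using card_real_sols unfolding real_sols_def card_real_roots_re_poly[OF real] by simp
qed

lemma card_pos:
  assumes "{x. (x, cnj x) \<in> hyperbola_system l c d (cnj c) (cnj d)} \<noteq> {}"
  shows "card {x. (x, cnj x) \<in> hyperbola_system l c d (cnj c) (cnj d)} > 0"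
  using assms finite_real_sols unfolding real_sols_def by (simp add: card_gt_0_iff)

end

lemma circle_real_coeffs: "real_coeffs (circle_poly c d (cnj c) (cnj d))"
  unfolding real_coeffs_def poly_circle_poly by (simp add: algebra_simps)

context
  fixes c d :: complex
  assumes good: "circle_good c d (cnj c) (cnj d)"
begin

interpretation hyperbola_roots 0 c d "circle_poly c d (cnj c) (cnj d)"
proof
  show "finite (hyperbola_system 0 c d (cnj c) (cnj d))" using circle_system_card[OF good] by blast
  show "inj_on prod_var (hyperbola_system 0 c d (cnj c) (cnj d))"
    "prod_var ` hyperbola_system 0 c d (cnj c) (cnj d) = {z. poly (circle_poly c d (cnj c) (cnj d)) z = 0}"
    using circle_system_roots good by (auto simp: circle_good_def)
qed (use hyperbola_system_swap[of _ _ 0] circle_real_coeffs in \<open>auto simp: prod_var_def\<close>)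

lemmas circle_card_real = card_pos_roots and circle_card_pos = card_pos

lemma circle_card_even: "even (card {x. (x, cnj x) \<in> hyperbola_system 0 c d (cnj c) (cnj d)})"
  using even_card_real_sols circle_system_card[OF good] unfolding real_sols_def by simp

text \<open>Six positive roots would force the coefficients to alternate in sign, but those of
  \<open>r\<^sup>2\<close> and \<open>r\<^sup>4\<close> cannot both be positive.\<close>

lemma circle_card_le_4: "card {x. (x, cnj x) \<in> hyperbola_system 0 c d (cnj c) (cnj d)} \<le> 4"
proof (rule ccontr)
  assume *: "\<not> ?thesis"
  let ?N = "re_poly (circle_poly c d (cnj c) (cnj d))"
  let ?R = "{r. r > 0 \<and> poly ?N r = 0}"
  have deg: "degree ?N = 6"
    using good by (simp add: degree_re_poly[OF circle_real_coeffs] circle_good_def)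
  then have nz: "?N \<noteq> 0" by auto
  have fin: "finite ?R" by (rule finite_subset[OF _ poly_roots_finite[OF nz]]) auto
  have "card ?R \<le> card {r. poly ?N r = 0}" by (rule card_mono[OF poly_roots_finite[OF nz]]) auto
  also have "\<dots> \<le> 6" using card_poly_roots_bound[OF nz] deg by simp
  finally have "card ?R \<le> 6" .
  moreover have "card ?R \<noteq> 5" using circle_card_even unfolding circle_card_real by auto
  ultimately have card: "card ?R = 6" using * unfolding circle_card_real by linarith
  let ?P = "\<Prod>r\<in>?R. [:- r, 1:]"
  have N: "?N = smult (lead_coeff ?N) ?P"
    by (rule poly_eq_prod_roots) (use fin card deg in auto)
  have lead: "lead_coeff ?N = (cmod c)\<^sup>2"
    using deg by (simp add: coeff_circle_poly flip: complex_norm_square)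
  moreover have "lead_coeff ?N \<noteq> 0" by (metis leading_coeff_0_iff nz)
  ultimately have "lead_coeff ?N > 0" by (metis order_le_less zero_le_power2)
  moreover have "(- 1) ^ (card ?R + 2) * coeff ?P 2 > 0" "(- 1) ^ (card ?R + 4) * coeff ?P 4 > 0"
    using card by (intro coeff_prod_positive_roots fin; auto)+
  then have "coeff ?P 2 > 0" "coeff ?P 4 > 0" unfolding card by simp_all
  moreover have "coeff ?N 2 = lead_coeff ?N * coeff ?P 2" "coeff ?N 4 = lead_coeff ?N * coeff ?P 4"
    by (subst (1) N, simp only: coeff_smult)+
  ultimately have "coeff ?N 2 > 0" "coeff ?N 4 > 0" by simp_all
  then have "(cmod c)\<^sup>2 - 2 * (cmod d)\<^sup>2 > 0" "(cmod d)\<^sup>2 - 2 * (cmod c)\<^sup>2 > 0"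
    by (simp_all add: coeff_circle_poly flip: complex_norm_square)
  then show False using zero_le_power2[of "cmod c"] zero_le_power2[of "cmod d"] by linarith
qed

end

context metric_frame
begin

lemma polyfun_poly_circle: "polyfun_poly (at_pars circle_poly)"
  unfolding at_pars_def circle_poly_def
  by (intro polyfun_poly_intros polyfun_intros polyfun_pars)

lemma generic_circle_good: "generic (at_pars circle_good)"
proof -
  \<comment> \<open>Taking \<open>D = - d\<close> cancels \<open>c d + C D\<close>; the same sample
    serves both conditions.\<close>
  have N: "circle_poly 1 1 1 (- 1) = [:- 1, - 1, 3, - 2, - 3, - 1, 1:]"
    by (simp add: circle_poly_def)
  have 1: "no_common_root (circle_poly 1 1 1 (- 1)) (pderiv (circle_poly 1 1 1 (- 1)))"
    unfolding no_common_root_def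
  proof (intro allI impI notI)
    fix r :: complex
    assume "poly (circle_poly 1 1 1 (- 1)) r = 0" "poly (pderiv (circle_poly 1 1 1 (- 1))) r = 0"
    then have "r ^ 6 - r ^ 5 - 3 * r ^ 4 - 2 * r ^ 3 + 3 * r ^ 2 - r - 1 = 0"
      "6 * r ^ 5 - 5 * r ^ 4 - 12 * r ^ 3 - 6 * r ^ 2 + 6 * r - 1 = 0"
      by (simp_all add: N pderiv_pCons algebra_simps power_numeral_reduce)
    then show False by algebra
  qed
  have 2: "no_common_root (circle_poly 1 1 1 (- 1)) ([:0, 1:] * [:- 1 * (- 1), 0, 1 * 1:])"
    unfolding no_common_root_def
  proof (intro allI impI notI)
    fix r :: complex
    assume "poly (circle_poly 1 1 1 (- 1)) r = 0" "poly ([:0, 1:] * [:- 1 * (- 1), 0, 1 * 1:]) r = 0"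
    then have "r ^ 6 - r ^ 5 - 3 * r ^ 4 - 2 * r ^ 3 + 3 * r ^ 2 - r - 1 = 0" "r * (r ^ 2 + 1) = 0"
      by (simp_all add: N algebra_simps power_numeral_reduce)
    then show False by algebra
  qed
  have g1: "generic (at_pars (\<lambda>c d C D. degree (circle_poly c d C D) = 6 \<and>
      no_common_root (circle_poly c d C D) (pderiv (circle_poly c d C D))))"
  proof (rule generic_pars[of circle_poly 6 1 1 1 "- 1" "\<lambda>c d C D. pderiv (circle_poly c d C D)" 5, OF polyfun_poly_circle _ _ _ _ 1])
    show "polyfun_poly (at_pars (\<lambda>c d C D. pderiv (circle_poly c d C D)))"
      using polyfun_poly_pderiv[OF polyfun_poly_circle] by (simp add: at_pars_def)
    show "degree (pderiv (circle_poly c d C D)) \<le> 5" for c d C D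
      using degree_circle_poly[of c d C D] by (simp add: degree_pderiv)
  qed (simp_all add: degree_circle_poly coeff_circle_poly)
  have g2: "generic (at_pars (\<lambda>c d C D. degree (circle_poly c d C D) = 6 \<and>
      no_common_root (circle_poly c d C D) ([:0, 1:] * [:- d * D, 0, c * C:])))"
  proof (rule generic_pars[of circle_poly 6 1 1 1 "- 1" "\<lambda>c d C D. [:0, 1:] * [:- d * D, 0, c * C:]" 3, OF polyfun_poly_circle _ _ _ _ 2])
    show "polyfun_poly (at_pars (\<lambda>c d C D. [:0, 1:] * [:- d * D, 0, c * C:]))"
      unfolding at_pars_def by (intro polyfun_poly_intros polyfun_intros polyfun_pars)
  qed (simp_all add: degree_circle_poly coeff_circle_poly)
  show ?thesis
    by (rule generic_mono[OF generic_conj[OF g1 g2]]) (simp add: at_pars_def circle_good_def)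
qed

text \<open>The coefficient signs +, +, +, -, -, -, + change twice, so at most two critical points
  exist. The nearest point excludes 0 and parity excludes 1.\<close>

lemma circle_open_2:
  assumes "l = 0"
  shows "\<exists>U. open U \<and> U \<noteq> {} \<and> (\<forall>u\<in>U. at_pars circle_good (real_t u) \<longrightarrow>
    card {x. (x, cnj x) \<in> at_pars (hyperbola_system l) (real_t u)} = 2)"
proof -
  define \<sigma> :: "nat \<Rightarrow> real" where "\<sigma> = nth [1, 1, 1, - 1, - 1, - 1, 1]"
  have le6: "i \<le> 6 \<longleftrightarrow> i = 0 \<or> i = 1 \<or> i = 2 \<or> i = 3 \<or> i = 4 \<or> i = 5 \<or> i = 6" for i :: nat by auto
  let ?U = "{u. \<forall>k\<le>6. \<sigma> k * Re (coeff (at_pars circle_poly (real_t u)) k) > 0}"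
  have "open ?U" by (rule open_coeff_signs[OF polyfun_poly_circle])
  moreover have "?U \<noteq> {}"
  proof -
    \<comment> \<open>Modulus 1/2 and argument pi/3, so that \<open>d * cnj d\<close> and
      \<open>d + cnj d\<close> are rational.\<close>
    let ?d = "Complex (1 / 4) (sqrt 3 / 4)"
    obtain u where u: "at_pars circle_poly (real_t u) = circle_poly 1 ?d (cnj 1) (cnj ?d)"
      using real_t_surj[of 1 ?d] by blast
    have d: "?d * cnj ?d = 1 / 4" "?d + cnj ?d = 1 / 2"
      by (simp_all add: complex_eq_iff power2_eq_square)
    have "circle_poly 1 ?d (cnj 1) (cnj ?d) = [:1 / 4, 7 / 16, 1 / 2, - 1 / 2, - 7 / 4, - 1 / 2, 1:]"
      unfolding circle_poly_def complex_cnj_one mult_1 d by simp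
    then have "u \<in> ?U" by (auto simp: u \<sigma>_def le6) (simp_all add: numeral_eq_Suc)
    then show ?thesis by blast
  qed
  moreover have "card {x. (x, cnj x) \<in> at_pars (hyperbola_system l) (real_t u)} = 2"
    if u: "u \<in> ?U" and good: "at_pars circle_good (real_t u)" for u
  proof -
    define c d where "c = c_par (real_t u)" and "d = d_par (real_t u)"
    have good: "circle_good c d (cnj c) (cnj d)" using good by (simp add: at_pars_real c_def d_def)
    let ?N = "re_poly (circle_poly c d (cnj c) (cnj d))"
    have coeffs: "\<sigma> k * coeff ?N k > 0" if "k \<le> 6" for k
      using u that by (simp add: at_pars_real c_def d_def)
    have high: "coeff ?N k = 0" if "k > 6" for k
      using that degree_circle_poly[of c d "cnj c" "cnj d"] by (simp add: coeff_eq_0)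
    have nz: "?N \<noteq> 0" using coeffs[of 0] by (metis coeff_0 le0 less_irrefl mult_zero_right)
    have "1 * (sign_pattern [3, 6] k * coeff ?N k) \<ge> 0" for k
    proof (cases "k \<le> 6")
      case True
      then have "k = 0 \<or> k = 1 \<or> k = 2 \<or> k = 3 \<or> k = 4 \<or> k = 5 \<or> k = 6" unfolding le6 .
      then show ?thesis
        using coeffs[OF True] by (elim disjE) (simp_all add: \<sigma>_def sign_pattern_def)
    qed (simp add: high del: coeff_re_poly)
    then have "card {r. r > 0 \<and> poly ?N r = 0} \<le> length [3, 6::nat]"
      by (intro descartes_rule[OF nz, of 1]) auto
    then have "card {x. (x, cnj x) \<in> hyperbola_system 0 c d (cnj c) (cnj d)} \<le> 2"
      by (simp add: circle_card_real[OF good])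
    moreover have "card {x. (x, cnj x) \<in> hyperbola_system 0 c d (cnj c) (cnj d)} > 0"
      by (rule circle_card_pos[OF good]) (use hyperbola_real_nonempty[of c d] assms in simp)
    moreover have "even (card {x. (x, cnj x) \<in> hyperbola_system 0 c d (cnj c) (cnj d)})"
      by (rule circle_card_even[OF good])
    moreover have "n = 2" if "n \<le> 2" "n > 0" "even n" for n :: nat
      using that by (cases "n = 1") auto
    ultimately show ?thesis using assms by (simp add: at_pars_real c_def d_def)
  qed
  ultimately show ?thesis by blast
qed

lemma circle_open_4:
  assumes "l = 0"
  shows "\<exists>U. open U \<and> U \<noteq> {} \<and> (\<forall>u\<in>U. at_pars circle_good (real_t u) \<longrightarrow>
    card {x. (x, cnj x) \<in> at_pars (hyperbola_system l) (real_t u)} = 4)"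
proof -
  define s :: "nat \<Rightarrow> real" where "s = nth [0, 1 / 2, 21 / 20, 2, 8]"
  define \<sigma> :: "nat \<Rightarrow> real" where "\<sigma> i = (- 1) ^ i" for i
  let ?U = "{u. \<forall>i\<le>4. \<sigma> i * Re (poly (at_pars circle_poly (real_t u)) (s i)) > 0}"
  have le4: "i \<le> 4 \<longleftrightarrow> i = 0 \<or> i = 1 \<or> i = 2 \<or> i = 3 \<or> i = 4" for i :: nat by auto
  have "open ?U"
    by (rule open_value_signs[OF polyfun_poly_circle, of 6]) (simp add: at_pars_def degree_circle_poly)
  moreover have "?U \<noteq> {}"
  proof -
    \<comment> \<open>At \<open>c = d = 3\<close> the eliminant is
      \<open>9 (r^2 - 1)^2 (r^2 - 7 r + 1)\<close>, with a double root 1 between two simple positive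
      roots. Raising \<open>d\<close> to 31/10 splits the double root and makes the values at the
      points \<open>s\<close> alternate.\<close>
    obtain u where "at_pars circle_poly (real_t u) = circle_poly 3 (31 / 10) (cnj 3) (cnj (31 / 10))"
      using real_t_surj[of 3 "31 / 10"] by blast
    then have "u \<in> ?U"
      by (auto simp: poly_circle_poly \<sigma>_def s_def le4 power2_eq_square)
    then show ?thesis by blast
  qed
  moreover have "card {x. (x, cnj x) \<in> at_pars (hyperbola_system l) (real_t u)} = 4"
    if u: "u \<in> ?U" and good: "at_pars circle_good (real_t u)" for u
  proof -
    define c d where "c = c_par (real_t u)" and "d = d_par (real_t u)"
    have good: "circle_good c d (cnj c) (cnj d)" using good by (simp add: at_pars_real c_def d_def)
    let ?N = "re_poly (circle_poly c d (cnj c) (cnj d))"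
    have signs: "\<sigma> i * poly ?N (s i) > 0" if "i \<le> 4" for i
      using u that by (simp add: at_pars_real c_def d_def poly_re_poly[OF circle_real_coeffs])
    have nz: "?N \<noteq> 0" using signs[of 0] by auto
    have "4 \<le> card {r. r > s 0 \<and> poly ?N r = 0}"
    proof (rule card_roots_ge_sign_changes[OF nz])
      fix i :: nat assume i: "i < 4"
      then show "s i < s (Suc i)" by (auto simp: s_def less_Suc_eq numeral_eq_Suc)
      have "0 < (\<sigma> i * poly ?N (s i)) * (\<sigma> (Suc i) * poly ?N (s (Suc i)))"
        using i by (intro mult_pos_pos signs) auto
      then show "poly ?N (s i) * poly ?N (s (Suc i)) < 0"
        by (simp add: \<sigma>_def algebra_simps flip: power_add power2_eq_square)
    qed
    then have "4 \<le> card {x. (x, cnj x) \<in> hyperbola_system 0 c d (cnj c) (cnj d)}"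
      by (simp add: circle_card_real[OF good] s_def)
    with circle_card_le_4[OF good] have "card {x. (x, cnj x) \<in> hyperbola_system 0 c d (cnj c) (cnj d)} = 4"
      by simp
    then show ?thesis using assms by (simp add: at_pars_real c_def d_def)
  qed
  ultimately show ?thesis by blast
qed

theorem circle_degrees:
  assumes "g \<noteq> 0" "l = 0"
  shows "has_vHDdeg (zero_locus {hyperbola g}) 6 \<and> HDdeg (zero_locus {hyperbola g}) = {2, 4}"
proof -
  have "has_vHDdeg (zero_locus {hyperbola g}) 6 \<and> {2, 4} \<subseteq> HDdeg (zero_locus {hyperbola g}) \<and>
      HDdeg (zero_locus {hyperbola g}) \<subseteq> {2, 4}"
  proof (rule hyperbola_degrees_from_system[OF assms(1) generic_circle_good])
    show "finite (hyperbola_system l c d C D) \<and> card (hyperbola_system l c d C D) = 6"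
      if "circle_good c d C D" for c d C D
      using circle_system_card[OF that] assms(2) by simp
    show "card {x. (x, cnj x) \<in> hyperbola_system l c d (cnj c) (cnj d)} \<in> {2, 4}"
      if "circle_good c d (cnj c) (cnj d)" for c d
    proof -
      have "n \<in> {2, 4}" if "n \<le> 4" "n > 0" "even n" for n :: nat
        using that by (cases "n = 1 \<or> n = 3") auto
      then show ?thesis
        using circle_card_le_4[OF that] circle_card_pos[OF that] circle_card_even[OF that]
          hyperbola_real_nonempty[of c d] assms(2) by simp
    qed
  qed (use circle_open_2[OF assms(2)] circle_open_4[OF assms(2)] in blast)
  then show ?thesis by blast
qed

end

subsection \<open>The case of a skew frame\<close>

text \<open>For \<open>r = x w\<close> the system reads \<open>a x + q w = b\<close> and
  \<open>a' x - q' w = 2 l (x^2 - w^2)\<close> with \<open>a = c r - D\<close>,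
  \<open>q = C r - d\<close>, \<open>a' = c r + D\<close>, \<open>q' = C r + d\<close> and
  \<open>b = 2 (r^2 - 1)\<close>. Here \<open>skew_a\<close> and \<open>skew_q\<close> are
  \<open>a\<close> and \<open>q\<close>, \<open>skew_h\<close> is half of
  \<open>q a' + a q'\<close>, and \<open>skew_m\<close> yields \<open>m1 = 2 l b - a a'\<close> and
  \<open>m2 = 2 l b - q q'\<close>.\<close>

definition skew_a :: "complex \<Rightarrow> complex \<Rightarrow> complex poly" where "skew_a c D = [:- D, c:]"
definition skew_q :: "complex \<Rightarrow> complex \<Rightarrow> complex poly" where "skew_q C d = [:- d, C:]"
definition skew_h :: "complex \<Rightarrow> complex \<Rightarrow> complex \<Rightarrow> complex \<Rightarrow> complex poly" where
  "skew_h c d C D = [:- (d * D), 0, c * C:]"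
definition skew_m :: "complex \<Rightarrow> complex \<Rightarrow> complex \<Rightarrow> complex poly" where
  "skew_m l c D = [:- (4 * l - D * D), 0, 4 * l - c * c:]"

text \<open>The polynomial satisfied by \<open>x w\<close>. Eliminating \<open>x\<close> and \<open>w\<close> from the two equations of the system by
  Cramer's rule gives this polynomial times \<open>4 (c r - D) (C r - d)\<close>.\<close>

definition skew_poly :: "complex \<Rightarrow> complex \<Rightarrow> complex \<Rightarrow> complex \<Rightarrow> complex \<Rightarrow> complex poly" where
  "skew_poly l c d C D =
     (let A = skew_a c D; Q = skew_q C d; H = skew_h c d C D; r = [:0, 1:]; B = [:- 1, 0, 1:]
      in B ^ 2 * skew_m l c D * skew_m l C d
        - [:2 * l * (C * D - c * d):] * B * r ^ 2 * (Q ^ 2 - A ^ 2)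
        - [:l * l:] * r ^ 2 * (Q ^ 2 - A ^ 2) ^ 2
        - [:16 * l * l:] * r * B ^ 2 * A * Q
        + [:4 * l:] * r * B * (Q ^ 2 + A ^ 2) * H
        - r * A * Q * H ^ 2)"

lemma poly_skew_poly:
  "poly (skew_poly l c d C D) r =
    (r\<^sup>2 - 1)\<^sup>2 * ((4 * l - c * c) * r\<^sup>2 - (4 * l - D * D)) * ((4 * l - C * C) * r\<^sup>2 - (4 * l - d * d))
    - 2 * l * (C * D - c * d) * (r\<^sup>2 - 1) * r\<^sup>2 * ((C * r - d)\<^sup>2 - (c * r - D)\<^sup>2)
    - l * l * r\<^sup>2 * ((C * r - d)\<^sup>2 - (c * r - D)\<^sup>2)\<^sup>2
    - 16 * l * l * r * (r\<^sup>2 - 1)\<^sup>2 * (c * r - D) * (C * r - d)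
    + 4 * l * r * (r\<^sup>2 - 1) * ((C * r - d)\<^sup>2 + (c * r - D)\<^sup>2) * (c * C * r\<^sup>2 - d * D)
    - r * (c * r - D) * (C * r - d) * (c * C * r\<^sup>2 - d * D)\<^sup>2"
proof -
  have "poly (skew_a c D) r = c * r - D" "poly (skew_q C d) r = C * r - d"
    "poly (skew_h c d C D) r = c * C * r\<^sup>2 - d * D"
    "poly (skew_m l c D) r = (4 * l - c * c) * r\<^sup>2 - (4 * l - D * D)"
    "poly (skew_m l C d) r = (4 * l - C * C) * r\<^sup>2 - (4 * l - d * d)"
    "poly [:- 1, 0, 1:] r = r\<^sup>2 - 1"
    by (simp_all add: skew_a_def skew_q_def skew_h_def skew_m_def power2_eq_square algebra_simps)
  then show ?thesis
    by (simp only: skew_poly_def Let_def poly_add poly_diff poly_mult poly_power) simp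
qed

lemma degree_mult_le_add: "degree p \<le> m \<Longrightarrow> degree q \<le> n \<Longrightarrow> degree (p * q) \<le> m + n"
  using degree_mult_le[of p q] by linarith

lemma degree_skew_poly: "degree (skew_poly l c d C D) \<le> 8"
proof -
  have base: "degree (skew_a c D) \<le> 1" "degree (skew_q C d) \<le> 1" "degree (skew_h c d C D) \<le> 2"
    "degree (skew_m l c D) \<le> 2" "degree (skew_m l C d) \<le> 2" "degree [:0, 1 :: complex:] \<le> 1"
    "degree [:- 1, 0, 1 :: complex:] \<le> 2" "\<And>a :: complex. degree [:a:] \<le> 0"
    by (auto simp: skew_a_def skew_q_def skew_h_def skew_m_def)
  note m = degree_mult_le_add
  have Q: "degree (skew_q C d ^ 2 - skew_a c D ^ 2) \<le> 2" "degree (skew_q C d ^ 2 + skew_a c D ^ 2) \<le> 2"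
    unfolding power2_eq_square
    using m[OF base(1) base(1)] m[OF base(2) base(2)] by (auto intro!: degree_diff_le degree_add_le)
  have r2: "degree ([:0, 1 :: complex:] ^ 2) \<le> 2" and B2: "degree ([:- 1, 0, 1 :: complex:] ^ 2) \<le> 4"
    and H2: "degree (skew_h c d C D ^ 2) \<le> 4" and Q2: "degree ((skew_q C d ^ 2 - skew_a c D ^ 2) ^ 2) \<le> 4"
    using m[OF base(6,6)] m[OF base(7,7)] m[OF base(3,3)] m[OF Q(1) Q(1)] by (simp_all only: power2_eq_square)
  show ?thesis
    unfolding skew_poly_def Let_def
    by (intro degree_diff_le degree_add_le;
      rule order.trans[OF m[OF m[OF B2 base(4)] base(5)]]
        order.trans[OF m[OF m[OF m[OF base(8) base(7)] r2] Q(1)]]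
        order.trans[OF m[OF m[OF base(8) r2] Q2]]
        order.trans[OF m[OF m[OF m[OF m[OF base(8) base(6)] B2] base(1)] base(2)]]
        order.trans[OF m[OF m[OF m[OF m[OF base(8) base(6)] base(7)] Q(2)] base(3)]]
        order.trans[OF m[OF m[OF m[OF base(6) base(1)] base(2)] H2]], simp)
qed

text \<open>At either end the two outer coefficients have the quotient \<open>- c C\<close> or
  \<open>- d D\<close>; these are the traces in \<open>skew_traces\<close>.\<close>

lemma coeff_skew_poly:
  "coeff (skew_poly l c d C D) 8 = (4 * l - c * c) * (4 * l - C * C)"
  "coeff (skew_poly l c d C D) 7 = - (c * C) * ((4 * l - c * c) * (4 * l - C * C))"
  "coeff (skew_poly l c d C D) 0 = (4 * l - d * d) * (4 * l - D * D)"
  "coeff (skew_poly l c d C D) 1 = - (d * D) * ((4 * l - d * d) * (4 * l - D * D))"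
  by (simp_all add: skew_poly_def skew_a_def skew_q_def skew_h_def skew_m_def Let_def power2_eq_square
      numeral_eq_Suc) (simp_all add: algebra_simps)

text \<open>The two equations of the system are linear in \<open>x\<close> and \<open>w\<close> once \<open>x\<^sup>2\<close> and \<open>w\<^sup>2\<close> are eliminated with the first.\<close>

lemma skew_elimination:
  fixes a q a' q' l x w :: complex
  defines "b \<equiv> a * x + q * w" and "r \<equiv> x * w"
  defines "m1 \<equiv> 2 * l * b - a * a'" and "m2 \<equiv> 2 * l * b - q * q'"
  defines "\<Delta> \<equiv> a' * x - q' * w - 2 * l * (x\<^sup>2 - w\<^sup>2)"
  shows "(q * q * m1 + a * a * m2) * x = q * (2 * l * r * (q * q - a * a)) + a * m2 * b - a * q * q * \<Delta>"
    and "(q * q * m1 + a * a * m2) * w = q * m1 * b - a * (2 * l * r * (q * q - a * a)) + a * a * q * \<Delta>"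
    and "b * b * m1 * m2 - 2 * l * r * b * (q * q - a * a) * (q * a' - a * q') - 4 * l * l * r * r * (q * q - a * a)\<^sup>2
      - 16 * l * l * r * b * b * a * q + 4 * l * r * b * (q * q + a * a) * (q * a' + a * q') - r * a * q * (q * a' + a * q')\<^sup>2
      = \<Delta> * ((q * q * m1 + a * a * m2) * (q * w - a * x) - a * a * q * q * \<Delta>)"
  unfolding assms by (simp_all add: power2_eq_square algebra_simps)

text \<open>The determinant of the linear system \<open>a x + q w = b\<close>,
  \<open>q m1 x - a m2 w = 2 l r (q^2 - a^2)\<close>. The second equation arises from that of the
  system by multiplying with \<open>a q\<close> and inserting \<open>a x^2 = b x - q r\<close> and
  \<open>q w^2 = b w - a r\<close>.\<close>

definition skew_det :: "complex \<Rightarrow> complex \<Rightarrow> complex \<Rightarrow> complex \<Rightarrow> complex \<Rightarrow> complex poly" where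
  "skew_det l c d C D = skew_q C d ^ 2 * skew_m l c D + skew_a c D ^ 2 * skew_m l C d"

text \<open>The converse of the elimination: the numerators of Cramer's rule have product
  \<open>r\<close> times the squared determinant, up to \<open>4 a q\<close> times the value of
  \<open>skew_poly\<close>. At a root with nonzero determinant the recovered \<open>x\<close> and
  \<open>w\<close> therefore satisfy \<open>x w = r\<close>.\<close>

lemma skew_back_substitution:
  fixes a q a' q' b l r :: complex
  defines "m1 \<equiv> 2 * l * b - a * a'" and "m2 \<equiv> 2 * l * b - q * q'"
  defines "R \<equiv> 2 * l * r * (q * q - a * a)"
  shows "(q * R + a * m2 * b) * (q * m1 * b - a * R) - r * (q * q * m1 + a * a * m2)\<^sup>2 =
    a * q * (b * b * m1 * m2 - 2 * l * r * b * (q * q - a * a) * (q * a' - a * q') - 4 * l * l * r * r * (q * q - a * a)\<^sup>2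
      - 16 * l * l * r * b * b * a * q + 4 * l * r * b * (q * q + a * a) * (q * a' + a * q') - r * a * q * (q * a' + a * q')\<^sup>2)"
  unfolding assms by (simp add: power2_eq_square algebra_simps)

text \<open>Treating the values of the auxiliary polynomials at \<open>r\<close> as atoms keeps the
  identities of the elimination short.\<close>

locale skew_values =
  fixes l c d C D r a q a' q' b m1 m2 :: complex
  assumes a: "a = c * r - D" and q: "q = C * r - d" and a': "a' = c * r + D" and q': "q' = C * r + d"
    and b: "b = 2 * (r\<^sup>2 - 1)" and m1: "m1 = 2 * l * b - a * a'" and m2: "m2 = 2 * l * b - q * q'"
begin

lemma det: "poly (skew_det l c d C D) r = q * q * m1 + a * a * m2"
  by (simp add: skew_det_def skew_q_def skew_a_def skew_m_def a q a' q' b m1 m2 power2_eq_square algebra_simps)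

lemma aq: "poly (skew_a c D) r = a" "poly (skew_q C d) r = q"
  by (simp_all add: skew_q_def skew_a_def a q algebra_simps)

lemma poly_value:
  "4 * poly (skew_poly l c d C D) r =
    b * b * m1 * m2 - 2 * l * r * b * (q * q - a * a) * (q * a' - a * q') - 4 * l * l * r * r * (q * q - a * a)\<^sup>2
      - 16 * l * l * r * b * b * a * q + 4 * l * r * b * (q * q + a * a) * (q * a' + a * q') - r * a * q * (q * a' + a * q')\<^sup>2"
proof -
  define B K H where "B = r\<^sup>2 - 1" and "K = (C * D - c * d) * r" and "H = c * C * r\<^sup>2 - d * D"
  have e: "q * a' - a * q' = 2 * K" "q * a' + a * q' = 2 * H"
    "(4 * l - c * c) * r\<^sup>2 - (4 * l - D * D) = m1" "(4 * l - C * C) * r\<^sup>2 - (4 * l - d * d) = m2"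
    "b = 2 * B"
    by (simp_all add: a q a' q' b m1 m2 B_def K_def H_def power2_eq_square algebra_simps)
  have "poly (skew_poly l c d C D) r = B\<^sup>2 * m1 * m2 - 2 * l * (C * D - c * d) * B * r\<^sup>2 * (q\<^sup>2 - a\<^sup>2)
    - l * l * r\<^sup>2 * (q\<^sup>2 - a\<^sup>2)\<^sup>2 - 16 * l * l * r * B\<^sup>2 * a * q + 4 * l * r * B * (q\<^sup>2 + a\<^sup>2) * H - r * a * q * H\<^sup>2"
    unfolding poly_skew_poly e(3,4) B_def[symmetric] H_def[symmetric] a[symmetric] q[symmetric] ..
  also have "\<dots> = B\<^sup>2 * m1 * m2 - 2 * l * K * B * r * (q\<^sup>2 - a\<^sup>2)
    - l * l * r\<^sup>2 * (q\<^sup>2 - a\<^sup>2)\<^sup>2 - 16 * l * l * r * B\<^sup>2 * a * q + 4 * l * r * B * (q\<^sup>2 + a\<^sup>2) * H - r * a * q * H\<^sup>2"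
    by (simp add: K_def power2_eq_square)
  finally have P: "poly (skew_poly l c d C D) r = \<dots>" .
  show ?thesis
    unfolding P e(1,2,5) by (simp add: power2_eq_square algebra_simps)
qed

end

lemma skew_valuesI:
  "skew_values l c d C D r (c * r - D) (C * r - d) (c * r + D) (C * r + d) (2 * (r\<^sup>2 - 1))
    (2 * l * (2 * (r\<^sup>2 - 1)) - (c * r - D) * (c * r + D)) (2 * l * (2 * (r\<^sup>2 - 1)) - (C * r - d) * (C * r + d))"
  by unfold_locales simp_all

lemma skew_values_exist: "\<exists>a q a' q' b m1 m2. skew_values l c d C D r a q a' q' b m1 m2"
  using skew_valuesI by blast

lemma skew_system_solved:
  assumes S: "(x, w) \<in> hyperbola_system l c d C D"
    and "skew_values l c d C D (x * w) a q a' q' b m1 m2"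
  shows "poly (skew_det l c d C D) (x * w) * x = q * (2 * l * (x * w) * (q * q - a * a)) + a * m2 * b"
    "poly (skew_det l c d C D) (x * w) * w = q * m1 * b - a * (2 * l * (x * w) * (q * q - a * a))"
    "poly (skew_poly l c d C D) (x * w) = 0"
proof -
  interpret skew_values l c d C D "x * w" a q a' q' b m1 m2 by fact
  have b': "b = a * x + q * w" and \<Delta>: "a' * x - q' * w - 2 * l * (x\<^sup>2 - w\<^sup>2) = 0"
    using S unfolding hyperbola_system_def a q a' q' b by simp_all
  note elim = skew_elimination[where l = l and a = a and x = x and q = q and w = w and a' = a' and q' = q', folded b', folded m1 m2, unfolded \<Delta>]
  show "poly (skew_det l c d C D) (x * w) * x = q * (2 * l * (x * w) * (q * q - a * a)) + a * m2 * b"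
    using elim(1) by (simp add: det)
  show "poly (skew_det l c d C D) (x * w) * w = q * m1 * b - a * (2 * l * (x * w) * (q * q - a * a))"
    using elim(2) by (simp add: det)
  have "4 * poly (skew_poly l c d C D) (x * w) = 0"
    unfolding poly_value using elim(3) by simp
  then show "poly (skew_poly l c d C D) (x * w) = 0" by simp
qed

text \<open>The third condition excludes \<open>r = 0\<close> and a vanishing determinant, the last
  one the factors \<open>a\<close> and \<open>q\<close> introduced by the elimination.\<close>

definition skew_good :: "complex \<Rightarrow> complex \<Rightarrow> complex \<Rightarrow> complex \<Rightarrow> complex \<Rightarrow> bool" where
  "skew_good l c d C D \<longleftrightarrow> degree (skew_poly l c d C D) = 8 \<and>
     no_common_root (skew_poly l c d C D) (pderiv (skew_poly l c d C D)) \<and>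
     no_common_root (skew_poly l c d C D) ([:0, 1:] * skew_det l c d C D) \<and>
     no_common_root (skew_poly l c d C D) (skew_a c D * skew_q C d)"

context
  fixes l c d C D :: complex
  assumes good: "skew_good l c d C D"
begin

lemma skew_root_nonzero:
  assumes "poly (skew_poly l c d C D) r = 0"
  shows "r \<noteq> 0" "poly (skew_det l c d C D) r \<noteq> 0" "poly (skew_a c D) r \<noteq> 0" "poly (skew_q C d) r \<noteq> 0"
proof -
  have "poly ([:0, 1:] * skew_det l c d C D) r \<noteq> 0" "poly (skew_a c D * skew_q C d) r \<noteq> 0"
    using good assms unfolding skew_good_def no_common_root_def by blast+
  then show "r \<noteq> 0" "poly (skew_det l c d C D) r \<noteq> 0" "poly (skew_a c D) r \<noteq> 0" "poly (skew_q C d) r \<noteq> 0"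
    by auto
qed

lemma skew_inj: "inj_on prod_var (hyperbola_system l c d C D)"
proof (rule inj_onI)
  fix s s' assume s: "s \<in> hyperbola_system l c d C D" "s' \<in> hyperbola_system l c d C D" "prod_var s = prod_var s'"
  obtain x w x' w' where xw: "s = (x, w)" "s' = (x', w')" by force
  have r: "x' * w' = x * w" using s(3) by (simp add: prod_var_def xw)
  obtain a q a' q' b m1 m2 where v: "skew_values l c d C D (x * w) a q a' q' b m1 m2"
    using skew_values_exist by blast
  note 1 = skew_system_solved[OF s(1)[unfolded xw] v]
    and 2 = skew_system_solved[OF s(2)[unfolded xw] v[folded r], unfolded r]
  have "poly (skew_det l c d C D) (x * w) \<noteq> 0" using skew_root_nonzero(2)[OF 1(3)] .
  then show "s = s'" using 1 2 unfolding xw by (metis mult_cancel_left)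
qed

lemma skew_roots: "prod_var ` hyperbola_system l c d C D = {r. poly (skew_poly l c d C D) r = 0}"
proof (intro equalityI subsetI)
  fix r assume "r \<in> prod_var ` hyperbola_system l c d C D"
  then obtain x w where xw: "(x, w) \<in> hyperbola_system l c d C D" "r = x * w"
    by (auto simp: prod_var_def)
  obtain a q a' q' b m1 m2 where "skew_values l c d C D (x * w) a q a' q' b m1 m2"
    using skew_values_exist by blast
  from skew_system_solved(3)[OF xw(1) this] show "r \<in> {r. poly (skew_poly l c d C D) r = 0}"
    by (simp add: xw(2))
next
  fix r assume "r \<in> {r. poly (skew_poly l c d C D) r = 0}"
  then have r: "poly (skew_poly l c d C D) r = 0" by simp
  obtain a q a' q' b m1 m2 where "skew_values l c d C D r a q a' q' b m1 m2"
    using skew_values_exist by blast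
  then interpret skew_values l c d C D r a q a' q' b m1 m2 .
  define m where "m = q * q * m1 + a * a * m2"
  define R where "R = 2 * l * r * (q * q - a * a)"
  have nz: "r \<noteq> 0" "m \<noteq> 0" "a \<noteq> 0" "q \<noteq> 0"
    using skew_root_nonzero[OF r] unfolding det aq m_def by auto
  define x where "x = (q * R + a * m2 * b) / m"
  define w where "w = (q * m1 * b - a * R) / m"
  have x: "m * x = q * R + a * m2 * b" and w: "m * w = q * m1 * b - a * R"
    using nz by (simp_all add: x_def w_def)
  have "(q * R + a * m2 * b) * (q * m1 * b - a * R) - r * m\<^sup>2 = 0"
    using skew_back_substitution[of q l r a b q' a', folded m1 m2, folded m_def R_def, folded poly_value] r by simp
  then have "m\<^sup>2 * (x * w - r) = 0"
    unfolding x[symmetric] w[symmetric] by (simp add: power2_eq_square algebra_simps)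
  then have xw: "x * w = r" using nz by simp
  have "m * (a * x + q * w - b) = a * (m * x) + q * (m * w) - m * b" by (simp add: algebra_simps)
  also have "\<dots> = 0" unfolding x w by (simp add: m_def algebra_simps)
  finally have b': "b = a * x + q * w" using nz by simp
  \<comment> \<open>The general formula for \<open>x\<close> ends in \<open>a q q\<close> times the
    defect of the second equation. Comparison with the choice of \<open>x\<close> makes this term
    zero, and \<open>a\<close>, \<open>q\<close> are nonzero at the root.\<close>
  have "a * q * q * (a' * x - q' * w - 2 * l * (x\<^sup>2 - w\<^sup>2)) = 0"
    using skew_elimination(1)[where l = l and a = a and x = x and q = q and w = w and a' = a' and q' = q', folded b', folded m1 m2, unfolded xw, folded m_def R_def] x
    by simp
  then have "a' * x - q' * w - 2 * l * (x\<^sup>2 - w\<^sup>2) = 0" using nz by simp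
  moreover have "x \<noteq> 0" "w \<noteq> 0" using xw nz by auto
  ultimately have "(x, w) \<in> hyperbola_system l c d C D"
    using b' b unfolding hyperbola_system_def mem_Collect_eq case_prod_conv xw a q a' q' by auto
  then show "r \<in> prod_var ` hyperbola_system l c d C D"
    by (rule rev_image_eqI) (simp add: prod_var_def xw)
qed

lemma skew_card_roots: "card {r. poly (skew_poly l c d C D) r = 0} = 8"
  by (rule card_roots_no_common_root_pderiv) (use good in \<open>auto simp: skew_good_def\<close>)

lemma skew_system_card: "finite (hyperbola_system l c d C D) \<and> card (hyperbola_system l c d C D) = 8"
proof -
  have "card (prod_var ` hyperbola_system l c d C D) = 8" by (simp add: skew_roots skew_card_roots)
  then have "card (hyperbola_system l c d C D) = 8" by (simp add: card_image[OF skew_inj])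
  then show ?thesis by (metis card.infinite zero_neq_numeral)
qed

lemma skew_traces:
  "(\<Sum>s\<in>hyperbola_system l c d C D. prod_var s) = c * C"
  "(\<Sum>s\<in>hyperbola_system l c d C D. 1 / prod_var s) = d * D"
proof -
  let ?N = "skew_poly l c d C D" and ?R = "{r. poly (skew_poly l c d C D) r = 0}"
  let ?P = "\<Prod>r\<in>?R. [:- r, 1:]"
  have deg: "degree ?N = 8" using good by (simp add: skew_good_def)
  have fin: "finite ?R" using skew_card_roots by (metis card.infinite zero_neq_numeral)
  have ne: "?R \<noteq> {}" using skew_card_roots by (metis card.empty zero_neq_numeral)
  have zero: "0 \<notin> ?R" using skew_root_nonzero(1) by blast
  have N: "?N = smult (lead_coeff ?N) ?P"
    by (rule poly_eq_prod_roots) (use fin skew_card_roots deg in auto)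
  have lead: "lead_coeff ?N \<noteq> 0" using deg by (metis degree_0 leading_coeff_0_iff zero_neq_numeral)
  have "coeff ?N 7 = lead_coeff ?N * coeff ?P (card ?R - 1)"
    unfolding skew_card_roots by (subst N) simp
  also have "\<dots> = lead_coeff ?N * - (\<Sum>r\<in>?R. r)" unfolding coeff_prod_linear(2)[OF fin ne] ..
  finally have "lead_coeff ?N * ((\<Sum>r\<in>?R. r) - c * C) = 0"
    unfolding deg coeff_skew_poly by (simp add: algebra_simps)
  then have 1: "(\<Sum>r\<in>?R. r) = c * C" using lead by simp
  have "coeff ?N 0 = lead_coeff ?N * coeff ?P 0" "coeff ?N 1 = lead_coeff ?N * coeff ?P 1"
    by (subst N, simp)+
  moreover have "coeff ?P 0 \<noteq> 0" "coeff ?P 1 = - (\<Sum>r\<in>?R. 1 / r) * coeff ?P 0"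
    using coeff_prod_linear(3,4)[OF fin zero] by simp_all
  ultimately have c1: "coeff ?N 1 = - (\<Sum>r\<in>?R. 1 / r) * coeff ?N 0" and c0: "coeff ?N 0 \<noteq> 0"
    using lead by simp_all
  have "coeff ?N 0 * ((\<Sum>r\<in>?R. 1 / r) - d * D) = 0"
    using c1 unfolding coeff_skew_poly by (simp add: algebra_simps)
  then have 2: "(\<Sum>r\<in>?R. 1 / r) = d * D" using c0 by simp
  show "(\<Sum>s\<in>hyperbola_system l c d C D. prod_var s) = c * C"
    using 1 unfolding skew_roots[symmetric] sum.reindex[OF skew_inj] by simp
  show "(\<Sum>s\<in>hyperbola_system l c d C D. 1 / prod_var s) = d * D"
    using 2 unfolding skew_roots[symmetric] sum.reindex[OF skew_inj] by simp
qed

end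

text \<open>Replacing \<open>w\<close> by \<open>1 / w\<close> exchanges the diagonal and off-diagonal entries of the metric.\<close>

lemma hyperbola_system_invert:
  assumes "l \<noteq> 0"
  shows "(x, 1 / w) \<in> hyperbola_system (1 / l) (c / l) (d / l) (D / l) (C / l) \<longleftrightarrow>
    (x, w) \<in> hyperbola_system l c d C D"
proof (cases "x = 0 \<or> w = 0")
  case False
  then have "(c / l - 1 / w - 1 / l * (1 / (1 / w))) * x = (c - w - l * (1 / w)) * x / l"
    "(d / l - 1 / l * (1 / w) - 1 / (1 / w)) * (1 / x) = (d - l * w - 1 / w) * (1 / x) / l"
    "(D / l - x - 1 / l * (1 / x)) * (1 / w) = (D - l * x - 1 / x) * (1 / w) / l"
    "(C / l - 1 / l * x - 1 / x) * (1 / (1 / w)) = (C - x - l * (1 / x)) * w / l"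
    using assms by (simp_all add: field_simps)
  then have "(c / l - 1 / w - 1 / l * (1 / (1 / w))) * x = (d / l - 1 / l * (1 / w) - 1 / (1 / w)) * (1 / x) \<longleftrightarrow>
      (c - w - l * (1 / w)) * x = (d - l * w - 1 / w) * (1 / x)"
    and "(D / l - x - 1 / l * (1 / x)) * (1 / w) = (C / l - 1 / l * x - 1 / x) * (1 / (1 / w)) \<longleftrightarrow>
      (C - x - l * (1 / x)) * w = (D - l * x - 1 / x) * (1 / w)"
    using assms by (auto simp only: divide_cancel_right)
  then show ?thesis
    using False by (simp only: hyperbola_system_iff divide_eq_0_iff one_neq_zero de_Morgan_disj simp_thms)
qed (auto simp: hyperbola_system_def)

text \<open>The first trace of the inverted system, where \<open>x w\<close> becomes
  \<open>x / w\<close> and the parameters \<open>c\<close>, \<open>C\<close> become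
  \<open>c / l\<close>, \<open>D / l\<close>.\<close>

lemma skew_inverted_trace:
  assumes "l \<noteq> 0" and "skew_good (1 / l) (c / l) (d / l) (D / l) (C / l)"
  shows "(\<Sum>(x, w)\<in>hyperbola_system l c d C D. x / w) = c * D / (l * l)"
proof -
  have "inj_on (\<lambda>(x, w). (x, 1 / w)) (hyperbola_system l c d C D)" by (auto simp: inj_on_def)
  moreover have "(\<lambda>(x, w). (x, 1 / w)) ` hyperbola_system l c d C D =
      hyperbola_system (1 / l) (c / l) (d / l) (D / l) (C / l)" (is "?f ` _ = ?S")
  proof (intro equalityI subsetI)
    fix s assume s: "s \<in> ?S"
    obtain x w where xw: "s = (x, 1 / w)" by (metis divide_divide_eq_right div_by_1 mult_1 surj_pair)
    then have "(x, w) \<in> hyperbola_system l c d C D" using s hyperbola_system_invert[OF assms(1)] by blast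
    then show "s \<in> ?f ` hyperbola_system l c d C D" by (rule rev_image_eqI) (simp add: xw)
  qed (use hyperbola_system_invert[OF assms(1)] in auto)
  ultimately have "(\<Sum>s\<in>?S. prod_var s) = (\<Sum>s\<in>hyperbola_system l c d C D. prod_var (?f s))"
    by (metis (no_types, lifting) sum.reindex_cong)
  then show ?thesis
    using skew_traces(1)[OF assms(2)] by (simp add: prod_var_def case_prod_unfold)
qed

text \<open>At conjugate parameters, conjugation exchanges \<open>(c, d)\<close> with
  \<open>(C, D)\<close>; this symmetry then makes the coefficients real.\<close>

lemma skew_poly_swap: "poly (skew_poly l c d C D) r = poly (skew_poly l C D c d) r"
proof -
  have "C * D - c * d = - (c * d - C * D)"
    "(C * r - d)\<^sup>2 - (c * r - D)\<^sup>2 = - ((c * r - D)\<^sup>2 - (C * r - d)\<^sup>2)"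
    "(C * r - d)\<^sup>2 + (c * r - D)\<^sup>2 = (c * r - D)\<^sup>2 + (C * r - d)\<^sup>2"
    "c * C = C * c" "d * D = D * d" by simp_all
  then show ?thesis
    unfolding poly_skew_poly by (simp only: mult_minus_left mult_minus_right power2_minus minus_minus)
      (simp add: mult_ac)
qed

lemma skew_real_coeffs:
  fixes l :: real
  shows "real_coeffs (skew_poly l c d (cnj c) (cnj d))"
proof -
  have "cnj (poly (skew_poly l c d C D) x) = poly (skew_poly l (cnj c) (cnj d) (cnj C) (cnj D)) (cnj x)" for C D x
    unfolding poly_skew_poly by simp
  then show ?thesis unfolding real_coeffs_def by (subst skew_poly_swap) simp
qed

text \<open>The choice \<open>c^2 = 8 l\<close> makes \<open>4 l - c^2 = - 4 l\<close>, so the two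
  quadratic factors become \<open>- 4 l (r^2 + 1)\<close> and \<open>4 l (r^2 - 1)\<close>, and only
  powers of \<open>r^2\<close> occur.\<close>

lemma skew_example:
  fixes l :: real
  assumes "l > 0" "c * c = 8 * of_real l"
  shows "poly (skew_poly l c 0 0 0) r = - (16 * of_real (l\<^sup>2)) * ((r\<^sup>2 - 1) ^ 3 * (r\<^sup>2 + 1) + 4 * of_real (l\<^sup>2) * r ^ 6)"
proof -
  have "poly (skew_poly l c 0 0 0) r = (r\<^sup>2 - 1)\<^sup>2 * ((4 * l - c * c) * r\<^sup>2 - 4 * l) * (4 * l * r\<^sup>2 - 4 * l)
      - l * l * r\<^sup>2 * ((c * c) * r\<^sup>2)\<^sup>2"
    unfolding poly_skew_poly by (simp add: power2_eq_square mult_ac)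
  then show ?thesis unfolding assms(2) by (simp add: power2_eq_square power_numeral_reduce algebra_simps)
qed

text \<open>With \<open>s = r^2\<close> and \<open>k = l^2\<close>, eliminating \<open>k\<close>
  from the polynomial and its derivative leaves \<open>(s - 1)^2 (s^2 + 2 s + 3)\<close>. The value
  1 is no root, and the quadratic factor forces \<open>27 k^2 - 46 k + 27 = 0\<close>, which has
  negative discriminant.\<close>

lemma skew_example_pderiv:
  fixes k :: real and s :: complex
  assumes "k > 0" and f: "(s - 1) ^ 3 * (s + 1) + 4 * of_real k * s ^ 3 = 0"
    and f': "3 * (s - 1)\<^sup>2 * (s + 1) + (s - 1) ^ 3 + 12 * of_real k * s\<^sup>2 = 0"
  shows False
proof -
  have "s * (3 * (s - 1)\<^sup>2 * (s + 1) + (s - 1) ^ 3 + 12 * of_real k * s\<^sup>2)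
      - 3 * ((s - 1) ^ 3 * (s + 1) + 4 * of_real k * s ^ 3) = (s - 1)\<^sup>2 * (s\<^sup>2 + 2 * s + 3)"
    by (simp add: power2_eq_square power_numeral_reduce algebra_simps)
  then have "(s - 1)\<^sup>2 * (s\<^sup>2 + 2 * s + 3) = 0" unfolding f f' by simp
  moreover have "s \<noteq> 1" using f \<open>k > 0\<close> by auto
  ultimately have "s\<^sup>2 + 2 * s + 3 = 0" by simp
  then have s: "s\<^sup>2 = - 2 * s - 3" by algebra
  then have s3: "s ^ 3 = s + 6" by algebra
  have "(1 + of_real k) * s = 4 - 6 * of_real k" using f s s3 by algebra
  then have "27 * (of_real k)\<^sup>2 - 46 * of_real k + 27 = (0 :: complex)" using s by algebra
  then have "of_real (27 * k\<^sup>2 - 46 * k + 27) = (0 :: complex)" by simp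
  then have k: "27 * k\<^sup>2 - 46 * k + 27 = 0" unfolding of_real_eq_0_iff .
  have "(27 * k - 23)\<^sup>2 + 200 = 27 * (27 * k\<^sup>2 - 46 * k + 27)"
    by (simp add: power2_eq_square algebra_simps)
  also have "\<dots> = 0" unfolding k by simp
  finally show False using zero_le_power2[of "27 * k - 23"] by linarith
qed

lemma polyfun_poly_skew:
  assumes "c \<in> polyfun" "d \<in> polyfun" "C \<in> polyfun" "D \<in> polyfun"
  shows "polyfun_poly (\<lambda>t. skew_poly l (c t) (d t) (C t) (D t))"
    "polyfun_poly (\<lambda>t. [:0, 1:] * skew_det l (c t) (d t) (C t) (D t))"
    "polyfun_poly (\<lambda>t. skew_a (c t) (D t) * skew_q (C t) (d t))"
  unfolding skew_poly_def skew_det_def skew_a_def skew_q_def skew_h_def skew_m_def Let_def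
  by (intro polyfun_poly_intros polyfun_intros assms)+

text \<open>The parameters are arbitrary polynomial functions because the lemma is applied twice: to
  the system itself and to the inverted one with \<open>1 / l\<close>, rescaled parameters and
  \<open>C\<close>, \<open>D\<close> exchanged.\<close>

lemma generic_skew_good:
  fixes l :: real
  assumes l: "l > 0"
    and pars: "c \<in> polyfun" "d \<in> polyfun" "C \<in> polyfun" "D \<in> polyfun"
    and surj: "\<And>c0 d0 C0 D0. \<exists>t. c t = c0 \<and> d t = d0 \<and> C t = C0 \<and> D t = D0"
  shows "generic (\<lambda>t. skew_good l (c t) (d t) (C t) (D t))"
proof -
  define c0 where "c0 = csqrt (8 * of_real l)"
  have c0: "c0 * c0 = 8 * of_real l"
    unfolding c0_def by (metis power2_csqrt power2_eq_square)
  define L where "L = complex_of_real (l\<^sup>2)"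
  have L: "L \<noteq> 0" using l by (simp add: L_def)
  obtain t0 where t0: "c t0 = c0" "d t0 = 0" "C t0 = 0" "D t0 = 0" using surj by blast
  \<comment> \<open>At \<open>t0\<close> the polynomial \<open>skew_q\<close> is zero, so the
    condition on \<open>skew_a\<close> and \<open>skew_q\<close> needs a second sample with nonzero
    \<open>C\<close>.\<close>
  obtain t1 where t1: "c t1 = c0" "d t1 = 0" "C t1 = c0" "D t1 = 0" using surj by blast
  let ?N = "\<lambda>t. skew_poly l (c t) (d t) (C t) (D t)"
  note N = polyfun_poly_skew[OF pars]
  have val: "poly (skew_poly l c0 0 0 0) r = - (16 * L) * ((r\<^sup>2 - 1) ^ 3 * (r\<^sup>2 + 1) + 4 * L * r ^ 6)" for r
    using skew_example[OF l c0] unfolding L_def .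
  have lead: "coeff (?N t0) 8 \<noteq> 0" "coeff (?N t1) 8 \<noteq> 0"
    unfolding coeff_skew_poly t0 t1 c0 using l by auto
  have "no_common_root (?N t0) (pderiv (?N t0))"
    unfolding no_common_root_def t0
  proof (intro allI impI notI)
    fix r :: complex
    let ?f = "(r\<^sup>2 - 1) ^ 3 * (r\<^sup>2 + 1) + 4 * of_real (l\<^sup>2) * (r\<^sup>2) ^ 3"
    let ?f' = "3 * (r\<^sup>2 - 1)\<^sup>2 * (r\<^sup>2 + 1) + (r\<^sup>2 - 1) ^ 3 + 12 * of_real (l\<^sup>2) * (r\<^sup>2)\<^sup>2"
    assume r: "poly (skew_poly l c0 0 0 0) r = 0" "poly (pderiv (skew_poly l c0 0 0 0)) r = 0"
    have "(poly (skew_poly l c0 0 0 0) has_field_derivative - (16 * L) * (2 * r * ?f')) (at r)"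
      unfolding val[abs_def] L_def[symmetric]
      by (auto intro!: derivative_eq_intros) (simp add: power2_eq_square power_numeral_reduce algebra_simps)
    then have "- (16 * L) * (2 * r * ?f') = 0"
      using r(2) by (metis DERIV_unique poly_DERIV)
    then have "r = 0 \<or> ?f' = 0" using L by simp
    moreover have "?f = 0" using r(1) L unfolding val by (simp add: L_def flip: power_mult)
    moreover from this have "r \<noteq> 0" by auto
    ultimately show False using skew_example_pderiv[of "l\<^sup>2" "r\<^sup>2"] l by simp
  qed
  moreover have "degree (pderiv (?N t)) \<le> 7" for t
    using degree_skew_poly[of l "c t" "d t" "C t" "D t"] unfolding degree_pderiv by linarith
  ultimately have g1: "generic (\<lambda>t. degree (?N t) = 8 \<and> no_common_root (?N t) (pderiv (?N t)))"
    by (intro generic_no_common_root[OF N(1) degree_skew_poly lead(1), of _ 7] polyfun_poly_pderiv[OF N(1)]) auto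
  have "no_common_root (?N t0) ([:0, 1:] * skew_det l (c t0) (d t0) (C t0) (D t0))"
    unfolding no_common_root_def t0
  proof (intro allI impI notI)
    fix r :: complex assume r: "poly (skew_poly l c0 0 0 0) r = 0" "poly ([:0, 1:] * skew_det l c0 0 0 0) r = 0"
    have "poly ([:0, 1:] * skew_det l c0 0 0 0) r = (c0 * c0) * 4 * l * r ^ 3 * (r\<^sup>2 - 1)"
      by (simp add: skew_det_def skew_q_def skew_a_def skew_m_def power2_eq_square power_numeral_reduce algebra_simps)
    then have "r = 0 \<or> r\<^sup>2 = 1" using r(2) c0 l by auto
    moreover have "r ^ 6 = (r\<^sup>2) ^ 3" by (simp flip: power_mult)
    ultimately have "poly (skew_poly l c0 0 0 0) r \<noteq> 0" unfolding val using L by auto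
    then show False using r(1) by simp
  qed
  note no_root = this
  have g2: "generic (\<lambda>t. degree (?N t) = 8 \<and> no_common_root (?N t) ([:0, 1:] * skew_det l (c t) (d t) (C t) (D t)))"
  proof (rule generic_no_common_root[OF N(1) degree_skew_poly lead(1) N(2) _ no_root])
    show "degree ([:0, 1:] * skew_det l (c t) (d t) (C t) (D t)) \<le> 5" for t
    proof -
      have b: "degree (skew_a (c t) (D t)) \<le> 1" "degree (skew_q (C t) (d t)) \<le> 1"
        "degree (skew_m l (c t) (D t)) \<le> 2" "degree (skew_m l (C t) (d t)) \<le> 2"
        by (auto simp: skew_a_def skew_q_def skew_m_def)
      have "degree (skew_det l (c t) (d t) (C t) (D t)) \<le> 4"
        unfolding skew_det_def power2_eq_square
        using degree_mult_le_add[OF degree_mult_le_add[OF b(2,2)] b(3)]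
          degree_mult_le_add[OF degree_mult_le_add[OF b(1,1)] b(4)]
        by (intro degree_add_le) simp_all
      then show ?thesis using degree_mult_le_add[of "[:0, 1 :: complex:]" 1] by force
    qed
  qed
  have "no_common_root (?N t1) (skew_a (c t1) (D t1) * skew_q (C t1) (d t1))"
    unfolding no_common_root_def t1
  proof (intro allI impI notI)
    fix r :: complex assume r: "poly (skew_poly l c0 0 c0 0) r = 0" "poly (skew_a c0 0 * skew_q c0 0) r = 0"
    then have "r = 0" using c0 l by (auto simp: skew_a_def skew_q_def)
    then show False using r(1) l by (simp add: poly_0_coeff_0 coeff_skew_poly)
  qed
  then have g3: "generic (\<lambda>t. degree (?N t) = 8 \<and> no_common_root (?N t) (skew_a (c t) (D t) * skew_q (C t) (d t)))"
    by (intro generic_no_common_root[OF N(1) degree_skew_poly lead(2) N(3), of 2])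
      (use degree_mult_le_add[of "skew_a (c t) (D t)" 1 "skew_q (C t) (d t)" 1 for t]
        in \<open>auto simp: skew_a_def skew_q_def\<close>)
  show ?thesis
    by (rule generic_mono[OF generic_conj[OF g1 generic_conj[OF g2 g3]]]) (auto simp: skew_good_def)
qed

text \<open>The second half is the regularity of the inverted system, needed for the trace of
  \<open>x / w\<close>.\<close>

definition skew_regular :: "real \<Rightarrow> complex \<Rightarrow> complex \<Rightarrow> complex \<Rightarrow> complex \<Rightarrow> bool" where
  "skew_regular l c d C D \<longleftrightarrow> skew_good l c d C D \<and> skew_good (1 / l) (c / l) (d / l) (D / l) (C / l)"

context
  fixes l :: real and c d :: complex
  assumes l: "0 < l" "l < 1" and regular: "skew_regular l c d (cnj c) (cnj d)"
begin

lemma skew_regular_good: "skew_good l c d (cnj c) (cnj d)"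
  using regular by (simp add: skew_regular_def)

interpretation hyperbola_roots l c d "skew_poly l c d (cnj c) (cnj d)"
proof
  show "finite (hyperbola_system l c d (cnj c) (cnj d))" using skew_system_card[OF skew_regular_good] by blast
  show "inj_on prod_var (hyperbola_system l c d (cnj c) (cnj d))" by (rule skew_inj[OF skew_regular_good])
  show "prod_var ` hyperbola_system l c d (cnj c) (cnj d) = {z. poly (skew_poly l c d (cnj c) (cnj d)) z = 0}"
    by (rule skew_roots[OF skew_regular_good])
qed (use hyperbola_system_swap[of _ _ l] skew_real_coeffs in \<open>auto simp: prod_var_def\<close>)

lemmas skew_card_real = card_pos_roots

lemma skew_card_even: "even (card {x. (x, cnj x) \<in> hyperbola_system l c d (cnj c) (cnj d)})"
  using even_card_real_sols skew_system_card[OF skew_regular_good] unfolding real_sols_def by simp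

lemma skew_card_le_8: "card {x. (x, cnj x) \<in> hyperbola_system l c d (cnj c) (cnj d)} \<le> 8"
proof -
  have "card {x. (x, cnj x) \<in> hyperbola_system l c d (cnj c) (cnj d)} \<le> card (fst ` hyperbola_system l c d (cnj c) (cnj d))"
    using fin by (intro card_mono) force+
  also have "\<dots> \<le> 8" using card_image_le[OF fin] skew_system_card[OF skew_regular_good] by force
  finally show ?thesis .
qed

text \<open>If all eight solutions were real, the traces of \<open>x w\<close>, \<open>1 / (x w)\<close> and \<open>x / w\<close> would be
  \<open>\<Sum>|x|\<^sup>2 = |c|\<^sup>2\<close>, \<open>\<Sum>|x|\<^sup>-\<^sup>2 = |d|\<^sup>2\<close> and \<open>\<Sum>x/cnj x\<close> of modulus \<open>|c| |d| / l\<^sup>2 > |c| |d|\<close>, against Cauchy--Schwarz.\<close>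

lemma skew_card_ne_8: "card {x. (x, cnj x) \<in> hyperbola_system l c d (cnj c) (cnj d)} \<noteq> 8"
proof
  let ?S = "hyperbola_system l c d (cnj c) (cnj d)"
  assume "card {x. (x, cnj x) \<in> ?S} = 8"
  then have all: "snd s = cnj (fst s)" if "s \<in> ?S" for s
    using all_real[of "fst s" "snd s"] skew_system_card[OF skew_regular_good] that unfolding real_sols_def by simp
  have ne: "?S \<noteq> {}" using skew_system_card[OF skew_regular_good] by auto
  have nz: "fst s \<noteq> 0" if "s \<in> ?S" for s using that by (auto simp: hyperbola_system_def)
  have prod: "prod_var s = of_real ((cmod (fst s))\<^sup>2)" if "s \<in> ?S" for s
    using all[OF that] prod_var_real[of "fst s"] by (metis prod.collapse)
  have "(\<Sum>s\<in>?S. prod_var s) = of_real (\<Sum>s\<in>?S. (cmod (fst s))\<^sup>2)" by (simp add: prod)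
  moreover have "c * cnj c = of_real ((cmod c)\<^sup>2)" by (simp only: complex_norm_square)
  ultimately have 1: "(\<Sum>s\<in>?S. (cmod (fst s))\<^sup>2) = (cmod c)\<^sup>2"
    using skew_traces(1)[OF skew_regular_good] by (simp only: of_real_eq_iff)
  have "(\<Sum>s\<in>?S. 1 / prod_var s) = of_real (\<Sum>s\<in>?S. (1 / cmod (fst s))\<^sup>2)"
    by (simp add: prod power_divide)
  moreover have "d * cnj d = of_real ((cmod d)\<^sup>2)" by (simp only: complex_norm_square)
  ultimately have 2: "(\<Sum>s\<in>?S. (1 / cmod (fst s))\<^sup>2) = (cmod d)\<^sup>2"
    using skew_traces(2)[OF skew_regular_good] by (simp only: of_real_eq_iff)
  have "(\<Sum>s\<in>?S. 1 :: real) = (\<Sum>s\<in>?S. cmod (fst s) * (1 / cmod (fst s)))" by (simp add: nz)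
  then have "(card ?S :: real)\<^sup>2 = (\<Sum>s\<in>?S. cmod (fst s) * (1 / cmod (fst s)))\<^sup>2" by simp
  also have "\<dots> \<le> (cmod c)\<^sup>2 * (cmod d)\<^sup>2"
    unfolding 1[symmetric] 2[symmetric] by (rule Cauchy_Schwarz_ineq_sum)
  finally have "8\<^sup>2 \<le> (cmod c * cmod d)\<^sup>2" using skew_system_card[OF skew_regular_good] by (simp add: power_mult_distrib)
  then have upper: "8 \<le> cmod c * cmod d" by (rule power2_le_imp_le) simp
  have "cmod (\<Sum>s\<in>?S. fst s / snd s) \<le> (\<Sum>s\<in>?S. cmod (fst s / snd s))" by (rule norm_sum)
  also have "\<dots> = (\<Sum>s\<in>?S. 1)" by (rule sum.cong) (auto simp: all nz norm_divide)
  also have "\<dots> = 8" using skew_system_card[OF skew_regular_good] by simp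
  finally have "cmod (c * cnj d / (of_real l * of_real l)) \<le> 8"
    using skew_inverted_trace[of l c d "cnj d" "cnj c"] regular l
    by (simp add: skew_regular_def case_prod_unfold)
  then have "cmod c * cmod d \<le> 8 * (l * l)"
    using l by (simp add: norm_divide norm_mult divide_le_eq)
  moreover have "l * l < 1" using l mult_strict_mono[of l 1 l 1] by simp
  ultimately show False using upper by linarith
qed

lemma skew_card_246:
  assumes "{x. (x, cnj x) \<in> hyperbola_system l c d (cnj c) (cnj d)} \<noteq> {}"
  shows "card {x. (x, cnj x) \<in> hyperbola_system l c d (cnj c) (cnj d)} \<in> {2, 4, 6}"
proof -
  have "n \<in> {2, 4, 6}" if "n \<le> 8" "n > 0" "even n" "n \<noteq> 8" for n :: nat
    using that by (cases "n = 1 \<or> n = 3 \<or> n = 5 \<or> n = 7") auto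
  then show ?thesis using skew_card_le_8 card_pos[OF assms] skew_card_even skew_card_ne_8 by blast
qed

end

context metric_frame
begin

lemma generic_skew_regular:
  assumes "l > 0"
  shows "generic (at_pars (skew_regular l))"
proof -
  have 1: "generic (\<lambda>t. skew_good l (c_par t) (d_par t) (C_par t) (D_par t))"
    by (intro generic_skew_good assms polyfun_pars pars_surj)
  have scale: "(\<lambda>t. f t / l) \<in> polyfun" if "f \<in> polyfun" for f
    using polyfun_mult[OF that polyfun_const[of "1 / l"]] by simp
  have 2: "generic (\<lambda>t. skew_good (1 / l) (c_par t / l) (d_par t / l) (D_par t / l) (C_par t / l))"
  proof -
    have "generic (\<lambda>t. skew_good (of_real (1 / l)) (c_par t / l) (d_par t / l) (D_par t / l) (C_par t / l))"
    proof (intro generic_skew_good scale polyfun_pars)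
      fix c0 d0 C0 D0 :: complex
      obtain t where "c_par t = l * c0" "d_par t = l * d0" "C_par t = l * D0" "D_par t = l * C0"
        using pars_surj by metis
      then show "\<exists>t. c_par t / l = c0 \<and> d_par t / l = d0 \<and> D_par t / l = C0 \<and> C_par t / l = D0"
        using assms by (intro exI[of _ t]) simp
    qed (use assms in simp)
    then show ?thesis by simp
  qed
  show ?thesis
    by (rule generic_mono[OF generic_conj[OF 1 2]]) (simp add: at_pars_def skew_regular_def)
qed

end

text \<open>With \<open>l = 25 n^2\<close>, the parameters \<open>c = 14 n\<close> and
  \<open>d = - 2 n\<close> satisfy \<open>c^2 + d^2 = 8 l\<close>. So \<open>4 l - c^2\<close> and
  \<open>4 l - d^2\<close> are opposite, each quadratic factor is \<open>- 96 n^2 (r^2 + 1)\<close>,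
  and for real \<open>n > 0\<close> all coefficients between the outer ones are negative.\<close>

lemma skew_poly_real_parameters:
  fixes n :: complex
  shows "skew_poly (25 * n\<^sup>2) (14 * n) (- 2 * n) (14 * n) (- 2 * n) =
    smult (9216 * n ^ 4) [:1, - 4 * n\<^sup>2, - 56 * n\<^sup>2, - 204 * n\<^sup>2, - 2 - 112 * n\<^sup>2, - 396 * n\<^sup>2, - 56 * n\<^sup>2, - 196 * n\<^sup>2, 1:]"
proof (rule poly_eq_poly_eq_iff[THEN iffD1], rule ext)
  fix r
  show "poly (skew_poly (25 * n\<^sup>2) (14 * n) (- 2 * n) (14 * n) (- 2 * n)) r = poly (smult (9216 * n ^ 4) [:1, - 4 * n\<^sup>2,
      - 56 * n\<^sup>2, - 204 * n\<^sup>2, - 2 - 112 * n\<^sup>2, - 396 * n\<^sup>2, - 56 * n\<^sup>2, - 196 * n\<^sup>2, 1:]) r"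
    unfolding poly_skew_poly by (simp add: power2_eq_square power_numeral_reduce algebra_simps)
qed

text \<open>With \<open>d = D = 0\<close> the eliminant depends on \<open>c\<close> and
  \<open>C\<close> only through \<open>E\<close> and \<open>F\<close>. Collecting powers of
  \<open>B\<close> prepares the expansion at \<open>r = 1\<close>.\<close>

lemma poly_skew_poly_d_zero:
  fixes l c C r :: complex
  defines "E \<equiv> c * C" and "F \<equiv> c * c + C * C" and "B \<equiv> r\<^sup>2 - 1"
  shows "poly (skew_poly l c 0 C 0) r = 16 * l\<^sup>2 * B ^ 4 + E\<^sup>2 * r ^ 4 * B\<^sup>2 - 16 * l\<^sup>2 * E * r ^ 3 * B\<^sup>2 - E ^ 3 * r ^ 7
    + 4 * l\<^sup>2 * E\<^sup>2 * r ^ 6 - 4 * l * F * r\<^sup>2 * B ^ 3 + 4 * l * E * F * r ^ 5 * B - l\<^sup>2 * F\<^sup>2 * r ^ 6"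
proof -
  have "r\<^sup>2 = B + 1" by (simp add: B_def)
  then have m: "(4 * l - c * c) * r\<^sup>2 - 4 * l = 4 * l * B - c * c * r\<^sup>2" for c by (simp add: algebra_simps)
  show ?thesis
    unfolding poly_skew_poly B_def[symmetric] mult_zero_right mult_zero_left diff_zero m
    by (simp add: E_def F_def power2_eq_square power_numeral_reduce algebra_simps)
qed

lemma skew_poly_d_zero:
  fixes l c C :: complex
  defines "E \<equiv> c * C" and "F \<equiv> c * c + C * C"
  shows "skew_poly l c 0 C 0 = [:16 * l\<^sup>2, 0, - 64 * l\<^sup>2 + 4 * l * F, - 16 * l\<^sup>2 * E, 96 * l\<^sup>2 + E\<^sup>2 - 12 * l * F,
    32 * l\<^sup>2 * E - 4 * l * E * F, - 64 * l\<^sup>2 - 2 * E\<^sup>2 + 12 * l * F + 4 * l\<^sup>2 * E\<^sup>2 - l\<^sup>2 * F\<^sup>2,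
    - 16 * l\<^sup>2 * E + 4 * l * E * F - E ^ 3, 16 * l\<^sup>2 + E\<^sup>2 - 4 * l * F:]" (is "_ = ?P")
proof (rule poly_eq_poly_eq_iff[THEN iffD1], rule ext)
  fix r
  show "poly (skew_poly l c 0 C 0) r = poly ?P r"
    unfolding poly_skew_poly_d_zero E_def[symmetric] F_def[symmetric]
    by (simp add: power2_eq_square power_numeral_reduce algebra_simps)
qed

lemma eventually_pos_at_right_zero:
  fixes h :: "real \<Rightarrow> real"
  assumes "isCont h 0" "h 0 > 0"
  shows "eventually (\<lambda>x. h x > 0) (at_right 0)"
proof -
  have "(h \<longlongrightarrow> h 0) (at_right 0)"
    using assms(1) unfolding isCont_def by (rule filterlim_mono) (simp_all add: at_le)
  then show ?thesis using assms(2) by (rule order_tendstoD)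
qed

text \<open>For small real \<open>e\<close> the choice \<open>c = e (2 + i)\<close>, \<open>d = 0\<close> leaves four positive roots. They
  split off from the fourfold root \<open>1\<close> at \<open>c = 0\<close>, near the points \<open>1 + e y\<close> with \<open>(4 y\<^sup>2 - 1) (y\<^sup>2 - 1) = 0\<close>.\<close>

lemma skew_small_parameters:
  fixes l :: real
  assumes "l > 0"
  defines "y \<equiv> nth [- 2, - 3 / 4, 0, 3 / 4, 2 :: real]" and "\<sigma> \<equiv> nth [1, 1, - 1, - 1, 1, 1, - 1 :: real]"
  obtains c s where "0 \<le> s 0" "\<And>i. i < 4 \<Longrightarrow> s i < s (Suc i)"
    "\<And>i. i \<le> 4 \<Longrightarrow> (- 1) ^ i * Re (poly (skew_poly l c 0 (cnj c) 0) (of_real (s i))) > 0"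
    "\<And>k. 2 \<le> k \<Longrightarrow> k \<le> 6 \<Longrightarrow> \<sigma> k * Re (coeff (skew_poly l c 0 (cnj c) 0) k) > 0"
proof -
  \<comment> \<open>For \<open>c = e (2 + i)\<close> one has \<open>E = 5 e^2\<close> and
    \<open>F = 6 e^2\<close>, and at \<open>r = 1 + e v\<close> also \<open>B = e Y\<close>. So
    \<open>h v e\<close> is the eliminant at \<open>1 + e v\<close> divided by \<open>e^4\<close>,
    extended continuously to \<open>e = 0\<close>.\<close>
  define Y :: "real \<Rightarrow> real \<Rightarrow> real" where "Y v e = 2 * v + e * v\<^sup>2" for v e
  define h :: "real \<Rightarrow> real \<Rightarrow> real" where
    "h v e = 16 * l\<^sup>2 * Y v e ^ 4 + 25 * e\<^sup>2 * (1 + e * v) ^ 4 * (Y v e)\<^sup>2 - 80 * l\<^sup>2 * (1 + e * v) ^ 3 * (Y v e)\<^sup>2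
      - 125 * e\<^sup>2 * (1 + e * v) ^ 7 + 100 * l\<^sup>2 * (1 + e * v) ^ 6 - 24 * l * e * (1 + e * v)\<^sup>2 * Y v e ^ 3
      + 120 * l * e * (1 + e * v) ^ 5 * Y v e - 36 * l\<^sup>2 * (1 + e * v) ^ 6" for v e
  have cont: "isCont (h v) 0" for v unfolding h_def Y_def by (intro continuous_intros)
  have h0: "h v 0 = 64 * l\<^sup>2 * ((4 * v\<^sup>2 - 1) * (v\<^sup>2 - 1))" for v
    by (simp add: h_def Y_def power2_eq_square power_numeral_reduce algebra_simps)
  have le4: "i \<le> 4 \<longleftrightarrow> i = 0 \<or> i = 1 \<or> i = 2 \<or> i = 3 \<or> i = 4" for i :: nat by auto
  have h_pos: "eventually (\<lambda>e. (- 1) ^ i * h (y i) e > 0) (at_right 0)" if "i \<le> 4" for i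
  proof (rule eventually_pos_at_right_zero)
    show "isCont (\<lambda>e. (- 1) ^ i * h (y i) e) 0" by (intro continuous_intros cont)
    show "(- 1) ^ i * h (y i) 0 > 0"
      using that \<open>l > 0\<close> unfolding le4 h0 by (auto simp: y_def power2_eq_square power_numeral_reduce)
  qed
  note pos = eventually_pos_at_right_zero
  have "eventually (\<lambda>e. \<forall>i\<in>{..4}. (- 1) ^ i * h (y i) e > 0) (at_right 0)"
    by (rule eventually_ball_finite) (use h_pos in auto)
  \<comment> \<open>\<open>1 - 2 e\<close> is the leftmost point of evaluation. The next four
    conditions give the signs of the coefficients 2, 4, 5 and 6, where \<open>e^2\<close> has been
    cancelled in the fifth; coefficient 3 is \<open>- 80 l^2 e^2\<close>.\<close>
  moreover have "eventually (\<lambda>e. 1 - 2 * e > 0) (at_right (0 :: real))" by (rule pos) auto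
  moreover have "eventually (\<lambda>e. 64 * l\<^sup>2 - 24 * l * e\<^sup>2 > 0) (at_right 0)" by (rule pos) (use \<open>l > 0\<close> in auto)
  moreover have "eventually (\<lambda>e. 96 * l\<^sup>2 + 25 * e ^ 4 - 72 * l * e\<^sup>2 > 0) (at_right 0)" by (rule pos) (use \<open>l > 0\<close> in auto)
  moreover have "eventually (\<lambda>e. 160 * l\<^sup>2 - 120 * l * e\<^sup>2 > 0) (at_right 0)" by (rule pos) (use \<open>l > 0\<close> in auto)
  moreover have "eventually (\<lambda>e. 64 * l\<^sup>2 + 50 * e ^ 4 - 72 * l * e\<^sup>2 - 64 * l\<^sup>2 * e ^ 4 > 0) (at_right 0)"
    by (rule pos) (use \<open>l > 0\<close> in auto)
  moreover have "eventually (\<lambda>e. e > 0) (at_right (0 :: real))" by (rule eventually_at_right_less)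
  ultimately have "eventually (\<lambda>e. (\<forall>i\<in>{..4}. (- 1) ^ i * h (y i) e > 0) \<and> 1 - 2 * e > 0 \<and> 64 * l\<^sup>2 - 24 * l * e\<^sup>2 > 0 \<and>
      96 * l\<^sup>2 + 25 * e ^ 4 - 72 * l * e\<^sup>2 > 0 \<and> 160 * l\<^sup>2 - 120 * l * e\<^sup>2 > 0 \<and>
      64 * l\<^sup>2 + 50 * e ^ 4 - 72 * l * e\<^sup>2 - 64 * l\<^sup>2 * e ^ 4 > 0 \<and> e > 0) (at_right 0)"
    by eventually_elim blast
  from eventually_happens'[OF trivial_limit_at_right_real this]
  obtain e where e: "\<forall>i\<in>{..4}. (- 1) ^ i * h (y i) e > 0" "1 - 2 * e > 0" "64 * l\<^sup>2 - 24 * l * e\<^sup>2 > 0"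
    "96 * l\<^sup>2 + 25 * e ^ 4 - 72 * l * e\<^sup>2 > 0" "160 * l\<^sup>2 - 120 * l * e\<^sup>2 > 0"
    "64 * l\<^sup>2 + 50 * e ^ 4 - 72 * l * e\<^sup>2 - 64 * l\<^sup>2 * e ^ 4 > 0" "e > 0"
    by (elim exE conjE) (rule that)
  define c where "c = Complex (2 * e) e"
  have E: "c * cnj c = of_real (5 * e\<^sup>2)" and F: "c * c + cnj c * cnj c = of_real (6 * e\<^sup>2)"
    by (simp_all add: c_def complex_eq_iff power2_eq_square)
  have val: "poly (skew_poly l c 0 (cnj c) 0) (of_real (1 + e * v)) = of_real (e ^ 4 * h v e)" for v
  proof -
    define R Z where "R = 1 + e * v" and "Z = Y v e"
    have "R\<^sup>2 - 1 = e * Z" by (simp add: R_def Z_def Y_def power2_eq_square algebra_simps)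
    then have B: "(of_real R)\<^sup>2 - 1 = (of_real (e * Z) :: complex)"
      by (metis of_real_1 of_real_diff of_real_power)
    have eq: "16 * l\<^sup>2 * (e * Z) ^ 4 + (5 * e\<^sup>2)\<^sup>2 * R ^ 4 * (e * Z)\<^sup>2 - 16 * l\<^sup>2 * (5 * e\<^sup>2) * R ^ 3 * (e * Z)\<^sup>2 - (5 * e\<^sup>2) ^ 3 * R ^ 7
      + 4 * l\<^sup>2 * (5 * e\<^sup>2)\<^sup>2 * R ^ 6 - 4 * l * (6 * e\<^sup>2) * R\<^sup>2 * (e * Z) ^ 3 + 4 * l * (5 * e\<^sup>2) * (6 * e\<^sup>2) * R ^ 5 * (e * Z)
      - l\<^sup>2 * (6 * e\<^sup>2)\<^sup>2 * R ^ 6 = e ^ 4 * h v e"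
      unfolding h_def R_def[symmetric] Z_def[symmetric]
      by (simp add: power2_eq_square power_numeral_reduce algebra_simps)
    show ?thesis
      unfolding R_def[symmetric] poly_skew_poly_d_zero B E F eq[symmetric]
      by (simp only: of_real_add of_real_diff of_real_mult of_real_power of_real_numeral)
  qed
  show ?thesis
  proof (rule that[of "\<lambda>i. 1 + e * y i" c])
    show "0 \<le> 1 + e * y 0" using e(2) by (simp add: y_def)
    show "1 + e * y i < 1 + e * y (Suc i)" if "i < 4" for i
      using that e(7) by (auto simp: y_def less_Suc_eq numeral_eq_Suc)
    show "(- 1) ^ i * Re (poly (skew_poly l c 0 (cnj c) 0) (of_real (1 + e * y i))) > 0" if "i \<le> 4" for i
    proof -
      have "0 < e ^ 4 * ((- 1) ^ i * h (y i) e)" using e(1) that e(7) by simp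
      then show ?thesis unfolding val by (simp add: mult_ac)
    qed
    show "\<sigma> k * Re (coeff (skew_poly l c 0 (cnj c) 0) k) > 0" if "2 \<le> k" "k \<le> 6" for k
    proof -
      have ee: "0 < e * (e * (160 * l\<^sup>2 - 120 * l * e\<^sup>2))" "0 < l * l * (e * e)" using e(5,7) \<open>l > 0\<close> by simp_all
      have "k = 2 \<or> k = 3 \<or> k = 4 \<or> k = 5 \<or> k = 6" using that by auto
      then show ?thesis
        unfolding skew_poly_d_zero E F using e(3,4,6) ee
        by (elim disjE) (simp_all add: \<sigma>_def numeral_eq_Suc flip: of_real_power of_real_mult, simp_all add: algebra_simps)
    qed
  qed
qed

context metric_frame
begin

lemma polyfun_poly_skew_poly: "polyfun_poly (at_pars (skew_poly l))"
  unfolding at_pars_def by (intro polyfun_poly_skew polyfun_pars)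

text \<open>Only the outer coefficients are positive near the sample, so Descartes' rule allows two
  roots, and 2 is the least count possible by \<open>skew_card_246\<close>.\<close>

lemma skew_open_2:
  assumes l: "0 < l" "l < 1"
  shows "\<exists>U. open U \<and> U \<noteq> {} \<and> (\<forall>u\<in>U. at_pars (skew_regular l) (real_t u) \<longrightarrow>
    card {x. (x, cnj x) \<in> at_pars (hyperbola_system l) (real_t u)} = 2)"
proof -
  define \<sigma> :: "nat \<Rightarrow> real" where "\<sigma> = nth [1, - 1, - 1, - 1, - 1, - 1, - 1, - 1, 1]"
  have le8: "i \<le> 8 \<longleftrightarrow> i = 0 \<or> i = 1 \<or> i = 2 \<or> i = 3 \<or> i = 4 \<or> i = 5 \<or> i = 6 \<or> i = 7 \<or> i = 8" for i :: nat by auto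
  let ?U = "{u. \<forall>k\<le>8. \<sigma> k * Re (coeff (at_pars (skew_poly l) (real_t u)) k) > 0}"
  have "open ?U" by (rule open_coeff_signs[OF polyfun_poly_skew_poly])
  moreover have "?U \<noteq> {}"
  proof -
    define n where "n = sqrt l / 5"
    have n: "n > 0" "l = 25 * n\<^sup>2" using l by (simp_all add: n_def power_divide)
    obtain u where u: "at_pars (skew_poly l) (real_t u) = skew_poly l (14 * n) (- 2 * n) (cnj (14 * n)) (cnj (- 2 * n))"
      using real_t_surj[of "14 * n" "- 2 * n"] by blast
    have "skew_poly l (14 * n) (- 2 * n) (cnj (14 * n)) (cnj (- 2 * n)) = smult (of_real (9216 * n ^ 4))
        [:1, of_real (- 4 * n\<^sup>2), of_real (- 56 * n\<^sup>2), of_real (- 204 * n\<^sup>2), of_real (- 2 - 112 * n\<^sup>2), of_real (- 396 * n\<^sup>2),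
          of_real (- 56 * n\<^sup>2), of_real (- 196 * n\<^sup>2), 1:]"
      using skew_poly_real_parameters[of "of_real n"] by (simp add: n(2))
    moreover have "n * (n * (n * (n * (- 2 - 112 * (n * n))))) < 0"
    proof -
      have "- 2 - 112 * (n * n) < 0" using n(1) mult_pos_pos[of n n] by linarith
      then show ?thesis using n(1) by (intro mult_pos_neg)
    qed
    ultimately have "u \<in> ?U" using n(1)
      by (auto simp: u \<sigma>_def le8) (simp_all add: numeral_eq_Suc zero_less_mult_iff add_pos_pos)
    then show ?thesis by blast
  qed
  moreover have "card {x. (x, cnj x) \<in> at_pars (hyperbola_system l) (real_t u)} = 2"
    if u: "u \<in> ?U" and reg: "at_pars (skew_regular l) (real_t u)" for u
  proof -
    define c d where "c = c_par (real_t u)" and "d = d_par (real_t u)"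
    have reg: "skew_regular l c d (cnj c) (cnj d)" using reg by (simp add: at_pars_real c_def d_def)
    let ?N = "re_poly (skew_poly l c d (cnj c) (cnj d))"
    have coeffs: "\<sigma> k * coeff ?N k > 0" if "k \<le> 8" for k
      using u that by (simp add: at_pars_real c_def d_def)
    have high: "coeff ?N k = 0" if "k > 8" for k
      using that degree_skew_poly[of l c d "cnj c" "cnj d"] by (simp add: coeff_eq_0)
    have nz: "?N \<noteq> 0" using coeffs[of 0] by (metis coeff_0 le0 less_irrefl mult_zero_right)
    have "1 * (sign_pattern [1, 8] k * coeff ?N k) \<ge> 0" for k
    proof (cases "k \<le> 8")
      case True
      from this[unfolded le8] show ?thesis
        using coeffs[OF True] by (elim disjE) (simp_all add: \<sigma>_def sign_pattern_def)
    qed (simp add: high del: coeff_re_poly)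
    then have "card {r. r > 0 \<and> poly ?N r = 0} \<le> length [1, 8::nat]"
      by (intro descartes_rule[OF nz, of 1]) auto
    then have "card {x. (x, cnj x) \<in> hyperbola_system l c d (cnj c) (cnj d)} \<le> 2"
      by (simp add: skew_card_real[OF l reg])
    then show ?thesis
      using skew_card_246[OF l reg hyperbola_real_nonempty] by (auto simp: at_pars_real c_def d_def)
  qed
  ultimately show ?thesis by blast
qed

text \<open>Four sign changes of the values give four roots at least, and four sign changes of the
  coefficients give four at most.\<close>

lemma skew_open_4:
  assumes l: "0 < l" "l < 1"
  shows "\<exists>U. open U \<and> U \<noteq> {} \<and> (\<forall>u\<in>U. at_pars (skew_regular l) (real_t u) \<longrightarrow>
    card {x. (x, cnj x) \<in> at_pars (hyperbola_system l) (real_t u)} = 4)"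
proof -
  let ?\<sigma> = "nth [1, 1, - 1, - 1, 1, 1, - 1 :: real]"
  obtain c0 s where s: "0 \<le> s 0" "\<And>i. i < 4 \<Longrightarrow> s i < s (Suc i)"
    and vals: "\<And>i. i \<le> 4 \<Longrightarrow> (- 1) ^ i * Re (poly (skew_poly l c0 0 (cnj c0) 0) (of_real (s i))) > 0"
    and coeffs: "\<And>k. 2 \<le> k \<Longrightarrow> k \<le> 6 \<Longrightarrow> ?\<sigma> k * Re (coeff (skew_poly l c0 0 (cnj c0) 0) k) > 0"
    using skew_small_parameters[OF l(1)] by metis
  let ?V = "{u. \<forall>i\<le>4. (- 1) ^ i * Re (poly (at_pars (skew_poly l) (real_t u)) (s i)) > 0}"
  let ?W = "\<Inter>k\<in>{2..6}. {u. ?\<sigma> k * Re (coeff (at_pars (skew_poly l) (real_t u)) k) > 0}"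
  have "open ?V"
    by (rule open_value_signs[OF polyfun_poly_skew_poly, of 8]) (simp add: at_pars_def degree_skew_poly)
  moreover have "open ?W"
    by (intro open_INT ballI open_Re_pos) (use polyfun_poly_skew_poly in \<open>auto simp: polyfun_poly_def\<close>)
  ultimately have "open (?V \<inter> ?W)" by (rule open_Int)
  moreover have "?V \<inter> ?W \<noteq> {}"
  proof -
    obtain u where "at_pars (skew_poly l) (real_t u) = skew_poly l c0 0 (cnj c0) (cnj 0)"
      using real_t_surj[of c0 0] by blast
    then have "u \<in> ?V \<inter> ?W" using vals coeffs by auto
    then show ?thesis by blast
  qed
  moreover have "card {x. (x, cnj x) \<in> at_pars (hyperbola_system l) (real_t u)} = 4"
    if u: "u \<in> ?V \<inter> ?W" and reg: "at_pars (skew_regular l) (real_t u)" for u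
  proof -
    define c d where "c = c_par (real_t u)" and "d = d_par (real_t u)"
    have reg: "skew_regular l c d (cnj c) (cnj d)" using reg by (simp add: at_pars_real c_def d_def)
    let ?P = "skew_poly l c d (cnj c) (cnj d)"
    let ?N = "re_poly ?P"
    have N: "at_pars (skew_poly l) (real_t u) = ?P" by (simp add: at_pars_real c_def d_def)
    have at_s: "(- 1) ^ i * poly ?N (s i) > 0" if "i \<le> 4" for i
      using u that by (simp add: N poly_re_poly[OF skew_real_coeffs])
    have middle: "?\<sigma> k * coeff ?N k > 0" if "2 \<le> k" "k \<le> 6" for k
      using u that by (simp add: N)
    have high: "coeff ?N k = 0" if "k > 8" for k
      using that degree_skew_poly[of l c d "cnj c" "cnj d"] by (simp add: coeff_eq_0)
    \<comment> \<open>At conjugate parameters the outer coefficients are squared moduli or products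
      of such with a minus sign, so their weak signs hold without a condition on \<open>u\<close>;
      only the coefficients 2 to 6 had to be prescribed.\<close>
    have sq: "(4 * complex_of_real l - z * z) * (4 * complex_of_real l - cnj z * cnj z) =
        of_real ((cmod (4 * complex_of_real l - z * z))\<^sup>2)" for z
      unfolding complex_norm_square by simp
    have sq': "z * cnj z = of_real ((cmod z)\<^sup>2)" for z by (simp only: complex_norm_square)
    have outer: "coeff ?N 0 \<ge> 0" "coeff ?N 1 \<le> 0" "coeff ?N 7 \<le> 0" "coeff ?N 8 \<ge> 0"
      unfolding coeff_re_poly coeff_skew_poly sq sq' by (simp_all flip: of_real_mult of_real_minus)
    have nz: "?N \<noteq> 0" using at_s[of 0] by auto
    have "1 * (sign_pattern [1, 4, 6, 8] k * coeff ?N k) \<ge> 0" for k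
    proof (cases "k \<le> 8")
      case True
      then have "k = 0 \<or> k = 1 \<or> k = 7 \<or> k = 8 \<or> k = 2 \<or> k = 3 \<or> k = 4 \<or> k = 5 \<or> k = 6" by auto
      then show ?thesis
        using outer middle[of k] by (elim disjE) (simp_all add: sign_pattern_def)
    qed (simp add: high del: coeff_re_poly)
    then have "card {r. r > 0 \<and> poly ?N r = 0} \<le> length [1, 4, 6, 8::nat]"
      by (intro descartes_rule[OF nz, of 1]) auto
    moreover have "4 \<le> card {r. r > s 0 \<and> poly ?N r = 0}"
    proof (rule card_roots_ge_sign_changes[OF nz])
      fix i :: nat assume i: "i < 4"
      then show "s i < s (Suc i)" by (rule s(2))
      have "0 < ((- 1) ^ i * poly ?N (s i)) * ((- 1) ^ Suc i * poly ?N (s (Suc i)))"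
        using i by (intro mult_pos_pos at_s) auto
      then show "poly ?N (s i) * poly ?N (s (Suc i)) < 0"
        by (simp add: algebra_simps flip: power_add power2_eq_square)
    qed
    moreover have "card {r. r > s 0 \<and> poly ?N r = 0} \<le> card {r. r > 0 \<and> poly ?N r = 0}"
      by (rule card_mono) (use s(1) in \<open>auto intro: finite_subset[OF _ poly_roots_finite[OF nz]]\<close>)
    ultimately show ?thesis
      using skew_card_real[OF l reg] by (simp add: at_pars_real c_def d_def)
  qed
  ultimately show ?thesis by blast
qed

theorem skew_degrees:
  assumes "g \<noteq> 0" "0 < l" "l < 1"
  shows "has_vHDdeg (zero_locus {hyperbola g}) 8 \<and> {2, 4} \<subseteq> HDdeg (zero_locus {hyperbola g}) \<and>
    HDdeg (zero_locus {hyperbola g}) \<subseteq> {2, 4, 6}"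
proof (rule hyperbola_degrees_from_system[OF assms(1) generic_skew_regular[OF assms(2)]])
  show "finite (hyperbola_system l c d C D) \<and> card (hyperbola_system l c d C D) = 8"
    if "skew_regular l c d C D" for c d C D
    by (rule skew_system_card) (use that in \<open>simp add: skew_regular_def\<close>)
  show "card {x. (x, cnj x) \<in> hyperbola_system l c d (cnj c) (cnj d)} \<in> {2, 4, 6}"
    if "skew_regular l c d (cnj c) (cnj d)" for c d
    by (rule skew_card_246[OF assms(2,3) that hyperbola_real_nonempty])
qed (use skew_open_2[OF assms(2,3)] skew_open_4[OF assms(2,3)] in blast)

end

section \<open>Classification of affine conics\<close>

definition conic_form where
  "conic_form a b c d e f z1 z2 = a * z1\<^sup>2 + 2 * b * z1 * z2 + c * z2\<^sup>2 + 2 * d * z1 + 2 * e * z2 + (f :: complex)"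

lemma mem_affine_conic: "z \<in> affine_conic a b c d e f \<longleftrightarrow> conic_form a b c d e f (z $ 1) (z $ 2) = 0"
  by (simp add: affine_conic_def zero_locus_def conic_form_def)

text \<open>Completing the square writes \<open>a\<close> times the quadric as
  \<open>(a z1 + b z2 + d)^2 - (m z2 + n)^2\<close>, where \<open>m^2 = b^2 - a c\<close>,
  \<open>n^2 = d^2 - a f\<close> and \<open>m n = b d - a e\<close>; the determinant condition makes
  these three equations compatible.\<close>

lemma conic_factors_leading:
  fixes a b c d e f :: complex
  assumes a: "a \<noteq> 0" and det: "a * c * f + 2 * b * d * e - a * e\<^sup>2 - c * d\<^sup>2 - b\<^sup>2 * f = 0"
  shows "\<exists>l1 l2 l3 m1 m2 m3. a = l1 * m1 \<and> 2 * b = l1 * m2 + l2 * m1 \<and> c = l2 * m2 \<and>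
    2 * d = l1 * m3 + l3 * m1 \<and> 2 * e = l2 * m3 + l3 * m2 \<and> f = l3 * m3"
proof -
  define m where "m = csqrt (b\<^sup>2 - a * c)"
  have m: "m\<^sup>2 = b\<^sup>2 - a * c" by (simp add: m_def)
  have *: "(b\<^sup>2 - a * c) * (d\<^sup>2 - a * f) = (b * d - a * e)\<^sup>2" using det by algebra
  obtain n where n: "n\<^sup>2 = d\<^sup>2 - a * f" "m * n = b * d - a * e"
  proof (cases "m = 0")
    case True
    then show ?thesis using * m that[of "csqrt (d\<^sup>2 - a * f)"] by simp
  next
    case False
    show ?thesis
    proof (rule that)
      have "m\<^sup>2 * ((b * d - a * e) / m)\<^sup>2 = m\<^sup>2 * (d\<^sup>2 - a * f)"
        using * False unfolding m by (simp add: power_divide flip: m)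
      then show "((b * d - a * e) / m)\<^sup>2 = d\<^sup>2 - a * f" using False by simp
      show "m * ((b * d - a * e) / m) = b * d - a * e" using False by simp
    qed
  qed
  have "a * c = (b + m) * (b - m)" "a * (2 * e) = (b + m) * (d - n) + (d + n) * (b - m)" "a * f = (d + n) * (d - n)"
    using m n by algebra+
  then have cef: "c = (b + m) / a * (b - m)" "2 * e = (b + m) / a * (d - n) + (d + n) / a * (b - m)"
    "f = (d + n) / a * (d - n)"
    using a by (simp_all add: eq_divide_eq mult.commute flip: add_divide_distrib)
  show ?thesis
    by (rule exI[of _ 1], rule exI[of _ "(b + m) / a"], rule exI[of _ "(d + n) / a"], rule exI[of _ a],
      rule exI[of _ "b - m"], rule exI[of _ "d - n"], intro conjI cef) (simp_all add: a)
qed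

lemma conic_factors:
  fixes a b c d e f :: complex
  assumes abc: "(a, b, c) \<noteq> (0, 0, 0)" and det: "a * c * f + 2 * b * d * e - a * e\<^sup>2 - c * d\<^sup>2 - b\<^sup>2 * f = 0"
  obtains l1 l2 l3 m1 m2 m3 where "a = l1 * m1" "2 * b = l1 * m2 + l2 * m1" "c = l2 * m2"
    "2 * d = l1 * m3 + l3 * m1" "2 * e = l2 * m3 + l3 * m2" "f = l3 * m3"
proof -
  consider "a \<noteq> 0" | "c \<noteq> 0" | "a = 0" "c = 0" "b \<noteq> 0" using abc by auto
  then show thesis
  proof cases
    case 1
    then show ?thesis using conic_factors_leading[OF 1 det] that by blast
  next
    case 2
    have "c * a * f + 2 * b * e * d - c * d\<^sup>2 - a * e\<^sup>2 - b\<^sup>2 * f = 0" using det by (simp add: algebra_simps)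
    from conic_factors_leading[OF 2 this] obtain l1 l2 l3 m1 m2 m3 where
      "c = l1 * m1" "2 * b = l1 * m2 + l2 * m1" "a = l2 * m2"
      "2 * e = l1 * m3 + l3 * m1" "2 * d = l2 * m3 + l3 * m2" "f = l3 * m3" by blast
    then show ?thesis using that[of l2 m2 m1 l1 m3 l3] by (simp add: add.commute)
  next
    case 3
    then have "b * (b * f - 2 * d * e) = 0" using det by (simp add: power2_eq_square algebra_simps)
    then have "f = 2 * d * e / b" using 3 by (simp add: field_simps)
    \<comment> \<open>The factorisation is \<open>(z1 + e / b) (2 b z2 + 2 d)\<close>.\<close>
    then show ?thesis using that[of 1 0 "2 * b" 0 "2 * d" "e / b"] 3 by (simp add: field_simps)
  qed
qed

subsection \<open>Lines\<close>

definition line_set :: "complex \<Rightarrow> complex \<Rightarrow> complex \<Rightarrow> (complex ^ 2) set" where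
  "line_set l1 l2 l3 = {z. l1 * z $ 1 + l2 * z $ 2 + l3 = 0}"

text \<open>\<open>p\<close> spans the direction of the line and \<open>q\<close> is normalised by
  \<open>l1 q1 + l2 q2 = 1\<close>, so the second frame coordinate is the defining form
  itself.\<close>

lemma affine_frame_line:
  assumes "l1 \<noteq> 0 \<or> l2 \<noteq> 0"
  obtains z0 p q where "affine_frame p q" "line_set l1 l2 l3 = zero_locus {affine_frame.L2 z0 p q}"
proof -
  define N where "N = l1 * cnj l1 + l2 * cnj l2"
  have "N = of_real ((cmod l1)\<^sup>2 + (cmod l2)\<^sup>2)"
    unfolding N_def of_real_add by (simp only: complex_norm_square)
  moreover have "(cmod l1)\<^sup>2 + (cmod l2)\<^sup>2 \<noteq> 0" using assms by (simp add: sum_power2_eq_zero_iff)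
  ultimately have N: "N \<noteq> 0" by (simp only: of_real_eq_0_iff not_False_eq_True)
  define p q z0 :: "complex ^ 2" where "p = vector [l2, - l1]" and "q = vector [cnj l1 / N, cnj l2 / N]"
    and "z0 = - l3 *s q"
  have "p $ 1 * q $ 2 - p $ 2 * q $ 1 = (l1 * cnj l1 + l2 * cnj l2) / N" by (simp add: p_def q_def add_divide_distrib)
  then interpret affine_frame z0 p q by unfold_locales (simp add: N flip: N_def)
  have q: "l1 * q $ 1 + l2 * q $ 2 = 1"
  proof -
    have "l1 * q $ 1 + l2 * q $ 2 = (l1 * cnj l1 + l2 * cnj l2) / N" by (simp add: q_def add_divide_distrib)
    then show ?thesis using N by (simp flip: N_def)
  qed
  have "pt x y \<in> line_set l1 l2 l3 \<longleftrightarrow> y = 0" for x y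
  proof -
    have "l1 * pt x y $ 1 + l2 * pt x y $ 2 + l3 = (y - l3) * (l1 * q $ 1 + l2 * q $ 2) + l3"
      unfolding pt_def by (simp add: z0_def p_def algebra_simps)
    then show ?thesis by (simp add: line_set_def q)
  qed
  moreover have "pt x y \<in> zero_locus {L2} \<longleftrightarrow> y = 0" for x y by (simp add: zero_locus_def)
  ultimately have "line_set l1 l2 l3 = zero_locus {L2}" by (metis pt_surj set_eqI)
  then show thesis using that affine_frame_axioms by blast
qed

lemma line_set_degrees:
  assumes "l1 \<noteq> 0 \<or> l2 \<noteq> 0"
  shows "irreducible_variety (line_set l1 l2 l3)"
    and "\<exists>s. zero_locus (hermitian_critical_ideal_at (line_set l1 l2 l3) t) = {s}"
    and "\<exists>z. hermitian_critical_points (line_set l1 l2 l3) u = {z}"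
proof -
  obtain z0 p q where frame: "affine_frame p q" and L: "line_set l1 l2 l3 = zero_locus {affine_frame.L2 z0 p q}"
    using affine_frame_line[OF assms] by metis
  show "irreducible_variety (line_set l1 l2 l3)"
    unfolding L by (rule smooth_plane_curve.irreducible[OF affine_frame.line[OF frame]])
  show "\<exists>s. zero_locus (hermitian_critical_ideal_at (line_set l1 l2 l3) t) = {s}"
    unfolding L by (rule affine_frame.line_zeros[OF frame])
  show "\<exists>z. hermitian_critical_points (line_set l1 l2 l3) u = {z}"
    unfolding L by (rule affine_frame.line_points[OF frame])
qed

lemma degrees_card_components:
  assumes "finite (irreducible_components X)"
    and zeros: "\<And>Y t. Y \<in> irreducible_components X \<Longrightarrow> \<exists>s. zero_locus (hermitian_critical_ideal_at Y t) = {s}"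
    and points: "\<And>Y u. Y \<in> irreducible_components X \<Longrightarrow> \<exists>z. hermitian_critical_points Y u = {z}"
  shows "has_vHDdeg X (card (irreducible_components X)) \<and> HDdeg X = {card (irreducible_components X)}"
proof
  have Z: "finite (zero_locus (hermitian_critical_ideal_at Y t)) \<and> card (zero_locus (hermitian_critical_ideal_at Y t)) = 1"
    if "Y \<in> irreducible_components X" for Y t using zeros[OF that, of t] by force
  have H: "finite (hermitian_critical_points Y u) \<and> card (hermitian_critical_points Y u) = 1"
    if "Y \<in> irreducible_components X" for Y u using points[OF that, of u] by force
  have v: "finite (virtual_critical_points X t) \<and> card (virtual_critical_points X t) = card (irreducible_components X)" for t
    unfolding virtual_critical_points_def using assms(1) Z by simp
  have h: "finite (tagged_critical_points X u) \<and> card (tagged_critical_points X u) = card (irreducible_components X)" for u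
    unfolding tagged_critical_points_def using assms(1) H by simp
  have "zariski_open (UNIV :: (complex ^ ('a + 'a)) set)" "zariski_dense (UNIV :: (complex ^ ('a + 'a)) set)"
    using zariski_closed_empty by (auto simp: zariski_open_def zariski_dense_def)
  then show "has_vHDdeg X (card (irreducible_components X))"
    unfolding has_vHDdeg_def using v by blast
  show "HDdeg X = {card (irreducible_components X)}"
    unfolding HDdeg_def using h by auto
qed

lemma line_set_subset:
  assumes l: "l1 \<noteq> 0 \<or> l2 \<noteq> 0" and m: "m1 \<noteq> 0 \<or> m2 \<noteq> 0" and "line_set l1 l2 l3 \<subseteq> line_set m1 m2 m3"
  shows "l1 * m2 - l2 * m1 = 0" "l1 * m3 - l3 * m1 = 0" "l2 * m3 - l3 * m2 = 0"
proof -
  have *: "m1 * x + m2 * y + m3 = 0" if "l1 * x + l2 * y + l3 = 0" for x y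
    using assms(3) that by (auto simp: line_set_def dest!: subsetD[of _ _ "vector [x, y]"])
  have "l1 * m2 - l2 * m1 = 0 \<and> l1 * m3 - l3 * m1 = 0 \<and> l2 * m3 - l3 * m2 = 0"
  proof (cases "l1 = 0")
    case True
    then have "l2 \<noteq> 0" using l by simp
    then have 0: "m1 * x + m2 * (- l3 / l2) + m3 = 0" for x using True by (intro *) simp
    have "m1 = 0" using 0[of 0] 0[of 1] by algebra
    moreover have "l2 * m3 = l3 * m2" using 0[of 0] \<open>l2 \<noteq> 0\<close> by (simp add: field_simps)
    ultimately show ?thesis using True by simp
  next
    case False
    have 0: "m1 * (- (l2 * y + l3) / l1) + m2 * y + m3 = 0" for y
      using False by (intro *) (simp add: field_simps)
    have 1: "l1 * m3 = l3 * m1" using 0[of 0] False by (simp add: field_simps)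
    have "l1 * (m2 + m3) = (l2 + l3) * m1" using 0[of 1] False by (simp add: field_simps)
    then have 2: "l1 * m2 = l2 * m1" using 1 by (simp add: algebra_simps)
    have "l1 * (l2 * m3) = l1 * (l3 * m2)" using 1 2 by algebra
    then show ?thesis using 1 2 False by simp
  qed
  then show "l1 * m2 - l2 * m1 = 0" "l1 * m3 - l3 * m1 = 0" "l2 * m3 - l3 * m2 = 0" by blast+
qed

lemma line_set_proportional:
  fixes l1 l2 l3 m1 m2 m3 :: complex
  assumes l: "l1 \<noteq> 0 \<or> l2 \<noteq> 0" and m: "m1 \<noteq> 0 \<or> m2 \<noteq> 0"
    and proportional: "l1 * m2 - l2 * m1 = 0" "l1 * m3 - l3 * m1 = 0" "l2 * m3 - l3 * m2 = 0"
  obtains t where "t \<noteq> 0" "m1 = t * l1" "m2 = t * l2" "m3 = t * l3"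
proof (cases "l1 = 0")
  case True
  then have "l2 \<noteq> 0" "m1 = 0" using l proportional by auto
  then show ?thesis using that[of "m2 / l2"] m proportional True by (simp add: field_simps)
next
  case False
  then have "m1 \<noteq> 0" using m proportional(1) by auto
  then show ?thesis using that[of "m1 / l1"] proportional False by (simp add: field_simps)
qed

subsection \<open>The rank of the matrix of a conic\<close>

lemma rank_one_rows:
  fixes A :: "complex ^ 'n ^ 'm"
  assumes "rank A = 1"
  shows "\<exists>v. \<forall>i. \<exists>k. A $ i = k *s v"
proof -
  have dim: "vec.dim (rows A) = 1" using assms by (simp add: row_rank_def_gen)
  obtain B where B: "B \<subseteq> rows A" "rows A \<subseteq> vec.span B" "card B = vec.dim (rows A)"
    using vec.basis_exists by metis
  then obtain v where "B = {v}" using dim by (auto simp: card_1_singleton_iff)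
  then have "A $ i \<in> vec.span {v}" for i using B(2) by (auto simp: rows_def row_def)
  then show ?thesis by (metis vec.span_singleton rangeE)
qed

lemma rank_le_1:
  fixes A :: "complex ^ 'n ^ 'm"
  assumes "\<And>i. \<exists>k. A $ i = k *s v"
  shows "rank A \<le> 1"
proof -
  have "rows A \<subseteq> vec.span {v}"
    using assms by (auto simp: rows_def row_def vec.span_singleton)
  then have "vec.dim (rows A) \<le> card {v}" by (rule vec.dim_le_card) simp
  then show ?thesis by (simp add: row_rank_def_gen)
qed

text \<open>The principal 2-minors of \<open>A\<close> are, up to the factor -1/4, squares of the
  minors of the two linear factors. So rank 1 means proportional factors and a single line, rank 2
  two different lines.\<close>

lemma singular_conic_degrees:
  fixes a b c d e f :: complex and A :: "complex ^ 3 ^ 3"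
  assumes abc: "(a, b, c) \<noteq> (0, 0, 0)" and A: "A = vector [vector [a, b, d], vector [b, c, e], vector [d, e, f]]"
    and det: "a * c * f + 2 * b * d * e - a * e\<^sup>2 - c * d\<^sup>2 - b\<^sup>2 * f = 0"
    and n: "rank A = n" "n = 1 \<or> n = 2"
  shows "has_vHDdeg (affine_conic a b c d e f) n \<and> HDdeg (affine_conic a b c d e f) = {n}"
proof -
  obtain l1 l2 l3 m1 m2 m3 where f: "a = l1 * m1" "2 * b = l1 * m2 + l2 * m1" "c = l2 * m2"
    "2 * d = l1 * m3 + l3 * m1" "2 * e = l2 * m3 + l3 * m2" "f = l3 * m3"
    using conic_factors[OF abc det] by metis
  let ?X = "affine_conic a b c d e f" and ?L = "line_set l1 l2 l3" and ?M = "line_set m1 m2 m3"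
  have l: "l1 \<noteq> 0 \<or> l2 \<noteq> 0" and m: "m1 \<noteq> 0 \<or> m2 \<noteq> 0"
    using abc f(1-3) by auto
  have "conic_form a b c d e f x y = (l1 * x + l2 * y + l3) * (m1 * x + m2 * y + m3)" for x y
    unfolding conic_form_def f by (simp add: power2_eq_square algebra_simps)
  then have X: "?X = ?L \<union> ?M" by (auto simp: mem_affine_conic line_set_def)
  have "finite (irreducible_components ?X) \<and> irreducible_components ?X \<subseteq> {?L, ?M} \<and> card (irreducible_components ?X) = n"
  proof (cases "n = 1")
    case True
    then obtain v where "\<forall>i. \<exists>k. A $ i = k *s v" using rank_one_rows n(1) by blast
    then obtain k where "\<And>i. A $ i = k i *s v" by metis
    then have minor: "A $ i $ i * A $ j $ j = A $ i $ j * A $ j $ i" for i j by simp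
    have "a * c = b * b" "a * f = d * d" "c * f = e * e"
      using minor[of 1 2] minor[of 1 3] minor[of 2 3] by (simp_all add: A)
    then have "(2 * b)\<^sup>2 - 4 * (a * c) = 0" "(2 * d)\<^sup>2 - 4 * (a * f) = 0" "(2 * e)\<^sup>2 - 4 * (c * f) = 0"
      by (simp_all add: power2_eq_square)
    moreover have "(2 * b)\<^sup>2 - 4 * (a * c) = (l1 * m2 - l2 * m1)\<^sup>2" "(2 * d)\<^sup>2 - 4 * (a * f) = (l1 * m3 - l3 * m1)\<^sup>2"
      "(2 * e)\<^sup>2 - 4 * (c * f) = (l2 * m3 - l3 * m2)\<^sup>2"
      unfolding f(2,4,5) unfolding f by (simp_all add: power2_eq_square algebra_simps)
    ultimately have proportional: "l1 * m2 - l2 * m1 = 0" "l1 * m3 - l3 * m1 = 0" "l2 * m3 - l3 * m2 = 0" by simp_all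
    obtain t where t: "t \<noteq> 0" "m1 = t * l1" "m2 = t * l2" "m3 = t * l3"
      by (rule line_set_proportional[OF l m proportional])
    have "m1 * x + m2 * y + m3 = t * (l1 * x + l2 * y + l3)" for x y
      unfolding t(2-4) by (simp add: algebra_simps)
    then have "?M = ?L" using t(1) by (simp add: line_set_def)
    then have "irreducible_components ?X = {?L}"
      unfolding X using irreducible_components_irreducible[OF line_set_degrees(1)[OF l]] by simp
    then show ?thesis using True by simp
  next
    case False
    have indep: "\<not> (l1 * m2 - l2 * m1 = 0 \<and> l1 * m3 - l3 * m1 = 0 \<and> l2 * m3 - l3 * m2 = 0)"
    proof
      assume proportional: "l1 * m2 - l2 * m1 = 0 \<and> l1 * m3 - l3 * m1 = 0 \<and> l2 * m3 - l3 * m2 = 0"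
      obtain t where t: "t \<noteq> 0" "m1 = t * l1" "m2 = t * l2" "m3 = t * l3"
        using line_set_proportional[OF l m] proportional by blast
      have e: "a = t * l1 * l1" "b = t * l1 * l2" "c = t * l2 * l2" "d = t * l1 * l3" "e = t * l2 * l3" "f = t * l3 * l3"
        using f unfolding t by algebra+
      have "\<exists>k. A $ i = k *s (vector [l1, l2, l3] :: complex ^ 3)" for i
      proof -
        have "i = 1 \<or> i = 2 \<or> i = 3" using exhaust_3 by blast
        then show ?thesis
        proof (elim disjE)
          assume "i = 1"
          then show ?thesis by (intro exI[of _ "t * l1"]) (simp add: A e vec_eq_iff forall_3)
        next
          assume "i = 2"
          then show ?thesis by (intro exI[of _ "t * l2"]) (simp add: A e vec_eq_iff forall_3)
        next
          assume "i = 3"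
          then show ?thesis by (intro exI[of _ "t * l3"]) (simp add: A e vec_eq_iff forall_3)
        qed
      qed
      from rank_le_1[OF this] show False using n False by simp
    qed
    have 1: "\<not> ?L \<subseteq> ?M" using line_set_subset[OF l m] indep by blast
    have 2: "\<not> ?M \<subseteq> ?L" using line_set_subset[OF m l] indep by (auto simp: algebra_simps)
    have "irreducible_components ?X = {?L, ?M}"
      unfolding X by (rule irreducible_components_Un[OF line_set_degrees(1)[OF l] line_set_degrees(1)[OF m] 1 2])
    moreover have "?L \<noteq> ?M" using 1 by auto
    ultimately show ?thesis using False n(2) by simp
  qed
  then have fin: "finite (irreducible_components ?X)" and comps: "\<And>Y. Y \<in> irreducible_components ?X \<Longrightarrow> Y = ?L \<or> Y = ?M"
    and card: "card (irreducible_components ?X) = n" by auto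
  show ?thesis
    unfolding card[symmetric]
  proof (rule degrees_card_components[OF fin])
    show "\<exists>s. zero_locus (hermitian_critical_ideal_at Y t) = {s}" if "Y \<in> irreducible_components ?X" for Y t
      using comps[OF that] line_set_degrees(2)[OF l] line_set_degrees(2)[OF m] by metis
    show "\<exists>z. hermitian_critical_points Y u = {z}" if "Y \<in> irreducible_components ?X" for Y u
      using comps[OF that] line_set_degrees(3)[OF l] line_set_degrees(3)[OF m] by metis
  qed
qed

subsection \<open>Normal forms of the nonsingular conics\<close>

text \<open>The quadratic part is a square \<open>(\<alpha> z1 + \<beta> z2)^2\<close>. The vector
  \<open>q\<close> spans the kernel of this linear form and \<open>p\<close> its orthogonal
  complement, whence \<open>l = 0\<close>.\<close>

lemma parabola_normal_form:
  fixes a b c d e f :: complex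
  assumes abc: "(a, b, c) \<noteq> (0, 0, 0)" and A1: "a * c - b\<^sup>2 = 0"
    and det: "a * c * f + 2 * b * d * e - a * e\<^sup>2 - c * d\<^sup>2 - b\<^sup>2 * f \<noteq> 0"
  obtains z0 p q \<kappa> where "metric_frame p q \<kappa> 0" "affine_conic a b c d e f = zero_locus {affine_frame.parabola z0 p q 1}"
proof -
  obtain \<alpha> \<beta> where sq: "a = \<alpha>\<^sup>2" "b = \<alpha> * \<beta>" "c = \<beta>\<^sup>2"
  proof (cases "a = 0")
    case True
    then show ?thesis using A1 that[of 0 "csqrt c"] by simp
  next
    case False
    have "a * c = b\<^sup>2" using A1 by simp
    then show ?thesis using False that[of "csqrt a" "b / csqrt a"] by (simp add: power_divide nonzero_eq_divide_eq mult.commute)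
  qed
  define m where "m = \<alpha> * e - \<beta> * d"
  have "a * c * f + 2 * b * d * e - a * e\<^sup>2 - c * d\<^sup>2 - b\<^sup>2 * f = - m\<^sup>2"
    unfolding sq m_def by (simp add: power2_eq_square algebra_simps)
  then have m: "m \<noteq> 0" using det by simp
  define N where "N = (cmod \<alpha>)\<^sup>2 + (cmod \<beta>)\<^sup>2"
  have N: "N > 0" using m by (auto simp: N_def m_def sum_power2_gt_zero_iff)
  have N_eq: "\<alpha> * cnj \<alpha> + \<beta> * cnj \<beta> = of_real N"
    unfolding N_def of_real_add by (simp only: complex_norm_square)
  \<comment> \<open>\<open>r\<close> and \<open>s\<close> solve \<open>|s| = r\<close>, which makes
    the norms of \<open>p\<close> and \<open>q\<close> equal, and \<open>2 s m = r^2 N^2\<close>,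
    which matches the coefficients of \<open>x^2\<close> and \<open>y\<close>.\<close>
  define r where "r = 2 * cmod m / N\<^sup>2"
  define s where "s = of_real (r\<^sup>2 * N\<^sup>2) / (2 * m)"
  have r: "r > 0" using m N by (simp add: r_def)
  have s_m: "2 * s * m = of_real (r\<^sup>2 * N\<^sup>2)" using m by (simp add: s_def)
  have "cmod s = r"
    using m N by (simp add: s_def norm_divide norm_mult norm_power r_def power2_eq_square)
  then have s: "s * cnj s = of_real (r\<^sup>2)" using complex_norm_square[of s] by simp
  \<comment> \<open>\<open>l0\<close> and \<open>t0\<close> are the values of
    \<open>\<alpha> z1 + \<beta> z2\<close> and \<open>d z1 + e z2\<close> at the origin of the
    frame; they are chosen so that the term linear in \<open>x\<close> and the constant term
    vanish.\<close>
  define G where "G = d * cnj \<alpha> + e * cnj \<beta>"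
  define l0 where "l0 = - G / of_real N"
  define t0 where "t0 = - (f + l0\<^sup>2) / 2"
  define p q z0 :: "complex ^ 2" where "p = vector [of_real r * cnj \<alpha>, of_real r * cnj \<beta>]"
    and "q = vector [s * \<beta>, - (s * \<alpha>)]" and "z0 = vector [(e * l0 - \<beta> * t0) / m, (\<alpha> * t0 - d * l0) / m]"
  have "p $ 1 * q $ 2 - p $ 2 * q $ 1 = - of_real r * s * (\<alpha> * cnj \<alpha> + \<beta> * cnj \<beta>)"
    by (simp add: p_def q_def algebra_simps)
  moreover have "s \<noteq> 0" using \<open>cmod s = r\<close> r by auto
  ultimately have frame: "affine_frame p q" using r N unfolding N_eq by unfold_locales simp
  then interpret affine_frame z0 p q .
  have "metric_frame p q (r\<^sup>2 * N) 0"
  proof (intro metric_frame.intro[OF frame] metric_frame_axioms.intro)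
    show "0 < r\<^sup>2 * N" using r N by simp
    have "(\<Sum>k\<in>UNIV. p $ k * cnj (p $ k)) = of_real r * of_real r * (\<alpha> * cnj \<alpha> + \<beta> * cnj \<beta>)"
      by (simp add: sum_2 p_def algebra_simps)
    then show "(\<Sum>k\<in>UNIV. p $ k * cnj (p $ k)) = of_real (r\<^sup>2 * N)" by (simp add: N_eq power2_eq_square)
    have "(\<Sum>k\<in>UNIV. q $ k * cnj (q $ k)) = (s * cnj s) * (\<alpha> * cnj \<alpha> + \<beta> * cnj \<beta>)"
      by (simp add: sum_2 q_def algebra_simps)
    then show "(\<Sum>k\<in>UNIV. q $ k * cnj (q $ k)) = of_real (r\<^sup>2 * N)" by (simp add: N_eq s)
    show "(\<Sum>k\<in>UNIV. p $ k * cnj (q $ k)) = of_real (r\<^sup>2 * N * 0)"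
      by (simp add: sum_2 p_def q_def algebra_simps)
  qed
  moreover have "affine_conic a b c d e f = zero_locus {parabola 1}"
  proof -
    have z0: "\<alpha> * z0 $ 1 + \<beta> * z0 $ 2 = l0" "d * z0 $ 1 + e * z0 $ 2 = t0"
    proof -
      have "\<alpha> * z0 $ 1 + \<beta> * z0 $ 2 = m * l0 / m" "d * z0 $ 1 + e * z0 $ 2 = m * t0 / m"
        unfolding z0_def by (simp_all add: m_def algebra_simps flip: add_divide_distrib)
      then show "\<alpha> * z0 $ 1 + \<beta> * z0 $ 2 = l0" "d * z0 $ 1 + e * z0 $ 2 = t0" using m by simp_all
    qed
    have "conic_form a b c d e f (pt x y $ 1) (pt x y $ 2) = of_real (r\<^sup>2 * N\<^sup>2) * (x * x - y)" for x y
    proof -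
      have 1: "\<alpha> * pt x y $ 1 + \<beta> * pt x y $ 2 = l0 + x * of_real r * of_real N"
        unfolding z0(1)[symmetric] N_eq[symmetric] pt_def by (simp add: p_def q_def algebra_simps)
      have 2: "d * pt x y $ 1 + e * pt x y $ 2 = t0 + x * of_real r * G - y * s * m"
        unfolding z0(2)[symmetric] G_def m_def pt_def by (simp add: p_def q_def algebra_simps)
      have "conic_form a b c d e f (pt x y $ 1) (pt x y $ 2) =
          (\<alpha> * pt x y $ 1 + \<beta> * pt x y $ 2)\<^sup>2 + 2 * (d * pt x y $ 1 + e * pt x y $ 2) + f"
        unfolding conic_form_def sq by (simp add: power2_eq_square algebra_simps)
      also have "\<dots> = (l0\<^sup>2 + 2 * t0 + f) + 2 * x * of_real r * (l0 * of_real N + G) + of_real (r\<^sup>2 * N\<^sup>2) * (x * x) - y * (2 * s * m)"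
        unfolding 1 2 by (simp add: power2_eq_square algebra_simps)
      also have "l0 * of_real N + G = 0" using N by (simp add: l0_def)
      also have "l0\<^sup>2 + 2 * t0 + f = 0" unfolding t0_def by (simp add: field_simps)
      finally show ?thesis unfolding s_m by (simp add: algebra_simps)
    qed
    then have "pt x y \<in> affine_conic a b c d e f \<longleftrightarrow> y = x * x" for x y
      using r N by (auto simp: mem_affine_conic)
    moreover have "pt x y \<in> zero_locus {parabola 1} \<longleftrightarrow> y = x * x" for x y
      by (simp add: zero_locus_def parabola_def)
    ultimately show ?thesis by (metis pt_surj set_eqI)
  qed
  ultimately show thesis by (rule that)
qed

text \<open>The equation \<open>x y = 1\<close> fixes only the product of the scalings of
  \<open>p\<close> and \<open>q\<close>. The modulus of \<open>u\<close> is used to balance their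
  norms and its phase to make their inner product real and nonnegative; hence \<open>u\<close> has
  the phase of a square root of \<open>cnj h * k\<close>.\<close>

lemma balancing_factors:
  fixes k h :: complex and L M :: real
  assumes k: "k \<noteq> 0" and LM: "L > 0" "M > 0"
  obtains u v where "u * v = k" "(cmod u)\<^sup>2 * M = (cmod v)\<^sup>2 * L" "u * cnj v * h = of_real (cmod k * cmod h)"
proof -
  define w where "w = (if h = 0 then 1 else cnj h * k)"
  have w: "w \<noteq> 0" using k by (simp add: w_def)
  define \<eta> where "\<eta> = csqrt w / of_real (cmod (csqrt w))"
  have "(cmod (csqrt w))\<^sup>2 = cmod w" by (simp flip: norm_power)
  then have \<eta>2: "\<eta>\<^sup>2 = w / of_real (cmod w)" by (simp add: \<eta>_def power_divide flip: of_real_power)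
  have \<eta>: "cmod \<eta> = 1" using w by (simp add: \<eta>_def norm_divide)
  define \<rho> where "\<rho> = sqrt (cmod k * sqrt (L / M))"
  have \<rho>: "\<rho> > 0" "\<rho>\<^sup>2 = cmod k * sqrt (L / M)" using k LM by (simp_all add: \<rho>_def)
  define u v where "u = of_real \<rho> * \<eta>" and "v = k / u"
  have nu: "cmod u = \<rho>" using \<rho> by (simp add: u_def norm_mult \<eta>)
  then have u: "u \<noteq> 0" using \<rho>(1) by auto
  show thesis
  proof (rule that)
    show "u * v = k" using u by (simp add: v_def)
    have "(\<rho>\<^sup>2)\<^sup>2 * M = (cmod k)\<^sup>2 * L"
      unfolding \<rho>(2) using LM by (simp add: power_mult_distrib)
    then have "\<rho>\<^sup>2 * M = (cmod k)\<^sup>2 / \<rho>\<^sup>2 * L"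
      using \<rho>(1) by (simp add: field_simps power2_eq_square)
    then show "(cmod u)\<^sup>2 * M = (cmod v)\<^sup>2 * L" by (simp add: v_def norm_divide nu power_divide)
    have "cnj \<eta> * \<eta> = 1" using complex_norm_square[of \<eta>] by (simp add: \<eta> mult.commute)
    then have inv: "1 / cnj \<eta> = \<eta>" using w by (metis mult.commute nonzero_eq_divide_eq mult_zero_left zero_neq_one)
    have "u * cnj v * h = \<eta> * (1 / cnj \<eta>) * cnj k * h" using \<rho>(1) by (simp add: v_def u_def)
    also have "\<dots> = \<eta>\<^sup>2 * cnj k * h" unfolding inv by (simp add: power2_eq_square)
    also have "\<dots> = of_real (cmod k * cmod h)"
    proof (cases "h = 0")
      case False
      have "\<eta>\<^sup>2 * cnj k * h = w * cnj w / of_real (cmod w)"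
        unfolding \<eta>2 using False by (simp add: w_def algebra_simps)
      also have "w * cnj w = of_real (cmod w) * of_real (cmod w)"
        using complex_norm_square[of w] by (simp add: power2_eq_square)
      finally show ?thesis using w False by (simp add: w_def norm_mult mult.commute)
    qed simp
    finally show "u * cnj v * h = of_real (cmod k * cmod h)" .
  qed
qed

text \<open>\<open>h\<close> is the inner product of the kernel vectors \<open>(m2, - m1)\<close>
  and \<open>(- l2, l1)\<close> of the two forms. The first part is Lagrange's identity. In the
  second the left side is the square of the difference of the singular values, so these agree
  exactly if the vectors are orthogonal.\<close>

lemma product_form_norms:
  fixes l1 l2 m1 m2 :: complex
  defines "h \<equiv> - (m2 * cnj l2 + m1 * cnj l1)" and "w \<equiv> l1 * m2 - l2 * m1"
  shows "((cmod l1)\<^sup>2 + (cmod l2)\<^sup>2) * ((cmod m1)\<^sup>2 + (cmod m2)\<^sup>2) = (cmod h)\<^sup>2 + (cmod w)\<^sup>2"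
    and "(cmod (l1 * m1))\<^sup>2 + 2 * (cmod ((l1 * m2 + l2 * m1) / 2))\<^sup>2 + (cmod (l2 * m2))\<^sup>2 -
      2 * cmod (l1 * m1 * (l2 * m2) - ((l1 * m2 + l2 * m1) / 2)\<^sup>2) = (cmod h)\<^sup>2"
proof -
  have "complex_of_real (((cmod l1)\<^sup>2 + (cmod l2)\<^sup>2) * ((cmod m1)\<^sup>2 + (cmod m2)\<^sup>2)) = of_real ((cmod h)\<^sup>2 + (cmod w)\<^sup>2)"
    unfolding of_real_add of_real_mult complex_norm_square h_def w_def by (simp add: algebra_simps)
  then show 1: "((cmod l1)\<^sup>2 + (cmod l2)\<^sup>2) * ((cmod m1)\<^sup>2 + (cmod m2)\<^sup>2) = (cmod h)\<^sup>2 + (cmod w)\<^sup>2"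
    by (simp only: of_real_eq_iff)
  have "(cmod (x + y))\<^sup>2 + (cmod (x - y))\<^sup>2 = 2 * (cmod x)\<^sup>2 + 2 * (cmod y)\<^sup>2" for x y
    unfolding cmod_power2 by (simp add: power2_eq_square algebra_simps)
  from this[of "l1 * m2" "l2 * m1"]
  have 2: "(cmod (l1 * m2 + l2 * m1))\<^sup>2 + (cmod w)\<^sup>2 = 2 * ((cmod l1)\<^sup>2 * (cmod m2)\<^sup>2) + 2 * ((cmod l2)\<^sup>2 * (cmod m1)\<^sup>2)"
    by (simp add: w_def norm_mult power_mult_distrib)
  have "l1 * m1 * (l2 * m2) - ((l1 * m2 + l2 * m1) / 2)\<^sup>2 = - (w\<^sup>2 / 4)"
    by (simp add: w_def power2_eq_square field_simps)
  then have 3: "cmod (l1 * m1 * (l2 * m2) - ((l1 * m2 + l2 * m1) / 2)\<^sup>2) = (cmod w)\<^sup>2 / 4"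
    by (simp add: norm_divide norm_power)
  show "(cmod (l1 * m1))\<^sup>2 + 2 * (cmod ((l1 * m2 + l2 * m1) / 2))\<^sup>2 + (cmod (l2 * m2))\<^sup>2 -
      2 * cmod (l1 * m1 * (l2 * m2) - ((l1 * m2 + l2 * m1) / 2)\<^sup>2) = (cmod h)\<^sup>2"
    unfolding 3 using 1 2 by (simp add: norm_mult norm_divide power_mult_distrib power_divide algebra_simps)
qed

text \<open>The quadratic part is a product of two linear forms, obtained from
  \<open>conic_factors\<close> with vanishing lower terms. Each of \<open>p\<close>,
  \<open>q\<close> is killed by one form, so in coordinates around the centre the conic is a
  multiple of \<open>1 - x y\<close>. Strict Cauchy-Schwarz gives \<open>l < 1\<close>, since the
  forms are independent.\<close>

lemma hyperbola_normal_form: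
  fixes a b c d e f :: complex
  assumes A1: "a * c - b\<^sup>2 \<noteq> 0"
    and det: "a * c * f + 2 * b * d * e - a * e\<^sup>2 - c * d\<^sup>2 - b\<^sup>2 * f \<noteq> 0"
  obtains z0 p q \<kappa> l where "metric_frame p q \<kappa> l" "0 \<le> l" "l < 1"
    "affine_conic a b c d e f = zero_locus {affine_frame.hyperbola z0 p q 1}"
    "l = 0 \<longleftrightarrow> (cmod a)\<^sup>2 + 2 * (cmod b)\<^sup>2 + (cmod c)\<^sup>2 = 2 * cmod (a * c - b\<^sup>2)"
    "2 * cmod (a * c - b\<^sup>2) \<le> (cmod a)\<^sup>2 + 2 * (cmod b)\<^sup>2 + (cmod c)\<^sup>2"
proof -
  have "(a, b, c) \<noteq> (0, 0, 0)" using A1 by auto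
  moreover have "a * c * 0 + 2 * b * 0 * 0 - a * 0\<^sup>2 - c * 0\<^sup>2 - b\<^sup>2 * 0 = 0" by simp
  ultimately obtain l1 l2 m1 m2 where f: "a = l1 * m1" "2 * b = l1 * m2 + l2 * m1" "c = l2 * m2"
    using conic_factors by metis
  have b: "b = (l1 * m2 + l2 * m1) / 2" using arg_cong[OF f(2), of "\<lambda>x. x / 2"] by simp
  define w where "w = l1 * m2 - l2 * m1"
  have "a * c - b\<^sup>2 = - (w\<^sup>2 / 4)" unfolding f b w_def by (simp add: power2_eq_square field_simps)
  then have w: "w \<noteq> 0" using A1 by auto
  define h where "h = - (m2 * cnj l2 + m1 * cnj l1)"
  define L M where "L = (cmod l1)\<^sup>2 + (cmod l2)\<^sup>2" and "M = (cmod m1)\<^sup>2 + (cmod m2)\<^sup>2"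
  note norms = product_form_norms[where ?l1.0 = l1 and ?l2.0 = l2 and ?m1.0 = m1 and ?m2.0 = m2, folded h_def w_def L_def M_def, folded f(1,3) b]
  have "(l1 \<noteq> 0 \<or> l2 \<noteq> 0) \<and> (m1 \<noteq> 0 \<or> m2 \<noteq> 0)" using w by (auto simp: w_def)
  then have LM: "L > 0" "M > 0" by (simp_all add: L_def M_def sum_power2_gt_zero_iff)
  have L: "l1 * cnj l1 + l2 * cnj l2 = of_real L" and M: "m1 * cnj m1 + m2 * cnj m2 = of_real M"
    unfolding L_def M_def of_real_add by (simp_all only: complex_norm_square)
  \<comment> \<open>The centre of the conic, where the gradient vanishes.\<close>
  define z0 :: "complex ^ 2" where "z0 = vector [(b * e - c * d) / (a * c - b\<^sup>2), (b * d - a * e) / (a * c - b\<^sup>2)]"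
  have grad: "a * z0 $ 1 + b * z0 $ 2 + d = 0" "b * z0 $ 1 + c * z0 $ 2 + e = 0"
  proof -
    have "a * z0 $ 1 + b * z0 $ 2 = - d * (a * c - b\<^sup>2) / (a * c - b\<^sup>2)"
      "b * z0 $ 1 + c * z0 $ 2 = - e * (a * c - b\<^sup>2) / (a * c - b\<^sup>2)"
      unfolding z0_def by (simp_all add: power2_eq_square algebra_simps flip: add_divide_distrib)
    then show "a * z0 $ 1 + b * z0 $ 2 + d = 0" "b * z0 $ 1 + c * z0 $ 2 + e = 0" using A1 by simp_all
  qed
  define f0 where "f0 = d * z0 $ 1 + e * z0 $ 2 + f"
  have "f0 * (a * c - b\<^sup>2) = a * c * f + 2 * b * d * e - a * e\<^sup>2 - c * d\<^sup>2 - b\<^sup>2 * f"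
    using grad unfolding f0_def by algebra
  then have f0: "f0 \<noteq> 0" using det by auto
  \<comment> \<open>With \<open>u v = k\<close> the quadratic part at \<open>x p + y q\<close> is
    \<open>k w^2 x y = - f0 x y\<close>.\<close>
  define k where "k = - f0 / w\<^sup>2"
  have k: "k \<noteq> 0" using f0 w by (simp add: k_def)
  obtain u v where uv: "u * v = k" "(cmod u)\<^sup>2 * M = (cmod v)\<^sup>2 * L" "u * cnj v * h = of_real (cmod k * cmod h)"
    by (rule balancing_factors[OF k LM])
  have nz: "u \<noteq> 0" "v \<noteq> 0" using uv(1) k by auto
  define p q :: "complex ^ 2" where "p = vector [u * m2, - (u * m1)]" and "q = vector [- (v * l2), v * l1]"
  define \<kappa> where "\<kappa> = (cmod u)\<^sup>2 * M"
  define l where "l = cmod k * cmod h / \<kappa>"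
  have \<kappa>: "\<kappa> > 0" using nz LM by (simp add: \<kappa>_def)
  have "p $ 1 * q $ 2 - p $ 2 * q $ 1 = k * w" by (simp add: p_def q_def w_def algebra_simps flip: uv(1))
  then have frame: "affine_frame p q" using k w by unfold_locales simp
  then interpret affine_frame z0 p q .
  have "metric_frame p q \<kappa> l"
  proof (intro metric_frame.intro[OF frame] metric_frame_axioms.intro \<kappa>)
    have nu: "u * cnj u = of_real ((cmod u)\<^sup>2)" and nv: "v * cnj v = of_real ((cmod v)\<^sup>2)"
      by (simp_all only: complex_norm_square)
    have "(\<Sum>k\<in>UNIV. p $ k * cnj (p $ k)) = (u * cnj u) * (m1 * cnj m1 + m2 * cnj m2)"
      by (simp add: sum_2 p_def algebra_simps)
    then show "(\<Sum>k\<in>UNIV. p $ k * cnj (p $ k)) = of_real \<kappa>" unfolding nu M \<kappa>_def by simp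
    have "(\<Sum>k\<in>UNIV. q $ k * cnj (q $ k)) = (v * cnj v) * (l1 * cnj l1 + l2 * cnj l2)"
      by (simp add: sum_2 q_def algebra_simps)
    then show "(\<Sum>k\<in>UNIV. q $ k * cnj (q $ k)) = of_real \<kappa>" unfolding nv L \<kappa>_def uv(2) by simp
    have "(\<Sum>k\<in>UNIV. p $ k * cnj (q $ k)) = u * cnj v * h"
      by (simp add: sum_2 p_def q_def h_def algebra_simps)
    then show "(\<Sum>k\<in>UNIV. p $ k * cnj (q $ k)) = of_real (\<kappa> * l)" using \<kappa> unfolding uv(3) l_def by simp
  qed
  moreover have "0 \<le> l" using \<kappa> by (simp add: l_def)
  moreover have "l < 1"
  proof -
    have "\<kappa>\<^sup>2 = ((cmod u)\<^sup>2 * M) * ((cmod v)\<^sup>2 * L)"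
      unfolding uv(2)[symmetric] \<kappa>_def power2_eq_square[of "_ * _"] ..
    also have "\<dots> = (cmod u * cmod v)\<^sup>2 * (L * M)" by (simp add: power_mult_distrib)
    also have "cmod u * cmod v = cmod k" unfolding uv(1)[symmetric] norm_mult ..
    finally have "\<kappa>\<^sup>2 = (cmod k * cmod h)\<^sup>2 + (cmod k)\<^sup>2 * (cmod w)\<^sup>2"
      unfolding norms(1) by (simp add: power_mult_distrib algebra_simps)
    moreover have "(cmod k)\<^sup>2 * (cmod w)\<^sup>2 > 0" using k w by simp
    ultimately have "(cmod k * cmod h)\<^sup>2 < \<kappa>\<^sup>2" by linarith
    then have "cmod k * cmod h < \<kappa>" by (rule power2_less_imp_less) (use \<kappa> in simp)
    then show ?thesis using \<kappa> by (simp add: l_def)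
  qed
  moreover have "affine_conic a b c d e f = zero_locus {hyperbola 1}"
  proof -
    have "conic_form a b c d e f (pt x y $ 1) (pt x y $ 2) = f0 * (1 - x * y)" for x y
    proof -
      define d1 d2 where "d1 = x * (u * m2) - y * (v * l2)" and "d2 = y * (v * l1) - x * (u * m1)"
      have z: "pt x y $ 1 = z0 $ 1 + d1" "pt x y $ 2 = z0 $ 2 + d2"
        unfolding pt_def by (simp_all add: p_def q_def d1_def d2_def)
      have "conic_form a b c d e f (z0 $ 1 + d1) (z0 $ 2 + d2) = (l1 * d1 + l2 * d2) * (m1 * d1 + m2 * d2) + f0
          + (z0 $ 1 + 2 * d1) * (a * z0 $ 1 + b * z0 $ 2 + d) + (z0 $ 2 + 2 * d2) * (b * z0 $ 1 + c * z0 $ 2 + e)"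
      proof -
        have "(l1 * d1 + l2 * d2) * (m1 * d1 + m2 * d2) = a * d1\<^sup>2 + 2 * b * d1 * d2 + c * d2\<^sup>2"
          unfolding f by (simp add: power2_eq_square algebra_simps)
        then show ?thesis unfolding conic_form_def f0_def by (simp add: power2_eq_square algebra_simps)
      qed
      also have "\<dots> = (l1 * d1 + l2 * d2) * (m1 * d1 + m2 * d2) + f0" unfolding grad by simp
      also have "l1 * d1 + l2 * d2 = x * u * w" by (simp add: d1_def d2_def w_def algebra_simps)
      also have "m1 * d1 + m2 * d2 = y * v * w" by (simp add: d1_def d2_def w_def algebra_simps)
      also have "x * u * w * (y * v * w) = x * y * ((u * v) * w\<^sup>2)" by (simp add: power2_eq_square algebra_simps)
      also have "(u * v) * w\<^sup>2 = - f0" unfolding uv(1) k_def using w by simp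
      finally show ?thesis unfolding z by (simp add: algebra_simps)
    qed
    then have "pt x y \<in> affine_conic a b c d e f \<longleftrightarrow> x * y = 1" for x y
      using f0 by (auto simp: mem_affine_conic)
    moreover have "pt x y \<in> zero_locus {hyperbola 1} \<longleftrightarrow> x * y = 1" for x y
      by (simp add: zero_locus_def hyperbola_def)
    ultimately show ?thesis by (metis pt_surj set_eqI)
  qed
  moreover have "l = 0 \<longleftrightarrow> h = 0" using \<kappa> k by (simp add: l_def)
  then have "l = 0 \<longleftrightarrow> (cmod a)\<^sup>2 + 2 * (cmod b)\<^sup>2 + (cmod c)\<^sup>2 = 2 * cmod (a * c - b\<^sup>2)"
    using norms(2) by auto
  moreover have "2 * cmod (a * c - b\<^sup>2) \<le> (cmod a)\<^sup>2 + 2 * (cmod b)\<^sup>2 + (cmod c)\<^sup>2"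
    using norms(2) zero_le_power2[of "cmod h"] by linarith
  ultimately show thesis by (rule that)
qed

text \<open>The matrix \<open>A^* A\<close> has trace \<open>T\<close> and determinant
  \<open>\<delta>\<^sup>2\<close>; its eigenvalues \<open>(T + R) / 2\<close> and
  \<open>(T - R) / 2\<close> agree exactly if \<open>T = 2 \<delta>\<close>.\<close>

lemma singular_values_symmetric:
  fixes a b c :: complex and A :: "complex ^ 2 ^ 2"
  assumes A: "A = vector [vector [a, b], vector [b, c]]"
    and ge: "2 * cmod (a * c - b\<^sup>2) \<le> (cmod a)\<^sup>2 + 2 * (cmod b)\<^sup>2 + (cmod c)\<^sup>2"
  shows "\<exists>s t. singular_values A = {#s, t#} \<and>
    (s = t \<longleftrightarrow> (cmod a)\<^sup>2 + 2 * (cmod b)\<^sup>2 + (cmod c)\<^sup>2 = 2 * cmod (a * c - b\<^sup>2))"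
proof -
  define T \<delta> where "T = (cmod a)\<^sup>2 + 2 * (cmod b)\<^sup>2 + (cmod c)\<^sup>2" and "\<delta> = cmod (a * c - b\<^sup>2)"
  have T: "2 * \<delta> \<le> T" "0 \<le> \<delta>" using ge by (simp_all add: T_def \<delta>_def)
  then have disc: "0 \<le> T\<^sup>2 - 4 * \<delta>\<^sup>2" using power_mono[of "2 * \<delta>" T 2] by simp
  define R where "R = sqrt (T\<^sup>2 - 4 * \<delta>\<^sup>2)"
  have R: "R\<^sup>2 = T\<^sup>2 - 4 * \<delta>\<^sup>2" "0 \<le> R" using disc by (simp_all add: R_def)
  have "R\<^sup>2 \<le> T\<^sup>2" unfolding R(1) by simp
  then have "R \<le> T" using T by (intro power2_le_imp_le[of R T]) linarith+
  define x y where "x = (T + R) / 2" and "y = (T - R) / 2"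
  have "x * y = (T\<^sup>2 - R\<^sup>2) / 4" by (simp add: x_def y_def power2_eq_square field_simps)
  then have "x * y = \<delta>\<^sup>2" unfolding R(1) by simp
  then have xy: "x + y = T" "x * y = \<delta>\<^sup>2" "0 \<le> x" "0 \<le> y"
    using R(2) \<open>R \<le> T\<close> T by (simp_all add: x_def y_def field_simps)
  have tr: "of_real T = a * cnj a + 2 * (b * cnj b) + c * cnj c" and dt: "of_real (\<delta>\<^sup>2) = (a * c - b\<^sup>2) * cnj (a * c - b\<^sup>2)"
    unfolding T_def \<delta>_def of_real_add of_real_mult complex_norm_square by simp_all
  have "charpoly (conj_transpose A ** A) = [:of_real (\<delta>\<^sup>2), - of_real T, 1:]"
    unfolding charpoly_def det_2 tr dt
    by (simp add: A matrix_matrix_mult_def conj_transpose_def sum_2 power2_eq_square algebra_simps)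
  also have "\<dots> = [:- of_real x, 1:] * [:- of_real y, 1:]"
    unfolding xy(1,2)[symmetric] by simp
  finally have "proots (charpoly (conj_transpose A ** A)) = {#of_real x, of_real y#}"
    by (simp only:) (subst proots_mult; simp)
  then have "singular_values A = {#sqrt x, sqrt y#}" by (simp add: singular_values_def)
  moreover have "sqrt x = sqrt y \<longleftrightarrow> R = 0" by (simp add: x_def y_def)
  moreover have "R = 0 \<longleftrightarrow> T = 2 * \<delta>"
  proof -
    have "R = 0 \<longleftrightarrow> T\<^sup>2 = (2 * \<delta>)\<^sup>2" by (simp add: R_def)
    also have "\<dots> \<longleftrightarrow> T = 2 * \<delta>" using T by (intro power2_eq_iff_nonneg) simp_all
    finally show ?thesis .
  qed
  ultimately show ?thesis unfolding T_def \<delta>_def by blast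
qed

theorem theorem3p19:
  fixes a b c d e f :: complex
    and A :: "complex ^ 3 ^ 3" and A1 :: "complex ^ 2 ^ 2" and X :: "(complex ^ 2) set"
  assumes "(a, b, c) \<noteq> (0, 0, 0)"
    and "X = affine_conic a b c d e f"
    and "A = vector [vector [a, b, d], vector [b, c, e], vector [d, e, f]]"
    and "A1 = vector [vector [a, b], vector [b, c]]"
  shows "(\<not> invertible A \<longrightarrow>
            (rank A = 1 \<longrightarrow> has_vHDdeg X 1 \<and> HDdeg X = {1}) \<and>
            (rank A = 2 \<longrightarrow> has_vHDdeg X 2 \<and> HDdeg X = {2})) \<and>
         (invertible A \<longrightarrow>
            (\<not> invertible A1 \<longrightarrow> has_vHDdeg X 5 \<and> HDdeg X = {1, 3}) \<and>
            (invertible A1 \<and> (\<exists>s. singular_values A1 = {#s, s#}) \<longrightarrow>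
               has_vHDdeg X 6 \<and> HDdeg X = {2, 4}) \<and>
            (invertible A1 \<and> (\<exists>s t. s \<noteq> t \<and> singular_values A1 = {#s, t#}) \<longrightarrow>
               has_vHDdeg X 8 \<and> {2, 4} \<subseteq> HDdeg X \<and> HDdeg X \<subseteq> {2, 4, 6}))"
proof -
  define \<Delta> where "\<Delta> = a * c * f + 2 * b * d * e - a * e\<^sup>2 - c * d\<^sup>2 - b\<^sup>2 * f"
  have A: "invertible A \<longleftrightarrow> \<Delta> \<noteq> 0"
    unfolding invertible_det_nz det_3 \<Delta>_def by (simp add: assms(3) power2_eq_square algebra_simps)
  have A1: "invertible A1 \<longleftrightarrow> a * c - b\<^sup>2 \<noteq> 0"
    unfolding invertible_det_nz det_2 by (simp add: assms(4) power2_eq_square)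
  have singular: "has_vHDdeg X n \<and> HDdeg X = {n}" if "\<Delta> = 0" "rank A = n" "n = 1 \<or> n = 2" for n
    unfolding assms(2) by (rule singular_conic_degrees[OF assms(1,3)]) (use that in \<open>auto simp: \<Delta>_def\<close>)
  have parab: "has_vHDdeg X 5 \<and> HDdeg X = {1, 3}" if ne: "\<Delta> \<noteq> 0" "a * c - b\<^sup>2 = 0"
  proof -
    obtain z0 p q \<kappa> where frame: "metric_frame p q \<kappa> 0" and X: "X = zero_locus {affine_frame.parabola z0 p q 1}"
      using parabola_normal_form[OF assms(1) ne(2) ne(1)[unfolded \<Delta>_def]] assms(2) by metis
    show ?thesis unfolding X by (rule metric_frame.parabola_degrees[OF frame]) simp_all
  qed
  have hyper: "((\<exists>s. singular_values A1 = {#s, s#}) \<longrightarrow> has_vHDdeg X 6 \<and> HDdeg X = {2, 4}) \<and>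
    ((\<exists>s t. s \<noteq> t \<and> singular_values A1 = {#s, t#}) \<longrightarrow>
      has_vHDdeg X 8 \<and> {2, 4} \<subseteq> HDdeg X \<and> HDdeg X \<subseteq> {2, 4, 6})" if ne: "\<Delta> \<noteq> 0" "a * c - b\<^sup>2 \<noteq> 0"
  proof -
    obtain z0 p q \<kappa> l where frame: "metric_frame p q \<kappa> l" and l: "0 \<le> l" "l < 1"
      and X: "X = zero_locus {affine_frame.hyperbola z0 p q 1}"
      and l0: "l = 0 \<longleftrightarrow> (cmod a)\<^sup>2 + 2 * (cmod b)\<^sup>2 + (cmod c)\<^sup>2 = 2 * cmod (a * c - b\<^sup>2)"
      and ge: "2 * cmod (a * c - b\<^sup>2) \<le> (cmod a)\<^sup>2 + 2 * (cmod b)\<^sup>2 + (cmod c)\<^sup>2"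
      using hyperbola_normal_form[OF ne(2) ne(1)[unfolded \<Delta>_def]] assms(2) by metis
    obtain s t where st: "singular_values A1 = {#s, t#}" "s = t \<longleftrightarrow> l = 0"
      using singular_values_symmetric[OF assms(4) ge] l0 by metis
    have "l = 0" if "singular_values A1 = {#r, r#}" for r
      using st that by (auto simp: add_eq_conv_ex)
    moreover have "l \<noteq> 0" if "singular_values A1 = {#r, r'#}" "r \<noteq> r'" for r r'
      using st that by (auto simp: add_eq_conv_ex)
    moreover have "has_vHDdeg X 6 \<and> HDdeg X = {2, 4}" if "l = 0"
      unfolding X by (rule metric_frame.circle_degrees[OF frame _ that]) simp
    moreover have "has_vHDdeg X 8 \<and> {2, 4} \<subseteq> HDdeg X \<and> HDdeg X \<subseteq> {2, 4, 6}" if "l \<noteq> 0"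
      unfolding X by (rule metric_frame.skew_degrees[OF frame _ _ l(2)]) (use l(1) that in simp_all)
    ultimately show ?thesis by blast
  qed
  show ?thesis unfolding A A1 using singular parab hyper by auto
qed

end
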